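(* Let $X$ be a locally compact Abelian (Hausdorff) group. Then the following are equivalent: (i) $X$ is totally disconnected. (ii) $\mathfrak{F}_0(X)$ embeds (as a topological group) into the product of a family of locally compact Abelian groups. (iii) $\mathfrak{F}_0(X)$ is a nuclear group. (iv) $\mathfrak{F}_0(X)$ is a Schwartz group. (v) $\mathfrak{F}_0(X)$ respects compactness. (vi) $\mathfrak{F}_0(X)$ has the Schur property. (vii) $\mathfrak{F}_0(X)$ respects countable compactness. (viii) $\mathfrak{F}_0(X)$ respects sequential compactness. (ix) $\mathfrak{F}_0(X)$ respects pseudocompactness. (x) $\mathfrak{F}_0(X)$ respects functional boundedness. Moreover, if $E$ is a functionally bounded subset in $\mathfrak{F}_0(X)^+$, then its closure $\mathrm{cl}_{\mathfrak{F}_0(X)}(E)$ in $\mathfrak{F}_0(X)$ is compact in $\mathfrak{F}_0(X)$.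
   Context: For an Abelian topological group $X$, $\mathfrak{F}_0(X)$ denotes the group $c_0(X)=\{(x_n)_{n\in\mathbb{N}}\in X^{\mathbb{N}}:\lim_n x_n=0\}$ with the uniform topology, i.e. the group topology with base at $0$ given by the sets $V^{\mathbb{N}}\cap c_0(X)$, $V$ an open neighborhood of $0$ in $X$. An Abelian topological group $G$ is MAP (maximally almost periodic) if its group $\widehat{G}$ of continuous characters separates points. For a MAP Abelian group $G$, $G^+$ is the group $G$ with the weakest group topology making all elements of $\widehat{G}$ continuous. (If $X$ is locally compact Abelian, then $\mathfrak{F}_0(X)$ is MAP.) A MAP group $G$ respects compactness (countable compactness, sequential compactness, pseudocompactness) if $G$ and $G^+$ have the same compact (countably compact, sequentially compact, pseudocompact) subsets. A subset $E$ of a space $Y$ is functionally bounded in $Y$ if every continuous real-valued function on $Y$ is bounded on $E$; $G$ respects functional boundedness if $G$ and $G^+$ have the same functionally bounded subsets. $G$ has the Schur property if $G$ and $G^+$ have the same convergent sequences. A subset $A$ of a space is countably compact if each countably infinite subset of $A$ has a cluster point in $A$, sequentially compact if each sequence in $A$ has a subsequence converging to a point of $A$, and pseudocompact if every continuous real-valued function on $A$ is bounded. A Hausdorff Abelian group $G$ is a Schwartz group if for every neighborhood $U$ of $0$ there is a sequence $\{F_n\}_{n\in\mathbb{N}}$ of finite subsets of $G$ such that $\bigcap_{n\in\mathbb{N}}\left((1/n)U+F_n\right)$ is a neighborhood of $0$, where $(1/n)U:=\{x\in G: kx\in U\ \text{for all } 1\le k\le n\}$. Nuclear group (Banaszczyk):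 for symmetric convex subsets $A,B$ of a real vector space $E$ and $k\ge 1$, let $d_k(A,B)=\inf\{t>0: A\subseteq tB+L \text{ for some linear subspace } L\subseteq E \text{ with } \dim L<k\}$. A Hausdorff Abelian group $G$ is nuclear if for every neighborhood $U$ of $0$ in $G$, every $c>0$ and every $m\in\mathbb{N}$ there exist a real vector space $E$, symmetric convex subsets $A,B$ of $E$ with $d_k(A,B)\le c k^{-m}$ for all $k\ge1$, a subgroup $K$ of $E$ and a homomorphism $\varphi:K\to G$ such that $\varphi(K\cap A)$ is a neighborhood of $0$ in $G$ and $\varphi(K\cap B)\subseteq U$.
   Formalization: The "Moreover" clause is stated only when X is totally disconnected (the equivalent conditions hold); without this it is false, e.g. for X = R the unit vectors of c_0 together with 0 are compact in F_0(R)^+ but closed and not compact in F_0(R). *)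

theory Defs
  imports "HOL-Analysis.Analysis" "HOL-Analysis.Finite_Function_Topology" "HOL-Algebra.Coset" "HOL-Algebra.Product_Groups"
begin

section \<open>Abelian topological groups\<close>

text \<open>
  Abelian groups are written multiplicatively, as in HOL-Algebra: the neutral element \<open>0\<close> of the
  usual additive notation is \<open>\<one>\<close> and \<open>k x\<close> is \<open>x [^] k\<close>. No separation axiom is built in.
\<close>

locale abelian_topological_group = comm_group G for G :: "('a, 'm) monoid_scheme" (structure) +
  fixes T :: "'a topology"
  assumes topspace_eq: "topspace T = carrier G"
    and continuous_mult: "continuous_map (prod_topology T T) T (\<lambda>(x, y). x \<otimes> y)"
    and continuous_inv: "continuous_map T T (\<lambda>x. inv x)"

definition neighbourhood_of_one :: "('a, 'm) monoid_scheme \<Rightarrow> 'a topology \<Rightarrow> 'a set \<Rightarrow> bool" where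
  "neighbourhood_of_one G T U \<longleftrightarrow>
     U \<subseteq> carrier G \<and> (\<exists>W. openin T W \<and> \<one>\<^bsub>G\<^esub> \<in> W \<and> W \<subseteq> U)"

definition locally_compact_abelian_group :: "('a, 'm) monoid_scheme \<Rightarrow> 'a topology \<Rightarrow> bool" where
  "locally_compact_abelian_group G T \<longleftrightarrow>
     abelian_topological_group G T \<and> Hausdorff_space T \<and> locally_compact_space T"

definition totally_disconnected_space :: "'a topology \<Rightarrow> bool" where
  "totally_disconnected_space T \<longleftrightarrow>
     (\<forall>x \<in> topspace T. connected_component_of_set T x = {x})"


section \<open>The group of null sequences with the uniform topology\<close>

definition null_seq_group :: "('a, 'm) monoid_scheme \<Rightarrow> 'a topology \<Rightarrow> (nat \<Rightarrow> 'a) monoid" where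
  "null_seq_group X T =
     \<lparr>carrier = {x. range x \<subseteq> carrier X \<and> limitin T x \<one>\<^bsub>X\<^esub> sequentially},
      monoid.mult = (\<lambda>x y n. x n \<otimes>\<^bsub>X\<^esub> y n),
      one = (\<lambda>n. \<one>\<^bsub>X\<^esub>)\<rparr>"

definition null_seq_topology :: "('a, 'm) monoid_scheme \<Rightarrow> 'a topology \<Rightarrow> (nat \<Rightarrow> 'a) topology" where
  "null_seq_topology X T = topology (\<lambda>W.
     W \<subseteq> carrier (null_seq_group X T) \<and>
     (\<forall>x\<in>W. \<exists>V. openin T V \<and> \<one>\<^bsub>X\<^esub> \<in> V \<and>
        x <#\<^bsub>null_seq_group X T\<^esub> {y \<in> carrier (null_seq_group X T). range y \<subseteq> V} \<subseteq> W))"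

lemma openin_null_seq_topology:
  "openin (null_seq_topology X T) W \<longleftrightarrow>
     W \<subseteq> carrier (null_seq_group X T) \<and>
     (\<forall>x\<in>W. \<exists>V. openin T V \<and> \<one>\<^bsub>X\<^esub> \<in> V \<and>
        x <#\<^bsub>null_seq_group X T\<^esub> {y \<in> carrier (null_seq_group X T). range y \<subseteq> V} \<subseteq> W)"
proof -
  let ?F = "null_seq_group X T"
  let ?N = "\<lambda>V. {y \<in> carrier ?F. range y \<subseteq> V}"
  let ?P = "\<lambda>x W. \<exists>V. openin T V \<and> \<one>\<^bsub>X\<^esub> \<in> V \<and> x <#\<^bsub>?F\<^esub> ?N V \<subseteq> W"
  have int: "?P x (A \<inter> B)" if "?P x A" "?P x B" for x A B
  proof -
    from that obtain V V' where "openin T V" "\<one>\<^bsub>X\<^esub> \<in> V" "x <#\<^bsub>?F\<^esub> ?N V \<subseteq> A"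
      "openin T V'" "\<one>\<^bsub>X\<^esub> \<in> V'" "x <#\<^bsub>?F\<^esub> ?N V' \<subseteq> B"
      by blast
    then have "openin T (V \<inter> V')" "\<one>\<^bsub>X\<^esub> \<in> V \<inter> V'" "x <#\<^bsub>?F\<^esub> ?N (V \<inter> V') \<subseteq> A \<inter> B"
      by (auto simp: l_coset_def)
    then show ?thesis by blast
  qed
  have mono: "?P x B" if "?P x A" "A \<subseteq> B" for x A B
    using that by (meson order_trans)
  have "istopology (\<lambda>W. W \<subseteq> carrier ?F \<and> (\<forall>x\<in>W. ?P x W))"
    unfolding istopology_def
  proof (rule conjI; intro allI impI; (elim conjE)?)
    fix A B assume "A \<subseteq> carrier ?F" "B \<subseteq> carrier ?F" "\<forall>x\<in>A. ?P x A" "\<forall>x\<in>B. ?P x B"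
    then show "A \<inter> B \<subseteq> carrier ?F \<and> (\<forall>x\<in>A \<inter> B. ?P x (A \<inter> B))"
      using int[of _ A B] by (simp add: le_infI1)
  next
    fix \<K> assume K: "\<forall>A\<in>\<K>. A \<subseteq> carrier ?F \<and> (\<forall>x\<in>A. ?P x A)"
    show "\<Union> \<K> \<subseteq> carrier ?F \<and> (\<forall>x\<in>\<Union> \<K>. ?P x (\<Union> \<K>))"
    proof (intro conjI ballI)
      show "\<Union> \<K> \<subseteq> carrier ?F" using K by blast
      fix x assume "x \<in> \<Union> \<K>"
      then obtain A where "A \<in> \<K>" "x \<in> A" by blast
      then have "?P x A" using K by blast
      moreover have "A \<subseteq> \<Union> \<K>" using \<open>A \<in> \<K>\<close> by blast
      ultimately show "?P x (\<Union> \<K>)" by (rule mono)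
    qed
  qed
  then show ?thesis
    unfolding null_seq_topology_def by (simp add: topology_inverse')
qed

lemma abelian_topological_group_null_seq:
  assumes "abelian_topological_group X T"
  shows "abelian_topological_group (null_seq_group X T) (null_seq_topology X T)"
proof -
  interpret abelian_topological_group X T by fact
  let ?F = "null_seq_group X T" and ?S = "null_seq_topology X T"
  let ?N = "\<lambda>V. {y \<in> carrier ?F. range y \<subseteq> V}"
  have car: "x \<in> carrier ?F \<longleftrightarrow> (\<forall>n. x n \<in> carrier X) \<and> limitin T x \<one>\<^bsub>X\<^esub> sequentially" for x
    by (auto simp: null_seq_group_def)
  have mulF: "x \<otimes>\<^bsub>?F\<^esub> y = (\<lambda>n. x n \<otimes>\<^bsub>X\<^esub> y n)" for x y
    by (simp add: null_seq_group_def)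
  have oneF: "\<one>\<^bsub>?F\<^esub> = (\<lambda>n. \<one>\<^bsub>X\<^esub>)"
    by (simp add: null_seq_group_def)
  have closed: "(\<lambda>n. x n \<otimes>\<^bsub>X\<^esub> y n) \<in> carrier ?F" if "x \<in> carrier ?F" "y \<in> carrier ?F" for x y
  proof -
    have "limitin (prod_topology T T) (\<lambda>n. (x n, y n)) (\<one>\<^bsub>X\<^esub>, \<one>\<^bsub>X\<^esub>) sequentially"
      using that by (simp add: limitin_pairwise car o_def)
    from continuous_map_limit[OF continuous_mult this] that show ?thesis
      by (simp add: car o_def)
  qed
  have invc: "(\<lambda>n. inv\<^bsub>X\<^esub> (x n)) \<in> carrier ?F" if "x \<in> carrier ?F" for x
    using continuous_map_limit[OF continuous_inv, of x "\<one>\<^bsub>X\<^esub>" sequentially] that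
    by (simp add: car o_def)
  have cg: "comm_group ?F"
  proof (rule comm_groupI)
    show "\<exists>y\<in>carrier ?F. y \<otimes>\<^bsub>?F\<^esub> x = \<one>\<^bsub>?F\<^esub>" if "x \<in> carrier ?F" for x
      using invc[OF that] that by (intro bexI[where x="\<lambda>n. inv\<^bsub>X\<^esub> (x n)"]) (auto simp: mulF oneF car)
    show "x \<otimes>\<^bsub>?F\<^esub> y \<in> carrier ?F" if "x \<in> carrier ?F" "y \<in> carrier ?F" for x y
      using closed[OF that] by (simp add: mulF)
  qed (auto simp: mulF oneF car m_ac limitin_const topspace_eq)
  interpret F: comm_group ?F by (rule cg)
  have invF: "inv\<^bsub>?F\<^esub> x = (\<lambda>n. inv\<^bsub>X\<^esub> (x n))" if "x \<in> carrier ?F" for x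
    using that invc by (intro F.inv_equality) (auto simp: mulF oneF car)
  have ts: "topspace ?S = carrier ?F"
  proof -
    have "openin ?S (carrier ?F)"
      unfolding openin_null_seq_topology
      using openin_topspace[of T] topspace_eq by (auto simp: l_coset_def intro!: exI[where x="topspace T"])
    then show ?thesis
      using openin_null_seq_topology by (metis openin_subset openin_topspace subset_antisym)
  qed
  have nbh2: "\<exists>V'. openin T V' \<and> \<one>\<^bsub>X\<^esub> \<in> V' \<and> (\<forall>a\<in>V'. \<forall>b\<in>V'. a \<otimes>\<^bsub>X\<^esub> b \<in> V)"
    if V: "openin T V" "\<one>\<^bsub>X\<^esub> \<in> V" for V
  proof -
    let ?Q = "{p \<in> topspace (prod_topology T T). (case p of (x, y) \<Rightarrow> x \<otimes>\<^bsub>X\<^esub> y) \<in> V}"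
    have "openin (prod_topology T T) ?Q"
      using continuous_mult V(1) by (rule openin_continuous_map_preimage)
    note Q = this[unfolded openin_prod_topology_alt, THEN spec, THEN spec, THEN mp]
    have "(\<one>\<^bsub>X\<^esub>, \<one>\<^bsub>X\<^esub>) \<in> ?Q" using V topspace_eq by auto
    from Q[OF this] obtain U W where "openin T U" "openin T W" "\<one>\<^bsub>X\<^esub> \<in> U" "\<one>\<^bsub>X\<^esub> \<in> W" "U \<times> W \<subseteq> ?Q"
      by (elim exE conjE)
    then show ?thesis by (intro exI[where x="U \<inter> W"]) auto
  qed
  have nbhi: "\<exists>V'. openin T V' \<and> \<one>\<^bsub>X\<^esub> \<in> V' \<and> (\<forall>a\<in>V'. inv\<^bsub>X\<^esub> a \<in> V)"
    if V: "openin T V" "\<one>\<^bsub>X\<^esub> \<in> V" for V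
    using openin_continuous_map_preimage[OF continuous_inv V(1)] V topspace_eq
    by (intro exI[where x="{x \<in> topspace T. inv\<^bsub>X\<^esub> x \<in> V}"]) auto
  have Nsub: "\<exists>W. openin ?S W \<and> x \<in> W \<and> W \<subseteq> x <#\<^bsub>?F\<^esub> ?N V"
    if V: "openin T V" "\<one>\<^bsub>X\<^esub> \<in> V" and x: "x \<in> carrier ?F" for x V
  proof -
    let ?W = "{w \<in> carrier ?F. \<exists>V'. openin T V' \<and> \<one>\<^bsub>X\<^esub> \<in> V' \<and> w <#\<^bsub>?F\<^esub> ?N V' \<subseteq> x <#\<^bsub>?F\<^esub> ?N V}"
    have "openin ?S ?W"
      unfolding openin_null_seq_topology
    proof (intro conjI ballI)
      fix w assume "w \<in> ?W"
      then obtain V' where V': "w \<in> carrier ?F" "openin T V'" "\<one>\<^bsub>X\<^esub> \<in> V'"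
        "w <#\<^bsub>?F\<^esub> ?N V' \<subseteq> x <#\<^bsub>?F\<^esub> ?N V" by blast
      obtain V'' where V'': "openin T V''" "\<one>\<^bsub>X\<^esub> \<in> V''" "\<And>a b. a\<in>V'' \<Longrightarrow> b\<in>V'' \<Longrightarrow> a \<otimes>\<^bsub>X\<^esub> b \<in> V'"
        using nbh2[OF V'(2,3)] by blast
      have "w <#\<^bsub>?F\<^esub> ?N V'' \<subseteq> ?W"
      proof
        fix u assume "u \<in> w <#\<^bsub>?F\<^esub> ?N V''"
        then obtain y where y: "y \<in> ?N V''" "u = w \<otimes>\<^bsub>?F\<^esub> y" by (auto simp: l_coset_def)
        have "u <#\<^bsub>?F\<^esub> ?N V'' \<subseteq> w <#\<^bsub>?F\<^esub> ?N V'"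
        proof
          fix v assume "v \<in> u <#\<^bsub>?F\<^esub> ?N V''"
          then obtain z where z: "z \<in> ?N V''" "v = u \<otimes>\<^bsub>?F\<^esub> z" by (auto simp: l_coset_def)
          have "y \<otimes>\<^bsub>?F\<^esub> z \<in> ?N V'"
            using y(1) z(1) V''(3) closed[of y z] by (auto simp: mulF image_subset_iff)
          moreover have "v = w \<otimes>\<^bsub>?F\<^esub> (y \<otimes>\<^bsub>?F\<^esub> z)"
            using y z V'(1) by (auto simp: F.m_assoc)
          ultimately show "v \<in> w <#\<^bsub>?F\<^esub> ?N V'" by (auto simp: l_coset_def)
        qed
        then have "u <#\<^bsub>?F\<^esub> ?N V'' \<subseteq> x <#\<^bsub>?F\<^esub> ?N V" using V'(4) by (rule subset_trans)
        moreover have "u \<in> carrier ?F" using y V'(1) by auto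
        ultimately show "u \<in> ?W" using V'' by blast
      qed
      then show "\<exists>V. openin T V \<and> \<one>\<^bsub>X\<^esub> \<in> V \<and> w <#\<^bsub>?F\<^esub> ?N V \<subseteq> ?W" using V'' by blast
    qed blast
    moreover have "x \<in> ?W" using x V by blast
    moreover have "?W \<subseteq> x <#\<^bsub>?F\<^esub> ?N V"
    proof
      fix w assume "w \<in> ?W"
      then obtain V' where V': "w \<in> carrier ?F" "openin T V'" "\<one>\<^bsub>X\<^esub> \<in> V'"
        "w <#\<^bsub>?F\<^esub> ?N V' \<subseteq> x <#\<^bsub>?F\<^esub> ?N V" by blast
      have "\<one>\<^bsub>?F\<^esub> \<in> ?N V'" using V'(3) F.one_closed oneF by auto
      then have "w \<otimes>\<^bsub>?F\<^esub> \<one>\<^bsub>?F\<^esub> \<in> w <#\<^bsub>?F\<^esub> ?N V'" unfolding l_coset_def by blast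
      then show "w \<in> x <#\<^bsub>?F\<^esub> ?N V" using V' by auto
    qed
    ultimately show ?thesis by blast
  qed
  show ?thesis
  proof (intro abelian_topological_group.intro abelian_topological_group_axioms.intro cg ts)
    show "continuous_map (prod_topology ?S ?S) ?S (\<lambda>(x, y). x \<otimes>\<^bsub>?F\<^esub> y)"
      unfolding continuous_map_def
    proof (intro conjI allI impI)
      show "(\<lambda>(x, y). x \<otimes>\<^bsub>?F\<^esub> y) \<in> topspace (prod_topology ?S ?S) \<rightarrow> topspace ?S"
        by (auto simp: ts)
      fix W assume W: "openin ?S W"
      show "openin (prod_topology ?S ?S) {p \<in> topspace (prod_topology ?S ?S). (case p of (x, y) \<Rightarrow> x \<otimes>\<^bsub>?F\<^esub> y) \<in> W}"
        unfolding openin_prod_topology_alt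
      proof (intro allI impI)
        fix x y assume "(x, y) \<in> {p \<in> topspace (prod_topology ?S ?S). (case p of (x, y) \<Rightarrow> x \<otimes>\<^bsub>?F\<^esub> y) \<in> W}"
        then have xy: "x \<in> carrier ?F" "y \<in> carrier ?F" "x \<otimes>\<^bsub>?F\<^esub> y \<in> W" by (auto simp: ts)
        obtain V where V: "openin T V" "\<one>\<^bsub>X\<^esub> \<in> V" "(x \<otimes>\<^bsub>?F\<^esub> y) <#\<^bsub>?F\<^esub> ?N V \<subseteq> W"
          using W xy(3) unfolding openin_null_seq_topology by blast
        obtain V' where V': "openin T V'" "\<one>\<^bsub>X\<^esub> \<in> V'" "\<And>a b. a\<in>V' \<Longrightarrow> b\<in>V' \<Longrightarrow> a \<otimes>\<^bsub>X\<^esub> b \<in> V"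
          using nbh2[OF V(1,2)] by blast
        obtain A where A: "openin ?S A" "x \<in> A" "A \<subseteq> x <#\<^bsub>?F\<^esub> ?N V'" using Nsub[OF V'(1,2) xy(1)] by blast
        obtain B where B: "openin ?S B" "y \<in> B" "B \<subseteq> y <#\<^bsub>?F\<^esub> ?N V'" using Nsub[OF V'(1,2) xy(2)] by blast
        have "a \<otimes>\<^bsub>?F\<^esub> b \<in> W" if ab: "a \<in> A" "b \<in> B" for a b
        proof -
          obtain u where u: "u \<in> ?N V'" "a = x \<otimes>\<^bsub>?F\<^esub> u" using A ab by (auto simp: l_coset_def)
          obtain v where v: "v \<in> ?N V'" "b = y \<otimes>\<^bsub>?F\<^esub> v" using B ab by (auto simp: l_coset_def)
          have "a \<otimes>\<^bsub>?F\<^esub> b = (x \<otimes>\<^bsub>?F\<^esub> y) \<otimes>\<^bsub>?F\<^esub> (u \<otimes>\<^bsub>?F\<^esub> v)"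
            using u v xy by (simp add: F.m_ac)
          moreover have "u \<otimes>\<^bsub>?F\<^esub> v \<in> ?N V"
            using u(1) v(1) V'(3) closed[of u v] by (auto simp: mulF image_subset_iff)
          ultimately show ?thesis using V(3) by (auto simp: l_coset_def)
        qed
        moreover have "A \<subseteq> carrier ?F" "B \<subseteq> carrier ?F"
          using openin_subset[OF A(1)] openin_subset[OF B(1)] ts by auto
        ultimately show "\<exists>U V. openin ?S U \<and> openin ?S V \<and> x \<in> U \<and> y \<in> V \<and>
           U \<times> V \<subseteq> {p \<in> topspace (prod_topology ?S ?S). (case p of (x, y) \<Rightarrow> x \<otimes>\<^bsub>?F\<^esub> y) \<in> W}"
          using A(1,2) B(1,2) by (intro exI[where x=A] exI[where x=B]) (auto simp: ts)
      qed
    qed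
    show "continuous_map ?S ?S (\<lambda>x. inv\<^bsub>?F\<^esub> x)"
      unfolding continuous_map_def
    proof (intro conjI allI impI)
      show "(\<lambda>x. inv\<^bsub>?F\<^esub> x) \<in> topspace ?S \<rightarrow> topspace ?S" by (auto simp: ts)
      fix W assume W: "openin ?S W"
      show "openin ?S {x \<in> topspace ?S. inv\<^bsub>?F\<^esub> x \<in> W}"
        unfolding openin_null_seq_topology
      proof (intro conjI ballI)
        show "{x \<in> topspace ?S. inv\<^bsub>?F\<^esub> x \<in> W} \<subseteq> carrier ?F" by (auto simp: ts)
        fix x assume "x \<in> {x \<in> topspace ?S. inv\<^bsub>?F\<^esub> x \<in> W}"
        then have x: "x \<in> carrier ?F" "inv\<^bsub>?F\<^esub> x \<in> W" by (auto simp: ts)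
        obtain V where V: "openin T V" "\<one>\<^bsub>X\<^esub> \<in> V" "(inv\<^bsub>?F\<^esub> x) <#\<^bsub>?F\<^esub> ?N V \<subseteq> W"
          using W x(2) unfolding openin_null_seq_topology by blast
        obtain V' where V': "openin T V'" "\<one>\<^bsub>X\<^esub> \<in> V'" "\<And>a. a\<in>V' \<Longrightarrow> inv\<^bsub>X\<^esub> a \<in> V"
          using nbhi[OF V(1,2)] by blast
        have "x <#\<^bsub>?F\<^esub> ?N V' \<subseteq> {x \<in> topspace ?S. inv\<^bsub>?F\<^esub> x \<in> W}"
        proof
          fix a assume "a \<in> x <#\<^bsub>?F\<^esub> ?N V'"
          then obtain u where u: "u \<in> ?N V'" "a = x \<otimes>\<^bsub>?F\<^esub> u" by (auto simp: l_coset_def)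
          have "inv\<^bsub>?F\<^esub> a = inv\<^bsub>?F\<^esub> x \<otimes>\<^bsub>?F\<^esub> inv\<^bsub>?F\<^esub> u"
            using u x(1) by (simp add: F.inv_mult)
          moreover have "inv\<^bsub>?F\<^esub> u \<in> ?N V"
            using u(1) V'(3) invc[of u] by (auto simp: invF image_subset_iff)
          ultimately have "inv\<^bsub>?F\<^esub> a \<in> W" using V(3) by (auto simp: l_coset_def)
          then show "a \<in> {x \<in> topspace ?S. inv\<^bsub>?F\<^esub> x \<in> W}" using u x(1) by (simp add: ts)
        qed
        then show "\<exists>V. openin T V \<and> \<one>\<^bsub>X\<^esub> \<in> V \<and>
            x <#\<^bsub>?F\<^esub> ?N V \<subseteq> {x \<in> topspace ?S. inv\<^bsub>?F\<^esub> x \<in> W}" using V' by blast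
      qed
    qed
  qed
qed



section \<open>Characters, maximal almost periodicity and the Bohr topology\<close>

definition circle_group :: "complex monoid" where
  "circle_group = \<lparr>carrier = sphere 0 1, monoid.mult = (*), one = 1\<rparr>"

definition continuous_characters :: "('a, 'm) monoid_scheme \<Rightarrow> 'a topology \<Rightarrow> ('a \<Rightarrow> complex) set" where
  "continuous_characters G T =
     {\<psi> \<in> hom G circle_group. continuous_map T (top_of_set (sphere 0 1)) \<psi>}"

definition MAP_group :: "('a, 'm) monoid_scheme \<Rightarrow> 'a topology \<Rightarrow> bool" where
  "MAP_group G T \<longleftrightarrow> abelian_topological_group G T \<and>
     (\<forall>x\<in>carrier G. \<forall>y\<in>carrier G. x \<noteq> y \<longrightarrow> (\<exists>\<psi>\<in>continuous_characters G T. \<psi> x \<noteq> \<psi> y))"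

text \<open>
  The topology of \<open>G\<^sup>+\<close>. It is defined as the weakest topology making all continuous characters
  continuous; \<open>bohr_topology_weakest\<close> below shows that it is a group topology, and hence
  the weakest group topology with this property.
\<close>

definition bohr_topology :: "('a, 'm) monoid_scheme \<Rightarrow> 'a topology \<Rightarrow> 'a topology" where
  "bohr_topology G T = topology_generated_by
     {{x \<in> carrier G. \<psi> x \<in> U} | \<psi> U. \<psi> \<in> continuous_characters G T \<and> open U}"

lemma bohr_topology_weakest:
  assumes "abelian_topological_group G T"
  shows "abelian_topological_group G (bohr_topology G T)"
    and "\<And>\<psi>. \<psi> \<in> continuous_characters G T \<Longrightarrow>
           continuous_map (bohr_topology G T) (top_of_set (sphere 0 1)) \<psi>"
    and "\<And>T' W. \<lbrakk>topspace T' = carrier G;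
            \<And>\<psi>. \<psi> \<in> continuous_characters G T \<Longrightarrow> continuous_map T' (top_of_set (sphere 0 1)) \<psi>;
            openin (bohr_topology G T) W\<rbrakk> \<Longrightarrow> openin T' W"
proof -
  interpret abelian_topological_group G T by fact
  let ?C = "continuous_characters G T" and ?B = "bohr_topology G T"
  have triv: "(\<lambda>_. 1) \<in> ?C"
    by (auto simp: continuous_characters_def hom_def circle_group_def)
  let ?S = "{{x \<in> carrier G. \<psi> x \<in> U} | \<psi> U. \<psi> \<in> ?C \<and> open U}"
  have "{x \<in> carrier G. (\<lambda>_. 1 :: complex) x \<in> UNIV} \<in> ?S"
    by (rule CollectI, intro exI conjI) (rule refl triv open_UNIV)+
  then have "carrier G \<subseteq> \<Union>?S" by (intro Union_upper) simp
  moreover have "\<Union>?S \<subseteq> carrier G" by blast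
  ultimately have "\<Union>?S = carrier G" by (rule subset_antisym[rotated])
  then have ts: "topspace ?B = carrier G"
    unfolding bohr_topology_def topology_generated_by_topspace .
  have sph: "\<psi> x \<in> sphere 0 1" if "\<psi> \<in> ?C" "x \<in> carrier G" for \<psi> x
    using that by (auto simp: continuous_characters_def hom_def circle_group_def)
  have mult: "\<psi> (x \<otimes>\<^bsub>G\<^esub> y) = \<psi> x * \<psi> y" if "\<psi> \<in> ?C" "x \<in> carrier G" "y \<in> carrier G" for \<psi> x y
    using that by (auto simp: continuous_characters_def hom_def circle_group_def)
  have op: "openin ?B {x \<in> carrier G. \<psi> x \<in> U}" if "\<psi> \<in> ?C" "open U" for \<psi> U
    unfolding bohr_topology_def by (rule topology_generated_by_Basis) (use that in blast)
  have contC: "continuous_map ?B euclidean \<psi>" if "\<psi> \<in> ?C" for \<psi>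
    using op[OF that] by (auto simp: continuous_map_def ts)
  show cont: "continuous_map ?B (top_of_set (sphere 0 1)) \<psi>" if "\<psi> \<in> ?C" for \<psi>
    using contC[OF that] sph[OF that] by (auto simp: continuous_map_in_subtopology ts)
  have univ: "continuous_map Y ?B f"
    if "f \<in> topspace Y \<rightarrow> carrier G"
      and "\<And>\<psi>. \<psi> \<in> ?C \<Longrightarrow> continuous_map Y euclidean (\<psi> \<circ> f)" for Y :: "'c topology" and f
    unfolding bohr_topology_def
  proof (rule continuous_on_generated_topo)
    show "f ` topspace Y \<subseteq> \<Union> {{x \<in> carrier G. \<psi> x \<in> U} |\<psi> U. \<psi> \<in> ?C \<and> open U}"
      using that(1) ts unfolding bohr_topology_def topology_generated_by_topspace by blast
  next
    fix W assume "W \<in> {{x \<in> carrier G. \<psi> x \<in> U} |\<psi> U. \<psi> \<in> ?C \<and> open U}"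
    then obtain \<psi> U where W: "W = {x \<in> carrier G. \<psi> x \<in> U}" "\<psi> \<in> ?C" "open U" by blast
    have "f -` W \<inter> topspace Y = {x \<in> topspace Y. (\<psi> \<circ> f) x \<in> U}"
      using that(1) W(1) by auto
    then show "openin Y (f -` W \<inter> topspace Y)"
      using that(2)[OF W(2)] W(3) by (simp add: continuous_map_def)
  qed
  show "abelian_topological_group G ?B"
  proof
    show "topspace ?B = carrier G" by (rule ts)
    show "continuous_map (prod_topology ?B ?B) ?B (\<lambda>(x, y). x \<otimes>\<^bsub>G\<^esub> y)"
    proof (rule univ)
      fix \<psi> assume psi: "\<psi> \<in> ?C"
      have "continuous_map (prod_topology ?B ?B) (prod_topology euclidean euclidean) (\<lambda>p. (\<psi> (fst p), \<psi> (snd p)))"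
        using continuous_map_compose[OF continuous_map_fst contC[OF psi]]
          continuous_map_compose[OF continuous_map_snd contC[OF psi]]
        by (intro continuous_map_pairedI) (simp_all add: o_def)
      moreover have "continuous_map (prod_topology euclidean euclidean) euclidean (\<lambda>p :: complex \<times> complex. fst p * snd p)"
        unfolding prod_topology_euclidean by (auto intro!: continuous_intros)
      ultimately have "continuous_map (prod_topology ?B ?B) euclidean
          ((\<lambda>p. fst p * snd p) \<circ> (\<lambda>p. (\<psi> (fst p), \<psi> (snd p))))"
        by (rule continuous_map_compose)
      then show "continuous_map (prod_topology ?B ?B) euclidean (\<psi> \<circ> (\<lambda>(x, y). x \<otimes>\<^bsub>G\<^esub> y))"
        by (rule continuous_map_eq) (auto simp: ts mult[OF psi])
    qed (auto simp: ts)
    show "continuous_map ?B ?B (\<lambda>x. inv\<^bsub>G\<^esub> x)"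
    proof (rule univ)
      fix \<psi> assume psi: "\<psi> \<in> ?C"
      have "continuous_map ?B euclidean (\<lambda>x. cnj (\<psi> x))"
        using continuous_map_compose[OF contC[OF psi], of euclidean cnj]
        by (simp add: o_def continuous_on_cnj)
      moreover have "cnj (\<psi> x) = \<psi> (inv\<^bsub>G\<^esub> x)" if "x \<in> carrier G" for x
      proof -
        have "\<psi> \<one>\<^bsub>G\<^esub> = \<psi> \<one>\<^bsub>G\<^esub> * \<psi> \<one>\<^bsub>G\<^esub>" "\<psi> \<one>\<^bsub>G\<^esub> \<noteq> 0"
          using mult[OF psi, of "\<one>\<^bsub>G\<^esub>" "\<one>\<^bsub>G\<^esub>"] sph[OF psi, of "\<one>\<^bsub>G\<^esub>"] by auto
        then have "\<psi> x * \<psi> (inv\<^bsub>G\<^esub> x) = 1"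
          using mult[OF psi, of x "inv\<^bsub>G\<^esub> x"] that by simp
        moreover have "\<psi> x * cnj (\<psi> x) = 1"
          using sph[OF psi that] by (simp add: complex_norm_square[symmetric])
        ultimately show ?thesis
          using mult_cancel_left[of "\<psi> x" "\<psi> (inv\<^bsub>G\<^esub> x)" "cnj (\<psi> x)"] by auto
      qed
      ultimately show "continuous_map ?B euclidean (\<psi> \<circ> (\<lambda>x. inv\<^bsub>G\<^esub> x))"
        by (auto intro: continuous_map_eq simp: ts)
    qed (auto simp: ts)
  qed
  show "openin T' W" if T': "topspace T' = carrier G"
      "\<And>\<psi>. \<psi> \<in> ?C \<Longrightarrow> continuous_map T' (top_of_set (sphere 0 1)) \<psi>" "openin ?B W" for T' W
  proof -
    have "continuous_map T' ?B (\<lambda>x. x)"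
      using T'(1,2) by (intro univ) (auto simp: o_def continuous_map_in_subtopology)
    then have "openin T' {x \<in> topspace T'. x \<in> W}"
      using T'(3) by (rule openin_continuous_map_preimage)
    moreover have "{x \<in> topspace T'. x \<in> W} = W"
      using openin_subset[OF T'(3)] unfolding ts T'(1) by blast
    ultimately show ?thesis by simp
  qed
qed



section \<open>Compactness-like properties of subsets and their preservation\<close>

text \<open>Compactness of subsets is \<^const>\<open>compactin\<close>.\<close>

definition countably_compactin :: "'a topology \<Rightarrow> 'a set \<Rightarrow> bool" where
  "countably_compactin T A \<longleftrightarrow> A \<subseteq> topspace T \<and>
     (\<forall>B \<subseteq> A. countable B \<and> infinite B \<longrightarrow> A \<inter> (T derived_set_of B) \<noteq> {})"

definition sequentially_compactin :: "'a topology \<Rightarrow> 'a set \<Rightarrow> bool" where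
  "sequentially_compactin T A \<longleftrightarrow> A \<subseteq> topspace T \<and>
     (\<forall>\<sigma> :: nat \<Rightarrow> 'a. range \<sigma> \<subseteq> A \<longrightarrow>
        (\<exists>l\<in>A. \<exists>r :: nat \<Rightarrow> nat. strict_mono r \<and> limitin T (\<sigma> \<circ> r) l sequentially))"

definition pseudocompactin :: "'a topology \<Rightarrow> 'a set \<Rightarrow> bool" where
  "pseudocompactin T A \<longleftrightarrow> A \<subseteq> topspace T \<and>
     (\<forall>f. continuous_map (subtopology T A) euclideanreal f \<longrightarrow> bounded (f ` A))"

definition functionally_boundedin :: "'a topology \<Rightarrow> 'a set \<Rightarrow> bool" where
  "functionally_boundedin T E \<longleftrightarrow> E \<subseteq> topspace T \<and>
     (\<forall>f. continuous_map T euclideanreal f \<longrightarrow> bounded (f ` E))"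

definition respects_property ::
    "('a topology \<Rightarrow> 'a set \<Rightarrow> bool) \<Rightarrow> ('a, 'm) monoid_scheme \<Rightarrow> 'a topology \<Rightarrow> bool" where
  "respects_property P G T \<longleftrightarrow> MAP_group G T \<and> (\<forall>A. P T A \<longleftrightarrow> P (bohr_topology G T) A)"

definition schur_property :: "('a, 'm) monoid_scheme \<Rightarrow> 'a topology \<Rightarrow> bool" where
  "schur_property G T \<longleftrightarrow> MAP_group G T \<and>
     (\<forall>\<sigma> :: nat \<Rightarrow> 'a. range \<sigma> \<subseteq> carrier G \<longrightarrow>
        ((\<exists>l. limitin T \<sigma> l sequentially) \<longleftrightarrow> (\<exists>l. limitin (bohr_topology G T) \<sigma> l sequentially)))"


section \<open>Embeddings into products of locally compact Abelian groups\<close>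

text \<open>
  The type arguments bound the index set and the elements of the factors. A Hausdorff group with
  elements of type \<open>'a\<close> that embeds into any product of LCA groups embeds into one with index type
  \<open>'a set\<close> and factors with elements of type \<open>'a set set\<close>: take one factor for each open
  neighbourhood of \<open>\<one>\<close>, namely the closure of the image of the group in a suitable finite
  subproduct; if the group has \<open>\<kappa>\<close> elements, this closure has at most \<open>2 ^ (2 ^ \<kappa>)\<close>.
\<close>

definition embeds_in_product_of_LCA ::
    "'i itself \<Rightarrow> 'h itself \<Rightarrow> ('a, 'm) monoid_scheme \<Rightarrow> 'a topology \<Rightarrow> bool" where
  "embeds_in_product_of_LCA _ _ G T \<longleftrightarrow>
     (\<exists>(I :: 'i set) (H :: 'i \<Rightarrow> 'h monoid) (S :: 'i \<Rightarrow> 'h topology) f.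
        (\<forall>i\<in>I. locally_compact_abelian_group (H i) (S i)) \<and>
        f \<in> hom G (product_group I H) \<and> embedding_map T (product_topology S I) f)"


section \<open>Schwartz groups\<close>

definition group_fraction :: "('a, 'm) monoid_scheme \<Rightarrow> nat \<Rightarrow> 'a set \<Rightarrow> 'a set" where
  "group_fraction G n U = {x \<in> carrier G. \<forall>k\<in>{1..n}. x [^]\<^bsub>G\<^esub> k \<in> U}"

definition schwartz_group :: "('a, 'm) monoid_scheme \<Rightarrow> 'a topology \<Rightarrow> bool" where
  "schwartz_group G T \<longleftrightarrow> abelian_topological_group G T \<and> Hausdorff_space T \<and>
     (\<forall>U. neighbourhood_of_one G T U \<longrightarrow>
        (\<exists>F :: nat \<Rightarrow> 'a set. (\<forall>n\<ge>1. finite (F n) \<and> F n \<subseteq> carrier G) \<and>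
           neighbourhood_of_one G T (\<Inter>n\<in>{1..}. group_fraction G n U <#>\<^bsub>G\<^esub> F n)))"


section \<open>Nuclear groups\<close>

text \<open>
  The numbers \<open>d\<^sub>k(A, B)\<close>, with value \<open>\<infinity>\<close> if there is no admissible \<open>t\<close>. The finite spanning set is
  needed because \<^const>\<open>dim\<close> is \<open>0\<close> on infinite-dimensional subspaces.
\<close>

definition kolmogorov_diameter ::
    "'e::real_vector set \<Rightarrow> nat \<Rightarrow> 'e set \<Rightarrow> 'e set \<Rightarrow> ereal" where
  "kolmogorov_diameter E k A B = Inf {ereal t | t. t > 0 \<and>
     (\<exists>L. subspace L \<and> L \<subseteq> E \<and> (\<exists>b. finite b \<and> span b = L) \<and> dim L < k \<and>
        A \<subseteq> {t *\<^sub>R y + l | y l. y \<in> B \<and> l \<in> L})}"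

definition additive_group :: "'e::real_vector set \<Rightarrow> 'e monoid" where
  "additive_group K = \<lparr>carrier = K, monoid.mult = (+), one = 0\<rparr>"

text \<open>
  The vector space \<open>E\<close> ranges over the linear subspaces of the type argument. For a group with
  elements of type \<open>'a\<close> the space \<open>('a \<times> nat, real) poly_mapping\<close> is large enough to cover
  all real vector spaces: shrink \<open>K\<close> to the subgroup generated by one preimage in \<open>K \<inter> A\<close> of each
  element of \<open>\<phi> ` (K \<inter> A)\<close>, and then \<open>E\<close> to the sum of the span of \<open>K\<close> and countably many
  finite-dimensional spaces \<open>L\<close> witnessing the bounds on the \<open>d\<^sub>k(A, B)\<close>.
\<close>

definition nuclear_group ::
    "'e::real_vector itself \<Rightarrow> ('a, 'm) monoid_scheme \<Rightarrow> 'a topology \<Rightarrow> bool" where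
  "nuclear_group _ G T \<longleftrightarrow> abelian_topological_group G T \<and> Hausdorff_space T \<and>
     (\<forall>U (c::real) (m::nat). neighbourhood_of_one G T U \<and> c > 0 \<longrightarrow>
        (\<exists>(E :: 'e set) A B K \<phi>.
           subspace E \<and>
           A \<subseteq> E \<and> convex A \<and> uminus ` A = A \<and>
           B \<subseteq> E \<and> convex B \<and> uminus ` B = B \<and>
           (\<forall>k\<ge>1. kolmogorov_diameter E k A B \<le> ereal (c / real k ^ m)) \<and>
           subgroup K (additive_group E) \<and>
           \<phi> \<in> hom (additive_group K) G \<and>
           neighbourhood_of_one G T (\<phi> ` (K \<inter> A)) \<and>
           \<phi> ` (K \<inter> B) \<subseteq> U))"

end

theory Submission
  imports Defs "HOL-Algebra.Free_Abelian_Groups"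
begin

text \<open>
  If \<open>X\<close> is totally disconnected, the null sequences with values in a compact open subgroup of \<open>X\<close>
  form an open subgroup of \<open>F\<close>, and these subgroups are a base at \<open>\<one>\<close>. Hence \<open>F\<close> embeds into a product
  of discrete groups and is nuclear and Schwartz. A functionally bounded set of \<open>F\<^sup>+\<close> has functionally
  bounded images in the Bohr topologies of the discrete quotients; such images are finite, so the set is
  relatively compact in \<open>F\<close>, where both topologies agree on compact sets.

  For the converses, write \<open>delta k x\<close> for the sequence with \<open>x\<close> at place \<open>k\<close> and \<open>\<one>\<close> elsewhere. For \<open>v\<close> near
  \<open>\<one>\<close>, all finite products of distinct \<open>delta k v\<close> are near \<open>\<one>\<close>, so the angles of their values under a
  character have small finite sums and tend to \<open>0\<close>. Such \<open>v\<close> generate an open subgroup, which contains every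
  connected set containing \<open>\<one>\<close>. If \<open>X\<close> is not totally disconnected, then \<open>delta k x\<close> tends to \<open>\<one>\<close> in
  \<open>F\<^sup>+\<close> for some \<open>x \<noteq> \<one>\<close>. But no functionally bounded set of \<open>F\<close> contains all \<open>delta k x\<close>. If \<open>F\<close> is nuclear
  or embeds into a product of locally compact groups, infinitely many of the \<open>delta k w\<close>, \<open>w\<close> near \<open>\<one>\<close>,
  are so close to each other that products of \<open>n\<close> elements near \<open>\<one>\<close> are near \<open>\<one>\<close>, uniformly in \<open>n\<close>. If \<open>F\<close>
  is Schwartz, the pigeonhole principle gives only that the powers of elements near \<open>\<one>\<close> are near \<open>\<one>\<close>; then the
  component of \<open>\<one>\<close> in \<open>X\<close> is compact, and it is trivial because the convolution powers of a function of
  mean zero on it would decay too fast.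
\<close>


section \<open>Open subgroups of topological groups\<close>

text \<open>The crux of the forward direction: for an infinite subset E of a discrete group and any
  point q, some character keeps infinitely many members of E away from its value at q. In a
  countable group all points can be treated in turn, and the resulting cut-offs add up to a
  continuous function that is unbounded on E. An uncountable group has too many points for this,
  hence the passage to a countable divisible group. The characters arise by extending partial
  homomorphisms into the divisible circle; the freedom in choosing roots makes their values
  oscillate.

  In the converses the order of choice is decisive: the neighbourhood W of \<open>\<one>\<close> is
  fixed before the number n of factors, so the whole subgroup generated by W stays in V. In a
  Schwartz group the sets \<open>(1/n)U\<close> control powers of single elements and need not be
  closed under products, so this scheme breaks down and compact connected groups have to be excluded
  analytically. The mean used there comes from the amenability of abelian groups without topology;
  being defined on all bounded functions, it replaces the Haar integral and avoids
  measurability.\<close>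

context abelian_topological_group
begin

lemma carrier_if_openin: "openin T U \<Longrightarrow> x \<in> U \<Longrightarrow> x \<in> carrier G"
  using openin_subset topspace_eq by blast

lemma openin_carrier [simp]: "openin T (carrier G)"
  using openin_topspace[of T] by (simp add: topspace_eq)

lemma continuous_map_group_mult:
  assumes "continuous_map Y T f" "continuous_map Y T g"
  shows "continuous_map Y T (\<lambda>y. f y \<otimes> g y)"
proof -
  have "continuous_map Y (prod_topology T T) (\<lambda>y. (f y, g y))"
    using assms by (simp add: continuous_map_pairedI)
  from continuous_map_compose[OF this continuous_mult] show ?thesis by (simp add: o_def)
qed

lemma continuous_map_translation: "a \<in> carrier G \<Longrightarrow> continuous_map T T (\<lambda>x. a \<otimes> x)"
  by (intro continuous_map_group_mult) (simp_all add: topspace_eq)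

lemma translate_eq_preimage:
  assumes "a \<in> carrier G" "U \<subseteq> carrier G"
  shows "(\<lambda>x. a \<otimes> x) ` U = {x \<in> topspace T. inv a \<otimes> x \<in> U}"
proof -
  have "x \<in> (\<lambda>x. a \<otimes> x) ` U" if "x \<in> carrier G" "inv a \<otimes> x \<in> U" for x
    using that assms by (intro image_eqI[where x="inv a \<otimes> x"]) (auto simp: m_assoc[symmetric])
  with assms show ?thesis
    by (auto simp: topspace_eq m_assoc[symmetric] subset_iff)
qed

lemma openin_translate:
  assumes "openin T U" "a \<in> carrier G"
  shows "openin T ((\<lambda>x. a \<otimes> x) ` U)"
  using openin_continuous_map_preimage[OF continuous_map_translation assms(1), of "inv a"] assms
    openin_subset[OF assms(1)]
  by (simp add: translate_eq_preimage topspace_eq)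

lemma nbhd_sym_mult:
  assumes "openin T V" "\<one> \<in> V"
  obtains W where "openin T W" "\<one> \<in> W" "\<And>a. a \<in> W \<Longrightarrow> inv a \<in> W"
    "\<And>a b. a \<in> W \<Longrightarrow> b \<in> W \<Longrightarrow> a \<otimes> b \<in> V" "W \<subseteq> V"
proof -
  let ?Q = "{p \<in> topspace (prod_topology T T). (case p of (x, y) \<Rightarrow> x \<otimes> y) \<in> V}"
  have "openin (prod_topology T T) ?Q"
    using continuous_mult assms(1) by (rule openin_continuous_map_preimage)
  moreover have "(\<one>, \<one>) \<in> ?Q" using assms topspace_eq by auto
  ultimately obtain A B where AB: "openin T A" "openin T B" "\<one> \<in> A" "\<one> \<in> B" "A \<times> B \<subseteq> ?Q"
    unfolding openin_prod_topology_alt by (smt (verit))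
  define C where "C = A \<inter> B \<inter> V"
  define W where "W = C \<inter> {x \<in> topspace T. inv x \<in> C}"
  have "openin T C" unfolding C_def using AB assms by auto
  then have "openin T W"
    unfolding W_def using openin_continuous_map_preimage[OF continuous_inv] by blast
  then show thesis
    using AB assms openin_subset[OF AB(1)]
    by (intro that[of W]) (auto simp: W_def C_def topspace_eq)
qed

lemma openin_subgroup_if_nbhd:
  assumes H: "subgroup H G" and U: "openin T U" "\<one> \<in> U" "U \<subseteq> H"
  shows "openin T H"
proof (subst openin_subopen, intro ballI)
  interpret H: subgroup H G by fact
  fix h assume h: "h \<in> H"
  show "\<exists>W. openin T W \<and> h \<in> W \<and> W \<subseteq> H"
  proof (intro exI conjI)
    show "openin T ((\<lambda>x. h \<otimes> x) ` U)" using U h by (intro openin_translate) auto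
    show "h \<in> (\<lambda>x. h \<otimes> x) ` U" using U h by (intro image_eqI[where x=\<one>]) auto
    show "(\<lambda>x. h \<otimes> x) ` U \<subseteq> H" using U h by auto
  qed
qed

lemma closedin_open_subgroup:
  assumes H: "subgroup H G" and "openin T H"
  shows "closedin T H"
proof -
  interpret H: subgroup H G by fact
  have "openin T (carrier G - H)"
  proof (subst openin_subopen, intro ballI)
    fix g assume g: "g \<in> carrier G - H"
    have "h \<notin> H \<or> g \<otimes> h \<notin> H" if "h \<in> carrier G" for h
    proof (rule ccontr)
      assume "\<not> ?thesis"
      then have "(g \<otimes> h) \<otimes> inv h \<in> H" by blast
      then show False using g that by (simp add: m_assoc)
    qed
    then show "\<exists>W. openin T W \<and> g \<in> W \<and> W \<subseteq> carrier G - H"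
      using assms g by (intro exI[where x="(\<lambda>x. g \<otimes> x) ` H"])
        (auto intro!: openin_translate image_eqI[where x=\<one>])
  qed
  then show ?thesis using openin_subset[OF assms(2)] by (simp add: closedin_def topspace_eq)
qed

lemma compactin_mult:
  assumes "compactin T A" "compactin T B"
  shows "compactin T (A <#> B)"
proof -
  have "compactin T ((\<lambda>(x, y). x \<otimes> y) ` (A \<times> B))"
    using assms continuous_mult by (intro image_compactin) (auto simp: compactin_Times)
  moreover have "(\<lambda>(x, y). x \<otimes> y) ` (A \<times> B) = A <#> B"
    by (auto simp: set_mult_def)
  ultimately show ?thesis by simp
qed

end

text \<open>Unlike \<open>generate\<close>, this keeps track of the number of factors, which all
  later estimates count. For symmetric A the union over n is the subgroup generated by A.\<close>

primrec set_power :: "('a, 'm) monoid_scheme \<Rightarrow> 'a set \<Rightarrow> nat \<Rightarrow> 'a set" where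
  "set_power G A 0 = {\<one>\<^bsub>G\<^esub>}"
| "set_power G A (Suc n) = A <#>\<^bsub>G\<^esub> set_power G A n"

context comm_group
begin

lemma set_power_subset: "A \<subseteq> carrier G \<Longrightarrow> set_power G A n \<subseteq> carrier G"
  by (induction n) (auto simp: set_mult_def subset_iff)

lemma set_power_mono: "A \<subseteq> B \<Longrightarrow> set_power G A n \<subseteq> set_power G B n"
  by (induction n) (auto simp: set_mult_def)

lemma set_power_1: "A \<subseteq> carrier G \<Longrightarrow> set_power G A (Suc 0) = A"
  by (auto simp: set_mult_def subset_iff)

lemma set_power_add:
  assumes "A \<subseteq> carrier G" "x \<in> set_power G A m" "y \<in> set_power G A n"
  shows "x \<otimes> y \<in> set_power G A (m + n)"
  using assms(2)
proof (induction m arbitrary: x)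
  case 0
  then show ?case using assms set_power_subset[OF assms(1), of n] by auto
next
  case (Suc m)
  then obtain a b where "a \<in> A" "b \<in> set_power G A m" "x = a \<otimes> b" by (auto simp: set_mult_def)
  moreover have "a \<in> carrier G" "b \<in> carrier G" "y \<in> carrier G"
    using calculation assms set_power_subset[OF assms(1)] by blast+
  ultimately show ?case using Suc.IH[of b] by (auto simp: set_mult_def m_assoc)
qed

lemma set_power_inv:
  assumes "A \<subseteq> carrier G" "\<And>a. a \<in> A \<Longrightarrow> inv a \<in> A" "x \<in> set_power G A n"
  shows "inv x \<in> set_power G A n"
  using assms(3)
proof (induction n arbitrary: x)
  case (Suc n)
  then obtain a b where ab: "a \<in> A" "b \<in> set_power G A n" "x = a \<otimes> b" by (auto simp: set_mult_def)
  then have "a \<in> carrier G" "b \<in> carrier G" using assms set_power_subset[OF assms(1)] by blast+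
  then have "inv x = inv a \<otimes> inv b" using ab by (simp add: inv_mult)
  then show ?case using ab Suc.IH assms by (auto simp: set_mult_def)
qed auto

lemma subgroup_Union_set_power:
  assumes "A \<subseteq> carrier G" "\<And>a. a \<in> A \<Longrightarrow> inv a \<in> A"
  shows "subgroup (\<Union>n. set_power G A n) G"
proof (rule subgroupI)
  show "(\<Union>n. set_power G A n) \<subseteq> carrier G" using set_power_subset[OF assms(1)] by blast
  have "\<one> \<in> set_power G A 0" by simp
  then show "(\<Union>n. set_power G A n) \<noteq> {}" by blast
  show "inv a \<in> (\<Union>n. set_power G A n)" if "a \<in> (\<Union>n. set_power G A n)" for a
    using that set_power_inv[OF assms, of a] by auto
  show "a \<otimes> b \<in> (\<Union>n. set_power G A n)"
    if "a \<in> (\<Union>n. set_power G A n)" "b \<in> (\<Union>n. set_power G A n)" for a b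
    using that set_power_add[OF assms(1), of a _ b] by auto
qed

end

section \<open>Small open subgroups and total disconnectedness\<close>

context abelian_topological_group
begin

text \<open>If \<open>A A\<close> lies in V and products of n elements of B lie in A, then products
  of n+1 elements of the intersection lie in V.\<close>

lemma nbhd_root:
  assumes "openin T V" "\<one> \<in> V"
  obtains W where "openin T W" "\<one> \<in> W" "\<And>a. a \<in> W \<Longrightarrow> inv a \<in> W" "set_power G W n \<subseteq> V"
proof -
  have "\<exists>W. openin T W \<and> \<one> \<in> W \<and> (\<forall>a\<in>W. inv a \<in> W) \<and> set_power G W n \<subseteq> V"
    using assms
  proof (induction n arbitrary: V)
    case 0
    then show ?case using nbhd_sym_mult[of V] by (metis empty_subsetI insert_subset set_power.simps(1))
  next
    case (Suc n)
    obtain A where A: "openin T A" "\<one> \<in> A" "\<And>a. a \<in> A \<Longrightarrow> inv a \<in> A"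
      "\<And>a b. a \<in> A \<Longrightarrow> b \<in> A \<Longrightarrow> a \<otimes> b \<in> V"
      using nbhd_sym_mult[OF Suc.prems] by metis
    obtain B where B: "openin T B" "\<one> \<in> B" "\<forall>a\<in>B. inv a \<in> B" "set_power G B n \<subseteq> A"
      using Suc.IH[OF A(1,2)] by blast
    have "set_power G (A \<inter> B) (Suc n) \<subseteq> V"
      using A(4) B(4) set_power_mono[of "A \<inter> B" B n] by (fastforce simp: set_mult_def)
    moreover have "openin T (A \<inter> B)" "\<one> \<in> A \<inter> B" "\<forall>a\<in>A \<inter> B. inv a \<in> A \<inter> B"
      using A(1-3) B(1-3) by auto
    ultimately show ?case by blast
  qed
  then show thesis using that by blast
qed

text \<open>An open subgroup is clopen. A connected set through x and y, translated so that x
  becomes \<open>\<one>\<close>, would meet such a subgroup without being contained in it, once the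
  subgroup is small enough to miss the translate of y.\<close>

lemma totally_disconnected_if_small_open_subgroups:
  assumes "Hausdorff_space T"
    and small: "\<And>U. openin T U \<Longrightarrow> \<one> \<in> U \<Longrightarrow> \<exists>H. subgroup H G \<and> openin T H \<and> H \<subseteq> U"
  shows "totally_disconnected_space T"
  unfolding totally_disconnected_space_def
proof
  fix x assume "x \<in> topspace T"
  then have x: "x \<in> carrier G" by (simp add: topspace_eq)
  have False if y: "connected_component_of T x y" "y \<noteq> x" for y
  proof -
    have yG: "y \<in> carrier G" using y connected_component_in_topspace topspace_eq by metis
    have ne: "inv x \<otimes> y \<noteq> \<one>" using x yG y(2) by (metis inv_closed inv_equality m_comm inv_inv)
    then obtain U where U: "openin T U" "\<one> \<in> U" "inv x \<otimes> y \<notin> U"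
      using assms(1) x yG unfolding Hausdorff_space_def disjnt_iff
      by (metis inv_closed m_closed one_closed topspace_eq)
    then obtain H where H: "subgroup H G" "openin T H" "H \<subseteq> U" using small by blast
    obtain C where C: "connectedin T C" "x \<in> C" "y \<in> C"
      using y(1) connected_component_of_def by metis
    let ?D = "(\<lambda>z. inv x \<otimes> z) ` C"
    have "connectedin T ?D"
      using connectedin_continuous_map_image[OF continuous_map_translation C(1)] x by simp
    moreover have "inv x \<otimes> y \<in> ?D" "\<one> \<in> ?D"
      using C x by (auto intro!: image_eqI[of \<one> _ x])
    ultimately have "\<not> disjnt ?D H" "\<not> ?D \<subseteq> H"
      using H U(3) subgroup.one_closed[OF H(1)] by (auto simp: disjnt_iff)
    then show False
      using \<open>connectedin T ?D\<close> H closedin_open_subgroup connectedin_clopen_cases by metis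
  qed
  then show "connected_component_of_set T x = {x}"
    using \<open>x \<in> topspace T\<close> connected_component_of_refl[of T x] by fastforce
qed

text \<open>Van Dantzig's theorem. A compact open set \<open>U\<close> containing \<open>\<one>\<close> is stable under multiplication
  by some symmetric neighbourhood of \<open>\<one>\<close>, whence it contains the subgroup generated by the latter.\<close>

lemma small_compact_open_subgroup:
  assumes "Hausdorff_space T" "locally_compact_space T" "totally_disconnected_space T"
    and V: "openin T V" "\<one> \<in> V"
  obtains H where "subgroup H G" "openin T H" "compactin T H" "H \<subseteq> V"
proof -
  have one: "\<one> \<in> topspace T" by (simp add: topspace_eq)
  obtain A K where AK: "openin T A" "compactin T K" "\<one> \<in> A" "A \<subseteq> K"
    using assms(2) one unfolding locally_compact_space_def by blast
  have "connected_component_of_set T \<one> = {\<one>}"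
    using assms(3) one by (simp add: totally_disconnected_space_def)
  then have "{\<one>} \<in> connected_components_of T"
    using one unfolding connected_components_of_def by (metis image_eqI)
  \<comment> \<open>Wilder's theorem applies because the component of \<open>\<one>\<close> is the
    compact set \<open>{\<one>}\<close>: it yields a clopen set inside the compact neighbourhood K
    and inside V, and this set is compact.\<close>
  note wilder_locally_compact_component_thm[OF assms(2,1) this]
  moreover have "compactin T {\<one>}" using one by simp
  moreover have "openin T (A \<inter> V)" using AK(1) V(1) by (rule openin_Int)
  moreover have "{\<one>} \<subseteq> A \<inter> V" using AK V by simp
  ultimately obtain U U' where
    U: "openin T U" "openin T U'" "disjnt U U'" "U \<union> U' = topspace T" "{\<one>} \<subseteq> U" "U \<subseteq> A \<inter> V"
    by blast
  have "U = topspace T - U'" using U unfolding disjnt_iff by blast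
  then have "closedin T U" using U by (simp add: closedin_diff)
  then have cU: "compactin T U" using AK U by (meson closed_compactin le_infE order_trans)
  let ?Q = "{p \<in> topspace (prod_topology T T). (case p of (x, y) \<Rightarrow> x \<otimes> y) \<in> U}"
  have "openin (prod_topology T T) ?Q"
    using continuous_mult U(1) by (rule openin_continuous_map_preimage)
  moreover have "U \<times> {\<one>} \<subseteq> ?Q" using openin_subset[OF U(1)] by (auto simp: topspace_eq)
  ultimately have "\<exists>B C. openin T B \<and> openin T C \<and> U \<subseteq> B \<and> \<one> \<in> C \<and> B \<times> C \<subseteq> ?Q"
    by (rule tube_lemma_left[OF _ cU one])
  then obtain B C where BC: "openin T B" "openin T C" "U \<subseteq> B" "\<one> \<in> C" "B \<times> C \<subseteq> ?Q"
    by (elim exE conjE)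
  obtain W where W: "openin T W" "\<one> \<in> W" "\<And>a. a \<in> W \<Longrightarrow> inv a \<in> W" "W \<subseteq> C"
    using nbhd_sym_mult[OF BC(2,4)] by metis
  have WG: "W \<subseteq> carrier G" using W(1) openin_subset topspace_eq by metis
  have "set_power G W n \<subseteq> U" for n
  proof (induction n)
    case (Suc n)
    show ?case
    proof
      fix x assume "x \<in> set_power G W (Suc n)"
      then obtain a b where ab: "a \<in> W" "b \<in> set_power G W n" "x = a \<otimes> b" by (auto simp: set_mult_def)
      then have "b \<in> U" "a \<in> C" using Suc W by auto
      moreover then have "x = b \<otimes> a" using ab m_comm carrier_if_openin U(1) BC(2) by simp
      moreover have "(b, a) \<in> ?Q" using \<open>b \<in> U\<close> \<open>a \<in> C\<close> BC(3,5) by (meson SigmaI subsetD)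
      ultimately show "x \<in> U" by simp
    qed
  qed (use U in auto)
  then have sub: "(\<Union>n. set_power G W n) \<subseteq> U" by blast
  have "W = set_power G W (Suc 0)" using set_power_1[OF WG] by simp
  then have "W \<subseteq> (\<Union>n. set_power G W n)" by blast
  with subgroup_Union_set_power[OF WG W(3)] W(1,2)
  have *: "subgroup (\<Union>n. set_power G W n) G" "openin T (\<Union>n. set_power G W n)"
    using openin_subgroup_if_nbhd by blast+
  show thesis
    using that[OF *] closed_compactin[OF cU sub closedin_open_subgroup[OF *]] sub U(6) by blast
qed

end


section \<open>Homomorphisms into divisible groups\<close>

text \<open>The graph of a homomorphism from a subgroup of G into Q. Because the graph is itself a
  subgroup, single-valuedness needs to be required only at \<open>\<one>\<close>. With graphs,
  extension is inclusion and the upper bound of a chain is its union.\<close>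

definition partial_hom where
  "partial_hom G Q \<Gamma> \<longleftrightarrow> subgroup \<Gamma> (G \<times>\<times> Q) \<and> (\<forall>q. (\<one>\<^bsub>G\<^esub>, q) \<in> \<Gamma> \<longrightarrow> q = \<one>\<^bsub>Q\<^esub>)"

definition divisible_group :: "('a, 'm) monoid_scheme \<Rightarrow> bool" where
  "divisible_group Q \<longleftrightarrow> (\<forall>q\<in>carrier Q. \<forall>n::nat. n > 0 \<longrightarrow> (\<exists>r\<in>carrier Q. r [^]\<^bsub>Q\<^esub> n = q))"

locale two_comm_groups = comm_group G + Q: comm_group Q
  for G :: "('a, 'm) monoid_scheme" (structure) and Q :: "('b, 'k) monoid_scheme"
begin

lemma subgroup_DirProd_iff:
  "subgroup \<Gamma> (G \<times>\<times> Q) \<longleftrightarrow> \<Gamma> \<subseteq> carrier G \<times> carrier Q \<and> (\<one>, \<one>\<^bsub>Q\<^esub>) \<in> \<Gamma> \<and>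
     (\<forall>x q y r. (x, q) \<in> \<Gamma> \<longrightarrow> (y, r) \<in> \<Gamma> \<longrightarrow> (x \<otimes> y, q \<otimes>\<^bsub>Q\<^esub> r) \<in> \<Gamma>) \<and>
     (\<forall>x q. (x, q) \<in> \<Gamma> \<longrightarrow> (inv x, inv\<^bsub>Q\<^esub> q) \<in> \<Gamma>)" (is "?l \<longleftrightarrow> ?r")
proof
  interpret P: group "G \<times>\<times> Q" by (rule DirProd_group) (rule is_group Q.is_group)+
  assume ?l
  then interpret S: subgroup \<Gamma> "G \<times>\<times> Q" .
  have sub: "\<Gamma> \<subseteq> carrier G \<times> carrier Q" using S.subset by simp
  moreover have "(inv x, inv\<^bsub>Q\<^esub> q) \<in> \<Gamma>" if "(x, q) \<in> \<Gamma>" for x q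
  proof -
    have c: "x \<in> carrier G" "q \<in> carrier Q" using that sub by auto
    show ?thesis using S.m_inv_closed[OF that] inv_DirProd[OF is_group Q.is_group c] by simp
  qed
  moreover have "(x \<otimes> y, q \<otimes>\<^bsub>Q\<^esub> r) \<in> \<Gamma>" if "(x, q) \<in> \<Gamma>" "(y, r) \<in> \<Gamma>" for x q y r
    using S.m_closed[OF that] by simp
  ultimately show ?r using S.one_closed by auto
next
  assume R: ?r
  interpret P: group "G \<times>\<times> Q" by (rule DirProd_group) (rule is_group Q.is_group)+
  show ?l
  proof (rule P.subgroupI)
    show "inv\<^bsub>G \<times>\<times> Q\<^esub> a \<in> \<Gamma>" if "a \<in> \<Gamma>" for a
    proof -
      obtain x q where a: "a = (x, q)" by (cases a)
      have c: "x \<in> carrier G" "q \<in> carrier Q" using that R a by auto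
      show ?thesis using R that inv_DirProd[OF is_group Q.is_group c] unfolding a by simp
    qed
    show "a \<otimes>\<^bsub>G \<times>\<times> Q\<^esub> b \<in> \<Gamma>" if "a \<in> \<Gamma>" "b \<in> \<Gamma>" for a b
      using that R by (cases a, cases b) auto
  qed (use R in auto)
qed

lemma partial_homD:
  assumes "partial_hom G Q \<Gamma>"
  shows "(x, q) \<in> \<Gamma> \<Longrightarrow> x \<in> carrier G" "(x, q) \<in> \<Gamma> \<Longrightarrow> q \<in> carrier Q"
    and "(\<one>, \<one>\<^bsub>Q\<^esub>) \<in> \<Gamma>"
    and "(x, q) \<in> \<Gamma> \<Longrightarrow> (y, r) \<in> \<Gamma> \<Longrightarrow> (x \<otimes> y, q \<otimes>\<^bsub>Q\<^esub> r) \<in> \<Gamma>"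
    and "(x, q) \<in> \<Gamma> \<Longrightarrow> (inv x, inv\<^bsub>Q\<^esub> q) \<in> \<Gamma>"
    and "(\<one>, q) \<in> \<Gamma> \<Longrightarrow> q = \<one>\<^bsub>Q\<^esub>"
  using assms unfolding partial_hom_def subgroup_DirProd_iff by blast+

lemma partial_hom_unique:
  assumes "partial_hom G Q \<Gamma>" "(x, q) \<in> \<Gamma>" "(x, r) \<in> \<Gamma>"
  shows "q = r"
proof -
  note PD = partial_homD[OF assms(1)]
  have c: "x \<in> carrier G" "q \<in> carrier Q" "r \<in> carrier Q" using PD assms by blast+
  have "(x \<otimes> inv x, q \<otimes>\<^bsub>Q\<^esub> inv\<^bsub>Q\<^esub> r) \<in> \<Gamma>" using PD(4,5) assms by blast
  then have "q \<otimes>\<^bsub>Q\<^esub> inv\<^bsub>Q\<^esub> r = \<one>\<^bsub>Q\<^esub>" using PD(6) c by simp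
  then show ?thesis using Q.inv_equality[of q "inv\<^bsub>Q\<^esub> r"] c by simp
qed

lemma partial_hom_int_pow:
  assumes "partial_hom G Q \<Gamma>" "(x, q) \<in> \<Gamma>"
  shows "(x [^] (a::int), q [^]\<^bsub>Q\<^esub> a) \<in> \<Gamma>"
proof -
  note PD = partial_homD[OF assms(1)]
  have *: "(x [^] n, q [^]\<^bsub>Q\<^esub> n) \<in> \<Gamma>" for n :: nat
  proof (induction n)
    case (Suc n)
    show ?case using PD(4)[OF Suc.IH assms(2)] by simp
  qed (use PD(3) in simp)
  show ?thesis
  proof (cases "a < 0")
    case True
    then show ?thesis using PD(5)[OF *[of "nat (- a)"]] by (simp only: int_pow_def2 if_True)
  next
    case False
    then show ?thesis using *[of "nat a"] by (simp only: int_pow_def2 if_False)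
  qed
qed

text \<open>The only obstruction to prescribing the value q at x comes from those powers of x that
  already have a value. If q is compatible with them, the map sending \<open>d x^a\<close> to
  \<open>r q^a\<close> is well defined, as one sees by testing single-valuedness at
  \<open>\<one>\<close>.\<close>

lemma partial_hom_insert:
  assumes \<Gamma>: "partial_hom G Q \<Gamma>" and x: "x \<in> carrier G" and q: "q \<in> carrier Q"
    and comp: "\<And>(a::int) r. (x [^] a, r) \<in> \<Gamma> \<Longrightarrow> r = q [^]\<^bsub>Q\<^esub> a"
  defines "\<Gamma>' \<equiv> {(d \<otimes> x [^] a, r \<otimes>\<^bsub>Q\<^esub> q [^]\<^bsub>Q\<^esub> a) | d r a. (d, r) \<in> \<Gamma> \<and> (a::int) \<in> UNIV}"
  shows "partial_hom G Q \<Gamma>'" "\<Gamma> \<subseteq> \<Gamma>'" "(x, q) \<in> \<Gamma>'"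
proof -
  note PD = partial_homD[OF \<Gamma>]
  have mem: "(d \<otimes> x [^] a, r \<otimes>\<^bsub>Q\<^esub> q [^]\<^bsub>Q\<^esub> a) \<in> \<Gamma>'" if "(d, r) \<in> \<Gamma>" for d r and a :: int
    using that unfolding \<Gamma>'_def by blast
  have ex: "\<exists>d r. \<exists>a::int. u = d \<otimes> x [^] a \<and> v = r \<otimes>\<^bsub>Q\<^esub> q [^]\<^bsub>Q\<^esub> a \<and> (d, r) \<in> \<Gamma> \<and> d \<in> carrier G \<and> r \<in> carrier Q"
    if "(u, v) \<in> \<Gamma>'" for u v
    using that PD(1,2) unfolding \<Gamma>'_def by blast
  have "\<Gamma>' \<subseteq> carrier G \<times> carrier Q"
  proof
    fix p assume "p \<in> \<Gamma>'"
    then show "p \<in> carrier G \<times> carrier Q" using ex[of "fst p" "snd p"] x q by (cases p) auto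
  qed
  moreover have "(\<one>, \<one>\<^bsub>Q\<^esub>) \<in> \<Gamma>'"
    using mem[OF PD(3), of 0] by simp
  moreover have "(u \<otimes> u', v \<otimes>\<^bsub>Q\<^esub> v') \<in> \<Gamma>'" if uv: "(u, v) \<in> \<Gamma>'" and uv': "(u', v') \<in> \<Gamma>'" for u v u' v'
  proof -
    obtain d r and a :: int where 1: "u = d \<otimes> x [^] a" "v = r \<otimes>\<^bsub>Q\<^esub> q [^]\<^bsub>Q\<^esub> a" "(d, r) \<in> \<Gamma>" "d \<in> carrier G" "r \<in> carrier Q"
      using ex[OF uv] by metis
    obtain d' r' and a' :: int where 2: "u' = d' \<otimes> x [^] a'" "v' = r' \<otimes>\<^bsub>Q\<^esub> q [^]\<^bsub>Q\<^esub> a'" "(d', r') \<in> \<Gamma>" "d' \<in> carrier G" "r' \<in> carrier Q"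
      using ex[OF uv'] by metis
    have "u \<otimes> u' = (d \<otimes> d') \<otimes> x [^] (a + a')" "v \<otimes>\<^bsub>Q\<^esub> v' = (r \<otimes>\<^bsub>Q\<^esub> r') \<otimes>\<^bsub>Q\<^esub> q [^]\<^bsub>Q\<^esub> (a + a')"
      using 1 2 x q by (simp_all add: int_pow_mult Q.int_pow_mult m_ac Q.m_ac)
    then show ?thesis using mem[OF PD(4)[OF 1(3) 2(3)]] by simp
  qed
  moreover have "(inv u, inv\<^bsub>Q\<^esub> v) \<in> \<Gamma>'" if uv: "(u, v) \<in> \<Gamma>'" for u v
  proof -
    obtain d r and a :: int where 1: "u = d \<otimes> x [^] a" "v = r \<otimes>\<^bsub>Q\<^esub> q [^]\<^bsub>Q\<^esub> a" "(d, r) \<in> \<Gamma>" "d \<in> carrier G" "r \<in> carrier Q"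
      using ex[OF uv] by metis
    have "inv u = inv d \<otimes> x [^] (- a)" "inv\<^bsub>Q\<^esub> v = inv\<^bsub>Q\<^esub> r \<otimes>\<^bsub>Q\<^esub> q [^]\<^bsub>Q\<^esub> (- a)"
      using 1 x q by (simp_all add: int_pow_neg Q.int_pow_neg inv_mult Q.inv_mult)
    then show ?thesis using mem[OF PD(5)[OF 1(3)]] by simp
  qed
  moreover have "v = \<one>\<^bsub>Q\<^esub>" if uv: "(\<one>, v) \<in> \<Gamma>'" for v
  proof -
    obtain d r and a :: int where 1: "\<one> = d \<otimes> x [^] a" "v = r \<otimes>\<^bsub>Q\<^esub> q [^]\<^bsub>Q\<^esub> a" "(d, r) \<in> \<Gamma>" "d \<in> carrier G" "r \<in> carrier Q"
      using ex[OF uv] by metis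
    then have "inv d = x [^] a" using x inv_equality[of "x [^] a" d] m_comm[of d "x [^] a"] by simp
    then have "(x [^] a, inv\<^bsub>Q\<^esub> r) \<in> \<Gamma>" using PD(5)[OF 1(3)] by simp
    then have "inv\<^bsub>Q\<^esub> r = q [^]\<^bsub>Q\<^esub> a" by (rule comp)
    then show ?thesis using 1 Q.r_inv[of r] by simp
  qed
  ultimately show "partial_hom G Q \<Gamma>'"
    unfolding partial_hom_def subgroup_DirProd_iff by blast
  show "\<Gamma> \<subseteq> \<Gamma>'"
  proof
    fix p assume p: "p \<in> \<Gamma>"
    then have "p = (fst p \<otimes> x [^] (0::int), snd p \<otimes>\<^bsub>Q\<^esub> q [^]\<^bsub>Q\<^esub> (0::int))"
      using PD(1,2)[of "fst p" "snd p"] by simp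
    then show "p \<in> \<Gamma>'" using mem[of "fst p" "snd p" 0] p by simp
  qed
  show "(x, q) \<in> \<Gamma>'" using mem[OF PD(3), of 1] x q by simp
qed

text \<open>The exponents a with \<open>x^a\<close> in the domain are the multiples of the least
  positive one, by division with remainder. So an n-th root of the value at \<open>x^n\<close> is
  compatible with all of them.\<close>

lemma partial_hom_root:
  assumes \<Gamma>: "partial_hom G Q \<Gamma>" and x: "x \<in> carrier G" and q: "q \<in> carrier Q"
    and n: "(n::nat) > 0" "(x [^] n, r) \<in> \<Gamma>" "\<And>m s. 0 < m \<Longrightarrow> m < n \<Longrightarrow> (x [^] m, s) \<notin> \<Gamma>"
    and r: "q [^]\<^bsub>Q\<^esub> n = r" and a: "(x [^] (a::int), s) \<in> \<Gamma>"
  shows "s = q [^]\<^bsub>Q\<^esub> a"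
proof -
  note PD = partial_homD[OF \<Gamma>]
  let ?k = "a div int n" and ?m = "a mod int n"
  have "(x [^] (int n * ?k), r [^]\<^bsub>Q\<^esub> ?k) \<in> \<Gamma>"
    using partial_hom_int_pow[OF \<Gamma> n(2), of ?k] x
    by (metis int_pow_int int_pow_pow)
  moreover have rk: "r [^]\<^bsub>Q\<^esub> ?k = q [^]\<^bsub>Q\<^esub> (int n * ?k)"
    using r q by (metis int_pow_int Q.int_pow_pow)
  ultimately have 1: "(x [^] (int n * ?k), q [^]\<^bsub>Q\<^esub> (int n * ?k)) \<in> \<Gamma>" by simp
  have "(x [^] a \<otimes> inv (x [^] (int n * ?k)), s \<otimes>\<^bsub>Q\<^esub> inv\<^bsub>Q\<^esub> (q [^]\<^bsub>Q\<^esub> (int n * ?k))) \<in> \<Gamma>"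
    using PD(4)[OF a PD(5)[OF 1]] .
  moreover have "x [^] a \<otimes> inv (x [^] (int n * ?k)) = x [^] ?m"
    using x by (simp add: int_pow_diff[symmetric] minus_mult_div_eq_mod)
  moreover have "?m = int (nat ?m)" using n(1) by simp
  ultimately have 2: "(x [^] nat ?m, s \<otimes>\<^bsub>Q\<^esub> inv\<^bsub>Q\<^esub> (q [^]\<^bsub>Q\<^esub> (int n * ?k))) \<in> \<Gamma>"
    by (metis int_pow_int)
  moreover have "nat ?m < n" using n(1) by (simp add: nat_less_iff)
  ultimately have "nat ?m = 0" using n(3)[of "nat ?m"] by blast
  with \<open>?m = int (nat ?m)\<close> have "?m = 0" by linarith
  then have "int n * ?k = a" using mult_div_mod_eq[of "int n" a] by simp
  with 1 have "(x [^] a, q [^]\<^bsub>Q\<^esub> a) \<in> \<Gamma>" by (simp only:)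
  then show ?thesis using partial_hom_unique[OF \<Gamma> a] by blast
qed

text \<open>The complementary case, in which x is independent of the domain: compatibility concerns
  the exponent 0 only, and every value may be prescribed at x.\<close>

lemma partial_hom_free:
  assumes \<Gamma>: "partial_hom G Q \<Gamma>" and x: "x \<in> carrier G"
    and n: "\<And>m s. 0 < m \<Longrightarrow> (x [^] (m::nat), s) \<notin> \<Gamma>" and a: "(x [^] (a::int), s) \<in> \<Gamma>"
  shows "a = 0 \<and> s = \<one>\<^bsub>Q\<^esub>"
proof -
  note PD = partial_homD[OF \<Gamma>]
  have "a = 0"
  proof (rule ccontr)
    assume "a \<noteq> 0"
    have "(inv (x [^] a), inv\<^bsub>Q\<^esub> s) \<in> \<Gamma>" using PD(5)[OF a] .
    then obtain t where t: "(x [^] \<bar>a\<bar>, t) \<in> \<Gamma>" using a x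
      by (cases "a \<ge> 0") (auto simp: int_pow_neg)
    have "x [^] \<bar>a\<bar> = x [^] nat \<bar>a\<bar>"
      using int_pow_int[of G x "nat \<bar>a\<bar>"] by simp
    moreover have "0 < nat \<bar>a\<bar>" using \<open>a \<noteq> 0\<close> by simp
    ultimately show False using n[of "nat \<bar>a\<bar>" t] t by metis
  qed
  with a PD(6)[of s] show ?thesis by simp
qed

text \<open>Divisible groups are injective. A graph that is maximal by Zorn's lemma is total: at a
  missing x one takes a root where a power of x already has a value, and the value
  \<open>\<one>\<close> otherwise.\<close>

lemma partial_hom_extend:
  assumes \<Gamma>: "partial_hom G Q \<Gamma>" and div: "divisible_group Q"
  obtains f where "f \<in> hom G Q" "\<And>x q. (x, q) \<in> \<Gamma> \<Longrightarrow> f x = q"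
proof -
  let ?A = "{\<Delta>. partial_hom G Q \<Delta> \<and> \<Gamma> \<subseteq> \<Delta>}"
  have "\<exists>M\<in>?A. \<forall>X\<in>?A. M \<subseteq> X \<longrightarrow> X = M"
  proof (rule subset_Zorn_nonempty)
    show "?A \<noteq> {}" using \<Gamma> by blast
    fix C assume C: "C \<noteq> {}" "subset.chain ?A C"
    then have CA: "C \<subseteq> ?A" and ch: "\<And>X Y. X \<in> C \<Longrightarrow> Y \<in> C \<Longrightarrow> X \<subseteq> Y \<or> Y \<subseteq> X"
      unfolding subset_chain_def by blast+
    have "(x \<otimes> y, q \<otimes>\<^bsub>Q\<^esub> r) \<in> \<Union>C" if xq: "(x, q) \<in> \<Union>C" and yr: "(y, r) \<in> \<Union>C" for x q y r
    proof -
      obtain X Y where XY: "X \<in> C" "Y \<in> C" "(x, q) \<in> X" "(y, r) \<in> Y" using xq yr by blast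
      then obtain Z where Z: "Z \<in> C" "(x, q) \<in> Z" "(y, r) \<in> Z" using ch[OF XY(1,2)] by blast
      then have "(x \<otimes> y, q \<otimes>\<^bsub>Q\<^esub> r) \<in> Z" using CA partial_homD(4) by blast
      with Z show ?thesis by blast
    qed
    moreover have "\<Union>C \<subseteq> carrier G \<times> carrier Q"
    proof
      fix p assume "p \<in> \<Union>C"
      then obtain Z where "p \<in> Z" "partial_hom G Q Z" using CA by blast
      then show "p \<in> carrier G \<times> carrier Q" using partial_homD(1,2)[of Z "fst p" "snd p"] by (cases p) auto
    qed
    moreover have "(\<one>, \<one>\<^bsub>Q\<^esub>) \<in> \<Union>C" using C(1) CA partial_homD(3) by blast
    moreover have "(inv x, inv\<^bsub>Q\<^esub> q) \<in> \<Union>C" if "(x, q) \<in> \<Union>C" for x q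
      using that CA partial_homD(5) by blast
    moreover have "q = \<one>\<^bsub>Q\<^esub>" if "(\<one>, q) \<in> \<Union>C" for q
      using that CA partial_homD(6) by blast
    ultimately have "partial_hom G Q (\<Union>C)"
      unfolding partial_hom_def subgroup_DirProd_iff by blast
    with C(1) CA show "\<Union>C \<in> ?A" by blast
  qed
  then obtain M where MA: "M \<in> ?A" and maxA: "\<forall>X\<in>?A. M \<subseteq> X \<longrightarrow> X = M" by (rule bexE)
  have M: "partial_hom G Q M" "\<Gamma> \<subseteq> M" using MA by blast+
  have max: "X = M" if "partial_hom G Q X" "M \<subseteq> X" for X
  proof -
    have "X \<in> ?A" using that M(2) by simp
    with maxA that(2) show ?thesis by blast
  qed
  have total: "\<exists>q. (x, q) \<in> M" if x: "x \<in> carrier G" for x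
  proof -
    have "\<exists>q\<in>carrier Q. \<forall>(a::int) s. (x [^] a, s) \<in> M \<longrightarrow> s = q [^]\<^bsub>Q\<^esub> a"
    proof (cases "\<exists>n::nat. n > 0 \<and> (\<exists>r. (x [^] n, r) \<in> M)")
      case True
      define n where "n = (LEAST n::nat. n > 0 \<and> (\<exists>r. (x [^] n, r) \<in> M))"
      have n: "n > 0" "\<exists>r. (x [^] n, r) \<in> M"
        using LeastI_ex[OF True] unfolding n_def by blast+
      then obtain r where r: "(x [^] n, r) \<in> M" by blast
      have min: "(x [^] m, s) \<notin> M" if "0 < m" "m < n" for m s
        using not_less_Least[of m] that unfolding n_def by blast
      have "r \<in> carrier Q" using partial_homD(2)[OF M(1)] r by blast
      then obtain q where q: "q \<in> carrier Q" "q [^]\<^bsub>Q\<^esub> n = r"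
        using div n(1) unfolding divisible_group_def by blast
      then show ?thesis using partial_hom_root[OF M(1) x q(1) n(1) r min q(2)] by blast
    next
      case False
      have "s = \<one>\<^bsub>Q\<^esub> [^]\<^bsub>Q\<^esub> a" if "(x [^] (a::int), s) \<in> M" for a s
      proof -
        have "a = 0 \<and> s = \<one>\<^bsub>Q\<^esub>"
          using False by (intro partial_hom_free[OF M(1) x _ that]) blast
        then show ?thesis by simp
      qed
      then show ?thesis by blast
    qed
    then obtain q where q: "q \<in> carrier Q" "\<And>(a::int) s. (x [^] a, s) \<in> M \<Longrightarrow> s = q [^]\<^bsub>Q\<^esub> a" by blast
    note ins = partial_hom_insert[OF M(1) x q]
    show ?thesis using ins(3) max[OF ins(1,2)] by blast
  qed
  define f where "f x = (THE q. (x, q) \<in> M)" for x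
  have f: "f x = q" if "(x, q) \<in> M" for x q
    unfolding f_def using that partial_hom_unique[OF M(1)] by blast
  have fM: "(x, f x) \<in> M" if "x \<in> carrier G" for x using total[OF that] f by auto
  have "f \<in> hom G Q"
  proof (rule homI)
    show "f x \<in> carrier Q" if "x \<in> carrier G" for x using fM[OF that] partial_homD(2)[OF M(1)] by blast
    show "f (x \<otimes> y) = f x \<otimes>\<^bsub>Q\<^esub> f y" if "x \<in> carrier G" "y \<in> carrier G" for x y
      using partial_homD(4)[OF M(1) fM[OF that(1)] fM[OF that(2)]] by (rule f)
  qed
  then show thesis using that M(2) f by blast
qed

end


section \<open>Characters of groups without topology\<close>

lemma circle_inverse_mult: "norm (x::complex) = 1 \<Longrightarrow> inverse x * x = 1"
  by (intro left_inverse) auto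

lemma comm_group_circle: "comm_group circle_group"
proof (rule comm_groupI)
  show "\<exists>y\<in>carrier circle_group. y \<otimes>\<^bsub>circle_group\<^esub> x = \<one>\<^bsub>circle_group\<^esub>" if "x \<in> carrier circle_group" for x
    using that by (intro bexI[of _ "inverse x"]) (auto simp: circle_group_def norm_inverse circle_inverse_mult)
qed (auto simp: circle_group_def norm_mult)

interpretation circle: comm_group circle_group by (rule comm_group_circle)

lemma circle_simps [simp]:
  "x \<in> carrier circle_group \<longleftrightarrow> norm x = 1"
  "x \<otimes>\<^bsub>circle_group\<^esub> y = x * y" "\<one>\<^bsub>circle_group\<^esub> = 1"
  by (auto simp: circle_group_def)

lemma circle_inv [simp]: "norm x = 1 \<Longrightarrow> inv\<^bsub>circle_group\<^esub> x = inverse x"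
  using circle.inv_equality[of "inverse x" x] by (simp add: norm_inverse circle_inverse_mult)

lemma circle_nat_pow [simp]: "x [^]\<^bsub>circle_group\<^esub> (n::nat) = x ^ n"
  by (induction n) auto

lemma circle_int_pow [simp]: "norm x = 1 \<Longrightarrow> x [^]\<^bsub>circle_group\<^esub> (n::int) = x powi n"
  by (auto simp: int_pow_def2 power_int_def norm_power norm_inverse power_inverse)

lemma circle_root:
  assumes "norm (r::complex) = 1" "n > 0"
  obtains q where "norm q = 1" "q ^ n = r"
proof
  show "cis (Arg r / real n) ^ n = r"
  proof -
    have "r \<noteq> 0" using assms by auto
    then have "cis (Arg r) = r" using cis_Arg[of r] assms by (simp add: sgn_eq)
    moreover have "real n * (Arg r / real n) = Arg r" using assms by simp
    ultimately show ?thesis by (simp add: Complex.DeMoivre)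
  qed
qed simp

lemma divisible_circle: "divisible_group circle_group"
  unfolding divisible_group_def using circle_root by (metis circle_simps(1) circle_nat_pow)

text \<open>The \<open>n\<close>-th roots of \<open>r\<close> sum up to \<open>0\<close>, so they do not all lie in the open half plane around \<open>v\<close>.\<close>

lemma circle_root_half_plane:
  assumes r: "norm (r::complex) = 1" and n: "n \<ge> 2"
  obtains q where "norm q = 1" "q ^ n = r" "Re (q * cnj v) \<le> 0"
proof -
  obtain p where p: "norm p = 1" "p ^ n = r" using circle_root[OF r, of n] n by auto
  let ?S = "{z::complex. z ^ n = 1}"
  have fin: "finite ?S" using finite_roots_unity[of n] n by simp
  have "\<exists>z\<in>?S. Re (p * z * cnj v) \<le> 0"
  proof (rule ccontr)
    assume "\<not> ?thesis"
    then have "(\<Sum>z\<in>?S. Re (p * z * cnj v)) > 0"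
      using fin by (intro sum_pos) (auto intro!: exI[of _ 1])
    moreover have "(\<Sum>z\<in>?S. p * z * cnj v) = p * cnj v * (\<Sum>?S)"
      by (simp add: sum_distrib_left mult_ac)
    moreover have "\<Sum>?S = 0" using sum_roots_unity[of n] n by simp
    ultimately show False by (metis Re_sum mult_zero_right zero_complex.sel(1) less_irrefl)
  qed
  then obtain z where z: "z ^ n = 1" "Re (p * z * cnj v) \<le> 0" by blast
  have "norm z = 1"
  proof -
    have "norm z ^ n = 1 ^ n" using z by (metis norm_power norm_one power_one)
    then show ?thesis using n by (intro power_eq_imp_eq_base[of "norm z" n 1]) auto
  qed
  then show thesis using that[of "p * z"] p z by (simp add: norm_mult power_mult_distrib)
qed

text \<open>Law of cosines. The distance is even at least the square root of 2; the bound 1 is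
  enough to destroy convergence.\<close>

lemma norm_diff_circle:
  assumes "norm (q::complex) = 1" "norm v = 1" "Re (q * cnj v) \<le> 0"
  shows "norm (q - v) \<ge> 1"
proof -
  have "(norm (q - v))\<^sup>2 = (norm q)\<^sup>2 + (norm v)\<^sup>2 - 2 * Re (q * cnj v)"
    unfolding cmod_power2 by (simp add: power2_eq_square algebra_simps)
  then have "(norm (q - v))\<^sup>2 \<ge> 1" using assms by simp
  then show ?thesis by (metis norm_ge_zero one_power2 power2_le_imp_le)
qed

section \<open>Characters with prescribed oscillation\<close>

context comm_group
begin

interpretation circ: two_comm_groups G circle_group
  by unfold_locales

text \<open>At a new point x the value can be pushed into the half plane opposite to v. If a power
  of x has a value, the candidates are the n-th roots of it, with n at least 2 because x is not in
  the domain; otherwise \<open>- v\<close> itself is admissible. The bound on the new domain keeps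
  domains finitely generated when the step is iterated.\<close>

lemma partial_character_step:
  assumes \<Gamma>: "partial_hom G circle_group \<Gamma>" and x: "x \<in> carrier G" "x \<notin> Domain \<Gamma>" and v: "norm v = 1"
  obtains q \<Gamma>' where "partial_hom G circle_group \<Gamma>'" "\<Gamma> \<subseteq> \<Gamma>'" "(x, q) \<in> \<Gamma>'" "Re (q * cnj v) \<le> 0"
    "Domain \<Gamma>' \<subseteq> generate G (insert x (Domain \<Gamma>))"
proof -
  note PD = circ.partial_homD[OF \<Gamma>]
  have "\<exists>q. norm q = 1 \<and> Re (q * cnj v) \<le> 0 \<and>
      (\<forall>(a::int) s. (x [^] a, s) \<in> \<Gamma> \<longrightarrow> s = q [^]\<^bsub>circle_group\<^esub> a)"
  proof (cases "\<exists>n::nat. n > 0 \<and> (\<exists>r. (x [^] n, r) \<in> \<Gamma>)")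
    case True
    define n where "n = (LEAST n::nat. n > 0 \<and> (\<exists>r. (x [^] n, r) \<in> \<Gamma>))"
    have n: "n > 0" "\<exists>r. (x [^] n, r) \<in> \<Gamma>"
      using LeastI_ex[OF True] unfolding n_def by blast+
    then obtain r where r: "(x [^] n, r) \<in> \<Gamma>" by blast
    have min: "(x [^] m, s) \<notin> \<Gamma>" if "0 < m" "m < n" for m s
      using not_less_Least[of m] that unfolding n_def by blast
    have "norm r = 1" using PD(2)[OF r] by simp
    moreover have "n \<noteq> 1" using r x by (auto simp: Domain_iff)
    then have "n \<ge> 2" using n by simp
    ultimately obtain q where q: "norm q = 1" "q ^ n = r" "Re (q * cnj v) \<le> 0"
      using circle_root_half_plane by blast
    have "s = q [^]\<^bsub>circle_group\<^esub> a" if "(x [^] (a::int), s) \<in> \<Gamma>" for a s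
      using q by (intro circ.partial_hom_root[OF \<Gamma> x(1) _ n(1) r min _ that]) auto
    with q show ?thesis by blast
  next
    case False
    have "s = (- v) [^]\<^bsub>circle_group\<^esub> a" if "(x [^] (a::int), s) \<in> \<Gamma>" for a s
    proof -
      have "a = 0 \<and> s = \<one>\<^bsub>circle_group\<^esub>"
        using False by (intro circ.partial_hom_free[OF \<Gamma> x(1) _ that]) blast
      then show ?thesis by simp
    qed
    moreover have "Re (- v * cnj v) \<le> 0" by simp
    ultimately show ?thesis using v by (intro exI[of _ "- v"]) simp
  qed
  then obtain q where q: "norm q = 1" "Re (q * cnj v) \<le> 0"
    and comp: "\<And>(a::int) s. (x [^] a, s) \<in> \<Gamma> \<Longrightarrow> s = q [^]\<^bsub>circle_group\<^esub> a" by blast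
  have q': "q \<in> carrier circle_group" using q by simp
  let ?\<Gamma>' = "{(d \<otimes> x [^] a, r \<otimes>\<^bsub>circle_group\<^esub> q [^]\<^bsub>circle_group\<^esub> a) | d r a. (d, r) \<in> \<Gamma> \<and> (a::int) \<in> UNIV}"
  note ins = circ.partial_hom_insert[OF \<Gamma> x(1) q' comp]
  have sub: "insert x (Domain \<Gamma>) \<subseteq> carrier G" using PD(1) x by blast
  interpret S: subgroup "generate G (insert x (Domain \<Gamma>))" G
    using sub by (rule generate_is_subgroup)
  have xg: "x \<in> generate G (insert x (Domain \<Gamma>))" by (auto intro: generate.incl)
  have "Domain ?\<Gamma>' \<subseteq> generate G (insert x (Domain \<Gamma>))"
  proof
    fix u assume "u \<in> Domain ?\<Gamma>'"
    then obtain d r and a :: int where d: "u = d \<otimes> x [^] a" "(d, r) \<in> \<Gamma>" by blast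
    have "d \<in> generate G (insert x (Domain \<Gamma>))" using d(2) by (auto intro!: generate.incl)
    moreover have "x [^] a \<in> generate G (insert x (Domain \<Gamma>))"
      using subgroup_int_pow_closed[OF S.subgroup_axioms xg] .
    ultimately show "u \<in> generate G (insert x (Domain \<Gamma>))" unfolding d(1) by (rule S.m_closed)
  qed
  then show thesis using that[OF ins(1,2,3) q(2)] by blast
qed

lemma partial_hom_trivial: "partial_hom G circle_group {(\<one>, 1)}"
  unfolding partial_hom_def circ.subgroup_DirProd_iff by auto

lemma character_extend:
  assumes "partial_hom G circle_group \<Gamma>"
  obtains f where "f \<in> hom G circle_group" "\<And>x q. (x, q) \<in> \<Gamma> \<Longrightarrow> f x = q"
  using circ.partial_hom_extend[OF assms divisible_circle] by blast

text \<open>The step above with v = 1, starting from the trivial partial character: a value with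
  non-positive real part is not 1.\<close>

lemma character_separates:
  assumes "x \<in> carrier G" "x \<noteq> \<one>"
  obtains f where "f \<in> hom G circle_group" "f x \<noteq> 1"
proof -
  have "x \<notin> Domain {(\<one>, 1::complex)}" using assms by auto
  from partial_character_step[OF partial_hom_trivial assms(1) this, of 1]
  obtain q \<Gamma>' where \<Gamma>': "partial_hom G circle_group \<Gamma>'" "(x, q) \<in> \<Gamma>'" "Re (q * cnj 1) \<le> 0"
    by (metis norm_one)
  obtain f where "f \<in> hom G circle_group" "f x = q" using character_extend[OF \<Gamma>'(1)] \<Gamma>'(2) by metis
  moreover have "q \<noteq> 1" using \<Gamma>'(3) by (intro notI) simp
  ultimately show thesis using that[of f] by simp
qed

lemma hom_circle:
  assumes "f \<in> hom G circle_group"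
  shows "x \<in> carrier G \<Longrightarrow> norm (f x) = 1"
    and "x \<in> carrier G \<Longrightarrow> y \<in> carrier G \<Longrightarrow> f (x \<otimes> y) = f x * f y"
    and "f \<one> = 1"
    and "x \<in> carrier G \<Longrightarrow> f (inv x) = inverse (f x)"
    and "x \<in> carrier G \<Longrightarrow> f (x [^] (a::int)) = f x powi a"
proof -
  interpret h: group_hom G circle_group f
    using assms by unfold_locales
  show n: "norm (f x) = 1" if "x \<in> carrier G" for x using h.hom_closed[OF that] by simp
  show "x \<in> carrier G \<Longrightarrow> y \<in> carrier G \<Longrightarrow> f (x \<otimes> y) = f x * f y" by simp
  show "f \<one> = 1" using h.hom_one by simp
  show "x \<in> carrier G \<Longrightarrow> f (inv x) = inverse (f x)" using h.hom_inv n by simp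
  show "x \<in> carrier G \<Longrightarrow> f (x [^] (a::int)) = f x powi a" using h.hom_int_pow n by simp
qed

text \<open>As e leaves every finitely generated subgroup, there is always a later term outside the
  current domain, and its value can be chosen at distance at least 1 from the previous one. The
  union of the partial characters then extends to a character that is not Cauchy along e.\<close>

lemma nonconvergent_character_chain:
  assumes e: "range e \<subseteq> carrier G"
    and inf: "\<And>S. finite S \<Longrightarrow> S \<subseteq> carrier G \<Longrightarrow> \<exists>n::nat. e n \<notin> generate G S"
  obtains f where "f \<in> hom G circle_group" "\<not> convergent (\<lambda>n. f (e n))"
proof -
  \<comment> \<open>A state consists of the partial character, the index last treated and the value
    taken there; in the initial state the latter two are dummies. The finite set S witnesses that
    the domain is still small.\<close>
  define P where "P p \<longleftrightarrow> (case p of (\<Gamma>, n::nat, v::complex) \<Rightarrow> partial_hom G circle_group \<Gamma> \<and> norm v = 1 \<and>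
     (\<exists>S. finite S \<and> S \<subseteq> carrier G \<and> Domain \<Gamma> \<subseteq> generate G S))" for p
  define R where "R p p' \<longleftrightarrow> (case p of (\<Gamma>, n::nat, v) \<Rightarrow> case p' of (\<Gamma>', n', v') \<Rightarrow>
     \<Gamma> \<subseteq> \<Gamma>' \<and> n < n' \<and> (e n', v') \<in> \<Gamma>' \<and> Re (v' * cnj v) \<le> 0)" for p p'
  have "\<exists>s. \<forall>k. P (s k) \<and> R (s k) (s (Suc k))"
  proof (rule dependent_nat_choice[where P = "\<lambda>_. P" and Q = "\<lambda>_. R"])
    have "P ({(\<one>, 1)}, 0, 1)"
      unfolding P_def using partial_hom_trivial by (auto intro!: exI[of _ "{}"] generate.one)
    then show "\<exists>x. P x" by blast
    fix p :: "('a \<times> complex) set \<times> nat \<times> complex" and k :: nat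
    obtain \<Gamma> n v where p: "p = (\<Gamma>, n, v)" by (cases p)
    assume "P p"
    then obtain S where \<Gamma>: "partial_hom G circle_group \<Gamma>" "norm v = 1"
      and S: "finite S" "S \<subseteq> carrier G" "Domain \<Gamma> \<subseteq> generate G S"
      unfolding P_def p by auto
    have "e ` {..n} \<subseteq> carrier G" using e by blast
    then obtain m where m: "e m \<notin> generate G (S \<union> e ` {..n})"
      using inf[of "S \<union> e ` {..n}"] S by auto
    have "e i \<in> generate G (S \<union> e ` {..n})" if "i \<le> n" for i using that by (auto intro: generate.incl)
    \<comment> \<open>The terms up to index n were added to the generators only in order to force
      the new index beyond n.\<close>
    then have mn: "n < m" using m by (meson not_le_imp_less)
    have "generate G S \<subseteq> generate G (S \<union> e ` {..n})" by (rule mono_generate) auto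
    then have mD: "e m \<notin> Domain \<Gamma>" using m S(3) by blast
    have em: "e m \<in> carrier G" using e by blast
    obtain q \<Gamma>' where \<Gamma>': "partial_hom G circle_group \<Gamma>'" "\<Gamma> \<subseteq> \<Gamma>'" "(e m, q) \<in> \<Gamma>'" "Re (q * cnj v) \<le> 0"
      "Domain \<Gamma>' \<subseteq> generate G (insert (e m) (Domain \<Gamma>))"
      using partial_character_step[OF \<Gamma>(1) em mD \<Gamma>(2)] by metis
    have S': "insert (e m) S \<subseteq> carrier G" using S em by blast
    have "generate G S \<subseteq> generate G (insert (e m) S)" by (rule mono_generate) auto
    then have "insert (e m) (Domain \<Gamma>) \<subseteq> generate G (insert (e m) S)"
      using S(3) by (auto intro: generate.incl)
    then have "generate G (insert (e m) (Domain \<Gamma>)) \<subseteq> generate G (insert (e m) S)"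
      using generate_is_subgroup[OF S'] by (rule generate_subgroup_incl)
    then have "P (\<Gamma>', m, q)"
      unfolding P_def using \<Gamma>' S' S(1) circ.partial_homD(2)[OF \<Gamma>'(1,3)]
      by (auto intro!: exI[of _ "insert (e m) S"])
    moreover have "R p (\<Gamma>', m, q)" unfolding R_def p using \<Gamma>' mn by simp
    ultimately show "\<exists>y. P y \<and> R p y" by blast
  qed
  then obtain s where s: "\<And>k. P (s k)" "\<And>k. R (s k) (s (Suc k))" by blast
  define \<Gamma> n v where "\<Gamma> k = fst (s k)" and "n k = fst (snd (s k))" and "v k = snd (snd (s k))" for k
  have s_eq: "s k = (\<Gamma> k, n k, v k)" for k by (simp add: \<Gamma>_def n_def v_def)
  have ph: "partial_hom G circle_group (\<Gamma> k)" and nv: "norm (v k) = 1" for k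
    using s(1)[of k] unfolding P_def s_eq by auto
  have step: "\<Gamma> k \<subseteq> \<Gamma> (Suc k)" "n k < n (Suc k)" "(e (n (Suc k)), v (Suc k)) \<in> \<Gamma> (Suc k)"
    "Re (v (Suc k) * cnj (v k)) \<le> 0" for k
    using s(2)[of k] unfolding R_def s_eq by auto
  have mono: "\<Gamma> k \<subseteq> \<Gamma> l" if "k \<le> l" for k l using lift_Suc_mono_le[of \<Gamma>, OF step(1) that] .
  have "partial_hom G circle_group (\<Union>k. \<Gamma> k)"
    unfolding partial_hom_def circ.subgroup_DirProd_iff
  proof (intro conjI allI impI)
    show "(\<Union>k. \<Gamma> k) \<subseteq> carrier G \<times> carrier circle_group"
    proof
      fix p assume "p \<in> (\<Union>k. \<Gamma> k)"
      then obtain k where "p \<in> \<Gamma> k" by blast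
      then show "p \<in> carrier G \<times> carrier circle_group"
        using circ.partial_homD(1,2)[OF ph[of k], of "fst p" "snd p"] by (cases p) auto
    qed
    show "(\<one>, \<one>\<^bsub>circle_group\<^esub>) \<in> (\<Union>k. \<Gamma> k)" using circ.partial_homD(3)[OF ph[of 0]] by blast
    show "(inv x, inv\<^bsub>circle_group\<^esub> q) \<in> (\<Union>k. \<Gamma> k)" if "(x, q) \<in> (\<Union>k. \<Gamma> k)" for x q
      using that circ.partial_homD(5)[OF ph] by blast
    show "q = \<one>\<^bsub>circle_group\<^esub>" if "(\<one>, q) \<in> (\<Union>k. \<Gamma> k)" for q
      using that circ.partial_homD(6)[OF ph] by blast
    show "(x \<otimes> y, q \<otimes>\<^bsub>circle_group\<^esub> r) \<in> (\<Union>k. \<Gamma> k)"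
      if xq: "(x, q) \<in> (\<Union>k. \<Gamma> k)" and yr: "(y, r) \<in> (\<Union>k. \<Gamma> k)" for x q y r
    proof -
      obtain k l where "(x, q) \<in> \<Gamma> k" "(y, r) \<in> \<Gamma> l" using xq yr by blast
      then have "(x, q) \<in> \<Gamma> (max k l)" "(y, r) \<in> \<Gamma> (max k l)"
        using mono[of k "max k l"] mono[of l "max k l"] by auto
      from circ.partial_homD(4)[OF ph this] show ?thesis by blast
    qed
  qed
  then obtain f where f: "f \<in> hom G circle_group" "\<And>x q. (x, q) \<in> (\<Union>k. \<Gamma> k) \<Longrightarrow> f x = q"
    using character_extend by metis
  have fv: "f (e (n (Suc k))) = v (Suc k)" for k using f(2) step(3)[of k] by blast
  have "\<not> convergent (\<lambda>m. f (e m))"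
  proof
    assume c: "convergent (\<lambda>m. f (e m))"
    have "strict_mono (\<lambda>k. n (Suc k))" using step(2) by (simp add: strict_mono_Suc_iff)
    from convergent_subseq_convergent[OF c this] have "convergent (\<lambda>k. v (Suc k))"
      by (simp add: o_def fv)
    then obtain L where L: "(\<lambda>k. v (Suc k)) \<longlonglongrightarrow> L" unfolding convergent_def by blast
    then have "(\<lambda>k. v (Suc (Suc k)) - v (Suc k)) \<longlonglongrightarrow> L - L"
      by (intro tendsto_diff) (simp_all add: filterlim_sequentially_Suc[of "\<lambda>k. v (Suc k)"])
    then have "(\<lambda>k. norm (v (Suc (Suc k)) - v (Suc k))) \<longlonglongrightarrow> 0"
      using tendsto_norm_zero by fastforce
    moreover have "1 \<le> norm (v (Suc (Suc k)) - v (Suc k))" for k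
      using norm_diff_circle nv step(4) by blast
    ultimately have "(1::real) \<le> 0" by (intro LIMSEQ_le_const) blast+
    then show False by simp
  qed
  with f(1) that show thesis by blast
qed

end

text \<open>Suppose convergence for every t. Comparing each term with a later one of different
  exponent makes \<open>cos (d n * t)\<close> tend to 1 for every t, with non-zero integers
  \<open>d n\<close>. Each of these functions has integral 0 over a period, so dominated convergence
  would give \<open>2 * pi = 0\<close>.\<close>

lemma nonconvergent_cis:
  fixes a :: "nat \<Rightarrow> int"
  assumes fin: "\<And>c. finite {n. a n = c}"
  obtains t :: real where "\<not> convergent (\<lambda>n. cis (of_int (a n) * t))"
proof -
  have "\<exists>t::real. \<not> convergent (\<lambda>n. cis (of_int (a n) * t))"
  proof (rule ccontr)
    assume "\<not> ?thesis"
    then have conv: "convergent (\<lambda>n. cis (of_int (a n) * t))" for t by blast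
    have "\<exists>m>n. a m \<noteq> a n" for n
    proof (rule ccontr)
      assume "\<not> ?thesis"
      then have "{n<..} \<subseteq> {m. a m = a n}" by auto
      then show False using fin finite_subset infinite_Ioi by blast
    qed
    then obtain q where q: "\<And>n. q n > n" "\<And>n. a (q n) \<noteq> a n" by metis
    have qlim: "filterlim q at_top sequentially"
      by (rule filterlim_at_top_mono[OF filterlim_ident]) (use q(1) less_imp_le in \<open>auto intro!: always_eventually\<close>)
    define d :: "nat \<Rightarrow> real" where "d n = of_int (a n - a (q n))" for n
    have d0: "d n \<noteq> 0" for n using q(2)[of n] unfolding d_def by simp
    have lim: "(\<lambda>n. cos (d n * t)) \<longlonglongrightarrow> 1" for t :: real
    proof -
      obtain L where L: "(\<lambda>n. cis (of_int (a n) * t)) \<longlonglongrightarrow> L" using conv unfolding convergent_def by blast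
      have "(\<lambda>n. norm (cis (of_int (a n) * t))) \<longlonglongrightarrow> norm L" using L by (rule tendsto_norm)
      then have "norm L = 1" by (simp add: LIMSEQ_const_iff)
      have L2: "(\<lambda>n. cis (of_int (a (q n)) * t)) \<longlonglongrightarrow> L"
        using filterlim_compose[OF L qlim] by simp
      have "(\<lambda>n. cis (of_int (a n) * t) * cnj (cis (of_int (a (q n)) * t))) \<longlonglongrightarrow> L * cnj L"
        using L L2 by (intro tendsto_mult tendsto_cnj)
      moreover have "L * cnj L = 1" using \<open>norm L = 1\<close> by (simp add: complex_norm_square[symmetric])
      ultimately have "(\<lambda>n. Re (cis (of_int (a n) * t) * cnj (cis (of_int (a (q n)) * t)))) \<longlonglongrightarrow> 1"
        using tendsto_Re by fastforce
      moreover have "Re (cis (of_int (a n) * t) * cnj (cis (of_int (a (q n)) * t))) = cos (d n * t)" for n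
        by (simp add: d_def cos_diff algebra_simps)
      ultimately show ?thesis by simp
    qed
    have int: "((\<lambda>t. cos (d n * t)) has_integral 0) {0..2 * pi}" for n
    proof -
      have "((\<lambda>t. cos (d n * t)) has_integral (sin (d n * (2 * pi)) / d n - sin (d n * 0) / d n)) {0..2 * pi}"
        using d0[of n] by (intro fundamental_theorem_of_calculus)
          (auto intro!: derivative_eq_intros simp: has_real_derivative_iff_has_vector_derivative[symmetric])
      moreover have "sin (d n * (2 * pi)) = 0"
        using sin_int_2pin[of "a n - a (q n)"] by (simp add: d_def mult.commute mult.left_commute)
      ultimately show ?thesis by simp
    qed
    have "(\<lambda>n. integral {0..2 * pi} (\<lambda>t. cos (d n * t))) \<longlonglongrightarrow> integral {0..2 * pi} (\<lambda>t. 1::real)"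
    proof (rule dominated_convergence(2))
      show "(\<lambda>t. cos (d n * t)) integrable_on {0..2 * pi}" for n using int by blast
      show "(\<lambda>t. 1::real) integrable_on {0..2 * pi}" by (rule integrable_continuous_real) simp
    qed (use lim in auto)
    moreover have "integral {0..2 * pi} (\<lambda>t. cos (d n * t)) = 0" for n using int by (rule integral_unique)
    ultimately have "integral {0..2 * pi} (\<lambda>t. 1::real) = 0" by (simp add: LIMSEQ_const_iff)
    then show False by simp
  qed
  then show thesis using that by blast
qed


context comm_group
begin

interpretation circ: two_comm_groups G circle_group
  by unfold_locales

lemma generate_insert_decompose:
  assumes S: "S \<subseteq> carrier G" and x: "x \<in> carrier G" and y: "y \<in> generate G (insert x S)"
  obtains h and a :: int where "h \<in> generate G S" "y = h \<otimes> x [^] a"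
proof -
  interpret S: subgroup "generate G S" G using S by (rule generate_is_subgroup)
  have "\<exists>h\<in>generate G S. \<exists>a::int. y = h \<otimes> x [^] a"
    using y
  proof (induction rule: generate.induct)
    case one
    show ?case using x by (intro bexI[of _ \<one>] exI[of _ 0]) auto
  next
    case (incl h)
    show ?case
    proof (cases "h = x")
      case True
      then show ?thesis using x by (intro bexI[of _ \<one>] exI[of _ 1]) auto
    next
      case False
      then have "h \<in> generate G S" using incl by (auto intro: generate.incl)
      then show ?thesis by (intro bexI[of _ h] exI[of _ 0]) (use S.mem_carrier in auto)
    qed
  next
    case (inv h)
    show ?case
    proof (cases "h = x")
      case True
      then show ?thesis using x by (intro bexI[of _ \<one>] exI[of _ "- 1"]) (auto simp: int_pow_neg)
    next
      case False
      then have "inv h \<in> generate G S" using inv by (auto intro: generate.inv)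
      then show ?thesis by (intro bexI[of _ "inv h"] exI[of _ 0]) (use S.mem_carrier in auto)
    qed
  next
    case (eng h1 h2)
    then obtain k1 k2 and a1 a2 :: int where k: "k1 \<in> generate G S" "h1 = k1 \<otimes> x [^] a1"
      "k2 \<in> generate G S" "h2 = k2 \<otimes> x [^] a2" by blast
    have "k1 \<in> carrier G" "k2 \<in> carrier G" using k S.mem_carrier by blast+
    then have "h1 \<otimes> h2 = (k1 \<otimes> k2) \<otimes> x [^] (a1 + a2)"
      using k x by (simp add: int_pow_mult m_ac)
    then show ?case using S.m_closed[OF k(1,3)] by blast
  qed
  then show thesis using that by blast
qed

text \<open>Along the infinitely many terms in one coset of H, a character differs from its values
  on the H-parts by the constant factor \<open>f (x^c)\<close> only, so the question descends to an
  injective sequence in H.\<close>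

lemma nonconvergent_character_coset:
  fixes a :: "nat \<Rightarrow> int"
  assumes IH: "\<And>e. inj e \<Longrightarrow> range e \<subseteq> H \<Longrightarrow> \<exists>f\<in>hom G circle_group. \<not> convergent (\<lambda>n::nat. f (e n))"
    and H: "H \<subseteq> carrier G" and x: "x \<in> carrier G" and e: "inj e"
    and h: "\<And>n. h n \<in> H" "\<And>n. e n = h n \<otimes> x [^] a n" and inf: "infinite {n. a n = c}"
  shows "\<exists>f\<in>hom G circle_group. \<not> convergent (\<lambda>n::nat. f (e n))"
proof -
  define r where "r = enumerate {n. a n = c}"
  have r: "strict_mono r" unfolding r_def using inf by (rule strict_mono_enumerate)
  have ar: "a (r n) = c" for n using enumerate_in_set[OF inf, of n] unfolding r_def by simp
  have "inj (\<lambda>n. h (r n))"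
  proof (rule injI)
    fix m n assume "h (r m) = h (r n)"
    then have "e (r m) = e (r n)" by (simp add: h(2) ar)
    then show "m = n" using e r by (metis injD strict_mono_eq)
  qed
  moreover have "range (\<lambda>n. h (r n)) \<subseteq> H" using h(1) by blast
  ultimately obtain f where f: "f \<in> hom G circle_group" "\<not> convergent (\<lambda>n. f (h (r n)))"
    using IH by blast
  have "\<not> convergent (\<lambda>n. f (e n))"
  proof
    assume "convergent (\<lambda>n. f (e n))"
    then have "convergent (\<lambda>n. f (e (r n)))"
      using convergent_subseq_convergent[OF _ r] by (simp add: o_def)
    moreover have "f (e (r n)) = f (x [^] c) * f (h (r n))" for n
      using hom_circle(2)[OF f(1)] h H x by (simp add: ar subset_iff mult.commute)
    moreover have "f (x [^] c) \<noteq> 0" using hom_circle(1)[OF f(1), of "x [^] c"] x by force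
    ultimately show False using f(2) convergent_mult_const_iff[of "f (x [^] c)"] by simp
  qed
  with f(1) show ?thesis by blast
qed

text \<open>Induction on the generators, with \<open>e n = h n x^(a n)\<close>. If some positive
  power of x lies in the subgroup H of the other generators, exponents can be reduced modulo it and
  one coset of H is met infinitely often; the same holds if some exponent recurs infinitely often.
  Otherwise x is independent of H, and the character that is 1 on H and \<open>cis t\<close> at x
  reduces the claim to integer exponents.\<close>

lemma nonconvergent_character_fg:
  assumes "finite S" "S \<subseteq> carrier G" "inj e" "range e \<subseteq> generate G S"
  shows "\<exists>f\<in>hom G circle_group. \<not> convergent (\<lambda>n::nat. f (e n))"
  using assms
proof (induction S arbitrary: e rule: finite_induct)
  case empty
  then have "e 0 = \<one>" "e 1 = \<one>" using generate_empty by auto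
  then show ?case using empty by (metis injD zero_neq_one)
next
  case (insert x S)
  let ?H = "generate G S"
  have S: "S \<subseteq> carrier G" and x: "x \<in> carrier G" using insert.prems by auto
  interpret H: subgroup ?H G using S by (rule generate_is_subgroup)
  have "\<exists>h a. h \<in> ?H \<and> e n = h \<otimes> x [^] (a::int)" for n
    using generate_insert_decompose[OF S x, of "e n"] insert.prems by (metis rangeI subsetD)
  then obtain h a where ha: "\<And>n. h n \<in> ?H" "\<And>n. e n = h n \<otimes> x [^] (a n :: int)" by metis
  have hc: "h n \<in> carrier G" for n using ha(1) H.mem_carrier by blast
  note coset = nonconvergent_character_coset[OF insert.IH[OF S] H.subset x \<open>inj e\<close>]
  show ?case
  proof (cases "\<exists>m::nat. m > 0 \<and> x [^] m \<in> ?H")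
    case True
    then obtain m :: nat where m: "m > 0" "x [^] m \<in> ?H" by blast
    let ?k = "\<lambda>n. a n div int m" and ?b = "\<lambda>n. a n mod int m"
    let ?h = "\<lambda>n. h n \<otimes> (x [^] m) [^] ?k n"
    have h': "?h n \<in> ?H" for n
      using ha(1) subgroup_int_pow_closed[OF H.subgroup_axioms m(2)] by simp
    have "(x [^] m) [^] ?k n = x [^] (int m * ?k n)" for n
      using x int_pow_pow[of x "int m" "?k n"] int_pow_int[of G x m] by simp
    then have "?h n \<otimes> x [^] ?b n = h n \<otimes> x [^] (int m * ?k n + ?b n)" for n
      using x hc[of n] by (simp add: int_pow_mult[symmetric] m_assoc)
    then have e': "e n = ?h n \<otimes> x [^] ?b n" for n using ha(2) by simp
    have "range ?b \<subseteq> {0..<int m}" using m(1) by auto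
    then have "finite (range ?b)" by (rule finite_subset) simp
    then obtain n0 where "infinite {n. ?b n = ?b n0}"
      using pigeonhole_infinite[of "UNIV :: nat set" ?b] by auto
    from coset[where h = ?h and a = ?b, OF _ _ h' e' this] show ?thesis by blast
  next
    case False
    show ?thesis
    proof (cases "\<exists>c. infinite {n. a n = c}")
      case True
      then obtain c where "infinite {n. a n = c}" by blast
      from coset[where h = h and a = a, OF _ _ ha this] show ?thesis by blast
    next
      case fin: False
      then obtain t :: real where t: "\<not> convergent (\<lambda>n. cis (of_int (a n) * t))"
        using nonconvergent_cis[of a] by blast
      let ?\<Gamma> = "?H \<times> {1::complex}"
      have \<Gamma>: "partial_hom G circle_group ?\<Gamma>"
        unfolding partial_hom_def circ.subgroup_DirProd_iff using H.subset by auto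
      have comp: "s = cis t [^]\<^bsub>circle_group\<^esub> b" if "(x [^] (b::int), s) \<in> ?\<Gamma>" for b s
      proof -
        have "b = 0 \<and> s = \<one>\<^bsub>circle_group\<^esub>"
          using False by (intro circ.partial_hom_free[OF \<Gamma> x _ that]) blast
        then show ?thesis by simp
      qed
      have "cis t \<in> carrier circle_group" by simp
      note ins = circ.partial_hom_insert[OF \<Gamma> x this comp]
      obtain f where f: "f \<in> hom G circle_group" "f x = cis t" "\<And>y. y \<in> ?H \<Longrightarrow> f y = 1"
        using character_extend[OF ins(1)] ins(2,3) by (metis (no_types, lifting) SigmaI singletonI subsetD)
      have "f (e n) = cis (of_int (a n) * t)" for n
        using hom_circle(2,5)[OF f(1)] hc x f(2,3) ha by (simp add: cis_power_int)
      then have "\<not> convergent (\<lambda>n. f (e n))" using t by (simp only: not_False_eq_True)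
      with f(1) show ?thesis by blast
    qed
  qed
qed

text \<open>The Bohr topology of a discrete group has no non-trivial convergent sequences. An
  injective sequence either stays in a finitely generated subgroup or leaves each of them, and both
  cases have been treated.\<close>

lemma nonconvergent_character:
  assumes "inj e" "range e \<subseteq> carrier G"
  obtains f where "f \<in> hom G circle_group" "\<not> convergent (\<lambda>n::nat. f (e n))"
proof (cases "\<exists>S. finite S \<and> S \<subseteq> carrier G \<and> range e \<subseteq> generate G S")
  case True
  then show thesis using nonconvergent_character_fg[OF _ _ assms(1)] that by metis
next
  case False
  then have "\<exists>n. e n \<notin> generate G S" if "finite S" "S \<subseteq> carrier G" for S
    using that by blast
  then show thesis using nonconvergent_character_chain[OF assms(2)] that by metis
qed

text \<open>A sequence of values that does not converge does not converge to z in particular. This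
  is the form in which characters enter the construction of unbounded functions.\<close>

lemma infinite_character_away:
  assumes E: "infinite E" "E \<subseteq> carrier G"
  obtains f \<epsilon> where "f \<in> hom G circle_group" "\<epsilon> > 0" "infinite {x\<in>E. dist (f x) z > \<epsilon>}"
proof -
  obtain e :: "nat \<Rightarrow> 'a" where e: "inj e" "range e \<subseteq> E"
    using infinite_countable_subset[OF E(1)] by blast
  obtain f where f: "f \<in> hom G circle_group" "\<not> convergent (\<lambda>n. f (e n))"
    using nonconvergent_character[OF e(1)] e(2) E(2) by (metis order_trans)
  have "\<not> (\<lambda>n. f (e n)) \<longlonglongrightarrow> z" using f(2) unfolding convergent_def by blast
  then obtain \<epsilon> where \<epsilon>: "\<epsilon> > 0" "\<And>N. \<exists>n\<ge>N. dist (f (e n)) z \<ge> \<epsilon>"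
    unfolding lim_sequentially by (metis not_le)
  have "infinite {n. dist (f (e n)) z \<ge> \<epsilon>}"
    unfolding infinite_nat_iff_unbounded_le using \<epsilon>(2) by auto
  then have "infinite (e ` {n. dist (f (e n)) z \<ge> \<epsilon>})"
    using e(1) by (simp add: finite_image_iff inj_on_subset)
  moreover have "e ` {n. dist (f (e n)) z \<ge> \<epsilon>} \<subseteq> {x\<in>E. dist (f x) z > \<epsilon> / 2}"
    using e(2) \<epsilon>(1) by force
  ultimately have "infinite {x\<in>E. dist (f x) z > \<epsilon> / 2}" using finite_subset by blast
  with f(1) \<epsilon>(1) that[of f "\<epsilon> / 2"] show thesis by simp
qed

end


section \<open>Functionally bounded sets in the Bohr topology\<close>

lemma topspace_bohr: "abelian_topological_group G T \<Longrightarrow> topspace (bohr_topology G T) = carrier G"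
  using bohr_topology_weakest(1) abelian_topological_group.topspace_eq by blast

lemma continuous_map_bohr_character:
  assumes "abelian_topological_group G T" "f \<in> continuous_characters G T"
  shows "continuous_map (bohr_topology G T) euclidean f"
  using bohr_topology_weakest(2)[OF assms] by (simp add: continuous_map_in_subtopology)

lemma openin_bohr_imp_openin:
  assumes "abelian_topological_group G T" "openin (bohr_topology G T) W"
  shows "openin T W"
  using bohr_topology_weakest(3)[OF assms(1) _ _ assms(2)] assms(1) abelian_topological_group.topspace_eq
  by (fastforce simp: continuous_characters_def)

lemma continuous_map_bohr:
  assumes G: "abelian_topological_group G T" and G': "abelian_topological_group G' T'"
    and \<phi>: "\<phi> \<in> hom G G'" "continuous_map T T' \<phi>"
  shows "continuous_map (bohr_topology G T) (bohr_topology G' T') \<phi>"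
proof -
  have top: "topspace T = carrier G" "topspace T' = carrier G'"
    using G G' abelian_topological_group.topspace_eq by blast+
  have \<phi>c: "\<phi> x \<in> carrier G'" if "x \<in> carrier G" for x using \<phi>(1) that by (auto simp: hom_def)
  let ?S = "{{x \<in> carrier G'. \<psi> x \<in> U} |\<psi> U. \<psi> \<in> continuous_characters G' T' \<and> open U}"
  have un: "\<Union>?S = carrier G'"
    using topspace_bohr[OF G'] unfolding bohr_topology_def topology_generated_by_topspace .
  show ?thesis
    unfolding bohr_topology_def[of G' T']
  proof (rule continuous_on_generated_topo)
    show "\<phi> ` topspace (bohr_topology G T) \<subseteq> \<Union>?S"
      unfolding un topspace_bohr[OF G] using \<phi>c by blast
    fix W assume "W \<in> ?S"
    then obtain \<psi> U where W: "W = {x \<in> carrier G'. \<psi> x \<in> U}" "\<psi> \<in> continuous_characters G' T'" "open U" by blast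
    have "\<psi> \<circ> \<phi> \<in> hom G circle_group"
      using W(2) \<phi>(1) hom_compose unfolding continuous_characters_def by blast
    moreover have "continuous_map T (top_of_set (sphere 0 1)) (\<psi> \<circ> \<phi>)"
      using W(2) \<phi>(2) continuous_map_compose unfolding continuous_characters_def by blast
    ultimately have "\<psi> \<circ> \<phi> \<in> continuous_characters G T" unfolding continuous_characters_def by blast
    then have "openin (bohr_topology G T) {x \<in> carrier G. (\<psi> \<circ> \<phi>) x \<in> U}"
      unfolding bohr_topology_def by (intro topology_generated_by_Basis) (use W(3) in blast)
    moreover have "\<phi> -` W \<inter> topspace (bohr_topology G T) = {x \<in> carrier G. (\<psi> \<circ> \<phi>) x \<in> U}"
      using \<phi>c W(1) topspace_bohr[OF G] by auto
    ultimately show "openin (bohr_topology G T) (\<phi> -` W \<inter> topspace (bohr_topology G T))" by simp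
  qed
qed

lemma Hausdorff_bohr:
  assumes "MAP_group G T"
  shows "Hausdorff_space (bohr_topology G T)"
  unfolding Hausdorff_space_def
proof (intro allI impI, elim conjE)
  have G: "abelian_topological_group G T" using assms by (simp add: MAP_group_def)
  note top = topspace_bohr[OF G]
  fix x y assume "x \<in> topspace (bohr_topology G T)" "y \<in> topspace (bohr_topology G T)" "x \<noteq> y"
  then obtain f where xy: "x \<in> carrier G" "y \<in> carrier G"
    and f: "f \<in> continuous_characters G T" "f x \<noteq> f y"
    using assms unfolding MAP_group_def top by blast
  obtain U V where UV: "open U" "open V" "f x \<in> U" "f y \<in> V" "U \<inter> V = {}"
    using hausdorff[OF f(2)] by (elim exE conjE) (rule that)
  have op: "openin (bohr_topology G T) {z \<in> carrier G. f z \<in> U}" if "open U" for U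
  proof -
    have "openin euclidean U" using that by (rule open_openin[THEN iffD1])
    from openin_continuous_map_preimage[OF continuous_map_bohr_character[OF G f(1)] this]
    show ?thesis by (simp only: top)
  qed
  show "\<exists>U V. openin (bohr_topology G T) U \<and> openin (bohr_topology G T) V \<and> x \<in> U \<and> y \<in> V \<and> disjnt U V"
  proof (intro exI conjI)
    show "openin (bohr_topology G T) {z \<in> carrier G. f z \<in> U}" using op UV(1) .
    show "openin (bohr_topology G T) {z \<in> carrier G. f z \<in> V}" using op UV(2) .
    show "disjnt {z \<in> carrier G. f z \<in> U} {z \<in> carrier G. f z \<in> V}"
      using UV(5) unfolding disjnt_iff by blast
  qed (use xy UV in simp_all)
qed

text \<open>Serves for sums that are finite only locally and for locally constant coset
  maps.\<close>

lemma continuous_map_locally: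
  assumes "\<And>x. x \<in> topspace X \<Longrightarrow> \<exists>U g. openin X U \<and> x \<in> U \<and> continuous_map X Y g \<and> (\<forall>y\<in>U. f y = g y)"
  shows "continuous_map X Y f"
  unfolding continuous_map_def
proof (intro conjI allI impI)
  show "f \<in> topspace X \<rightarrow> topspace Y"
  proof
    fix x assume x: "x \<in> topspace X"
    then obtain U g where "x \<in> U" "continuous_map X Y g" "\<forall>y\<in>U. f y = g y" using assms by blast
    then show "f x \<in> topspace Y" using continuous_map_image_subset_topspace x by fastforce
  qed
  fix W assume W: "openin Y W"
  show "openin X {x \<in> topspace X. f x \<in> W}"
  proof (subst openin_subopen, intro ballI)
    fix x assume x: "x \<in> {x \<in> topspace X. f x \<in> W}"
    then obtain U g where U: "openin X U" "x \<in> U" "continuous_map X Y g" "\<forall>y\<in>U. f y = g y"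
      using assms by blast
    have "openin X (U \<inter> {y \<in> topspace X. g y \<in> W})"
      using U(1) openin_continuous_map_preimage[OF U(3) W] by (rule openin_Int)
    moreover have "x \<in> U \<inter> {y \<in> topspace X. g y \<in> W}" using U x by simp
    moreover have "U \<inter> {y \<in> topspace X. g y \<in> W} \<subseteq> {x \<in> topspace X. f x \<in> W}" using U(4) by auto
    ultimately show "\<exists>V. openin X V \<and> x \<in> V \<and> V \<subseteq> {x \<in> topspace X. f x \<in> W}" by blast
  qed
qed

lemma functionally_boundedin_image:
  assumes "continuous_map T T' \<phi>" "functionally_boundedin T E"
  shows "functionally_boundedin T' (\<phi> ` E)"
  unfolding functionally_boundedin_def
proof (intro conjI allI impI)
  show "\<phi> ` E \<subseteq> topspace T'"
    using assms continuous_map_image_subset_topspace unfolding functionally_boundedin_def by blast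
  fix f assume "continuous_map T' euclideanreal f"
  then have "continuous_map T euclideanreal (f \<circ> \<phi>)" using assms(1) continuous_map_compose by blast
  then have "bounded ((f \<circ> \<phi>) ` E)" using assms(2) unfolding functionally_boundedin_def by blast
  then show "bounded (f ` \<phi> ` E)" by (simp add: image_comp)
qed

lemma functionally_boundedin_mono:
  "functionally_boundedin T E \<Longrightarrow> D \<subseteq> E \<Longrightarrow> functionally_boundedin T D"
  unfolding functionally_boundedin_def by (meson bounded_subset image_mono order_trans)

lemma abelian_topological_group_discrete:
  assumes "comm_group G"
  shows "abelian_topological_group G (discrete_topology (carrier G))"
proof -
  interpret comm_group G by fact
  show ?thesis
    by unfold_locales (auto simp: prod_topology_discrete_topology[symmetric])
qed

lemma continuous_characters_discrete:
  "continuous_characters G (discrete_topology (carrier G)) = hom G circle_group"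
  by (auto simp: continuous_characters_def hom_def circle_group_def)

section \<open>Functionally bounded sets of discrete groups in the Bohr topology\<close>

context comm_group
begin

abbreviation "discrete_bohr \<equiv> bohr_topology G (discrete_topology (carrier G))"

text \<open>Enumerate the group as \<open>q n\<close>. Recursively, a character \<open>f n\<close>
  separates an infinite part \<open>D (Suc n)\<close> of \<open>D n\<close> from the point
  \<open>q n\<close>. The product \<open>h n\<close> of the first n+1 cut-offs vanishes near
  \<open>q j\<close> for each j up to n and is 1 on \<open>D (Suc n)\<close>. Hence the sum of all
  \<open>h n\<close> is locally finite, thus continuous, and exceeds N on the non-empty set
  \<open>D (Suc N)\<close>.\<close>

lemma countable_imp_not_functionally_bounded:
  assumes count: "countable (carrier G)" and E: "infinite E" "E \<subseteq> carrier G"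
  shows "\<not> functionally_boundedin discrete_bohr E"
proof
  assume fb: "functionally_boundedin discrete_bohr E"
  note ATG = abelian_topological_group_discrete[OF comm_group_axioms]
  define q where "q = from_nat_into (carrier G)"
  define P :: "nat \<Rightarrow> 'a set \<times> ('a \<Rightarrow> complex) \<times> real \<Rightarrow> bool" where
    "P n p \<longleftrightarrow> (case p of (D, f, \<epsilon>) \<Rightarrow> D \<subseteq> E \<and> f \<in> hom G circle_group \<and> \<epsilon> > 0 \<and>
       infinite {x \<in> D. dist (f x) (f (q n)) > \<epsilon>})" for n p
  define R :: "nat \<Rightarrow> 'a set \<times> ('a \<Rightarrow> complex) \<times> real \<Rightarrow> 'a set \<times> ('a \<Rightarrow> complex) \<times> real \<Rightarrow> bool" where
    "R n p p' \<longleftrightarrow> (case p of (D, f, \<epsilon>) \<Rightarrow> fst p' = {x \<in> D. dist (f x) (f (q n)) > \<epsilon>})" for n p p'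
  \<comment> \<open>Translation by the inverse of \<open>q n\<close> turns distance from the value
    at \<open>q n\<close> into distance from 1.\<close>
  have away: "\<exists>f \<epsilon>. f \<in> hom G circle_group \<and> \<epsilon> > 0 \<and> infinite {x \<in> D. dist (f x) (f (q n)) > \<epsilon>}"
    if D: "infinite D" "D \<subseteq> E" for D n
  proof -
    have qn: "q n \<in> carrier G" unfolding q_def by (rule from_nat_into) blast
    have sub: "(\<lambda>x. x \<otimes> inv (q n)) ` D \<subseteq> carrier G" using D E qn by blast
    have inj: "inj_on (\<lambda>x. x \<otimes> inv (q n)) D"
      using D E qn by (intro inj_onI) (auto simp: subset_iff)
    then have "infinite ((\<lambda>x. x \<otimes> inv (q n)) ` D)" using D(1) by (simp add: finite_image_iff)
    then obtain f \<epsilon> where f: "f \<in> hom G circle_group" "\<epsilon> > 0"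
      "infinite {y \<in> (\<lambda>x. x \<otimes> inv (q n)) ` D. dist (f y) 1 > \<epsilon>}"
      using infinite_character_away[OF _ sub] by metis
    have "dist (f (x \<otimes> inv (q n))) 1 = dist (f x) (f (q n))" if "x \<in> D" for x
    proof -
      have x: "x \<in> carrier G" using that D E by blast
      have n1: "norm (f (q n)) = 1" using hom_circle(1)[OF f(1) qn] .
      then have "f (x \<otimes> inv (q n)) - 1 = (f x - f (q n)) * inverse (f (q n))"
        using hom_circle(2,4)[OF f(1)] x qn circle_inverse_mult[OF n1] by (simp add: algebra_simps)
      then show ?thesis using n1 by (simp add: dist_norm norm_mult norm_inverse)
    qed
    then have "{y \<in> (\<lambda>x. x \<otimes> inv (q n)) ` D. dist (f y) 1 > \<epsilon>} \<subseteq>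
        (\<lambda>x. x \<otimes> inv (q n)) ` {x \<in> D. dist (f x) (f (q n)) > \<epsilon>}" by auto
    then have "infinite {x \<in> D. dist (f x) (f (q n)) > \<epsilon>}"
      using f(3) finite_subset finite_imageI by meson
    with f show ?thesis by blast
  qed
  have "\<exists>s. \<forall>n. P n (s n) \<and> R n (s n) (s (Suc n))"
  proof (rule dependent_nat_choice)
    obtain f \<epsilon> where "f \<in> hom G circle_group" "\<epsilon> > 0" "infinite {x \<in> E. dist (f x) (f (q 0)) > \<epsilon>}"
      using away[OF E(1) order_refl] by blast
    then have "P 0 (E, f, \<epsilon>)" unfolding P_def by simp
    then show "\<exists>x. P 0 x" by blast
    fix p n assume P: "P n p"
    obtain D f \<epsilon> where p: "p = (D, f, \<epsilon>)" by (cases p)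
    let ?D = "{x \<in> D. dist (f x) (f (q n)) > \<epsilon>}"
    have D: "infinite ?D" "?D \<subseteq> E" using P unfolding P_def p by auto
    obtain f' \<epsilon>' where "f' \<in> hom G circle_group" "\<epsilon>' > 0" "infinite {x \<in> ?D. dist (f' x) (f' (q (Suc n))) > \<epsilon>'}"
      using away[OF D, of "Suc n"] by blast
    then have "P (Suc n) (?D, f', \<epsilon>')" unfolding P_def using D(2) by simp
    moreover have "R n p (?D, f', \<epsilon>')" unfolding R_def p by simp
    ultimately show "\<exists>y. P (Suc n) y \<and> R n p y" by blast
  qed
  then obtain s where s: "\<And>n. P n (s n)" "\<And>n. R n (s n) (s (Suc n))" by blast
  define D f \<epsilon> where "D n = fst (s n)" and "f n = fst (snd (s n))" and "\<epsilon> n = snd (snd (s n))" for n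
  have s_eq: "s n = (D n, f n, \<epsilon> n)" for n by (simp add: D_def f_def \<epsilon>_def)
  have DE: "D n \<subseteq> E" and f: "f n \<in> hom G circle_group" and \<epsilon>: "\<epsilon> n > 0"
    and infD: "infinite {x \<in> D n. dist (f n x) (f n (q n)) > \<epsilon> n}" for n
    using s(1)[of n] unfolding P_def s_eq by auto
  have DSuc: "D (Suc n) = {x \<in> D n. dist (f n x) (f n (q n)) > \<epsilon> n}" for n
    using s(2)[of n] unfolding R_def s_eq by simp
  have Dmono: "D m \<subseteq> D n" if "n \<le> m" for m n
    using that by (induction rule: dec_induct) (auto simp: DSuc)
  \<comment> \<open>A ramp in the distance from \<open>f n (q n)\<close>: 0 up to half of
    \<open>\<epsilon> n\<close>, and 1 from \<open>\<epsilon> n\<close> on. The flat part at 0 makes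
    it vanish on a whole neighbourhood of \<open>q n\<close>.\<close>
  define p where "p n x = max 0 (min 1 (2 * dist (f n x) (f n (q n)) / \<epsilon> n - 1))" for n x
  define h where "h n x = (\<Prod>j\<le>n. p j x)" for n x
  define J where "J = to_nat_on (carrier G)"
  define F where "F x = (\<Sum>n<J x. h n x)" for x
  have qJ: "q (J x) = x" if "x \<in> carrier G" for x
    unfolding q_def J_def using count that by (rule from_nat_into_to_nat_on)
  have p0: "p n x = 0" if "dist (f n x) (f n (q n)) < \<epsilon> n / 2" for n x
    using that \<epsilon>[of n] unfolding p_def by (simp add: field_simps)
  have p1: "p n x = 1" if "dist (f n x) (f n (q n)) > \<epsilon> n" for n x
    using that \<epsilon>[of n] unfolding p_def by (simp add: field_simps min_def)
  have h0: "h n x = 0" if "j \<le> n" "p j x = 0" for n j x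
    unfolding h_def using that by (intro prod_zero) auto
  have hn: "h n x \<ge> 0" for n x unfolding h_def by (intro prod_nonneg) (simp add: p_def)
  have hJ: "h n x = 0" if "x \<in> carrier G" "J x \<le> n" for n x
    using h0[OF that(2) p0] qJ[OF that(1)] \<epsilon>[of "J x"] by simp
  \<comment> \<open>Truncating at \<open>J x\<close> loses nothing, since x is the point with index
    \<open>J x\<close> and all later products contain a factor vanishing there. Near
    \<open>q j\<close> the same factor allows truncation at j, which no longer depends on the
    point.\<close>
  have Feq: "F y = (\<Sum>n<j. h n y)" if y: "y \<in> carrier G" and "dist (f j y) (f j (q j)) < \<epsilon> j / 2" for y j
  proof -
    have z: "h n y = 0" if "j \<le> n" for n using h0[OF that p0] \<open>dist (f j y) (f j (q j)) < \<epsilon> j / 2\<close> by blast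
    have "F y = (\<Sum>n<max (J y) j. h n y)"
      unfolding F_def
    proof (rule sum.mono_neutral_left)
      show "{..<J y} \<subseteq> {..<max (J y) j}" by simp
      show "\<forall>i\<in>{..<max (J y) j} - {..<J y}. h i y = 0" using hJ[OF y] by (simp add: not_less)
    qed simp
    also have "\<dots> = (\<Sum>n<j. h n y)"
    proof (rule sum.mono_neutral_right)
      show "{..<j} \<subseteq> {..<max (J y) j}" by simp
      show "\<forall>i\<in>{..<max (J y) j} - {..<j}. h i y = 0" using z by (simp add: not_less)
    qed simp
    finally show ?thesis .
  qed
  have top: "topspace discrete_bohr = carrier G" using topspace_bohr[OF ATG] .
  have contf: "continuous_map discrete_bohr euclidean (f n)" for n
    using continuous_map_bohr_character[OF ATG] f[of n] by (simp add: continuous_characters_discrete)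
  have contd: "continuous_map discrete_bohr euclideanreal (\<lambda>x. dist (f n x) c)" for n c
    unfolding dist_norm by (intro continuous_intros contf) simp
  have contp: "continuous_map discrete_bohr euclideanreal (p n)" for n
    unfolding p_def[abs_def] using \<epsilon>[of n]
    by (intro continuous_map_real_max continuous_map_real_min continuous_map_diff continuous_map_real_divide
        continuous_map_real_mult contd) auto
  have conth: "continuous_map discrete_bohr euclideanreal (h n)" for n
    unfolding h_def[abs_def] by (intro continuous_map_prod contp) simp
  have "continuous_map discrete_bohr euclideanreal F"
  proof (rule continuous_map_locally)
    fix x assume "x \<in> topspace discrete_bohr"
    then have x: "x \<in> carrier G" by (simp add: top)
    let ?j = "J x"
    let ?U = "{y \<in> topspace discrete_bohr. dist (f ?j y) (f ?j (q ?j)) \<in> {..<\<epsilon> ?j / 2}}"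
    have "openin discrete_bohr ?U"
      by (rule openin_continuous_map_preimage[OF contd]) simp
    moreover have "x \<in> ?U" using x qJ[OF x] \<epsilon>[of ?j] by (simp add: top)
    moreover have "continuous_map discrete_bohr euclideanreal (\<lambda>y. \<Sum>n<?j. h n y)"
      by (intro continuous_map_sum conth) simp
    moreover have "\<forall>y\<in>?U. F y = (\<Sum>n<?j. h n y)" using Feq by (auto simp: top)
    ultimately show "\<exists>U g. openin discrete_bohr U \<and> x \<in> U \<and> continuous_map discrete_bohr euclideanreal g \<and> (\<forall>y\<in>U. F y = g y)"
      by blast
  qed
  then have "bounded (F ` E)" using fb unfolding functionally_boundedin_def by blast
  then obtain b where b: "\<And>x. x \<in> E \<Longrightarrow> norm (F x) \<le> b" unfolding bounded_iff by blast
  obtain N :: nat where N: "b < N" using reals_Archimedean2 by blast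
  have "infinite (D (Suc N))" unfolding DSuc by (rule infD)
  then obtain x where x: "x \<in> D (Suc N)" by (metis finite.emptyI ex_in_conv)
  have h1: "h n x = 1" if "n \<le> N" for n
  proof -
    have "p j x = 1" if "j \<le> n" for j
    proof (rule p1)
      have "x \<in> D (Suc j)" using x Dmono[of "Suc j" "Suc N"] that \<open>n \<le> N\<close> by auto
      then show "dist (f j x) (f j (q j)) > \<epsilon> j" unfolding DSuc by simp
    qed
    then show ?thesis unfolding h_def by (intro prod.neutral) simp
  qed
  have xE: "x \<in> E" using x DE by blast
  \<comment> \<open>Products of index at least \<open>J x\<close> vanish at x, whereas those up to N
    are 1. So the sum defining \<open>F x\<close> really contains the N+1 terms equal to 1.\<close>
  have "N < J x"
  proof (rule ccontr)
    assume "\<not> N < J x"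
    then have "h N x = 0" using hJ xE E by auto
    with h1[of N] show False by simp
  qed
  then have "(\<Sum>n\<le>N. h n x) \<le> F x" unfolding F_def using hn by (intro sum_mono2) auto
  moreover have "(\<Sum>n\<le>N. h n x) = real N + 1" using h1 by simp
  ultimately show False using b[OF xE] N by auto
qed

text \<open>Closing up under quotients and under one chosen n-th root of every element, for every
  positive n, adds countably many elements in each of countably many rounds.\<close>

lemma countable_divisible_subgroup:
  assumes div: "divisible_group G" and A: "A \<subseteq> carrier G" "countable A"
  obtains Q where "subgroup Q G" "countable Q" "A \<subseteq> Q" "divisible_group (G\<lparr>carrier := Q\<rparr>)"
proof -
  define r where "r n q = (SOME x. x \<in> carrier G \<and> x [^] (n::nat) = q)" for n q
  have r: "r n q \<in> carrier G \<and> r n q [^] n = q" if "q \<in> carrier G" "n > 0" for n q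
    unfolding r_def
  proof (rule someI_ex)
    show "\<exists>x. x \<in> carrier G \<and> x [^] n = q" using div that unfolding divisible_group_def by blast
  qed
  define step where "step Z = Z \<union> (\<lambda>(x, y). x \<otimes> inv y) ` (Z \<times> Z) \<union> (\<lambda>(n, x). r n x) ` ({0<..} \<times> Z)" for Z
  define Z where "Z k = (step ^^ k) (insert \<one> A)" for k
  have ZSuc: "Z (Suc k) = step (Z k)" for k by (simp add: Z_def)
  have mono: "Z k \<subseteq> Z l" if "k \<le> l" for k l
    by (rule lift_Suc_mono_le[of Z, OF _ that]) (unfold ZSuc step_def, blast)
  have car: "Z k \<subseteq> carrier G" for k
  proof (induction k)
    case (Suc k)
    then show ?case unfolding ZSuc step_def using r by (auto simp: subset_iff)
  qed (use A in \<open>simp add: Z_def\<close>)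
  have cnt: "countable (Z k)" for k
  proof (induction k)
    case (Suc k)
    then show ?case unfolding ZSuc step_def by (intro countable_Un countable_image countable_SIGMA) auto
  qed (use A in \<open>simp add: Z_def\<close>)
  have div_mem: "x \<otimes> inv y \<in> (\<Union>k. Z k)" if xy: "x \<in> (\<Union>k. Z k)" "y \<in> (\<Union>k. Z k)" for x y
  proof -
    obtain k l where "x \<in> Z k" "y \<in> Z l" using xy by blast
    then have "x \<in> Z (max k l)" "y \<in> Z (max k l)" using mono[of k "max k l"] mono[of l "max k l"] by auto
    then have "x \<otimes> inv y \<in> Z (Suc (max k l))" unfolding ZSuc step_def by force
    then show ?thesis by blast
  qed
  have one: "\<one> \<in> (\<Union>k. Z k)" by (rule UN_I[of 0]) (auto simp: Z_def)
  have QG: "(\<Union>k. Z k) \<subseteq> carrier G" using car by blast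
  have inv: "inv y \<in> (\<Union>k. Z k)" if "y \<in> (\<Union>k. Z k)" for y
    using div_mem[OF one that] that QG by (simp add: subset_iff)
  have sub: "subgroup (\<Union>k. Z k) G"
  proof (rule subgroupI[OF QG])
    show "(\<Union>k. Z k) \<noteq> {}" using one by blast
    show "inv y \<in> (\<Union>k. Z k)" if "y \<in> (\<Union>k. Z k)" for y using inv that .
    show "x \<otimes> y \<in> (\<Union>k. Z k)" if "x \<in> (\<Union>k. Z k)" "y \<in> (\<Union>k. Z k)" for x y
      using div_mem[OF that(1) inv[OF that(2)]] that QG by (simp add: subset_iff)
  qed
  have pow: "x [^]\<^bsub>G\<lparr>carrier := Q\<rparr>\<^esub> (n::nat) = x [^] n" for x Q n
    by (simp add: nat_pow_def)
  have "divisible_group (G\<lparr>carrier := (\<Union>k. Z k)\<rparr>)"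
    unfolding divisible_group_def pow
  proof (intro ballI allI impI)
    fix q and n :: nat assume "q \<in> carrier (G\<lparr>carrier := (\<Union>k. Z k)\<rparr>)" and n: "0 < n"
    then obtain k where k: "q \<in> Z k" by auto
    then have "r n q \<in> Z (Suc k)" unfolding ZSuc step_def using n by force
    moreover have "r n q [^] n = q" using r[of q n] k car n by blast
    ultimately show "\<exists>x\<in>carrier (G\<lparr>carrier := (\<Union>k. Z k)\<rparr>). x [^] n = q" by auto
  qed
  moreover have "Z 0 = insert \<one> A" by (simp add: Z_def)
  then have "A \<subseteq> (\<Union>k. Z k)" by blast
  moreover have "countable (\<Union>k. Z k)" using cnt by simp
  ultimately show thesis using that sub by blast
qed

text \<open>Since homomorphisms into divisible groups extend, it suffices to embed a countable part of
  \<open>E\<close> into a countable divisible group.\<close>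

theorem functionally_bounded_discrete_bohr_imp_finite:
  assumes fb: "functionally_boundedin discrete_bohr E"
  shows "finite E"
proof (rule ccontr)
  assume "infinite E"
  then obtain E' where E': "E' \<subseteq> E" "countable E'" "infinite E'" using infinite_countable_subset' by blast
  note ATG = abelian_topological_group_discrete[OF comm_group_axioms]
  have EG: "E' \<subseteq> carrier G" using fb E'(1) unfolding functionally_boundedin_def topspace_bohr[OF ATG] by blast
  \<comment> \<open>The countable power of the circle is divisible, and its coordinates accommodate
    one separating character for each of the countably many pairs from \<open>E'\<close>; this makes
    \<open>\<Psi>\<close> injective on \<open>E'\<close>.\<close>
  let ?M = "product_group (UNIV :: nat set) (\<lambda>_. circle_group)"
  have Mgroup: "group ?M" by (rule product_group) (rule circle.is_group)
  interpret M: comm_group ?M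
    by (rule group.group_comm_groupI[OF Mgroup]) (simp add: mult.commute)
  have Mpow: "x [^]\<^bsub>?M\<^esub> (n::nat) = (\<lambda>i. x i ^ n)" for x n
    by (induction n) auto
  have "divisible_group ?M"
    unfolding divisible_group_def Mpow
  proof (intro ballI allI impI)
    fix q and n :: nat assume q: "q \<in> carrier ?M" and n: "0 < n"
    have "norm (q i) = 1" for i using q by (simp add: PiE_iff)
    then have "\<exists>x. norm x = 1 \<and> x ^ n = q i" for i using circle_root[OF _ n] by blast
    then have "\<exists>x. \<forall>i. norm (x i) = 1 \<and> x i ^ n = q i" by (intro choice allI)
    then obtain x where "\<forall>i. norm (x i) = 1 \<and> x i ^ n = q i" ..
    then show "\<exists>r\<in>carrier ?M. (\<lambda>i. r i ^ n) = q" by (intro bexI[of _ x]) auto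
  qed
  have "\<exists>f. f \<in> hom G circle_group \<and> (fst p \<noteq> snd p \<longrightarrow> f (fst p) \<noteq> f (snd p))" if p: "p \<in> E' \<times> E'" for p
  proof (cases "fst p = snd p")
    case True
    then show ?thesis by (intro exI[of _ "\<lambda>_. 1"]) (auto simp: hom_def)
  next
    case False
    have c: "fst p \<in> carrier G" "snd p \<in> carrier G" using p EG by auto
    have "fst p \<otimes> inv (snd p) \<noteq> \<one>" using inv_equality[of "fst p" "inv (snd p)"] c False by auto
    then obtain f where f: "f \<in> hom G circle_group" "f (fst p \<otimes> inv (snd p)) \<noteq> 1"
      using character_separates[of "fst p \<otimes> inv (snd p)"] c by blast
    then have "f (fst p) \<noteq> f (snd p)"
      using hom_circle(1,2,4)[OF f(1)] c circle_inverse_mult[of "f (snd p)"] by (auto simp: mult.commute)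
    with f(1) show ?thesis by blast
  qed
  then obtain ch where ch: "\<And>p. p \<in> E' \<times> E' \<Longrightarrow> ch p \<in> hom G circle_group"
    "\<And>x y. (x, y) \<in> E' \<times> E' \<Longrightarrow> x \<noteq> y \<Longrightarrow> ch (x, y) x \<noteq> ch (x, y) y"
    by (metis fst_conv snd_conv)
  define pr where "pr = from_nat_into (E' \<times> E')"
  have ne: "E' \<times> E' \<noteq> {}" using E'(3) by auto
  have prE: "pr i \<in> E' \<times> E'" for i unfolding pr_def using ne by (rule from_nat_into)
  have cntE: "countable (E' \<times> E')" using E'(2) by (intro countable_SIGMA) auto
  define \<Psi> where "\<Psi> x = (\<lambda>i. ch (pr i) x)" for x
  have \<Psi>: "\<Psi> \<in> hom G ?M"
    using hom_circle(1,2)[OF ch(1)[OF prE]] by (intro homI) (auto simp: \<Psi>_def)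
  have inj: "inj_on \<Psi> E'"
  proof (rule inj_onI)
    fix x y assume xy: "x \<in> E'" "y \<in> E'" "\<Psi> x = \<Psi> y"
    then obtain i where "pr i = (x, y)"
      unfolding pr_def using from_nat_into_surj[OF cntE, of "(x, y)"] by auto
    moreover have "ch (pr i) x = ch (pr i) y" using xy(3) unfolding \<Psi>_def by metis
    ultimately show "x = y" using ch(2)[of x y] xy by auto
  qed
  have \<Psi>c: "\<Psi> x \<in> carrier ?M" if "x \<in> carrier G" for x using \<Psi> that by (auto simp: hom_def)
  obtain Q where Q: "subgroup Q ?M" "countable Q" "\<Psi> ` E' \<subseteq> Q" "divisible_group (?M\<lparr>carrier := Q\<rparr>)"
  proof (rule M.countable_divisible_subgroup[OF \<open>divisible_group ?M\<close>, of "\<Psi> ` E'"])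
    show "\<Psi> ` E' \<subseteq> carrier ?M" using \<Psi>c EG by blast
    show "countable (\<Psi> ` E')" using E'(2) by simp
  qed
  let ?Q = "?M\<lparr>carrier := Q\<rparr>"
  have Qcg: "comm_group ?Q"
    by (rule group.group_comm_groupI[OF subgroup.subgroup_is_group[OF Q(1) Mgroup]]) (simp add: mult.commute)
  interpret Q: comm_group ?Q by (rule Qcg)
  interpret GQ: two_comm_groups G ?Q by unfold_locales
  interpret QS: subgroup Q ?M by (rule Q(1))
  interpret \<Psi>: group_hom G ?M \<Psi> using \<Psi> by unfold_locales
  let ?C = "generate G E'"
  interpret C: subgroup ?C G using EG by (rule generate_is_subgroup)
  have CQ: "\<Psi> c \<in> Q" if "c \<in> ?C" for c
    using that
  proof (induction rule: generate.induct)
    case one show ?case using \<Psi>.hom_one QS.one_closed by metis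
  next
    case (incl h) then show ?case using Q(3) by blast
  next
    case (inv h)
    then have "\<Psi> h \<in> Q" "h \<in> carrier G" using Q(3) EG by blast+
    then show ?case using \<Psi>.hom_inv[of h] QS.m_inv_closed by metis
  next
    case (eng h1 h2)
    then have "h1 \<in> carrier G" "h2 \<in> carrier G" using C.mem_carrier by blast+
    then show ?case using \<Psi>.hom_mult[of h1 h2] QS.m_closed eng by metis
  qed
  have Qinv: "inv\<^bsub>?Q\<^esub> x = inv\<^bsub>?M\<^esub> x" if "x \<in> Q" for x
    using M.m_inv_consistent[OF Q(1) that] .
  \<comment> \<open>\<open>\<Psi>\<close> need not map all of G into the countable group Q. Its
    restriction to the subgroup generated by \<open>E'\<close> does, and by divisibility of Q this
    restriction extends to a new homomorphism of G into Q, still injective on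
    \<open>E'\<close>.\<close>
  have "partial_hom G ?Q {(c, \<Psi> c) | c. c \<in> ?C}"
    unfolding partial_hom_def GQ.subgroup_DirProd_iff
  proof (intro conjI allI impI)
    show "{(c, \<Psi> c) | c. c \<in> ?C} \<subseteq> carrier G \<times> carrier ?Q" using CQ C.subset by auto
    have "\<Psi> \<one> = \<one>\<^bsub>?Q\<^esub>" using \<Psi>.hom_one by simp
    then show "(\<one>, \<one>\<^bsub>?Q\<^esub>) \<in> {(c, \<Psi> c) | c. c \<in> ?C}"
      using C.one_closed by (metis (mono_tags, lifting) mem_Collect_eq)
    show "(x \<otimes> y, q \<otimes>\<^bsub>?Q\<^esub> r) \<in> {(c, \<Psi> c) | c. c \<in> ?C}"
      if "(x, q) \<in> {(c, \<Psi> c) | c. c \<in> ?C}" "(y, r) \<in> {(c, \<Psi> c) | c. c \<in> ?C}" for x q y r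
    proof -
      have m: "x \<in> ?C" "y \<in> ?C" "q = \<Psi> x" "r = \<Psi> y" using that by auto
      then have "\<Psi> (x \<otimes> y) = q \<otimes>\<^bsub>?M\<^esub> r" using \<Psi>.hom_mult[of x y] C.mem_carrier by simp
      then have "q \<otimes>\<^bsub>?Q\<^esub> r = \<Psi> (x \<otimes> y)" by simp
      then show ?thesis using C.m_closed[OF m(1,2)] by blast
    qed
    show "(inv x, inv\<^bsub>?Q\<^esub> q) \<in> {(c, \<Psi> c) | c. c \<in> ?C}" if "(x, q) \<in> {(c, \<Psi> c) | c. c \<in> ?C}" for x q
    proof -
      have m: "x \<in> ?C" "q = \<Psi> x" using that by auto
      then have "inv\<^bsub>?Q\<^esub> q = \<Psi> (inv x)" using \<Psi>.hom_inv[of x] C.mem_carrier Qinv CQ by simp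
      then show ?thesis using C.m_inv_closed[OF m(1)] by blast
    qed
    show "q = \<one>\<^bsub>?Q\<^esub>" if "(\<one>, q) \<in> {(c, \<Psi> c) | c. c \<in> ?C}" for q
      using that \<open>\<Psi> \<one> = \<one>\<^bsub>?Q\<^esub>\<close> by blast
  qed
  note ph = this
  obtain \<Phi> where \<Phi>: "\<Phi> \<in> hom G ?Q" "\<And>x q. (x, q) \<in> {(c, \<Psi> c) | c. c \<in> ?C} \<Longrightarrow> \<Phi> x = q"
  proof (rule GQ.partial_hom_extend[OF ph Q(4)])
    fix f assume f: "f \<in> hom G ?Q" "\<And>x q. (x, q) \<in> {(c, \<Psi> c) | c. c \<in> ?C} \<Longrightarrow> f x = q"
    show thesis by (rule that[OF f])
  qed
  have "\<Phi> x = \<Psi> x" if "x \<in> E'" for x using \<Phi>(2)[of x "\<Psi> x"] that by (auto intro: generate.incl)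
  then have im: "\<Phi> ` E' = \<Psi> ` E'" by simp
  have "continuous_map (discrete_topology (carrier G)) (discrete_topology (carrier ?Q)) \<Phi>"
    using \<Phi>(1) by (auto simp: hom_def)
  from continuous_map_bohr[OF ATG abelian_topological_group_discrete[OF Qcg] \<Phi>(1) this]
  have "functionally_boundedin Q.discrete_bohr (\<Phi> ` E')"
    using functionally_boundedin_mono[OF fb E'(1)] by (rule functionally_boundedin_image)
  moreover have "infinite (\<Psi> ` E')" using E'(3) inj by (simp add: finite_image_iff)
  moreover have "countable (carrier ?Q)" using Q(2) by simp
  ultimately show False using Q.countable_imp_not_functionally_bounded Q(3) im by simp
qed

end


section \<open>Relations between compactness-like properties\<close>

lemma unbounded_sequence:
  assumes "\<not> bounded (f ` A)"
  obtains s :: "nat \<Rightarrow> 'a" where "\<And>n. s n \<in> A" "\<And>n. norm (f (s n) :: real) > real n"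
proof -
  have "\<exists>x. x \<in> A \<and> norm (f x) > real n" for n
  proof (rule ccontr)
    assume "\<not> ?thesis"
    then have "\<forall>y\<in>f ` A. norm y \<le> real n" by force
    then show False using assms unfolding bounded_iff by blast
  qed
  then have "\<exists>s. \<forall>n. s n \<in> A \<and> norm (f (s n)) > real n" by (intro choice allI)
  then show thesis using that by blast
qed

lemma compactin_imp_functionally_boundedin:
  assumes "compactin T A"
  shows "functionally_boundedin T A"
  unfolding functionally_boundedin_def
proof (intro conjI allI impI)
  show "A \<subseteq> topspace T" using assms by (rule compactin_subset_topspace)
  fix f assume "continuous_map T euclideanreal f"
  then have "compactin euclideanreal (f ` A)" using assms image_compactin by blast
  then show "bounded (f ` A)" by (simp add: compact_imp_bounded)
qed

lemma pseudocompactin_imp_functionally_boundedin: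
  assumes "pseudocompactin T A"
  shows "functionally_boundedin T A"
  using assms continuous_map_from_subtopology
  unfolding functionally_boundedin_def pseudocompactin_def by blast

lemma compactin_imp_pseudocompactin:
  assumes "compactin T A"
  shows "pseudocompactin T A"
proof -
  have "functionally_boundedin (subtopology T A) A"
    using assms by (intro compactin_imp_functionally_boundedin) simp
  then show ?thesis
    using compactin_subset_topspace[OF assms]
    unfolding functionally_boundedin_def pseudocompactin_def by blast
qed

lemma sequentially_compactin_imp_functionally_boundedin:
  assumes "sequentially_compactin T A"
  shows "functionally_boundedin T A"
  unfolding functionally_boundedin_def
proof (intro conjI allI impI)
  show "A \<subseteq> topspace T" using assms by (simp add: sequentially_compactin_def)
  fix f assume f: "continuous_map T euclideanreal f"
  show "bounded (f ` A)"
  proof (rule ccontr)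
    assume "\<not> bounded (f ` A)"
    then obtain s where s: "\<And>n. s n \<in> A" "\<And>n::nat. norm (f (s n)) > real n" using unbounded_sequence by blast
    then have "range s \<subseteq> A" by blast
    then obtain l and r :: "nat \<Rightarrow> nat" where l: "strict_mono r" "limitin T (s \<circ> r) l sequentially"
      using assms unfolding sequentially_compactin_def by blast
    have "limitin euclideanreal (f \<circ> (s \<circ> r)) (f l) sequentially"
      using f l(2) by (rule continuous_map_limit)
    then have "(f \<circ> (s \<circ> r)) \<longlonglongrightarrow> f l" by simp
    then have "Bseq (f \<circ> (s \<circ> r))" by (intro convergent_imp_Bseq convergentI)
    then obtain K where K: "\<And>n. norm (f (s (r n))) \<le> K" unfolding Bseq_def by auto
    obtain N :: nat where "K < N" using reals_Archimedean2 by blast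
    moreover have "real N \<le> real (r N)" using seq_suble[OF l(1)] by simp
    ultimately show False using K[of N] s(2)[of "r N"] by linarith
  qed
qed

text \<open>By the Hausdorff property a cluster point a has infinitely many of the chosen points in
  each neighbourhood. Where f stays within 1 of \<open>f a\<close>, only finitely many of them can
  lie, because \<open>f\<close> exceeds n in absolute value at the n-th one.\<close>

lemma countably_compactin_imp_functionally_boundedin:
  assumes "Hausdorff_space T" "countably_compactin T A"
  shows "functionally_boundedin T A"
  unfolding functionally_boundedin_def
proof (intro conjI allI impI)
  show "A \<subseteq> topspace T" using assms by (simp add: countably_compactin_def)
  fix f assume f: "continuous_map T euclideanreal f"
  show "bounded (f ` A)"
  proof (rule ccontr)
    assume "\<not> bounded (f ` A)"
    then obtain s where s: "\<And>n. s n \<in> A" "\<And>n::nat. norm (f (s n)) > real n" using unbounded_sequence by blast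
    have sub: "range s \<subseteq> A" using s by blast
    have "infinite (range s)"
    proof
      assume "finite (range s)"
      then have "bounded (f ` range s)" by (rule finite_imp_bounded[OF finite_imageI])
      then obtain b where "\<forall>y\<in>f ` range s. norm y \<le> b" unfolding bounded_iff ..
      then have b: "norm (f (s n)) \<le> b" for n by simp
      obtain N :: nat where "b < N" using reals_Archimedean2 by blast
      then show False using b[of N] s(2)[of N] by linarith
    qed
    moreover have "countable (range s)" by simp
    ultimately obtain a where a: "a \<in> T derived_set_of (range s)"
      using assms(2) sub unfolding countably_compactin_def by blast
    let ?U = "{x \<in> topspace T. f x \<in> ball (f a) 1}"
    have "openin T ?U" by (rule openin_continuous_map_preimage[OF f]) simp
    moreover have "a \<in> ?U" using a by (simp add: in_derived_set_of)
    moreover have "\<forall>U. a \<in> U \<and> openin T U \<longrightarrow> infinite (range s \<inter> U)"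
      using a derived_set_of_infinite_openin[OF assms(1), of "range s"] by simp
    ultimately have inf: "infinite (range s \<inter> ?U)" by (elim allE[of _ ?U] impE) (rule conjI)
    obtain N :: nat where N: "norm (f a) + 1 < N" using reals_Archimedean2 by blast
    have "range s \<inter> ?U \<subseteq> s ` {..<N}"
    proof
      fix x assume x: "x \<in> range s \<inter> ?U"
      then obtain n where n: "x = s n" by blast
      have "norm (f x) < norm (f a) + 1" using x by (auto simp: dist_norm)
      then have "real n < N" using s(2)[of n] N n by simp
      then show "x \<in> s ` {..<N}" using n by simp
    qed
    then show False using inf finite_subset by blast
  qed
qed

lemma compactin_imp_countably_compactin:
  assumes "compactin T A"
  shows "countably_compactin T A"
  using assms compactin_imp_Bolzano_Weierstrass compactin_subset_topspace
  unfolding countably_compactin_def by metis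

section \<open>Properties determined by the subspace topology\<close>

lemma compactin_cong_subtopology:
  assumes "topspace T = topspace T'" "subtopology T A = subtopology T' A"
  shows "compactin T A \<longleftrightarrow> compactin T' A"
  using assms by (simp add: compactin_subspace)

lemma countably_compactin_cong_subtopology:
  assumes "topspace T = topspace T'" "subtopology T A = subtopology T' A"
  shows "countably_compactin T A \<longleftrightarrow> countably_compactin T' A"
proof -
  have "A \<inter> (T derived_set_of B) = A \<inter> (T' derived_set_of B)" if "B \<subseteq> A" for B
    using derived_set_of_subtopology[of T A B] derived_set_of_subtopology[of T' A B] assms(2) that
    by (simp add: Int_absorb1)
  then show ?thesis using assms(1) unfolding countably_compactin_def by metis
qed

lemma pseudocompactin_cong_subtopology:
  assumes "topspace T = topspace T'" "subtopology T A = subtopology T' A"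
  shows "pseudocompactin T A \<longleftrightarrow> pseudocompactin T' A"
  using assms by (simp add: pseudocompactin_def)

lemma limitin_cong_subtopology:
  assumes "subtopology T A = subtopology T' A" "range s \<subseteq> A" "l \<in> A"
  shows "limitin T s l sequentially \<longleftrightarrow> limitin T' s l sequentially"
  using limitin_subtopology[of T A s l sequentially] limitin_subtopology[of T' A s l sequentially] assms
  by (simp add: range_subsetD)

lemma sequentially_compactin_cong_subtopology:
  assumes "topspace T = topspace T'" "subtopology T A = subtopology T' A"
  shows "sequentially_compactin T A \<longleftrightarrow> sequentially_compactin T' A"
proof -
  have "limitin T (s \<circ> r) l sequentially \<longleftrightarrow> limitin T' (s \<circ> r) l sequentially"
    if "range s \<subseteq> A" "l \<in> A" for s :: "nat \<Rightarrow> 'a" and r :: "nat \<Rightarrow> nat" and l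
    using that by (intro limitin_cong_subtopology[OF assms(2)]) auto
  then show ?thesis using assms(1) unfolding sequentially_compactin_def by (metis (no_types, opaque_lifting))
qed

text \<open>A continuous map from a compact space to a Hausdorff space is closed. Applied to the
  identity on K, this shows that the finer topology induces nothing new there.\<close>

lemma subtopology_eq_if_compactin:
  assumes top: "topspace T = topspace T'" and fine: "\<And>U. openin T' U \<Longrightarrow> openin T U"
    and "Hausdorff_space T'" and K: "compactin T K" and A: "A \<subseteq> K"
  shows "subtopology T A = subtopology T' A"
proof -
  have "continuous_map T T' (\<lambda>x. x)"
    unfolding continuous_map_def
  proof (intro conjI allI impI)
    fix U assume "openin T' U"
    moreover have "{x \<in> topspace T. x \<in> U} = U" using openin_subset[OF \<open>openin T' U\<close>] top by blast
    ultimately show "openin T {x \<in> topspace T. x \<in> U}" using fine by simp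
  qed (simp add: top)
  note id = this
  have "subtopology T K = subtopology T' K"
    unfolding topology_eq
  proof (intro allI iffI)
    fix U assume U: "openin (subtopology T K) U"
    then have UK: "U \<subseteq> K" by (metis openin_subset topspace_subtopology le_inf_iff)
    have "closedin (subtopology T K) (K - U)"
      using U openin_closedin_eq[of "subtopology T K" U] compactin_subset_topspace[OF K]
      by (simp add: inf.absorb2)
    then have "compactin (subtopology T K) (K - U)"
      using closed_compactin[of "subtopology T K" K "K - U"] K by simp
    then have "compactin T (K - U)" by (simp add: compactin_subtopology)
    then have "compactin T' ((\<lambda>x. x) ` (K - U))" using id by (rule image_compactin)
    then have "closedin T' (K - U)" using compactin_imp_closedin[OF assms(3)] by simp
    moreover have "U = K \<inter> (topspace T' - (K - U))"
      using UK compactin_subset_topspace[OF K] top by blast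
    ultimately show "openin (subtopology T' K) U"
      unfolding openin_subtopology by (metis Int_commute openin_diff openin_topspace)
  next
    fix U assume "openin (subtopology T' K) U"
    then show "openin (subtopology T K) U" using fine unfolding openin_subtopology by blast
  qed
  then have "subtopology (subtopology T K) A = subtopology (subtopology T' K) A" by simp
  then show ?thesis using A by (simp add: subtopology_subtopology inf.absorb2)
qed

text \<open>Isolates the compactness of closures: this property and maximal almost periodicity
  together imply that all five compactness-like notions are respected, as well as the Schur
  property.\<close>

locale fb_closure_compact =
  fixes G :: "('a, 'm) monoid_scheme" and T :: "'a topology"
  assumes MAP: "MAP_group G T"
    and closure: "\<And>E. functionally_boundedin (bohr_topology G T) E \<Longrightarrow> compactin T (T closure_of E)"
begin

abbreviation "T\<^sub>b \<equiv> bohr_topology G T"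

lemma ATG: "abelian_topological_group G T" using MAP by (simp add: MAP_group_def)

lemma top: "topspace T = topspace T\<^sub>b"
  using topspace_bohr[OF ATG] ATG abelian_topological_group.topspace_eq by metis

lemma Hausdorff_b: "Hausdorff_space T\<^sub>b" using MAP by (rule Hausdorff_bohr)

lemma Hausdorff: "Hausdorff_space T"
  using Hausdorff_b openin_bohr_imp_openin[OF ATG] top unfolding Hausdorff_space_def by metis

lemma sub_eq:
  assumes "functionally_boundedin T\<^sub>b E"
  shows "subtopology T E = subtopology T\<^sub>b E"
proof (rule subtopology_eq_if_compactin[OF top openin_bohr_imp_openin[OF ATG] Hausdorff_b closure[OF assms]])
  show "E \<subseteq> T closure_of E"
    using assms top by (intro closure_of_subset) (simp add: functionally_boundedin_def)
qed

lemma fb_iff: "functionally_boundedin T E \<longleftrightarrow> functionally_boundedin T\<^sub>b E"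
proof
  have "continuous_map T T\<^sub>b (\<lambda>x. x)"
    unfolding continuous_map_def
  proof (intro conjI allI impI)
    fix U assume U: "openin T\<^sub>b U"
    moreover have "{x \<in> topspace T. x \<in> U} = U" using openin_subset[OF U] top by blast
    ultimately show "openin T {x \<in> topspace T. x \<in> U}" using openin_bohr_imp_openin[OF ATG] by simp
  qed (simp add: top)
  moreover assume "functionally_boundedin T E"
  ultimately have "functionally_boundedin T\<^sub>b ((\<lambda>x. x) ` E)" by (rule functionally_boundedin_image)
  then show "functionally_boundedin T\<^sub>b E" by simp
next
  assume fb: "functionally_boundedin T\<^sub>b E"
  have "functionally_boundedin T (T closure_of E)"
    using closure[OF fb] by (rule compactin_imp_functionally_boundedin)
  moreover have "E \<subseteq> T closure_of E"
    using fb top by (intro closure_of_subset) (simp add: functionally_boundedin_def)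
  ultimately show "functionally_boundedin T E" by (rule functionally_boundedin_mono)
qed

text \<open>Both topologies have the same functionally bounded sets and induce the same topology on
  each of them. So any notion that implies functional boundedness and depends only on the subspace
  is respected.\<close>

lemma respects_if_functionally_bounded:
  assumes "\<And>A. P T A \<Longrightarrow> functionally_boundedin T A" "\<And>A. P T\<^sub>b A \<Longrightarrow> functionally_boundedin T\<^sub>b A"
    and "\<And>A. subtopology T A = subtopology T\<^sub>b A \<Longrightarrow> P T A \<longleftrightarrow> P T\<^sub>b A"
  shows "respects_property P G T"
  unfolding respects_property_def using MAP assms sub_eq fb_iff by metis

lemma respects_all:
  "respects_property compactin G T" "respects_property countably_compactin G T"
  "respects_property sequentially_compactin G T" "respects_property pseudocompactin G T"
  "respects_property functionally_boundedin G T"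
proof -
  show "respects_property compactin G T"
    using compactin_imp_functionally_boundedin compactin_imp_functionally_boundedin
      compactin_cong_subtopology[OF top]
    by (rule respects_if_functionally_bounded)
  show "respects_property countably_compactin G T"
    using countably_compactin_imp_functionally_boundedin[OF Hausdorff]
      countably_compactin_imp_functionally_boundedin[OF Hausdorff_b] countably_compactin_cong_subtopology[OF top]
    by (rule respects_if_functionally_bounded)
  show "respects_property sequentially_compactin G T"
    using sequentially_compactin_imp_functionally_boundedin
      sequentially_compactin_imp_functionally_boundedin sequentially_compactin_cong_subtopology[OF top]
    by (rule respects_if_functionally_bounded)
  show "respects_property pseudocompactin G T"
    using pseudocompactin_imp_functionally_boundedin
      pseudocompactin_imp_functionally_boundedin pseudocompactin_cong_subtopology[OF top]
    by (rule respects_if_functionally_bounded)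
  show "respects_property functionally_boundedin G T"
    unfolding respects_property_def using MAP fb_iff by blast
qed

lemma schur: "schur_property G T"
  unfolding schur_property_def
proof (intro conjI allI impI MAP)
  fix s :: "nat \<Rightarrow> 'a" assume s: "range s \<subseteq> carrier G"
  have sT: "range s \<subseteq> topspace T" using s topspace_bohr[OF ATG] top by simp
  have "limitin T s l sequentially \<longleftrightarrow> limitin T\<^sub>b s l sequentially" for l
  proof
    assume "limitin T s l sequentially"
    then show "limitin T\<^sub>b s l sequentially"
      using top openin_bohr_imp_openin[OF ATG] unfolding limitin_def by simp
  next
    assume l: "limitin T\<^sub>b s l sequentially"
    \<comment> \<open>Together with its limit, a convergent sequence is compact, hence functionally
      bounded, and on such a set both topologies agree.\<close>
    have "compactin T\<^sub>b (insert l (range s))"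
      using compactin_sequence_with_limit[OF l] sT top by simp
    from sub_eq[OF compactin_imp_functionally_boundedin[OF this]] l
    show "limitin T s l sequentially"
      using limitin_cong_subtopology[of T "insert l (range s)" T\<^sub>b s l] by auto
  qed
  then show "(\<exists>l. limitin T s l sequentially) \<longleftrightarrow> (\<exists>l. limitin T\<^sub>b s l sequentially)" by simp
qed

end


section \<open>Null sequences\<close>

context abelian_topological_group
begin

lemma r_coset_eq_iff:
  assumes "subgroup K G" "x \<in> carrier G" "y \<in> carrier G"
  shows "K #> x = K #> y \<longleftrightarrow> x \<otimes> inv y \<in> K"
proof
  interpret K: subgroup K G by fact
  assume "K #> x = K #> y"
  then have "x \<in> K #> y" using rcos_self[OF assms(2,1)] by simp
  then obtain k where k: "k \<in> K" "x = k \<otimes> y" by (auto simp: r_coset_def)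
  then show "x \<otimes> inv y \<in> K" using assms(3) by (simp add: m_assoc)
next
  interpret K: subgroup K G by fact
  assume k: "x \<otimes> inv y \<in> K"
  have "x = (x \<otimes> inv y) \<otimes> y" using assms by (simp add: m_assoc)
  then have "x \<in> K #> y" using k unfolding r_coset_def by blast
  then show "K #> x = K #> y" using repr_independence assms by metis
qed

lemma normal_if_subgroup: "subgroup K G \<Longrightarrow> K \<lhd> G"
  by (simp add: normal_iff_subgroup)

lemma coset_map:
  assumes K: "subgroup K G" "openin T K"
  shows "(\<lambda>x. K #> x) \<in> hom G (G Mod K)"
    and "continuous_map T (discrete_topology (carrier (G Mod K))) (\<lambda>x. K #> x)"
proof -
  show "(\<lambda>x. K #> x) \<in> hom G (G Mod K)"
    by (rule normal.r_coset_hom_Mod[OF normal_if_subgroup[OF K(1)]])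
  show "continuous_map T (discrete_topology (carrier (G Mod K))) (\<lambda>x. K #> x)"
  proof (rule continuous_map_locally)
    fix x assume "x \<in> topspace T"
    then have x: "x \<in> carrier G" by (simp add: topspace_eq)
    have "K #> y = K #> x" if "y \<in> (\<lambda>k. x \<otimes> k) ` K" for y
    proof -
      obtain k where k: "k \<in> K" "y = x \<otimes> k" using \<open>y \<in> _\<close> by blast
      have kG: "k \<in> carrier G" using k(1) subgroup.subset[OF K(1)] by blast
      then have "y \<otimes> inv x = k" using k x by (metis inv_closed m_comm inv_solve_right m_closed)
      then show ?thesis using r_coset_eq_iff[OF K(1), of y x] k x kG by simp
    qed
    moreover have "x \<in> (\<lambda>k. x \<otimes> k) ` K"
      using x subgroup.one_closed[OF K(1)] by (intro image_eqI[of _ _ \<one>]) auto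
    moreover have "openin T ((\<lambda>k. x \<otimes> k) ` K)" using K(2) x by (rule openin_translate)
    moreover have "continuous_map T (discrete_topology (carrier (G Mod K))) (\<lambda>y. K #> x)"
      using x by (simp add: carrier_FactGroup)
    ultimately show "\<exists>U g. openin T U \<and> x \<in> U \<and> continuous_map T (discrete_topology (carrier (G Mod K))) g \<and>
       (\<forall>y\<in>U. K #> y = g y)"
      by (intro exI[of _ "(\<lambda>k. x \<otimes> k) ` K"] exI[of _ "\<lambda>y. K #> x"]) blast
  qed
qed

lemma continuous_map_coset_bohr:
  assumes K: "subgroup K G" "openin T K"
  shows "continuous_map (bohr_topology G T)
     (bohr_topology (G Mod K) (discrete_topology (carrier (G Mod K)))) (\<lambda>x. K #> x)"
  using coset_map[OF K]
  by (intro continuous_map_bohr abelian_topological_group_axioms abelian_topological_group_discrete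
      abelian_FactGroup[OF K(1)])

text \<open>The quotient map is continuous for the Bohr topologies, and the quotient is discrete, so
  the image is a functionally bounded set in the Bohr topology of a discrete group.\<close>

lemma finite_cosets_if_functionally_bounded:
  assumes K: "subgroup K G" "openin T K" and E: "functionally_boundedin (bohr_topology G T) E"
  shows "finite ((\<lambda>x. K #> x) ` E)"
  using functionally_boundedin_image[OF continuous_map_coset_bohr[OF K] E]
  by (rule comm_group.functionally_bounded_discrete_bohr_imp_finite[OF abelian_FactGroup[OF K(1)]])

text \<open>If K is an open subgroup missing \<open>x \<otimes> inv y\<close>, then x and y differ
  in the discrete quotient by K, and any character of that quotient is continuous on G.\<close>

lemma MAP_if_small_open_subgroups:
  assumes "Hausdorff_space T"
    and small: "\<And>U. openin T U \<Longrightarrow> \<one> \<in> U \<Longrightarrow> \<exists>H. subgroup H G \<and> openin T H \<and> H \<subseteq> U"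
  shows "MAP_group G T"
  unfolding MAP_group_def
proof (intro conjI ballI impI abelian_topological_group_axioms)
  fix x y assume xy: "x \<in> carrier G" "y \<in> carrier G" "x \<noteq> y"
  have ne: "x \<otimes> inv y \<noteq> \<one>" using inv_equality[of x "inv y"] xy by auto
  obtain U where U: "openin T U" "\<one> \<in> U" "x \<otimes> inv y \<notin> U"
    using assms(1) xy ne unfolding Hausdorff_space_def disjnt_iff
    by (metis inv_closed m_closed one_closed topspace_eq)
  then obtain K where K: "subgroup K G" "openin T K" "K \<subseteq> U" using small by blast
  interpret D: comm_group "G Mod K" using K(1) by (rule abelian_FactGroup)
  let ?d = "K #> (x \<otimes> inv y)"
  have "?d \<noteq> \<one>\<^bsub>G Mod K\<^esub>"
  proof
    assume "?d = \<one>\<^bsub>G Mod K\<^esub>"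
    then have "?d = K" by simp
    then have "x \<otimes> inv y \<in> K" using rcos_self[OF _ K(1), of "x \<otimes> inv y"] xy by simp
    then show False using K(3) U(3) by blast
  qed
  moreover have "?d \<in> carrier (G Mod K)" using xy by (simp add: carrier_FactGroup)
  ultimately obtain f where f: "f \<in> hom (G Mod K) circle_group" "f ?d \<noteq> 1"
    using D.character_separates by blast
  let ?f = "f \<circ> (\<lambda>x. K #> x)"
  have hom: "?f \<in> hom G circle_group" using coset_map(1)[OF K(1,2)] f(1) by (rule Group.hom_compose)
  have "continuous_map (discrete_topology (carrier (G Mod K))) (top_of_set (sphere 0 1)) f"
    using f(1) by (auto simp: hom_def circle_group_def)
  from continuous_map_compose[OF coset_map(2)[OF K(1,2)] this] hom
  have "?f \<in> continuous_characters G T" by (simp add: continuous_characters_def)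
  moreover have "?f x \<noteq> ?f y"
  proof
    assume e: "?f x = ?f y"
    have "?f (x \<otimes> inv y) = ?f x * inverse (?f y)"
      using hom_circle(2,4)[OF hom] xy by simp
    also have "\<dots> = 1" unfolding e using circle_inverse_mult[OF hom_circle(1)[OF hom xy(2)]] by (simp add: mult.commute)
    finally show False using f(2) by simp
  qed
  ultimately show "\<exists>\<psi>\<in>continuous_characters G T. \<psi> x \<noteq> \<psi> y" by blast
qed

end


section \<open>Neighbourhoods and coordinates of the group of null sequences\<close>

locale null_sequences = X: abelian_topological_group X T
  for X :: "('a, 'm) monoid_scheme" and T :: "'a topology"
begin

abbreviation "F \<equiv> null_seq_group X T"
abbreviation "S \<equiv> null_seq_topology X T"

definition N :: "'a set \<Rightarrow> (nat \<Rightarrow> 'a) set" where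
  "N V = {y \<in> carrier F. range y \<subseteq> V}"

sublocale F: abelian_topological_group F S
  by (rule abelian_topological_group_null_seq) (rule X.abelian_topological_group_axioms)

lemma carrier_F: "x \<in> carrier F \<longleftrightarrow> (\<forall>n. x n \<in> carrier X) \<and> limitin T x \<one>\<^bsub>X\<^esub> sequentially"
  by (auto simp: null_seq_group_def)

lemma mult_F [simp]: "x \<otimes>\<^bsub>F\<^esub> y = (\<lambda>n. x n \<otimes>\<^bsub>X\<^esub> y n)"
  by (simp add: null_seq_group_def)

lemma one_F [simp]: "\<one>\<^bsub>F\<^esub> = (\<lambda>n. \<one>\<^bsub>X\<^esub>)"
  by (simp add: null_seq_group_def)

lemma carrier_F_coord: "x \<in> carrier F \<Longrightarrow> x n \<in> carrier X"
  by (simp add: carrier_F)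

lemma inv_F:
  assumes "x \<in> carrier F"
  shows "inv\<^bsub>F\<^esub> x = (\<lambda>n. inv\<^bsub>X\<^esub> (x n))"
proof
  fix n
  have "inv\<^bsub>F\<^esub> x \<otimes>\<^bsub>F\<^esub> x = \<one>\<^bsub>F\<^esub>" using assms by (rule F.l_inv)
  then have "(inv\<^bsub>F\<^esub> x) n \<otimes>\<^bsub>X\<^esub> x n = \<one>\<^bsub>X\<^esub>" by (simp only: mult_F one_F) (metis)
  moreover have "(inv\<^bsub>F\<^esub> x) n \<in> carrier X" "x n \<in> carrier X"
    using assms carrier_F_coord F.inv_closed by blast+
  ultimately show "(inv\<^bsub>F\<^esub> x) n = inv\<^bsub>X\<^esub> (x n)" by (metis X.inv_equality)
qed

lemma pow_F: "x [^]\<^bsub>F\<^esub> (k::nat) = (\<lambda>n. x n [^]\<^bsub>X\<^esub> k)"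
  by (induction k) auto

lemma carrier_F_eventually:
  assumes "x \<in> carrier F" "openin T V" "\<one>\<^bsub>X\<^esub> \<in> V"
  obtains n0 where "\<And>n. n \<ge> n0 \<Longrightarrow> x n \<in> V"
  using assms unfolding carrier_F limitin_sequentially by blast

lemma in_N: "y \<in> N V \<longleftrightarrow> y \<in> carrier F \<and> (\<forall>n. y n \<in> V)"
  by (auto simp: N_def)

lemma N_mono: "V \<subseteq> W \<Longrightarrow> N V \<subseteq> N W"
  unfolding N_def by blast

lemma one_in_N: "\<one>\<^bsub>X\<^esub> \<in> V \<Longrightarrow> \<one>\<^bsub>F\<^esub> \<in> N V"
  using F.one_closed unfolding N_def by auto

lemma nbhd_iff:
  "neighbourhood_of_one F S U \<longleftrightarrow> U \<subseteq> carrier F \<and> (\<exists>V. openin T V \<and> \<one>\<^bsub>X\<^esub> \<in> V \<and> N V \<subseteq> U)"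
proof
  assume "neighbourhood_of_one F S U"
  then obtain W where W: "U \<subseteq> carrier F" "openin S W" "\<one>\<^bsub>F\<^esub> \<in> W" "W \<subseteq> U"
    unfolding neighbourhood_of_one_def by blast
  then obtain V where V: "openin T V" "\<one>\<^bsub>X\<^esub> \<in> V" "\<one>\<^bsub>F\<^esub> <#\<^bsub>F\<^esub> N V \<subseteq> W"
    unfolding openin_null_seq_topology N_def by blast
  have "N V \<subseteq> carrier F" unfolding N_def by blast
  then have "\<one>\<^bsub>F\<^esub> <#\<^bsub>F\<^esub> N V = N V" by (rule F.lcos_mult_one)
  then have "N V \<subseteq> W" using V(3) by (simp only:)
  then show "U \<subseteq> carrier F \<and> (\<exists>V. openin T V \<and> \<one>\<^bsub>X\<^esub> \<in> V \<and> N V \<subseteq> U)" using V W by blast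
next
  assume "U \<subseteq> carrier F \<and> (\<exists>V. openin T V \<and> \<one>\<^bsub>X\<^esub> \<in> V \<and> N V \<subseteq> U)"
  then obtain V where V: "U \<subseteq> carrier F" "openin T V" "\<one>\<^bsub>X\<^esub> \<in> V" "N V \<subseteq> U" by blast
  \<comment> \<open>The interior of \<open>N V\<close>. Its openness is the usual consequence of
    having neighbourhoods \<open>V''\<close> with \<open>V'' V''\<close> inside
    \<open>V'\<close>.\<close>
  let ?W = "{w \<in> carrier F. \<exists>V'. openin T V' \<and> \<one>\<^bsub>X\<^esub> \<in> V' \<and> w <#\<^bsub>F\<^esub> N V' \<subseteq> N V}"
  have "openin S ?W"
    unfolding openin_null_seq_topology
  proof (intro conjI ballI)
    fix w assume "w \<in> ?W"
    then obtain V' where V': "w \<in> carrier F" "openin T V'" "\<one>\<^bsub>X\<^esub> \<in> V'" "w <#\<^bsub>F\<^esub> N V' \<subseteq> N V" by blast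
    obtain V'' where V'': "openin T V''" "\<one>\<^bsub>X\<^esub> \<in> V''" "\<And>a b. a \<in> V'' \<Longrightarrow> b \<in> V'' \<Longrightarrow> a \<otimes>\<^bsub>X\<^esub> b \<in> V'"
      using X.nbhd_sym_mult[OF V'(2,3)] by metis
    have "w <#\<^bsub>F\<^esub> N V'' \<subseteq> ?W"
    proof
      fix u assume "u \<in> w <#\<^bsub>F\<^esub> N V''"
      then obtain y where y: "y \<in> N V''" "u = w \<otimes>\<^bsub>F\<^esub> y" by (auto simp: l_coset_def)
      then have yF: "y \<in> carrier F" by (simp add: N_def)
      have "u <#\<^bsub>F\<^esub> N V'' \<subseteq> N V"
      proof
        fix v assume "v \<in> u <#\<^bsub>F\<^esub> N V''"
        then obtain z where z: "z \<in> N V''" "v = u \<otimes>\<^bsub>F\<^esub> z" by (auto simp: l_coset_def)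
        then have zF: "z \<in> carrier F" by (simp add: N_def)
        have "y \<otimes>\<^bsub>F\<^esub> z \<in> N V'"
          using F.m_closed[OF yF zF] y(1) z(1) V''(3) unfolding in_N mult_F by simp
        moreover have "v = w \<otimes>\<^bsub>F\<^esub> (y \<otimes>\<^bsub>F\<^esub> z)"
          unfolding z(2) y(2) by (rule F.m_assoc[OF V'(1) yF zF])
        ultimately show "v \<in> N V" using V'(4) unfolding l_coset_def by blast
      qed
      moreover have "u \<in> carrier F" unfolding y(2) by (rule F.m_closed[OF V'(1) yF])
      ultimately show "u \<in> ?W" using V'' by blast
    qed
    then show "\<exists>V. openin T V \<and> \<one>\<^bsub>X\<^esub> \<in> V \<and> w <#\<^bsub>F\<^esub> {y \<in> carrier F. range y \<subseteq> V} \<subseteq> ?W"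
      using V''(1,2) unfolding N_def by blast
  qed blast
  moreover have "N V \<subseteq> carrier F" unfolding N_def by blast
  then have "\<one>\<^bsub>F\<^esub> <#\<^bsub>F\<^esub> N V = N V" by (rule F.lcos_mult_one)
  then have "\<one>\<^bsub>F\<^esub> <#\<^bsub>F\<^esub> N V \<subseteq> N V" by (simp only: order_refl)
  then have "\<one>\<^bsub>F\<^esub> \<in> ?W" using V(2,3) F.one_closed by blast
  moreover have "?W \<subseteq> N V"
  proof
    fix w assume "w \<in> ?W"
    then obtain V' where V': "w \<in> carrier F" "openin T V'" "\<one>\<^bsub>X\<^esub> \<in> V'" "w <#\<^bsub>F\<^esub> N V' \<subseteq> N V" by blast
    have "w \<otimes>\<^bsub>F\<^esub> \<one>\<^bsub>F\<^esub> \<in> w <#\<^bsub>F\<^esub> N V'" using one_in_N[OF V'(3)] unfolding l_coset_def by blast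
    then show "w \<in> N V" unfolding F.r_one[OF V'(1)] by (rule subsetD[OF V'(4)])
  qed
  ultimately show "neighbourhood_of_one F S U"
    unfolding neighbourhood_of_one_def using V by blast
qed

lemma nbhd_N: "openin T V \<Longrightarrow> \<one>\<^bsub>X\<^esub> \<in> V \<Longrightarrow> neighbourhood_of_one F S (N V)"
  unfolding nbhd_iff N_def by blast

lemma openin_S_nbhd:
  assumes "openin S U" "x \<in> U"
  obtains V where "openin T V" "\<one>\<^bsub>X\<^esub> \<in> V" "\<And>y. y \<in> N V \<Longrightarrow> x \<otimes>\<^bsub>F\<^esub> y \<in> U"
proof -
  obtain V where V: "openin T V" "\<one>\<^bsub>X\<^esub> \<in> V" "x <#\<^bsub>F\<^esub> N V \<subseteq> U"
    using assms unfolding openin_null_seq_topology N_def by blast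
  then show thesis by (intro that[of V]) (auto simp: l_coset_def)
qed

lemma continuous_map_coord: "continuous_map S T (\<lambda>x. x n)"
  unfolding continuous_map_def
proof (intro conjI allI impI)
  show "(\<lambda>x. x n) \<in> topspace S \<rightarrow> topspace T"
    by (auto simp: F.topspace_eq X.topspace_eq carrier_F_coord)
  fix U assume U: "openin T U"
  show "openin S {x \<in> topspace S. x n \<in> U}"
    unfolding openin_null_seq_topology F.topspace_eq
  proof (intro conjI ballI)
    fix x assume x: "x \<in> {x \<in> carrier F. x n \<in> U}"
    then have xc: "x \<in> carrier F" "x n \<in> carrier X" using carrier_F_coord by blast+
    let ?V = "{v \<in> topspace T. x n \<otimes>\<^bsub>X\<^esub> v \<in> U}"
    have "openin T ?V"
      using openin_continuous_map_preimage[OF X.continuous_map_translation[OF xc(2)] U] .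
    moreover have "\<one>\<^bsub>X\<^esub> \<in> ?V" using x xc by (simp add: X.topspace_eq)
    moreover have "x <#\<^bsub>F\<^esub> {y \<in> carrier F. range y \<subseteq> ?V} \<subseteq> {x \<in> carrier F. x n \<in> U}"
    proof
      fix z assume "z \<in> x <#\<^bsub>F\<^esub> {y \<in> carrier F. range y \<subseteq> ?V}"
      then obtain y where y: "y \<in> carrier F" "range y \<subseteq> ?V" "z = x \<otimes>\<^bsub>F\<^esub> y" by (auto simp: l_coset_def)
      have "y n \<in> ?V" using y(2) by blast
      then show "z \<in> {x \<in> carrier F. x n \<in> U}" using F.m_closed[OF xc(1) y(1)] y(3) by simp
    qed
    ultimately show "\<exists>V. openin T V \<and> \<one>\<^bsub>X\<^esub> \<in> V \<and> x <#\<^bsub>F\<^esub> {y \<in> carrier F. range y \<subseteq> V} \<subseteq> {x \<in> carrier F. x n \<in> U}"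
      by blast
  qed blast
qed

lemma Hausdorff_F:
  assumes "Hausdorff_space T"
  shows "Hausdorff_space S"
  unfolding Hausdorff_space_def
proof (intro allI impI, elim conjE)
  fix x y assume xy: "x \<in> topspace S" "y \<in> topspace S" "x \<noteq> y"
  then obtain n where n: "x n \<noteq> y n" by blast
  have "x n \<in> topspace T" "y n \<in> topspace T"
    using xy by (simp_all add: F.topspace_eq X.topspace_eq carrier_F_coord)
  then obtain U V where UV: "openin T U" "openin T V" "x n \<in> U" "y n \<in> V" "disjnt U V"
    using assms n unfolding Hausdorff_space_def by metis
  show "\<exists>U V. openin S U \<and> openin S V \<and> x \<in> U \<and> y \<in> V \<and> disjnt U V"
  proof (intro exI conjI)
    show "openin S {x \<in> topspace S. x n \<in> U}" "openin S {x \<in> topspace S. x n \<in> V}"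
      by (rule openin_continuous_map_preimage[OF continuous_map_coord UV(1)])
        (rule openin_continuous_map_preimage[OF continuous_map_coord UV(2)])
    show "disjnt {x \<in> topspace S. x n \<in> U} {x \<in> topspace S. x n \<in> V}"
      using UV(5) unfolding disjnt_iff by simp
    show "x \<in> {x \<in> topspace S. x n \<in> U}" using xy(1) UV(3) by simp
    show "y \<in> {x \<in> topspace S. x n \<in> V}" using xy(2) UV(4) by simp
  qed
qed

lemma subgroup_N:
  assumes "subgroup H X"
  shows "subgroup (N H) F"
proof -
  interpret H: subgroup H X by fact
  have 1: "inv\<^bsub>F\<^esub> x \<in> N H" if "x \<in> N H" for x
  proof -
    have x: "x \<in> carrier F" "\<forall>n. x n \<in> H" using that unfolding in_N by blast+
    have "inv\<^bsub>X\<^esub> (x n) \<in> H" for n by (rule H.m_inv_closed[OF spec[OF x(2)]])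
    then have "\<forall>n. (inv\<^bsub>F\<^esub> x) n \<in> H" unfolding inv_F[OF x(1)] ..
    with F.inv_closed[OF x(1)] show ?thesis unfolding in_N ..
  qed
  have 2: "x \<otimes>\<^bsub>F\<^esub> y \<in> N H" if "x \<in> N H" "y \<in> N H" for x y
  proof -
    have x: "x \<in> carrier F \<and> (\<forall>n. x n \<in> H)" by (rule iffD1[OF in_N that(1)])
    have y: "y \<in> carrier F \<and> (\<forall>n. y n \<in> H)" by (rule iffD1[OF in_N that(2)])
    note xy = x[THEN conjunct1] x[THEN conjunct2] y[THEN conjunct1] y[THEN conjunct2]
    have "x n \<otimes>\<^bsub>X\<^esub> y n \<in> H" for n by (rule H.m_closed[OF spec[OF xy(2)] spec[OF xy(4)]])
    then have "\<forall>n. (x \<otimes>\<^bsub>F\<^esub> y) n \<in> H" unfolding mult_F ..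
    with F.m_closed[OF xy(1,3)] show ?thesis unfolding in_N ..
  qed
  have 3: "N H \<subseteq> carrier F" unfolding N_def by (rule Collect_subset)
  have "N H \<noteq> {}"
  proof
    assume "N H = {}"
    with one_in_N[OF H.one_closed] have "\<one>\<^bsub>F\<^esub> \<in> {}" by (simp only:)
    then show False by (rule emptyE)
  qed
  from F.subgroupI[OF 3 this 1 2] show ?thesis .
qed

lemma openin_N_subgroup:
  assumes "subgroup H X" "openin T H"
  shows "openin S (N H)"
proof -
  have "neighbourhood_of_one F S (N H)" using assms subgroup.one_closed nbhd_N by blast
  then obtain W where "openin S W" "\<one>\<^bsub>F\<^esub> \<in> W" "W \<subseteq> N H" unfolding neighbourhood_of_one_def by blast
  then show ?thesis using F.openin_subgroup_if_nbhd[OF subgroup_N[OF assms(1)]] by blast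
qed

end

locale LCA_null_sequences = null_sequences X T
  for X :: "('a, 'm) monoid_scheme" and T :: "'a topology" +
  assumes Hausdorff_X: "Hausdorff_space T" and locally_compact_X: "locally_compact_space T"

section \<open>Compact closures over a totally disconnected group\<close>

locale TD_null_sequences = LCA_null_sequences X T
  for X :: "('a, 'm) monoid_scheme" and T :: "'a topology" +
  assumes td: "totally_disconnected_space T"
begin

lemma small_open_subgroup_F:
  assumes "neighbourhood_of_one F S U"
  obtains K where "subgroup K F" "openin S K" "K \<subseteq> U"
proof -
  obtain V where V: "openin T V" "\<one>\<^bsub>X\<^esub> \<in> V" "N V \<subseteq> U" using assms unfolding nbhd_iff by blast
  obtain H where "subgroup H X" "openin T H" "H \<subseteq> V"
    using X.small_compact_open_subgroup[OF Hausdorff_X locally_compact_X td V(1,2)] by metis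
  then show thesis using that subgroup_N openin_N_subgroup N_mono V(3) by (meson order_trans)
qed

lemma MAP_F: "MAP_group F S"
proof (rule F.MAP_if_small_open_subgroups[OF Hausdorff_F[OF Hausdorff_X]])
  fix U assume U: "openin S U" "\<one>\<^bsub>F\<^esub> \<in> U"
  then have "neighbourhood_of_one F S U"
    unfolding neighbourhood_of_one_def using openin_subset F.topspace_eq by blast
  then show "\<exists>H. subgroup H F \<and> openin S H \<and> H \<subseteq> U" using small_open_subgroup_F by metis
qed

text \<open>A functionally bounded set of \<open>F\<^sup>+\<close> has finite image modulo each open subgroup. Hence its members
  tend to \<open>\<one>\<close> uniformly, and on such sets the topology of \<open>F\<close> is the topology of pointwise
  convergence.\<close>

lemma compactin_closure_of_functionally_bounded:
  assumes E: "functionally_boundedin (bohr_topology F S) E"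
  shows "compactin S (S closure_of E)"
proof -
  have EF: "E \<subseteq> carrier F"
    using E topspace_bohr[OF F.abelian_topological_group_axioms] by (simp add: functionally_boundedin_def)
  define \<W> where "\<W> = {W. subgroup W X \<and> openin T W \<and> compactin T W}"
  have small: "\<exists>W\<in>\<W>. W \<subseteq> V" if "openin T V" "\<one>\<^bsub>X\<^esub> \<in> V" for V
    using X.small_compact_open_subgroup[OF Hausdorff_X locally_compact_X td that] unfolding \<W>_def by blast
  have "\<exists>A. finite A \<and> A \<subseteq> carrier F \<and> (\<forall>y\<in>E. \<exists>x\<in>A. y \<otimes>\<^bsub>F\<^esub> inv\<^bsub>F\<^esub> x \<in> N W)" if W: "W \<in> \<W>" for W
  proof -
    have W': "subgroup W X" "openin T W" using W unfolding \<W>_def by auto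
    note NW = subgroup_N[OF W'(1)] openin_N_subgroup[OF W']
    have "finite ((\<lambda>x. N W #>\<^bsub>F\<^esub> x) ` E)" using NW E by (rule F.finite_cosets_if_functionally_bounded)
    from finite_subset_image[OF this order_refl]
    obtain A where A: "A \<subseteq> E" "finite A" "(\<lambda>x. N W #>\<^bsub>F\<^esub> x) ` E = (\<lambda>x. N W #>\<^bsub>F\<^esub> x) ` A" by blast
    have "\<exists>x\<in>A. y \<otimes>\<^bsub>F\<^esub> inv\<^bsub>F\<^esub> x \<in> N W" if y: "y \<in> E" for y
    proof -
      have "N W #>\<^bsub>F\<^esub> y \<in> (\<lambda>x. N W #>\<^bsub>F\<^esub> x) ` A" unfolding A(3)[symmetric] using y by blast
      then obtain x where x: "x \<in> A" "N W #>\<^bsub>F\<^esub> y = N W #>\<^bsub>F\<^esub> x" by blast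
      have c: "y \<in> carrier F" "x \<in> carrier F" using x(1) y A(1) EF by (auto dest: subsetD)
      show ?thesis using iffD1[OF F.r_coset_eq_iff[OF NW(1) c] x(2)] x(1) by (rule bexI)
    qed
    then have "\<forall>y\<in>E. \<exists>x\<in>A. y \<otimes>\<^bsub>F\<^esub> inv\<^bsub>F\<^esub> x \<in> N W" ..
    with A(2) subset_trans[OF A(1) EF] show ?thesis by (intro exI[of _ A] conjI)
  qed
  then have "\<forall>W\<in>\<W>. \<exists>A. finite A \<and> A \<subseteq> carrier F \<and> (\<forall>y\<in>E. \<exists>x\<in>A. y \<otimes>\<^bsub>F\<^esub> inv\<^bsub>F\<^esub> x \<in> N W)" ..
  from bchoice[OF this] obtain A where A': "\<forall>W\<in>\<W>. finite (A W) \<and> A W \<subseteq> carrier F \<and>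
    (\<forall>y\<in>E. \<exists>x\<in>A W. y \<otimes>\<^bsub>F\<^esub> inv\<^bsub>F\<^esub> x \<in> N W)" ..
  have A: "finite (A W)" "A W \<subseteq> carrier F" "y \<in> E \<Longrightarrow> \<exists>x\<in>A W. y \<otimes>\<^bsub>F\<^esub> inv\<^bsub>F\<^esub> x \<in> N W"
    if "W \<in> \<W>" for W y
    using bspec[OF A' that] by simp_all
  have "\<exists>n0. \<forall>x\<in>A W. \<forall>n\<ge>n0. x n \<in> W" if W: "W \<in> \<W>" for W
  proof -
    have "\<exists>n0. \<forall>n\<ge>n0. x n \<in> W" if "x \<in> A W" for x
    proof -
      have "x \<in> carrier F" using A(2)[OF W] that ..
      moreover have "openin T W" "\<one>\<^bsub>X\<^esub> \<in> W" using W subgroup.one_closed[of W X] unfolding \<W>_def by simp_all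
      ultimately obtain n0 where "\<And>n. n \<ge> n0 \<Longrightarrow> x n \<in> W" by (rule carrier_F_eventually) (rule that)
      then show ?thesis by (intro exI[of _ n0]) simp
    qed
    then have "\<forall>x\<in>A W. \<exists>n0. \<forall>n\<ge>n0. x n \<in> W" ..
    from bchoice[OF this] obtain g where g: "\<forall>x\<in>A W. \<forall>n\<ge>g x. x n \<in> W" ..
    have "x n \<in> W" if x: "x \<in> A W" and n: "n \<ge> Max (insert 0 (g ` A W))" for x n
    proof -
      have "g x \<le> Max (insert 0 (g ` A W))" using x A(1)[OF W] by (intro Max_ge) auto
      then show ?thesis using g x n by auto
    qed
    then show ?thesis by blast
  qed
  then have "\<forall>W\<in>\<W>. \<exists>n0. \<forall>x\<in>A W. \<forall>n\<ge>n0. x n \<in> W" ..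
  from bchoice[OF this] obtain M where M': "\<forall>W\<in>\<W>. \<forall>x\<in>A W. \<forall>n\<ge>M W. x n \<in> W" ..
  have M: "x n \<in> W" if "W \<in> \<W>" "x \<in> A W" "n \<ge> M W" for W x n using M' that by simp
  obtain V where V: "V \<in> \<W>" using small[of "topspace T"] X.topspace_eq by auto
  \<comment> \<open>For one fixed compact open subgroup V, the n-th coordinates of members of E lie
    in finitely many cosets of V, which form a compact set. This bounds each coordinate by
    itself.\<close>
  define C where "C n = (\<Union>x\<in>A V. (\<lambda>v. x n \<otimes>\<^bsub>X\<^esub> v) ` V)" for n
  have comp: "compactin T W" and sub: "subgroup W X" and op: "openin T W" if "W \<in> \<W>" for W
    using that unfolding \<W>_def by auto
  have "compactin T (C n)" for n
    unfolding C_def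
  proof (rule compactin_Union)
    show "finite ((\<lambda>x. (\<lambda>v. x n \<otimes>\<^bsub>X\<^esub> v) ` V) ` A V)" using A(1)[OF V] by simp
    fix B assume "B \<in> (\<lambda>x. (\<lambda>v. x n \<otimes>\<^bsub>X\<^esub> v) ` V) ` A V"
    then obtain x where x: "x \<in> A V" "B = (\<lambda>v. x n \<otimes>\<^bsub>X\<^esub> v) ` V" by blast
    have "x n \<in> carrier X" using x A(2)[OF V] carrier_F_coord by blast
    then show "compactin T B" unfolding x(2)
      using comp[OF V] X.continuous_map_translation by (intro image_compactin)
  qed
  note compC = this
  \<comment> \<open>The second condition expresses uniform convergence to \<open>\<one>\<close>: the
    finitely many representatives in \<open>A W\<close> are in W from the common index
    \<open>M W\<close> on, hence so is every member of E. It makes P consist of null sequences and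
    is closed under pointwise limits.\<close>
  define P where "P = {y. (\<forall>n. y n \<in> C n) \<and> (\<forall>W\<in>\<W>. \<forall>n\<ge>M W. y n \<in> W)}"
  let ?\<Pi> = "product_topology (\<lambda>_::nat. T) UNIV"
  have CX: "C n \<subseteq> carrier X" for n using compactin_subset_topspace[OF compC] X.topspace_eq by simp
  have PF: "P \<subseteq> carrier F"
  proof
    fix y assume y: "y \<in> P"
    have "\<exists>n0. \<forall>n\<ge>n0. y n \<in> U" if "openin T U" "\<one>\<^bsub>X\<^esub> \<in> U" for U
      using small[OF that] y unfolding P_def by blast
    then have "limitin T y \<one>\<^bsub>X\<^esub> sequentially" unfolding limitin_sequentially by (simp add: X.topspace_eq)
    moreover have "y n \<in> carrier X" for n using y CX unfolding P_def by blast
    ultimately show "y \<in> carrier F" by (simp add: carrier_F)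
  qed
  have "E \<subseteq> P"
  proof
    fix y assume y: "y \<in> E"
    have yF: "y n \<in> carrier X" for n using y EF carrier_F_coord by blast
    have quot: "\<exists>x\<in>A W. \<exists>w. y n = x n \<otimes>\<^bsub>X\<^esub> w \<and> w \<in> W" if W: "W \<in> \<W>" for W n
    proof -
      obtain x where x: "x \<in> A W" "y \<otimes>\<^bsub>F\<^esub> inv\<^bsub>F\<^esub> x \<in> N W" using A(3)[OF W y] by blast
      have xF: "x \<in> carrier F" "x n \<in> carrier X" using x A(2)[OF W] carrier_F_coord by blast+
      have "y n \<otimes>\<^bsub>X\<^esub> inv\<^bsub>X\<^esub> (x n) \<in> W" using x(2) inv_F[OF xF(1)] unfolding in_N by simp
      moreover have "y n = x n \<otimes>\<^bsub>X\<^esub> (y n \<otimes>\<^bsub>X\<^esub> inv\<^bsub>X\<^esub> (x n))"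
        using xF(2) yF[of n] X.m_comm[of "x n" "y n \<otimes>\<^bsub>X\<^esub> inv\<^bsub>X\<^esub> (x n)"] by (simp add: X.m_assoc)
      ultimately show ?thesis using x(1) by blast
    qed
    have "y n \<in> C n" for n using quot[OF V, of n] unfolding C_def by blast
    moreover have "y n \<in> W" if W: "W \<in> \<W>" "n \<ge> M W" for W n
      using quot[OF W(1), of n] M[OF W(1) _ W(2)] subgroup.m_closed[OF sub[OF W(1)]] by metis
    ultimately show "y \<in> P" unfolding P_def by blast
  qed
  have "compactin ?\<Pi> (\<Pi>\<^sub>E n\<in>UNIV. C n)" using compC by (simp add: compactin_PiE)
  moreover have "closedin ?\<Pi> P"
  proof -
    let ?I = "{(n, C n) | n. True} \<union> {(n, W) | n W. W \<in> \<W> \<and> n \<ge> M W}"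
    have closed: "closedin T D" if "(n, D) \<in> ?I" for n D
      using that compC comp compactin_imp_closedin[OF Hausdorff_X] by auto
    have "closedin ?\<Pi> (\<Inter>p\<in>?I. {y \<in> topspace ?\<Pi>. y (fst p) \<in> snd p})"
    proof (rule closedin_INT)
      show "?I \<noteq> {}" by blast
      fix p assume p: "p \<in> ?I"
      have "continuous_map ?\<Pi> T (\<lambda>y. y (fst p))" by (rule continuous_map_product_projection) simp
      then show "closedin ?\<Pi> {y \<in> topspace ?\<Pi>. y (fst p) \<in> snd p}"
        using closed[of "fst p" "snd p"] p by (intro closedin_continuous_map_preimage) simp_all
    qed
    moreover have "(\<Inter>p\<in>?I. {y \<in> topspace ?\<Pi>. y (fst p) \<in> snd p}) = P" (is "?L = P")
    proof
      show "?L \<subseteq> P"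
      proof
        fix y assume y: "y \<in> ?L"
        have "y n \<in> C n" for n
        proof -
          have "(n, C n) \<in> ?I" by blast
          from INT_D[OF y this] show ?thesis by simp
        qed
        moreover have "y n \<in> W" if "W \<in> \<W>" "n \<ge> M W" for W n
        proof -
          have "(n, W) \<in> ?I" using that by blast
          from INT_D[OF y this] show ?thesis by simp
        qed
        ultimately show "y \<in> P" unfolding P_def by blast
      qed
      have "P \<subseteq> topspace ?\<Pi>" using CX unfolding P_def by (fastforce simp: X.topspace_eq PiE_iff)
      then show "P \<subseteq> ?L" unfolding P_def by auto
    qed
    ultimately show ?thesis by simp
  qed
  moreover have "P \<subseteq> (\<Pi>\<^sub>E n\<in>UNIV. C n)" unfolding P_def by auto
  ultimately have compP: "compactin ?\<Pi> P" using closed_compactin by blast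
  have "continuous_map (subtopology ?\<Pi> P) S (\<lambda>y. y)"
    unfolding continuous_map_def
  proof (intro conjI allI impI)
    show "(\<lambda>y. y) \<in> topspace (subtopology ?\<Pi> P) \<rightarrow> topspace S"
      using PF by (auto simp: F.topspace_eq)
    fix U assume U: "openin S U"
    have tP: "topspace (subtopology ?\<Pi> P) = P" using compactin_subset_topspace[OF compP] by auto
    show "openin (subtopology ?\<Pi> P) {y \<in> topspace (subtopology ?\<Pi> P). y \<in> U}"
      unfolding tP
    proof (subst openin_subopen, intro ballI)
      fix y assume y: "y \<in> {y \<in> P. y \<in> U}"
      then have yF: "y \<in> carrier F" "\<And>n. y n \<in> carrier X" using PF carrier_F_coord by blast+
      obtain V0 where V0: "openin T V0" "\<one>\<^bsub>X\<^esub> \<in> V0" "\<And>z. z \<in> N V0 \<Longrightarrow> y \<otimes>\<^bsub>F\<^esub> z \<in> U"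
        using openin_S_nbhd[OF U, of y] y by blast
      obtain W where W: "W \<in> \<W>" "W \<subseteq> V0" using small[OF V0(1,2)] by blast
      interpret W: subgroup W X by (rule sub[OF W(1)])
      \<comment> \<open>Only the coordinates below \<open>M W\<close> have to be restricted: from
        \<open>M W\<close> on, both y and z take values in the subgroup W because they belong to
        P.\<close>
      let ?O = "{z \<in> topspace ?\<Pi>. \<forall>n\<in>{..<M W}. z n \<in> (\<lambda>w. y n \<otimes>\<^bsub>X\<^esub> w) ` W}"
      have "openin ?\<Pi> {z \<in> topspace ?\<Pi>. z n \<in> (\<lambda>w. y n \<otimes>\<^bsub>X\<^esub> w) ` W}" for n
        by (rule openin_continuous_map_preimage[OF continuous_map_product_projection])
          (use X.openin_translate[OF op[OF W(1)] yF(2)] in simp_all)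
      then have "openin ?\<Pi> ((\<Inter>n\<in>{..<M W}. {z \<in> topspace ?\<Pi>. z n \<in> (\<lambda>w. y n \<otimes>\<^bsub>X\<^esub> w) ` W}) \<inter> topspace ?\<Pi>)"
        by (intro openin_INT) auto
      moreover have "(\<Inter>n\<in>{..<M W}. {z \<in> topspace ?\<Pi>. z n \<in> (\<lambda>w. y n \<otimes>\<^bsub>X\<^esub> w) ` W}) \<inter> topspace ?\<Pi> = ?O" by blast
      ultimately have "openin ?\<Pi> ?O" by simp
      then have "openin (subtopology ?\<Pi> P) (P \<inter> ?O)" by (simp add: openin_subtopology_Int2)
      moreover have "y n \<in> (\<lambda>w. y n \<otimes>\<^bsub>X\<^esub> w) ` W" for n
        using yF(2) W.one_closed by (intro image_eqI[of _ _ "\<one>\<^bsub>X\<^esub>"]) auto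
      then have "y \<in> P \<inter> ?O" using y compactin_subset_topspace[OF compP] by blast
      moreover have "P \<inter> ?O \<subseteq> {y \<in> P. y \<in> U}"
      proof
        fix z assume z: "z \<in> P \<inter> ?O"
        then have zF: "z \<in> carrier F" "\<And>n. z n \<in> carrier X" using PF carrier_F_coord by blast+
        have mem: "inv\<^bsub>X\<^esub> (y n) \<otimes>\<^bsub>X\<^esub> z n \<in> W" for n
        proof (cases "n < M W")
          case True
          then obtain w where w: "w \<in> W" "z n = y n \<otimes>\<^bsub>X\<^esub> w" using z by blast
          then show ?thesis using yF(2)[of n] by (simp add: X.m_assoc[symmetric])
        next
          case False
          then have "z n \<in> W" "y n \<in> W" using z y W(1) unfolding P_def by auto
          then show ?thesis by simp
        qed
        have "inv\<^bsub>F\<^esub> y \<otimes>\<^bsub>F\<^esub> z \<in> N V0"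
          unfolding in_N
        proof (intro conjI allI)
          show "inv\<^bsub>F\<^esub> y \<otimes>\<^bsub>F\<^esub> z \<in> carrier F" by (rule F.m_closed[OF F.inv_closed[OF yF(1)] zF(1)])
          show "(inv\<^bsub>F\<^esub> y \<otimes>\<^bsub>F\<^esub> z) n \<in> V0" for n
            unfolding mult_F inv_F[OF yF(1)] using subsetD[OF W(2) mem] .
        qed
        then have "y \<otimes>\<^bsub>F\<^esub> (inv\<^bsub>F\<^esub> y \<otimes>\<^bsub>F\<^esub> z) \<in> U" by (rule V0(3))
        moreover have "y \<otimes>\<^bsub>F\<^esub> (inv\<^bsub>F\<^esub> y \<otimes>\<^bsub>F\<^esub> z) = z"
          using F.m_assoc[OF yF(1) F.inv_closed[OF yF(1)] zF(1)] F.r_inv[OF yF(1)] F.l_one[OF zF(1)] by metis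
        ultimately show "z \<in> {y \<in> P. y \<in> U}" using z by auto
      qed
      ultimately show "\<exists>O'. openin (subtopology ?\<Pi> P) O' \<and> y \<in> O' \<and> O' \<subseteq> {y \<in> P. y \<in> U}" by blast
    qed
  qed
  moreover have "compactin (subtopology ?\<Pi> P) P" using compP by simp
  ultimately have "compactin S ((\<lambda>y. y) ` P)" by (rule image_compactin[rotated])
  then have cP: "compactin S P" by simp
  moreover have "S closure_of E \<subseteq> P"
    using \<open>E \<subseteq> P\<close> compactin_imp_closedin[OF Hausdorff_F[OF Hausdorff_X] cP] by (rule closure_of_minimal)
  ultimately show ?thesis using closed_compactin closedin_closure_of by blast
qed

sublocale fb_closure_compact F S
  by unfold_locales (rule MAP_F, rule compactin_closure_of_functionally_bounded)

end


section \<open>Null sequences in totally disconnected groups\<close>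

lemma group_additive: "group (additive_group (UNIV :: 'e::real_vector set))"
  by (rule groupI) (auto simp: additive_group_def add.assoc intro: exI[of _ "- _"] left_minus)

lemma subgroup_additiveI:
  assumes "0 \<in> K" "\<And>x y. x \<in> K \<Longrightarrow> y \<in> K \<Longrightarrow> x + y \<in> K" "\<And>x. x \<in> K \<Longrightarrow> - x \<in> K"
  shows "subgroup K (additive_group (UNIV :: 'e::real_vector set))"
proof (rule group.subgroupI[OF group_additive])
  have "inv\<^bsub>additive_group UNIV\<^esub> x = - x" for x :: 'e
    by (rule group.inv_equality[OF group_additive]) (simp_all add: additive_group_def)
  then show "inv\<^bsub>additive_group UNIV\<^esub> a \<in> K" if "a \<in> K" for a using assms(3)[OF that] by simp
qed (use assms in \<open>auto simp: additive_group_def\<close>)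

lemma (in comm_group) comm_group_subgroup:
  assumes "subgroup H G"
  shows "comm_group (G\<lparr>carrier := H\<rparr>)"
proof (rule group.group_comm_groupI[OF subgroup.subgroup_is_group[OF assms is_group]])
  fix x y assume "x \<in> carrier (G\<lparr>carrier := H\<rparr>)" "y \<in> carrier (G\<lparr>carrier := H\<rparr>)"
  then show "x \<otimes>\<^bsub>G\<lparr>carrier := H\<rparr>\<^esub> y = y \<otimes>\<^bsub>G\<lparr>carrier := H\<rparr>\<^esub> x"
    using subgroup.subset[OF assms] by (simp add: m_comm subset_iff)
qed

text \<open>Presents an arbitrary subgroup as a quotient of a free abelian group. The latter sits in
  a real vector space as its integer points, as nuclearity demands.\<close>

lemma (in comm_group) free_Abelian_group_retraction:
  assumes "subgroup H G"
  shows "\<exists>h\<in>hom (free_Abelian_group H) (G\<lparr>carrier := H\<rparr>). \<forall>x\<in>H. h (frag_of x) = x"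
proof -
  have "(\<lambda>x. x) ` H \<subseteq> carrier (G\<lparr>carrier := H\<rparr>)" by simp
  note univ = comm_group.free_Abelian_group_universal[where f = "\<lambda>x. x" and S = H, OF comm_group_subgroup[OF assms] this]
  show ?thesis
  proof (rule univ)
    fix h assume h: "h \<in> hom (free_Abelian_group H) (G\<lparr>carrier := H\<rparr>)" and id: "\<And>x. x \<in> H \<Longrightarrow> h (frag_of x) = x"
    show ?thesis by (rule bexI[OF ballI h]) (rule id)
  qed
qed

context TD_null_sequences
begin

text \<open>An open subgroup inside U is contained in \<open>(1/n)U\<close> for all n, so each
  finite set can be taken to be \<open>{\<one>}\<close>.\<close>

lemma schwartz_F: "schwartz_group F S"
  unfolding schwartz_group_def
proof (intro conjI allI impI F.abelian_topological_group_axioms Hausdorff_F Hausdorff_X)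
  fix U assume "neighbourhood_of_one F S U"
  then obtain K where K: "subgroup K F" "openin S K" "K \<subseteq> U" by (rule small_open_subgroup_F)
  interpret K: subgroup K F by (rule K(1))
  have pow: "x [^]\<^bsub>F\<^esub> (k::nat) \<in> K" if "x \<in> K" for x k
  proof (induction k)
    case 0
    show ?case unfolding nat_pow_0 by (rule K.one_closed)
  next
    case (Suc k)
    show ?case unfolding nat_pow_Suc by (rule K.m_closed[OF Suc.IH that])
  qed
  have "K \<subseteq> group_fraction F n U <#>\<^bsub>F\<^esub> {\<one>\<^bsub>F\<^esub>}" for n
  proof
    fix x assume x: "x \<in> K"
    have "x \<in> carrier F" using K.subset x by (rule subsetD)
    moreover have "x \<in> group_fraction F n U"
      unfolding group_fraction_def using \<open>x \<in> carrier F\<close> subsetD[OF K(3) pow[OF x]] by simp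
    ultimately show "x \<in> group_fraction F n U <#>\<^bsub>F\<^esub> {\<one>\<^bsub>F\<^esub>}"
      unfolding set_mult_def using F.r_one[of x] by (metis (no_types, lifting) UN_iff singletonI)
  qed
  then have sub: "K \<subseteq> (\<Inter>n\<in>{1..}. group_fraction F n U <#>\<^bsub>F\<^esub> {\<one>\<^bsub>F\<^esub>})" by blast
  have "group_fraction F 1 U <#>\<^bsub>F\<^esub> {\<one>\<^bsub>F\<^esub>} \<subseteq> carrier F"
    by (rule F.set_mult_closed) (auto simp: group_fraction_def simp del: one_F)
  then have "(\<Inter>n\<in>{1..}. group_fraction F n U <#>\<^bsub>F\<^esub> {\<one>\<^bsub>F\<^esub>}) \<subseteq> carrier F" by (intro INF_lower2[of 1]) auto
  then have "neighbourhood_of_one F S (\<Inter>n\<in>{1..}. group_fraction F n U <#>\<^bsub>F\<^esub> {\<one>\<^bsub>F\<^esub>})"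
    unfolding neighbourhood_of_one_def using K(2) K.one_closed sub by blast
  moreover have "{\<one>\<^bsub>F\<^esub>} \<subseteq> carrier F" using F.one_closed by (rule insert_subsetI) (rule empty_subsetI)
  then have "\<forall>n\<ge>1. finite {\<one>\<^bsub>F\<^esub>} \<and> {\<one>\<^bsub>F\<^esub>} \<subseteq> carrier F" by blast
  ultimately have "(\<forall>n\<ge>1. finite {\<one>\<^bsub>F\<^esub>} \<and> {\<one>\<^bsub>F\<^esub>} \<subseteq> carrier F) \<and>
      neighbourhood_of_one F S (\<Inter>n\<in>{1..}. group_fraction F n U <#>\<^bsub>F\<^esub> {\<one>\<^bsub>F\<^esub>})" by (rule conjI[rotated])
  then show "\<exists>A :: nat \<Rightarrow> (nat \<Rightarrow> 'a) set. (\<forall>n\<ge>1. finite (A n) \<and> A n \<subseteq> carrier F) \<and>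
      neighbourhood_of_one F S (\<Inter>n\<in>{1..}. group_fraction F n U <#>\<^bsub>F\<^esub> A n)"
    by (rule exI[where x = "\<lambda>_. {\<one>\<^bsub>F\<^esub>}"])
qed

text \<open>With A and B equal to the whole vector space every positive t is admissible with
  \<open>L = {0}\<close>, so the diameter bounds hold for all c and m. What remains is to find K and
  \<open>\<phi>\<close> whose image is an open subgroup H inside U; integer points mapping onto H do
  this.\<close>

lemma nuclear_F: "nuclear_group TYPE(((nat \<Rightarrow> 'a) \<times> nat, real) poly_mapping) F S"
  unfolding nuclear_group_def
proof (intro conjI allI impI F.abelian_topological_group_axioms Hausdorff_F Hausdorff_X; elim conjE)
  fix U and c :: real and m :: nat
  assume U: "neighbourhood_of_one F S U" and c: "c > 0"
  obtain H where H: "subgroup H F" "openin S H" "H \<subseteq> U" using U by (rule small_open_subgroup_F)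
  let ?FH = "F\<lparr>carrier := H\<rparr>"
  have HF: "H \<subseteq> carrier F" using H(1) by (rule subgroup.subset)
  obtain h where h: "h \<in> hom (free_Abelian_group H) ?FH" "\<forall>x\<in>H. h (frag_of x) = x"
    using F.free_Abelian_group_retraction[OF H(1)] by (rule bexE)
  define K where "K = {p :: ((nat \<Rightarrow> 'a) \<times> nat, real) poly_mapping.
    \<forall>k. Poly_Mapping.lookup p k \<in> \<int> \<and> (Poly_Mapping.lookup p k \<noteq> 0 \<longrightarrow> fst k \<in> H)}"
  \<comment> \<open>Reads off the integer coefficients at second index 0; the other indices only pad
    the type. The floor converts the real coefficients, which are integers on K, and is additive
    there.\<close>
  define \<iota> where "\<iota> p = Abs_poly_mapping (\<lambda>x. \<lfloor>Poly_Mapping.lookup p (x, 0)\<rfloor>)"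
    for p :: "((nat \<Rightarrow> 'a) \<times> nat, real) poly_mapping"
  have \<iota>: "Poly_Mapping.lookup (\<iota> p) x = \<lfloor>Poly_Mapping.lookup p (x, 0)\<rfloor>" for p x
  proof -
    have "{x. \<lfloor>Poly_Mapping.lookup p (x, 0)\<rfloor> \<noteq> 0} \<subseteq> fst ` Poly_Mapping.keys p"
    proof
      fix x assume "x \<in> {x. \<lfloor>Poly_Mapping.lookup p (x, 0)\<rfloor> \<noteq> 0}"
      then have "(x, 0) \<in> Poly_Mapping.keys p" by (intro in_keys_iff[THEN iffD2] notI) simp
      then show "x \<in> fst ` Poly_Mapping.keys p" by (rule image_eqI[rotated]) simp
    qed
    then have "finite {x. \<lfloor>Poly_Mapping.lookup p (x, 0)\<rfloor> \<noteq> 0}" by (rule finite_subset) simp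
    then show ?thesis unfolding \<iota>_def by (simp add: lookup_Abs_poly_mapping)
  qed
  have "\<iota> \<in> hom (additive_group K) (free_Abelian_group H)"
  proof (rule homI)
    fix p assume "p \<in> carrier (additive_group K)"
    then have "p \<in> K" by (simp add: additive_group_def)
    then show "\<iota> p \<in> carrier (free_Abelian_group H)" proof -
      assume p: "p \<in> K"
      have "x \<in> H" if "x \<in> Poly_Mapping.keys (\<iota> p)" for x
      proof -
        have "Poly_Mapping.lookup (\<iota> p) x \<noteq> 0" using that by (simp add: in_keys_iff)
        then have "Poly_Mapping.lookup p (x, 0) \<noteq> 0" unfolding \<iota> by (intro notI) simp
        then show "x \<in> H" using p unfolding K_def by fastforce
      qed
      then show ?thesis by auto
    qed
  next
    fix p q assume "p \<in> carrier (additive_group K)" "q \<in> carrier (additive_group K)"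
    then have "p \<in> K" by (simp add: additive_group_def)
    then have "\<lfloor>Poly_Mapping.lookup p (x, 0) + Poly_Mapping.lookup q (x, 0)\<rfloor> =
        \<lfloor>Poly_Mapping.lookup p (x, 0)\<rfloor> + \<lfloor>Poly_Mapping.lookup q (x, 0)\<rfloor>" for x
      unfolding K_def by (auto elim!: Ints_cases)
    then have "\<iota> (p + q) = \<iota> p + \<iota> q" by (intro poly_mapping_eqI) (simp add: \<iota> lookup_add)
    then show "\<iota> (p \<otimes>\<^bsub>additive_group K\<^esub> q) = \<iota> p \<otimes>\<^bsub>free_Abelian_group H\<^esub> \<iota> q"
      by (simp add: additive_group_def)
  qed
  from Group.hom_compose[OF this h(1)] have \<phi>H: "h \<circ> \<iota> \<in> hom (additive_group K) ?FH" .
  then have \<phi>: "h \<circ> \<iota> \<in> hom (additive_group K) F" using HF by (auto simp: hom_def)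
  have im: "(h \<circ> \<iota>) ` K = H"
  proof
    show "(h \<circ> \<iota>) ` K \<subseteq> H" using \<phi>H by (auto simp: hom_def additive_group_def)
    show "H \<subseteq> (h \<circ> \<iota>) ` K"
    proof
      fix x assume x: "x \<in> H"
      have "\<iota> (Poly_Mapping.single (x, 0) 1) = frag_of x"
        by (rule poly_mapping_eqI) (simp add: \<iota> lookup_single when_def)
      then have "(h \<circ> \<iota>) (Poly_Mapping.single (x, 0) 1) = x" using h(2) x by simp
      moreover have "Poly_Mapping.single (x, 0) 1 \<in> K" using x by (auto simp: K_def lookup_single when_def)
      ultimately show "x \<in> (h \<circ> \<iota>) ` K" by (metis image_eqI)
    qed
  qed
  have K: "subgroup K (additive_group UNIV)"
  proof (rule subgroup_additiveI)
    fix x y assume xy: "x \<in> K" "y \<in> K"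
    show "x + y \<in> K"
      unfolding K_def
    proof (intro CollectI allI conjI impI)
      fix k
      show "Poly_Mapping.lookup (x + y) k \<in> \<int>" using xy unfolding K_def lookup_add by (intro Ints_add) blast+
      assume "Poly_Mapping.lookup (x + y) k \<noteq> 0"
      then have "Poly_Mapping.lookup x k \<noteq> 0 \<or> Poly_Mapping.lookup y k \<noteq> 0" unfolding lookup_add by linarith
      then show "fst k \<in> H" using xy unfolding K_def by blast
    qed
  qed (auto simp: K_def)
  have kol: "kolmogorov_diameter UNIV k (UNIV :: ((nat \<Rightarrow> 'a) \<times> nat, real) poly_mapping set) UNIV \<le> ereal (c / real k ^ m)"
    if k: "k \<ge> 1" for k
    unfolding kolmogorov_diameter_def
  proof (rule Inf_lower, rule CollectI, intro exI conjI)
    show "0 < c / real k ^ m" using c k by simp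
    show "subspace {0}" by (rule subspace_single_0)
    show "span {} = {0}" by simp
    show "dim {0 :: ((nat \<Rightarrow> 'a) \<times> nat, real) poly_mapping} < k"
      using k dim_span[of "{} :: ((nat \<Rightarrow> 'a) \<times> nat, real) poly_mapping set"]
        dim_eq_card_independent[OF independent_empty, where ?'a = "((nat \<Rightarrow> 'a) \<times> nat, real) poly_mapping"] by simp
    have "x = (c / real k ^ m) *\<^sub>R ((1 / (c / real k ^ m)) *\<^sub>R x) + 0"
      for x :: "((nat \<Rightarrow> 'a) \<times> nat, real) poly_mapping"
      using c k by simp
    then show "UNIV \<subseteq> {(c / real k ^ m) *\<^sub>R y + l | y l. (y :: ((nat \<Rightarrow> 'a) \<times> nat, real) poly_mapping) \<in> UNIV \<and> l \<in> {0}}"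
      by blast
  qed auto
  show "\<exists>(E :: ((nat \<Rightarrow> 'a) \<times> nat, real) poly_mapping set) A B K \<phi>.
           subspace E \<and> A \<subseteq> E \<and> convex A \<and> uminus ` A = A \<and> B \<subseteq> E \<and> convex B \<and> uminus ` B = B \<and>
           (\<forall>k\<ge>1. kolmogorov_diameter E k A B \<le> ereal (c / real k ^ m)) \<and>
           subgroup K (additive_group E) \<and> \<phi> \<in> hom (additive_group K) F \<and>
           neighbourhood_of_one F S (\<phi> ` (K \<inter> A)) \<and> \<phi> ` (K \<inter> B) \<subseteq> U"
  proof (intro exI conjI)
    show "neighbourhood_of_one F S ((h \<circ> \<iota>) ` (K \<inter> UNIV))"
      unfolding Int_UNIV_right im neighbourhood_of_one_def
      using HF H(2) subgroup.one_closed[OF H(1)] by blast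
    show "(h \<circ> \<iota>) ` (K \<inter> UNIV) \<subseteq> U" unfolding Int_UNIV_right im by (rule H(3))
    show "\<forall>k\<ge>1. kolmogorov_diameter UNIV k (UNIV :: ((nat \<Rightarrow> 'a) \<times> nat, real) poly_mapping set) UNIV \<le> ereal (c / real k ^ m)"
      using kol by blast
  qed (use K \<phi> surj_uminus in auto)
qed

text \<open>The factors are the quotients by the open subgroups. The singletons only serve to give their
  elements the required type.\<close>

lemma embeds_F: "embeds_in_product_of_LCA TYPE((nat \<Rightarrow> 'a) set) TYPE((nat \<Rightarrow> 'a) set set) F S"
proof -
  define I where "I = {K. subgroup K F \<and> openin S K}"
  define q where "q K x = {K #>\<^bsub>F\<^esub> x}" for K x
  define H where "H K = \<lparr>carrier = q K ` carrier F,
    monoid.mult = (\<lambda>a b. {the_elem a <#>\<^bsub>F\<^esub> the_elem b}), one = {K}\<rparr>" for K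
  let ?T = "\<lambda>K. discrete_topology (carrier (H K))"
  have mult: "q K x \<otimes>\<^bsub>H K\<^esub> q K y = q K (x \<otimes>\<^bsub>F\<^esub> y)" if "K \<in> I" "x \<in> carrier F" "y \<in> carrier F" for K x y
  proof -
    have "K \<lhd> F" using that(1) F.normal_if_subgroup unfolding I_def by blast
    from normal.rcos_sum[OF this that(2,3)] show ?thesis by (simp add: H_def q_def del: mult_F)
  qed
  have one: "\<one>\<^bsub>H K\<^esub> = q K \<one>\<^bsub>F\<^esub>" if "K \<in> I" for K
  proof -
    have "K \<subseteq> carrier F" using that subgroup.subset unfolding I_def by blast
    from F.coset_mult_one[OF this] show ?thesis by (simp add: H_def q_def del: one_F)
  qed
  have carH: "carrier (H K) = q K ` carrier F" for K by (simp add: H_def)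
  have cg: "comm_group (H K)" if K: "K \<in> I" for K
  proof (rule comm_groupI)
    show "\<one>\<^bsub>H K\<^esub> \<in> carrier (H K)" unfolding one[OF K] carH using F.one_closed by (rule imageI)
    fix a assume "a \<in> carrier (H K)"
    then obtain x where x: "x \<in> carrier F" "a = q K x" unfolding carH by (rule imageE)
    show "\<one>\<^bsub>H K\<^esub> \<otimes>\<^bsub>H K\<^esub> a = a"
      unfolding one[OF K] x(2) mult[OF K F.one_closed x(1)] F.l_one[OF x(1)] ..
    have "q K (inv\<^bsub>F\<^esub> x) \<otimes>\<^bsub>H K\<^esub> a = \<one>\<^bsub>H K\<^esub>"
      unfolding one[OF K] x(2) mult[OF K F.inv_closed[OF x(1)] x(1)] F.l_inv[OF x(1)] ..
    then show "\<exists>y\<in>carrier (H K). y \<otimes>\<^bsub>H K\<^esub> a = \<one>\<^bsub>H K\<^esub>"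
      using imageI[OF F.inv_closed[OF x(1)], of "q K"] unfolding carH by (rule bexI)
    fix b assume "b \<in> carrier (H K)"
    then obtain y where y: "y \<in> carrier F" "b = q K y" unfolding carH by (rule imageE)
    show "a \<otimes>\<^bsub>H K\<^esub> b \<in> carrier (H K)"
      unfolding x(2) y(2) mult[OF K x(1) y(1)] carH using F.m_closed[OF x(1) y(1)] by (rule imageI)
    show "a \<otimes>\<^bsub>H K\<^esub> b = b \<otimes>\<^bsub>H K\<^esub> a"
      unfolding x(2) y(2) mult[OF K x(1) y(1)] mult[OF K y(1) x(1)] F.m_comm[OF x(1) y(1)] ..
    fix c assume "c \<in> carrier (H K)"
    then obtain z where z: "z \<in> carrier F" "c = q K z" unfolding carH by (rule imageE)
    show "a \<otimes>\<^bsub>H K\<^esub> b \<otimes>\<^bsub>H K\<^esub> c = a \<otimes>\<^bsub>H K\<^esub> (b \<otimes>\<^bsub>H K\<^esub> c)"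
      unfolding x(2) y(2) z(2) mult[OF K x(1) y(1)] mult[OF K y(1) z(1)]
        mult[OF K F.m_closed[OF x(1) y(1)] z(1)] mult[OF K x(1) F.m_closed[OF y(1) z(1)]]
        F.m_assoc[OF x(1) y(1) z(1)] ..
  qed
  define f where "f x = (\<lambda>K\<in>I. q K x)" for x
  have lca: "locally_compact_abelian_group (H K) (?T K)" if "K \<in> I" for K
    unfolding locally_compact_abelian_group_def
    using abelian_topological_group_discrete[OF cg[OF that]]
    by (simp add: Hausdorff_space_discrete_topology locally_compact_space_discrete_topology)
  have hom: "f \<in> hom F (product_group I H)"
  proof (rule homI)
    show "f x \<in> carrier (product_group I H)" if "x \<in> carrier F" for x
      using that by (simp add: f_def carH)
    show "f (x \<otimes>\<^bsub>F\<^esub> y) = f x \<otimes>\<^bsub>product_group I H\<^esub> f y" if "x \<in> carrier F" "y \<in> carrier F" for x y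
      using mult[OF _ that] by (auto simp: f_def simp del: mult_F intro!: restrict_ext)
  qed
  have q_eq: "q K x = q K y \<longleftrightarrow> x \<otimes>\<^bsub>F\<^esub> inv\<^bsub>F\<^esub> y \<in> K" if "K \<in> I" "x \<in> carrier F" "y \<in> carrier F" for K x y
    using F.r_coset_eq_iff[OF _ that(2,3), of K] that(1) unfolding q_def I_def by simp
  have qcont: "continuous_map S (?T K) (q K)" if K: "K \<in> I" for K
  proof -
    have K': "subgroup K F" "openin S K" using K unfolding I_def by blast+
    have "continuous_map (discrete_topology (carrier (F Mod K))) (?T K) (\<lambda>c. {c})"
      by (auto simp: carH q_def carrier_FactGroup)
    from continuous_map_compose[OF F.coset_map(2)[OF K'] this] show ?thesis
      by (simp add: o_def q_def[abs_def])
  qed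
  let ?P = "product_topology ?T I"
  have cont: "continuous_map S ?P f"
    unfolding continuous_map_componentwise
  proof (intro conjI ballI)
    show "f ` topspace S \<subseteq> extensional I" by (auto simp: f_def)
    fix K assume K: "K \<in> I"
    show "continuous_map S (?T K) (\<lambda>x. f x K)" using qcont[OF K] K by (simp add: f_def)
  qed
  \<comment> \<open>Separates points from closed sets by a single discrete quotient. Injectivity of
    f and openness onto its image both follow from this.\<close>
  have sep: "\<exists>K\<in>I. \<forall>y\<in>carrier F. q K y = q K x \<longrightarrow> y \<in> U" if U: "openin S U" "x \<in> U" for U x
  proof -
    have x: "x \<in> carrier F" using F.carrier_if_openin[OF U] .
    obtain V where V: "openin T V" "\<one>\<^bsub>X\<^esub> \<in> V" "\<And>y. y \<in> N V \<Longrightarrow> x \<otimes>\<^bsub>F\<^esub> y \<in> U"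
      using openin_S_nbhd[OF U] by metis
    obtain K where K: "subgroup K F" "openin S K" "K \<subseteq> N V"
      using small_open_subgroup_F[OF nbhd_N[OF V(1,2)]] by metis
    have "y \<in> U" if y: "y \<in> carrier F" "q K y = q K x" for y
    proof -
      have "K \<in> I" using K unfolding I_def by blast
      then have "y \<otimes>\<^bsub>F\<^esub> inv\<^bsub>F\<^esub> x \<in> N V" using q_eq[OF _ y(1) x] y(2) K(3) by blast
      then have "x \<otimes>\<^bsub>F\<^esub> (y \<otimes>\<^bsub>F\<^esub> inv\<^bsub>F\<^esub> x) \<in> U" by (rule V(3))
      moreover have "x \<otimes>\<^bsub>F\<^esub> (y \<otimes>\<^bsub>F\<^esub> inv\<^bsub>F\<^esub> x) = y"
        unfolding F.m_comm[OF y(1) F.inv_closed[OF x]] F.m_assoc[OF x F.inv_closed[OF x] y(1), symmetric]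
          F.r_inv[OF x] by (rule F.l_one[OF y(1)])
      ultimately show ?thesis by (simp only:)
    qed
    then show ?thesis using K unfolding I_def by blast
  qed
  have inj: "inj_on f (topspace S)"
  proof (rule inj_onI, rule ccontr)
    fix x y assume xy: "x \<in> topspace S" "y \<in> topspace S" "f x = f y" "x \<noteq> y"
    obtain U where U: "openin S U" "x \<in> U" "y \<notin> U"
      using Hausdorff_F[OF Hausdorff_X] xy unfolding Hausdorff_space_def disjnt_iff by metis
    obtain K where K: "K \<in> I" "\<forall>y\<in>carrier F. q K y = q K x \<longrightarrow> y \<in> U" using sep[OF U(1,2)] by blast
    have "f x K = f y K" using xy(3) by simp
    then have "q K y = q K x" using K(1) by (simp add: f_def)
    then show False using K(2) xy(2) U(3) by (simp add: F.topspace_eq)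
  qed
  have "homeomorphic_map S (subtopology ?P (f ` topspace S)) f"
  proof (rule bijective_open_imp_homeomorphic_map)
    show "continuous_map S (subtopology ?P (f ` topspace S)) f"
      using cont by (simp add: continuous_map_in_subtopology)
    show "f ` topspace S = topspace (subtopology ?P (f ` topspace S))"
      using continuous_map_image_subset_topspace[OF cont] by (simp add: inf.absorb2)
    show "open_map S (subtopology ?P (f ` topspace S)) f"
      unfolding open_map_def
    proof (intro allI impI)
      fix U assume U: "openin S U"
      show "openin (subtopology ?P (f ` topspace S)) (f ` U)"
      proof (subst openin_subopen, intro ballI)
        fix g assume "g \<in> f ` U"
        then obtain x where x: "x \<in> U" "g = f x" by blast
        then have xF: "x \<in> carrier F" using F.carrier_if_openin[OF U] by blast
        obtain K where K: "K \<in> I" "\<forall>y\<in>carrier F. q K y = q K x \<longrightarrow> y \<in> U" using sep[OF U x(1)] by blast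
        let ?O = "{h \<in> topspace ?P. h K \<in> {q K x}}"
        have "openin ?P ?O"
          using continuous_map_product_projection[OF K(1), of ?T] xF
          by (intro openin_continuous_map_preimage[of ?P "?T K"]) (auto simp: carH)
        then have "openin (subtopology ?P (f ` topspace S)) ((f ` topspace S) \<inter> ?O)"
          by (rule openin_subtopology_Int2)
        moreover have "g \<in> (f ` topspace S) \<inter> ?O"
        proof -
          have "g \<in> f ` topspace S" unfolding x(2) using xF by (simp add: F.topspace_eq)
          moreover have "g \<in> topspace ?P"
            using continuous_map_image_subset_topspace[OF cont] \<open>g \<in> f ` topspace S\<close> by blast
          moreover have "g K = q K x" unfolding x(2) using K(1) by (simp add: f_def)
          ultimately show ?thesis by simp
        qed
        moreover have "(f ` topspace S) \<inter> ?O \<subseteq> f ` U"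
        proof
          fix h assume h: "h \<in> (f ` topspace S) \<inter> ?O"
          then obtain y where y: "y \<in> carrier F" "h = f y" by (auto simp: F.topspace_eq)
          have "q K y = q K x" using h K(1) unfolding y(2) by (simp add: f_def)
          then show "h \<in> f ` U" using K(2) y by blast
        qed
        ultimately show "\<exists>V. openin (subtopology ?P (f ` topspace S)) V \<and> g \<in> V \<and> V \<subseteq> f ` U" by blast
      qed
    qed
  qed (rule inj)
  then have emb: "embedding_map S ?P f" by (simp add: embedding_map_def)
  show ?thesis
    unfolding embeds_in_product_of_LCA_def
    by (intro exI[of _ I] exI[of _ H] exI[of _ ?T] exI[of _ f] conjI ballI lca hom emb)
qed

end


section \<open>Null sequences embedded into products of locally compact groups\<close>

text \<open>Pass to infinite subsets once for each i. Heredity preserves what was achieved earlier,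
  and finiteness of I keeps the final set infinite.\<close>

lemma infinite_refine_finite:
  assumes "finite I"
    and refine: "\<And>i J. i \<in> I \<Longrightarrow> infinite (J :: nat set) \<Longrightarrow> J \<subseteq> J0 \<Longrightarrow> \<exists>J'\<subseteq>J. infinite J' \<and> Q i J'"
    and hereditary: "\<And>i J J'. Q i J \<Longrightarrow> J' \<subseteq> J \<Longrightarrow> Q i J'"
  shows "infinite J0 \<Longrightarrow> \<exists>J'\<subseteq>J0. infinite J' \<and> (\<forall>i\<in>I. Q i J')"
  using assms(1) refine
proof (induction I rule: finite_induct)
  case empty
  then show ?case by blast
next
  case (insert i I)
  have "\<exists>J'\<subseteq>J0. infinite J' \<and> (\<forall>i\<in>I. Q i J')"
    using insert.IH insert.prems by blast
  then obtain J where J: "J \<subseteq> J0" "infinite J" "\<forall>i\<in>I. Q i J" by blast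
  have "\<exists>J'\<subseteq>J. infinite J' \<and> Q i J'" using insert.prems(2)[of i J] J by blast
  then obtain J' where J': "J' \<subseteq> J" "infinite J'" "Q i J'" by blast
  have "Q k J'" if "k \<in> insert i I" for k
    using that J' J(3) hereditary[of k J J'] by auto
  with J' J(1) show ?case by blast
qed

lemma set_multI: "a \<in> A \<Longrightarrow> b \<in> B \<Longrightarrow> a \<otimes>\<^bsub>G\<^esub> b \<in> A <#>\<^bsub>G\<^esub> B"
  by (auto simp: set_mult_def)

context abelian_topological_group
begin

text \<open>Finitely many translates gW cover C, and one of them contains \<open>a j\<close> for
  infinitely many j. Quotients of elements of a single gW lie in \<open>W W\<close>, since W is
  symmetric.\<close>

lemma compactin_refine:
  assumes C: "compactin T C" and R: "openin T R" "\<one> \<in> R"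
    and J: "infinite (J :: nat set)" and a: "\<And>j. j \<in> J \<Longrightarrow> a j \<in> C"
  shows "\<exists>J'\<subseteq>J. infinite J' \<and> (\<forall>i\<in>J'. \<forall>j\<in>J'. a i \<otimes> inv (a j) \<in> R)"
proof -
  obtain W where W: "openin T W" "\<one> \<in> W" "\<And>x. x \<in> W \<Longrightarrow> inv x \<in> W" "\<And>x y. x \<in> W \<Longrightarrow> y \<in> W \<Longrightarrow> x \<otimes> y \<in> R"
    using nbhd_sym_mult[OF R] by metis
  have CG: "C \<subseteq> carrier G" using compactin_subset_topspace[OF C] topspace_eq by simp
  let ?U = "(\<lambda>g. (\<lambda>x. g \<otimes> x) ` W) ` C"
  have "C \<subseteq> \<Union>?U"
  proof
    fix g assume g: "g \<in> C"
    then have "g \<in> (\<lambda>x. g \<otimes> x) ` W" using W(2) CG by (intro image_eqI[of _ _ \<one>]) auto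
    then show "g \<in> \<Union>?U" using g by blast
  qed
  moreover have "\<forall>U\<in>?U. openin T U" using openin_translate[OF W(1)] CG by blast
  ultimately obtain \<F> where \<F>: "finite \<F>" "\<F> \<subseteq> ?U" "C \<subseteq> \<Union>\<F>"
    using C unfolding compactin_def by (metis (no_types, lifting))
  have "\<forall>j\<in>J. \<exists>U\<in>\<F>. a j \<in> U" using a \<F>(3) by blast
  from pigeonhole_infinite_rel[OF J \<F>(1) this]
  obtain U where U: "U \<in> \<F>" "infinite {j \<in> J. a j \<in> U}" by blast
  obtain g where g: "g \<in> C" "U = (\<lambda>x. g \<otimes> x) ` W" using U(1) \<F>(2) by blast
  have gG: "g \<in> carrier G" using g CG by blast
  have "a i \<otimes> inv (a j) \<in> R" if ij: "a i \<in> U" "a j \<in> U" for i j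
  proof -
    obtain x y where xy: "x \<in> W" "a i = g \<otimes> x" "y \<in> W" "a j = g \<otimes> y" using ij g(2) by blast
    note xyG = carrier_if_openin[OF W(1) xy(1)] carrier_if_openin[OF W(1) xy(3)]
    have "a i \<otimes> inv (a j) = x \<otimes> inv y"
    proof -
      have "g \<otimes> (inv g \<otimes> inv y) = inv y" using gG xyG m_assoc[of g "inv g" "inv y"] by simp
      moreover have "(x \<otimes> g) \<otimes> (inv g \<otimes> inv y) = x \<otimes> (g \<otimes> (inv g \<otimes> inv y))" using gG xyG by (simp add: m_assoc)
      ultimately show ?thesis unfolding xy(2,4) using gG xyG by (simp add: inv_mult m_comm[of g x])
    qed
    then show ?thesis using W(4)[OF xy(1) W(3)[OF xy(3)]] by simp
  qed
  then show ?thesis using U(2) by (intro exI[of _ "{j \<in> J. a j \<in> U}"]) auto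
qed

end

section \<open>Sequences with at most one non-trivial term\<close>

context null_sequences
begin

definition delta :: "nat \<Rightarrow> 'a \<Rightarrow> nat \<Rightarrow> 'a" where
  "delta j w = (\<lambda>i. if i = j then w else \<one>\<^bsub>X\<^esub>)"

lemma delta_same [simp]: "delta j w j = w"
  and delta_other: "i \<noteq> j \<Longrightarrow> delta j w i = \<one>\<^bsub>X\<^esub>"
  by (simp_all add: delta_def)

lemma delta_carrier:
  assumes "w \<in> carrier X"
  shows "delta j w \<in> carrier F"
  unfolding carrier_F limitin_sequentially
proof (intro conjI allI impI)
  show "delta j w n \<in> carrier X" for n using assms by (simp add: delta_def)
  show "\<one>\<^bsub>X\<^esub> \<in> topspace T" by (simp add: X.topspace_eq)
  show "\<exists>N. \<forall>n\<ge>N. delta j w n \<in> U" if "openin T U \<and> \<one>\<^bsub>X\<^esub> \<in> U" for U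
    using that by (intro exI[of _ "Suc j"]) (simp add: delta_def)
qed

lemma delta_in_N:
  assumes "V \<subseteq> carrier X" "\<one>\<^bsub>X\<^esub> \<in> V" "w \<in> V"
  shows "delta j w \<in> N V"
  using delta_carrier[of w j] assms unfolding in_N by (auto simp: delta_def)

lemma delta_mult: "delta j (v \<otimes>\<^bsub>X\<^esub> w) = delta j v \<otimes>\<^bsub>F\<^esub> delta j w"
  by (auto simp: delta_def)

lemma hom_delta: "delta j \<in> hom X F"
  using delta_carrier delta_mult by (intro homI)

lemma delta_one: "delta j \<one>\<^bsub>X\<^esub> = \<one>\<^bsub>F\<^esub>"
  by (auto simp: delta_def)

lemma delta_quotient_coord:
  assumes "w \<in> carrier X" "i \<noteq> j"
  shows "(delta i w \<otimes>\<^bsub>F\<^esub> inv\<^bsub>F\<^esub> (delta j w)) i = w"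
  using assms by (simp add: inv_F[OF delta_carrier] delta_other)

text \<open>The elements \<open>delta i w\<close> and \<open>delta j w\<close> carry \<open>w\<close> in different places. Whenever their quotient
  lies in the \<open>n\<close>-th part \<open>P\<close> of \<open>N V\<close>, the product of \<open>n\<close> such \<open>w\<close> lies in \<open>V\<close>.\<close>

lemma totally_disconnected_if_refinable:
  assumes Haus: "Hausdorff_space T"
    and refine: "\<And>V. openin T V \<Longrightarrow> \<one>\<^bsub>X\<^esub> \<in> V \<Longrightarrow> \<exists>W. openin T W \<and> \<one>\<^bsub>X\<^esub> \<in> W \<and>
      (\<forall>n. \<exists>P\<subseteq>carrier F. set_power F P n \<subseteq> N V \<and>
        (\<forall>w\<in>W. \<forall>J. infinite J \<longrightarrow>
          (\<exists>J'\<subseteq>J. infinite J' \<and> (\<forall>i\<in>J'. \<forall>j\<in>J'. delta i w \<otimes>\<^bsub>F\<^esub> inv\<^bsub>F\<^esub> (delta j w) \<in> P))))"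
  shows "totally_disconnected_space T"
proof (rule X.totally_disconnected_if_small_open_subgroups[OF Haus])
  fix V assume V: "openin T V" "\<one>\<^bsub>X\<^esub> \<in> V"
  obtain W0 where W0: "openin T W0" "\<one>\<^bsub>X\<^esub> \<in> W0"
    and ref: "\<And>n. \<exists>P\<subseteq>carrier F. set_power F P n \<subseteq> N V \<and>
        (\<forall>w\<in>W0. \<forall>J. infinite J \<longrightarrow>
          (\<exists>J'\<subseteq>J. infinite J' \<and> (\<forall>i\<in>J'. \<forall>j\<in>J'. delta i w \<otimes>\<^bsub>F\<^esub> inv\<^bsub>F\<^esub> (delta j w) \<in> P)))"
    using refine[OF V] by blast
  obtain W where W: "openin T W" "\<one>\<^bsub>X\<^esub> \<in> W" "\<And>a. a \<in> W \<Longrightarrow> inv\<^bsub>X\<^esub> a \<in> W" "W \<subseteq> W0"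
    using X.nbhd_sym_mult[OF W0] by metis
  have WX: "W \<subseteq> carrier X" using X.carrier_if_openin[OF W(1)] by blast
  \<comment> \<open>The neighbourhood W was fixed before n. Since n is arbitrary here, the whole
    open subgroup generated by W ends up in V.\<close>
  have sub: "set_power X W n \<subseteq> V" for n
  proof
    fix w assume w: "w \<in> set_power X W n"
    obtain P where P: "P \<subseteq> carrier F" "set_power F P n \<subseteq> N V"
      "\<And>w J. w \<in> W0 \<Longrightarrow> infinite J \<Longrightarrow>
          \<exists>J'\<subseteq>J. infinite J' \<and> (\<forall>i\<in>J'. \<forall>j\<in>J'. delta i w \<otimes>\<^bsub>F\<^esub> inv\<^bsub>F\<^esub> (delta j w) \<in> P)"
      using ref[of n] by blast
    \<comment> \<open>A product of k elements of W is treated factor by factor, each factor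
      shrinking the index set to an infinite subset and contributing one element of P to the
      quotient. In the end any two distinct indices in the remaining set suffice.\<close>
    have "\<exists>J'\<subseteq>J. infinite J' \<and> (\<forall>i\<in>J'. \<forall>j\<in>J'. delta i w \<otimes>\<^bsub>F\<^esub> inv\<^bsub>F\<^esub> (delta j w) \<in> set_power F P k)"
      if "w \<in> set_power X W k" "infinite J" for w k J
      using that
    proof (induction k arbitrary: w J)
      case 0
      then have w1: "w = \<one>\<^bsub>X\<^esub>" by simp
      have "delta i w \<otimes>\<^bsub>F\<^esub> inv\<^bsub>F\<^esub> (delta j w) \<in> set_power F P 0" for i j
        unfolding w1 delta_one F.r_inv[OF F.one_closed] set_power.simps(1) by (rule singletonI)
      then show ?case using 0 by blast
    next
      case (Suc k)
      then obtain a b where ab: "a \<in> W" "b \<in> set_power X W k" "w = a \<otimes>\<^bsub>X\<^esub> b"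
        by (auto simp: set_mult_def)
      have abX: "a \<in> carrier X" "b \<in> carrier X"
        using ab WX X.set_power_subset[OF WX] by blast+
      obtain J1 where J1: "J1 \<subseteq> J" "infinite J1"
        "\<forall>i\<in>J1. \<forall>j\<in>J1. delta i a \<otimes>\<^bsub>F\<^esub> inv\<^bsub>F\<^esub> (delta j a) \<in> P"
        using P(3)[OF subsetD[OF W(4) ab(1)] Suc.prems(2)] by (elim exE conjE) (rule that)
      obtain J2 where J2: "J2 \<subseteq> J1" "infinite J2"
        "\<forall>i\<in>J2. \<forall>j\<in>J2. delta i b \<otimes>\<^bsub>F\<^esub> inv\<^bsub>F\<^esub> (delta j b) \<in> set_power F P k"
        using Suc.IH[OF ab(2) J1(2)] by (elim exE conjE) (rule that)
      have "delta i w \<otimes>\<^bsub>F\<^esub> inv\<^bsub>F\<^esub> (delta j w) \<in> set_power F P (Suc k)" if ij: "i \<in> J2" "j \<in> J2" for i j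
      proof -
        note c = delta_carrier[OF abX(1)] delta_carrier[OF abX(2)]
        note ic = F.inv_closed[OF c(1)] F.inv_closed[OF c(2)]
        have inv: "inv\<^bsub>F\<^esub> (delta j w) = inv\<^bsub>F\<^esub> (delta j a) \<otimes>\<^bsub>F\<^esub> inv\<^bsub>F\<^esub> (delta j b)"
          unfolding ab(3) delta_mult by (rule F.inv_mult[OF c])
        have "delta i w \<otimes>\<^bsub>F\<^esub> inv\<^bsub>F\<^esub> (delta j w) =
          (delta i a \<otimes>\<^bsub>F\<^esub> delta i b) \<otimes>\<^bsub>F\<^esub> (inv\<^bsub>F\<^esub> (delta j a) \<otimes>\<^bsub>F\<^esub> inv\<^bsub>F\<^esub> (delta j b))"
          unfolding inv unfolding ab(3) delta_mult ..
        also have "\<dots> = (delta i a \<otimes>\<^bsub>F\<^esub> inv\<^bsub>F\<^esub> (delta j a)) \<otimes>\<^bsub>F\<^esub> (delta i b \<otimes>\<^bsub>F\<^esub> inv\<^bsub>F\<^esub> (delta j b))"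
          using c ic by (simp only: F.m_ac F.m_closed)
        finally have eq: "delta i w \<otimes>\<^bsub>F\<^esub> inv\<^bsub>F\<^esub> (delta j w) =
          (delta i a \<otimes>\<^bsub>F\<^esub> inv\<^bsub>F\<^esub> (delta j a)) \<otimes>\<^bsub>F\<^esub> (delta i b \<otimes>\<^bsub>F\<^esub> inv\<^bsub>F\<^esub> (delta j b))" .
        have "delta i a \<otimes>\<^bsub>F\<^esub> inv\<^bsub>F\<^esub> (delta j a) \<in> P"
          using J1(3) subsetD[OF J2(1) ij(1)] subsetD[OF J2(1) ij(2)] by blast
        moreover have "delta i b \<otimes>\<^bsub>F\<^esub> inv\<^bsub>F\<^esub> (delta j b) \<in> set_power F P k"
          using J2(3) ij by blast
        ultimately show ?thesis
          unfolding set_power.simps(2) eq by (rule set_multI)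
      qed
      then have "\<forall>i\<in>J2. \<forall>j\<in>J2. delta i w \<otimes>\<^bsub>F\<^esub> inv\<^bsub>F\<^esub> (delta j w) \<in> set_power F P (Suc k)" by simp
      with subset_trans[OF J2(1) J1(1)] J2(2) show ?case by (intro exI conjI)
    qed
    then obtain J where J: "infinite J" "\<forall>i\<in>J. \<forall>j\<in>J. delta i w \<otimes>\<^bsub>F\<^esub> inv\<^bsub>F\<^esub> (delta j w) \<in> N V"
      using w P(2) infinite_UNIV_nat by (meson subsetD)
    obtain i where i: "i \<in> J" using J(1) by fastforce
    obtain j where j: "j \<in> J" "j \<noteq> i" using J(1) by (metis finite.simps insertI1 subsetI subset_singletonD)
    have "w \<in> carrier X" using w X.set_power_subset[OF WX] by blast
    from delta_quotient_coord[OF this j(2)[symmetric]]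
    have "(delta i w \<otimes>\<^bsub>F\<^esub> inv\<^bsub>F\<^esub> (delta j w)) i = w" .
    moreover have "(delta i w \<otimes>\<^bsub>F\<^esub> inv\<^bsub>F\<^esub> (delta j w)) i \<in> V" using J(2) i j(1) unfolding in_N by blast
    ultimately show "w \<in> V" by (simp only:)
  qed
  let ?H = "\<Union>n. set_power X W n"
  have H: "subgroup ?H X" using WX W(3) by (rule X.subgroup_Union_set_power)
  have "W \<subseteq> ?H" using X.set_power_1[OF WX] by blast
  with H W(1,2) have "openin T ?H" using X.openin_subgroup_if_nbhd by blast
  with H sub show "\<exists>H. subgroup H X \<and> openin T H \<and> H \<subseteq> V" by blast
qed

end

lemma set_power_hom_image:
  assumes "group G" "group H" "f \<in> hom G H" "P \<subseteq> carrier G" "\<And>p. p \<in> P \<Longrightarrow> f p \<in> R"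
  shows "x \<in> set_power G P n \<Longrightarrow> x \<in> carrier G \<and> f x \<in> set_power H R n"
proof (induction n arbitrary: x)
  case 0
  interpret group_hom G H f using assms(1-3) by (simp add: group_hom_def group_hom_axioms_def)
  show ?case using 0 by simp
next
  case (Suc n)
  interpret group_hom G H f using assms(1-3) by (simp add: group_hom_def group_hom_axioms_def)
  obtain a b where ab: "a \<in> P" "b \<in> set_power G P n" "x = a \<otimes>\<^bsub>G\<^esub> b" using Suc.prems by (auto simp: set_mult_def)
  have "a \<in> carrier G" "b \<in> carrier G" "f b \<in> set_power H R n" using ab assms(4) Suc.IH by blast+
  then show ?case using ab assms(5)[OF ab(1)] by (auto simp: set_mult_def)
qed

context LCA_null_sequences
begin

text \<open>Membership in \<open>N V\<close> is decided by a finite set \<open>I0\<close> of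
  factors. Local compactness gives W such that all \<open>delta j w\<close> have their
  \<open>I0\<close>-coordinates in fixed compact sets, and this choice does not involve n. For given
  n, P is cut out by neighbourhoods \<open>R i\<close> with \<open>R i ^ n\<close> inside
  \<open>B i\<close>, and compactness makes infinitely many of the coordinates close modulo
  \<open>R i\<close>.\<close>

theorem totally_disconnected_if_embeds:
  assumes "embeds_in_product_of_LCA TYPE('i) TYPE('h) F S"
  shows "totally_disconnected_space T"
proof (rule totally_disconnected_if_refinable[OF Hausdorff_X])
  obtain I :: "'i set" and H :: "'i \<Rightarrow> 'h monoid" and S' f where
    lca: "\<And>i. i \<in> I \<Longrightarrow> locally_compact_abelian_group (H i) (S' i)"
    and f: "f \<in> hom F (product_group I H)" and emb: "embedding_map S (product_topology S' I) f"
    using assms unfolding embeds_in_product_of_LCA_def by blast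
  let ?P = "product_topology S' I"
  have ATG: "abelian_topological_group (H i) (S' i)" if "i \<in> I" for i
    using lca[OF that] by (simp add: locally_compact_abelian_group_def)
  have grp: "group (H i)" if "i \<in> I" for i
    using ATG[OF that] by (simp add: abelian_topological_group_def comm_group_def)
  have fi: "(\<lambda>x. f x i) \<in> hom F (H i)" if i: "i \<in> I" for i
  proof (rule homI)
    show "f x i \<in> carrier (H i)" if "x \<in> carrier F" for x
      using f that i by (auto simp: hom_def PiE_iff Pi_iff)
    show "f (x \<otimes>\<^bsub>F\<^esub> y) i = f x i \<otimes>\<^bsub>H i\<^esub> f y i" if "x \<in> carrier F" "y \<in> carrier F" for x y
    proof -
      have "f (x \<otimes>\<^bsub>F\<^esub> y) = f x \<otimes>\<^bsub>product_group I H\<^esub> f y" using f that by (simp add: hom_def del: mult_F)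
      then show ?thesis using i by simp
    qed
  qed
  have hm: "homeomorphic_map S (subtopology ?P (f ` topspace S)) f" using emb by (simp add: embedding_map_def)
  have cont: "continuous_map S ?P f"
    using homeomorphic_imp_continuous_map[OF hm] by (simp add: continuous_map_in_subtopology)
  have inj: "inj_on f (topspace S)" using homeomorphic_imp_injective_map[OF hm] .
  have fT: "f x \<in> topspace ?P" if "x \<in> carrier F" for x
    using continuous_map_image_subset_topspace[OF cont] that F.topspace_eq by blast
  have conti: "continuous_map S (S' i) (\<lambda>x. f x i)" if "i \<in> I" for i
    using continuous_map_compose[OF cont continuous_map_product_projection[OF that]] by (simp add: o_def)
  fix V assume V: "openin T V" "\<one>\<^bsub>X\<^esub> \<in> V"
  obtain O' where O': "openin S O'" "\<one>\<^bsub>F\<^esub> \<in> O'" "O' \<subseteq> N V"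
    using nbhd_N[OF V] unfolding neighbourhood_of_one_def by blast
  have "openin (subtopology ?P (f ` topspace S)) (f ` O')"
    using homeomorphic_imp_open_map[OF hm] O'(1) unfolding open_map_def by blast
  then obtain Z where Z: "openin ?P Z" "f ` O' = Z \<inter> f ` topspace S" unfolding openin_subtopology by blast
  have "f \<one>\<^bsub>F\<^esub> \<in> Z" using Z(2) O'(2) by blast
  from product_topology_open_contains_basis[OF Z(1) this]
  obtain B where B: "f \<one>\<^bsub>F\<^esub> \<in> PiE I B" "\<And>i. openin (S' i) (B i)" "finite {i. B i \<noteq> topspace (S' i)}" "PiE I B \<subseteq> Z"
    by blast
  define I0 where "I0 = {i \<in> I. B i \<noteq> topspace (S' i)}"
  have I0: "finite I0" "I0 \<subseteq> I" using B(3) unfolding I0_def by auto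
  \<comment> \<open>Factors outside \<open>I0\<close> impose no restriction. Injectivity of f then
    brings x itself, and not merely its image, into the neighbourhood.\<close>
  have mem: "x \<in> N V" if x: "x \<in> carrier F" "\<And>i. i \<in> I0 \<Longrightarrow> f x i \<in> B i" for x
  proof -
    have "f x i \<in> B i" if i: "i \<in> I" for i
    proof (cases "i \<in> I0")
      case False
      then have "B i = topspace (S' i)" using i unfolding I0_def by blast
      then show ?thesis using fT[OF x(1)] i by (auto simp: PiE_iff)
    qed (rule x(2))
    then have "f x \<in> PiE I B" using fT[OF x(1)] by (auto simp: PiE_iff)
    then have "f x \<in> f ` O'" using Z(2) B(4) x(1) F.topspace_eq by blast
    then obtain y where y: "y \<in> O'" "f x = f y" by blast
    have "y \<in> topspace S" using y(1) openin_subset[OF O'(1)] by blast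
    then have "x = y" using inj y(2) x(1) F.topspace_eq by (simp add: inj_on_def)
    then show ?thesis using y(1) O'(3) by blast
  qed
  have one_i: "f \<one>\<^bsub>F\<^esub> i = \<one>\<^bsub>H i\<^esub>" if "i \<in> I" for i
    using hom_one[OF fi[OF that] F.is_group grp[OF that]] .
  have Bi: "openin (S' i) (B i)" "\<one>\<^bsub>H i\<^esub> \<in> B i" if "i \<in> I0" for i
  proof -
    show "openin (S' i) (B i)" by (rule B(2))
    have "f \<one>\<^bsub>F\<^esub> i \<in> B i" using B(1) that I0(2) by (auto simp: PiE_iff)
    then show "\<one>\<^bsub>H i\<^esub> \<in> B i" using one_i[of i] that I0(2) by (metis subsetD)
  qed
  have "\<exists>A C. openin (S' i) A \<and> compactin (S' i) C \<and> \<one>\<^bsub>H i\<^esub> \<in> A \<and> A \<subseteq> C" if i: "i \<in> I0" for i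
  proof -
    have "locally_compact_space (S' i)" using lca i I0(2) unfolding locally_compact_abelian_group_def by blast
    moreover have "\<one>\<^bsub>H i\<^esub> \<in> topspace (S' i)" using Bi[OF i] openin_subset by blast
    ultimately show ?thesis unfolding locally_compact_space_def by blast
  qed
  then have "\<forall>i\<in>I0. \<exists>p. openin (S' i) (fst p) \<and> compactin (S' i) (snd p) \<and> \<one>\<^bsub>H i\<^esub> \<in> fst p \<and> fst p \<subseteq> snd p"
    by simp
  from bchoice[OF this] obtain AC where
    AC: "\<forall>i\<in>I0. openin (S' i) (fst (AC i)) \<and> compactin (S' i) (snd (AC i)) \<and> \<one>\<^bsub>H i\<^esub> \<in> fst (AC i) \<and> fst (AC i) \<subseteq> snd (AC i)" ..
  let ?D = "(\<Inter>i\<in>I0. {x \<in> topspace S. f x i \<in> fst (AC i)}) \<inter> topspace S"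
  have "openin S ?D"
  proof (rule openin_INT[OF I0(1)])
    fix i assume i: "i \<in> I0"
    then have "i \<in> I" using I0(2) by blast
    from openin_continuous_map_preimage[OF conti[OF this]] AC i
    show "openin S {x \<in> topspace S. f x i \<in> fst (AC i)}" by blast
  qed
  moreover have "\<one>\<^bsub>F\<^esub> \<in> ?D"
  proof (intro IntI INT_I CollectI conjI)
    show "\<one>\<^bsub>F\<^esub> \<in> topspace S" unfolding F.topspace_eq by (rule F.one_closed)
    then show "\<one>\<^bsub>F\<^esub> \<in> topspace S" .
    fix i assume i: "i \<in> I0"
    show "f \<one>\<^bsub>F\<^esub> i \<in> fst (AC i)" unfolding one_i[OF subsetD[OF I0(2) i]] using AC i by blast
  qed
  ultimately have "neighbourhood_of_one F S ?D"
    unfolding neighbourhood_of_one_def using F.topspace_eq by blast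
  then obtain W where W: "openin T W" "\<one>\<^bsub>X\<^esub> \<in> W" "N W \<subseteq> ?D" unfolding nbhd_iff by blast
  have WX: "W \<subseteq> carrier X" using X.carrier_if_openin[OF W(1)] by blast
  have "\<exists>P\<subseteq>carrier F. set_power F P n \<subseteq> N V \<and>
        (\<forall>w\<in>W. \<forall>J. infinite J \<longrightarrow>
          (\<exists>J'\<subseteq>J. infinite J' \<and> (\<forall>i\<in>J'. \<forall>j\<in>J'. delta i w \<otimes>\<^bsub>F\<^esub> inv\<^bsub>F\<^esub> (delta j w) \<in> P)))" for n
  proof -
    have "\<exists>R. openin (S' i) R \<and> \<one>\<^bsub>H i\<^esub> \<in> R \<and> set_power (H i) R n \<subseteq> B i" if i: "i \<in> I0" for i
    proof -
      have iI: "i \<in> I" using i I0(2) by blast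
      show ?thesis
      proof (rule abelian_topological_group.nbhd_root[OF ATG[OF iI] Bi[OF i]])
        fix R assume "openin (S' i) R" "\<one>\<^bsub>H i\<^esub> \<in> R" "set_power (H i) R n \<subseteq> B i"
        then show ?thesis by (intro exI[of _ R] conjI)
      qed
    qed
    then have "\<forall>i\<in>I0. \<exists>R. openin (S' i) R \<and> \<one>\<^bsub>H i\<^esub> \<in> R \<and> set_power (H i) R n \<subseteq> B i" ..
    from bchoice[OF this] obtain R where
      R: "\<forall>i\<in>I0. openin (S' i) (R i) \<and> \<one>\<^bsub>H i\<^esub> \<in> R i \<and> set_power (H i) (R i) n \<subseteq> B i" ..
    define P where "P = {x \<in> carrier F. \<forall>i\<in>I0. f x i \<in> R i}"
    have PF: "P \<subseteq> carrier F" unfolding P_def by blast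
    have "set_power F P n \<subseteq> N V"
    proof
      fix x assume x: "x \<in> set_power F P n"
      show "x \<in> N V"
      proof (rule mem)
        show "x \<in> carrier F" using x F.set_power_subset[OF PF] by blast
        fix i assume i: "i \<in> I0"
        then have iI: "i \<in> I" using I0(2) by blast
        have "f p i \<in> R i" if "p \<in> P" for p using that i unfolding P_def by blast
        from set_power_hom_image[OF F.is_group grp[OF iI] fi[OF iI] PF this x]
        show "f x i \<in> B i" using R i by blast
      qed
    qed
    moreover have "\<exists>J'\<subseteq>J. infinite J' \<and> (\<forall>i\<in>J'. \<forall>j\<in>J'. delta i w \<otimes>\<^bsub>F\<^esub> inv\<^bsub>F\<^esub> (delta j w) \<in> P)"
      if w: "w \<in> W" and J: "infinite J" for w J
    proof -
      have wX: "w \<in> carrier X" using w WX by blast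
      have "\<exists>J'\<subseteq>J. infinite J' \<and>
          (\<forall>i\<in>I0. \<forall>k\<in>J'. \<forall>l\<in>J'. f (delta k w) i \<otimes>\<^bsub>H i\<^esub> inv\<^bsub>H i\<^esub> (f (delta l w) i) \<in> R i)"
      proof (rule infinite_refine_finite[OF I0(1) _ _ J])
        fix i and J' :: "nat set" assume i: "i \<in> I0" "infinite J'"
        then have iI: "i \<in> I" using I0(2) by blast
        have "f (delta j w) i \<in> snd (AC i)" for j
        proof -
          have "delta j w \<in> ?D" using subsetD[OF W(3) delta_in_N[OF WX W(2) w]] .
          then have "f (delta j w) i \<in> fst (AC i)" using i(1) by blast
          then show ?thesis using AC i(1) by blast
        qed
        then show "\<exists>J''\<subseteq>J'. infinite J'' \<and>
            (\<forall>k\<in>J''. \<forall>l\<in>J''. f (delta k w) i \<otimes>\<^bsub>H i\<^esub> inv\<^bsub>H i\<^esub> (f (delta l w) i) \<in> R i)"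
          using AC R i by (intro abelian_topological_group.compactin_refine[OF ATG[OF iI], where C = "snd (AC i)"]) blast+
      qed blast
      then obtain J' where J': "J' \<subseteq> J" "infinite J'"
        "\<And>i k l. i \<in> I0 \<Longrightarrow> k \<in> J' \<Longrightarrow> l \<in> J' \<Longrightarrow> f (delta k w) i \<otimes>\<^bsub>H i\<^esub> inv\<^bsub>H i\<^esub> (f (delta l w) i) \<in> R i" by blast
      have "delta k w \<otimes>\<^bsub>F\<^esub> inv\<^bsub>F\<^esub> (delta l w) \<in> P" if kl: "k \<in> J'" "l \<in> J'" for k l
      proof -
        have c: "delta k w \<in> carrier F" "inv\<^bsub>F\<^esub> (delta l w) \<in> carrier F"
          using delta_carrier[OF wX] F.inv_closed by blast+
        have "f (delta k w \<otimes>\<^bsub>F\<^esub> inv\<^bsub>F\<^esub> (delta l w)) i \<in> R i" if i: "i \<in> I0" for i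
        proof -
          have iI: "i \<in> I" using i I0(2) by blast
          interpret h: group_hom F "H i" "\<lambda>x. f x i"
            using F.is_group grp[OF iI] fi[OF iI] by (simp add: group_hom_def group_hom_axioms_def)
          show ?thesis using J'(3)[OF i kl] h.hom_mult[OF c] h.hom_inv[OF delta_carrier[OF wX]] by (simp only:)
        qed
        then show ?thesis unfolding P_def using F.m_closed[OF c] by blast
      qed
      then show ?thesis using J'(1,2) by (intro exI[of _ J']) blast
    qed
    ultimately show ?thesis using PF by blast
  qed
  then show "\<exists>W. openin T W \<and> \<one>\<^bsub>X\<^esub> \<in> W \<and>
      (\<forall>n. \<exists>P\<subseteq>carrier F. set_power F P n \<subseteq> N V \<and>
        (\<forall>w\<in>W. \<forall>J. infinite J \<longrightarrow>
          (\<exists>J'\<subseteq>J. infinite J' \<and> (\<forall>i\<in>J'. \<forall>j\<in>J'. delta i w \<otimes>\<^bsub>F\<^esub> inv\<^bsub>F\<^esub> (delta j w) \<in> P))))"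
    using W(1,2) by (intro exI[of _ W]) blast
qed

end


section \<open>Nuclear groups of null sequences\<close>

text \<open>For convex symmetric B the sets \<open>sB\<close> act as the balls of radius s of a
  seminorm, and this is the triangle inequality. Working with the sets avoids the gauge, which could
  be infinite because B need not be absorbing.\<close>

lemma scaled_add:
  fixes B :: "'e::real_vector set"
  assumes B: "convex B" and x: "x \<in> (*\<^sub>R) s ` B" and y: "y \<in> (*\<^sub>R) t ` B" and st: "s \<ge> 0" "t \<ge> 0"
  shows "x + y \<in> (*\<^sub>R) (s + t) ` B"
proof -
  obtain b c where bc: "b \<in> B" "x = s *\<^sub>R b" "c \<in> B" "y = t *\<^sub>R c" using x y by blast
  show ?thesis
  proof (cases "s + t = 0")
    case True
    then have "s = 0" "t = 0" using st by auto
    then show ?thesis using bc by (intro image_eqI[of _ _ b]) simp_all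
  next
    case False
    then have p: "s + t > 0" using st by simp
    have "(s / (s + t)) *\<^sub>R b + (t / (s + t)) *\<^sub>R c \<in> B"
      using B bc(1,3) st p by (intro convexD) (simp_all add: add_divide_distrib[symmetric])
    moreover have "x + y = (s + t) *\<^sub>R ((s / (s + t)) *\<^sub>R b + (t / (s + t)) *\<^sub>R c)"
      using p by (simp add: bc(2,4) scaleR_add_right)
    ultimately show ?thesis by (rule image_eqI[rotated])
  qed
qed

lemma scaled_mono:
  fixes B :: "'e::real_vector set"
  assumes B: "convex B" "0 \<in> B" and x: "x \<in> (*\<^sub>R) s ` B" and st: "0 \<le> s" "s \<le> t"
  shows "x \<in> (*\<^sub>R) t ` B"
proof -
  have "0 \<in> (*\<^sub>R) (t - s) ` B" using B(2) by (intro image_eqI[of _ _ 0]) simp_all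
  from scaled_add[OF B(1) x this] st show ?thesis by simp
qed

lemma scaled_uminus:
  fixes B :: "'e::real_vector set"
  assumes "uminus ` B = B" "x \<in> (*\<^sub>R) s ` B"
  shows "- x \<in> (*\<^sub>R) s ` B"
proof -
  obtain b where b: "b \<in> B" "x = s *\<^sub>R b" using assms(2) by blast
  have "- b \<in> B" using b(1) assms(1) by blast
  then show ?thesis using b(2) by (intro image_eqI[of _ _ "- b"]) simp_all
qed

lemma scaled_diff:
  fixes B :: "'e::real_vector set"
  assumes "convex B" "uminus ` B = B" "x \<in> (*\<^sub>R) s ` B" "y \<in> (*\<^sub>R) t ` B" "s \<ge> 0" "t \<ge> 0"
  shows "x - y \<in> (*\<^sub>R) (s + t) ` B"
  using scaled_add[OF assms(1,3) scaled_uminus[OF assms(2,4)] assms(5,6)] by simp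

lemma scaled_scale:
  fixes B :: "'e::real_vector set"
  assumes "uminus ` B = B" "x \<in> (*\<^sub>R) s ` B"
  shows "r *\<^sub>R x \<in> (*\<^sub>R) (\<bar>r\<bar> * s) ` B"
proof -
  have "\<bar>r\<bar> *\<^sub>R x \<in> (*\<^sub>R) (\<bar>r\<bar> * s) ` B" using assms(2) by force
  moreover have "r *\<^sub>R x = \<bar>r\<bar> *\<^sub>R x \<or> r *\<^sub>R x = - (\<bar>r\<bar> *\<^sub>R x)" by (auto simp: abs_if)
  ultimately show ?thesis using scaled_uminus[OF assms(1)] by metis
qed

text \<open>Pigeonhole on the cells of a grid of mesh \<open>\<eta>\<close>.\<close>

lemma bounded_real_refine:
  fixes t :: "nat \<Rightarrow> real"
  assumes J: "infinite J" and t: "\<forall>j\<in>J. \<bar>t j\<bar> \<le> b" and "\<eta> > 0"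
  shows "\<exists>J'\<subseteq>J. infinite J' \<and> (\<forall>i\<in>J'. \<forall>j\<in>J'. \<bar>t i - t j\<bar> \<le> \<eta>)"
proof -
  let ?f = "\<lambda>j. \<lfloor>t j / \<eta>\<rfloor>"
  have "?f ` J \<subseteq> {\<lfloor>- b / \<eta>\<rfloor>..\<lfloor>b / \<eta>\<rfloor>}"
  proof
    fix z assume "z \<in> ?f ` J"
    then obtain j where j: "j \<in> J" "z = ?f j" by blast
    have "- b \<le> t j" "t j \<le> b" using bspec[OF t j(1)] by linarith+
    then have "- b / \<eta> \<le> t j / \<eta>" "t j / \<eta> \<le> b / \<eta>" using \<open>\<eta> > 0\<close> divide_right_mono[of "- b" "t j" \<eta>] divide_right_mono[of "t j" b \<eta>] by simp_all
    then show "z \<in> {\<lfloor>- b / \<eta>\<rfloor>..\<lfloor>b / \<eta>\<rfloor>}" unfolding j(2) by (simp add: floor_mono)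
  qed
  then have "finite (?f ` J)" by (rule finite_subset) simp
  from pigeonhole_infinite[OF J this] obtain k where k: "infinite {j \<in> J. ?f j = ?f k}" by blast
  have "\<bar>t i - t j\<bar> \<le> \<eta>" if "?f i = ?f k" "?f j = ?f k" for i j
  proof -
    have "\<bar>t i / \<eta> - t j / \<eta>\<bar> \<le> 1" using that by linarith
    then show ?thesis using \<open>\<eta> > 0\<close> by (simp add: diff_divide_distrib[symmetric] abs_divide)
  qed
  then have "\<forall>i\<in>{j \<in> J. ?f j = ?f k}. \<forall>j\<in>{j \<in> J. ?f j = ?f k}. \<bar>t i - t j\<bar> \<le> \<eta>" by simp
  with k show ?thesis by (intro exI[of _ "{j \<in> J. ?f j = ?f k}"] conjI) simp_all
qed

text \<open>Induction on the dimension. If \<open>v\<close> is arbitrarily close to the span of the other vectors, it is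
  replaced by approximations; otherwise the coefficients of \<open>v\<close> are bounded.\<close>

lemma finite_dimensional_refine:
  fixes B :: "'e::real_vector set"
  assumes B: "convex B" "uminus ` B = B" "0 \<in> B"
  shows "finite Vs \<Longrightarrow> Vs \<subseteq> B \<Longrightarrow> infinite (J :: nat set) \<Longrightarrow> s \<ge> 0 \<Longrightarrow> \<epsilon> > 0 \<Longrightarrow>
    \<forall>j\<in>J. a j \<in> span Vs \<and> a j \<in> (*\<^sub>R) s ` B \<Longrightarrow>
    \<exists>J'\<subseteq>J. infinite J' \<and> (\<forall>i\<in>J'. \<forall>j\<in>J'. a i - a j \<in> (*\<^sub>R) \<epsilon> ` B)"
proof (induction Vs arbitrary: J s \<epsilon> a rule: finite_induct)
  case empty
  have z: "0 \<in> (*\<^sub>R) \<epsilon> ` B" using B(3) by (intro image_eqI[of _ _ 0]) simp_all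
  have "a j = 0" if "j \<in> J" for j using bspec[OF empty.prems(5) that] by simp
  then have "\<forall>i\<in>J. \<forall>j\<in>J. a i - a j \<in> (*\<^sub>R) \<epsilon> ` B" using z by simp
  with empty.prems(2) show ?case by blast
next
  case (insert v Vs)
  have v: "v \<in> B" and Vs: "Vs \<subseteq> B" using insert.prems(1) by auto
  have "\<exists>t. a j - t *\<^sub>R v \<in> span Vs" if "j \<in> J" for j
    using bspec[OF insert.prems(5) that] span_breakdown_eq[of "a j" v Vs] by blast
  then have "\<forall>j\<in>J. \<exists>t. a j - t *\<^sub>R v \<in> span Vs" by blast
  from bchoice[OF this] obtain t where t: "\<forall>j\<in>J. a j - t j *\<^sub>R v \<in> span Vs" ..
  show ?case
  proof (cases "\<forall>\<delta>>0. \<exists>m\<in>span Vs. v - m \<in> (*\<^sub>R) \<delta> ` B")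
    case True
    \<comment> \<open>One third each for the approximation errors of \<open>a i\<close> and
      \<open>a j\<close> and for the difference of the approximations.\<close>
    define \<eta> where "\<eta> = \<epsilon> / 3"
    have \<eta>: "\<eta> > 0" using insert.prems(4) by (simp add: \<eta>_def)
    have "\<exists>m\<in>span Vs. t j *\<^sub>R v - m \<in> (*\<^sub>R) \<eta> ` B" for j
    proof (cases "t j = 0")
      case True
      have "0 \<in> (*\<^sub>R) \<eta> ` B" using B(3) by (intro image_eqI[of _ _ 0]) simp_all
      then show ?thesis using True by (intro bexI[of _ 0]) (simp_all add: span_zero)
    next
      case False
      then have "\<eta> / \<bar>t j\<bar> > 0" using \<eta> by simp
      then obtain m where m: "m \<in> span Vs" "v - m \<in> (*\<^sub>R) (\<eta> / \<bar>t j\<bar>) ` B" using True by blast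
      have "t j *\<^sub>R (v - m) \<in> (*\<^sub>R) (\<bar>t j\<bar> * (\<eta> / \<bar>t j\<bar>)) ` B" using B(2) m(2) by (rule scaled_scale)
      then have "t j *\<^sub>R v - t j *\<^sub>R m \<in> (*\<^sub>R) \<eta> ` B" using False by (simp add: scaleR_diff_right)
      then show ?thesis using span_scale[OF m(1)] by blast
    qed
    then have "\<forall>j. \<exists>m. m \<in> span Vs \<and> t j *\<^sub>R v - m \<in> (*\<^sub>R) \<eta> ` B" by blast
    from choice[OF this] obtain m where m: "\<forall>j. m j \<in> span Vs \<and> t j *\<^sub>R v - m j \<in> (*\<^sub>R) \<eta> ` B" ..
    define l where "l j = (a j - t j *\<^sub>R v) + m j" for j
    have al: "a j - l j \<in> (*\<^sub>R) \<eta> ` B" for j using m by (simp add: l_def)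
    have l: "l j \<in> span Vs \<and> l j \<in> (*\<^sub>R) (s + \<eta>) ` B" if j: "j \<in> J" for j
    proof
      show "l j \<in> span Vs" unfolding l_def using t m j by (intro span_add) blast+
      have "a j - (a j - l j) \<in> (*\<^sub>R) (s + \<eta>) ` B"
        using scaled_diff[OF B(1,2) conjunct2[OF bspec[OF insert.prems(5) j]] al insert.prems(3) less_imp_le[OF \<eta>]] .
      then show "l j \<in> (*\<^sub>R) (s + \<eta>) ` B" by simp
    qed
    have ll: "\<forall>j\<in>J. l j \<in> span Vs \<and> l j \<in> (*\<^sub>R) (s + \<eta>) ` B" using l by (intro ballI)
    have "s + \<eta> \<ge> 0" using insert.prems(3) \<eta> by simp
    from insert.IH[OF Vs insert.prems(2) this \<eta> ll]
    obtain J' where J': "J' \<subseteq> J" "infinite J'" "\<forall>i\<in>J'. \<forall>j\<in>J'. l i - l j \<in> (*\<^sub>R) \<eta> ` B"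
      by (elim exE conjE) (rule that)
    have "a i - a j \<in> (*\<^sub>R) \<epsilon> ` B" if "i \<in> J'" "j \<in> J'" for i j
    proof -
      have "l i - l j \<in> (*\<^sub>R) \<eta> ` B" using J'(3) that by blast
      then have "(l i - l j) + (a i - l i) \<in> (*\<^sub>R) (\<eta> + \<eta>) ` B"
        by (rule scaled_add[OF B(1) _ al less_imp_le[OF \<eta>] less_imp_le[OF \<eta>]])
      then have "(l i - l j) + (a i - l i) - (a j - l j) \<in> (*\<^sub>R) (\<eta> + \<eta> + \<eta>) ` B"
        by (rule scaled_diff[OF B(1,2) _ al]) (use \<eta> in simp_all)
      then show ?thesis by (simp add: \<eta>_def)
    qed
    then show ?thesis using J'(1,2) by blast
  next
    case False
    then obtain d where d: "d > 0" "\<And>m. m \<in> span Vs \<Longrightarrow> v - m \<notin> (*\<^sub>R) d ` B" by blast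
    \<comment> \<open>A larger coefficient would contradict the choice of d: dividing
      \<open>a j\<close> by \<open>t j\<close> would give a point of \<open>dB\<close> of the form v
      minus an element of the span of \<open>Vs\<close>.\<close>
    have tb: "\<bar>t j\<bar> \<le> s / d" if j: "j \<in> J" for j
    proof (rule ccontr)
      assume "\<not> ?thesis"
      then have gt: "s / d < \<bar>t j\<bar>" by simp
      then have t0: "t j \<noteq> 0" using insert.prems(3) d(1) by (metis abs_zero divide_nonneg_pos not_le)
      have "(1 / t j) *\<^sub>R a j \<in> (*\<^sub>R) (\<bar>1 / t j\<bar> * s) ` B"
        by (rule scaled_scale[OF B(2) conjunct2[OF bspec[OF insert.prems(5) j]]])
      moreover have "\<bar>1 / t j\<bar> * s \<le> d" using gt t0 d(1) by (simp add: field_simps)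
      moreover have "0 \<le> \<bar>1 / t j\<bar> * s" using insert.prems(3) by simp
      ultimately have "(1 / t j) *\<^sub>R a j \<in> (*\<^sub>R) d ` B" by (metis scaled_mono[OF B(1,3)])
      moreover have "(1 / t j) *\<^sub>R a j = v - (- 1 / t j) *\<^sub>R (a j - t j *\<^sub>R v)"
        using t0 by (simp add: scaleR_diff_right)
      moreover have "(- 1 / t j) *\<^sub>R (a j - t j *\<^sub>R v) \<in> span Vs" by (rule span_scale[OF bspec[OF t j]])
      ultimately show False using d(2)[of "(- 1 / t j) *\<^sub>R (a j - t j *\<^sub>R v)"] by (simp only: not_True_eq_False)
    qed
    have tb': "\<forall>j\<in>J. \<bar>t j\<bar> \<le> s / d" using tb by (rule ballI)
    have e2: "\<epsilon> / 2 > 0" using insert.prems(4) by simp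
    obtain J1 where J1: "J1 \<subseteq> J" "infinite J1" "\<forall>i\<in>J1. \<forall>j\<in>J1. \<bar>t i - t j\<bar> \<le> \<epsilon> / 2"
      using bounded_real_refine[OF insert.prems(2) tb' e2] by (elim exE conjE) (rule that)
    let ?m = "\<lambda>j. a j - t j *\<^sub>R v"
    have v1: "v \<in> (*\<^sub>R) 1 ` B" using v by simp
    have m: "?m j \<in> span Vs \<and> ?m j \<in> (*\<^sub>R) (s + s / d) ` B" if j: "j \<in> J1" for j
    proof
      have jJ: "j \<in> J" using j J1(1) by blast
      show "?m j \<in> span Vs" using t jJ by blast
      have "t j *\<^sub>R v \<in> (*\<^sub>R) (\<bar>t j\<bar> * 1) ` B" by (rule scaled_scale[OF B(2) v1])
      from scaled_mono[OF B(1,3) this, of "s / d"]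
      have "t j *\<^sub>R v \<in> (*\<^sub>R) (s / d) ` B" using tb[OF jJ] by simp
      then show "?m j \<in> (*\<^sub>R) (s + s / d) ` B"
        by (rule scaled_diff[OF B(1,2) conjunct2[OF bspec[OF insert.prems(5) jJ]] _ insert.prems(3)])
          (use insert.prems(3) d(1) in simp)
    qed
    have mm: "\<forall>j\<in>J1. ?m j \<in> span Vs \<and> ?m j \<in> (*\<^sub>R) (s + s / d) ` B" using m by (intro ballI)
    have "s + s / d \<ge> 0" using insert.prems(3) d(1) by simp
    from insert.IH[OF Vs J1(2) this e2 mm]
    obtain J' where J': "J' \<subseteq> J1" "infinite J'" "\<forall>i\<in>J'. \<forall>j\<in>J'. ?m i - ?m j \<in> (*\<^sub>R) (\<epsilon> / 2) ` B"
      by (elim exE conjE) (rule that)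
    have "a i - a j \<in> (*\<^sub>R) \<epsilon> ` B" if ij: "i \<in> J'" "j \<in> J'" for i j
    proof -
      have "(t i - t j) *\<^sub>R v \<in> (*\<^sub>R) (\<bar>t i - t j\<bar> * 1) ` B" by (rule scaled_scale[OF B(2) v1])
      from scaled_mono[OF B(1,3) this] have *: "(t i - t j) *\<^sub>R v \<in> (*\<^sub>R) (\<epsilon> / 2) ` B" if "\<bar>t i - t j\<bar> * 1 \<le> \<epsilon> / 2"
        using that by simp
      have "\<bar>t i - t j\<bar> * 1 \<le> \<epsilon> / 2" using J1(3) subsetD[OF J'(1) ij(1)] subsetD[OF J'(1) ij(2)] by simp
      then have tv: "(t i - t j) *\<^sub>R v \<in> (*\<^sub>R) (\<epsilon> / 2) ` B" by (rule *)
      have "?m i - ?m j \<in> (*\<^sub>R) (\<epsilon> / 2) ` B" using J'(3) ij by blast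
      then have "(?m i - ?m j) + (t i - t j) *\<^sub>R v \<in> (*\<^sub>R) (\<epsilon> / 2 + \<epsilon> / 2) ` B"
        by (rule scaled_add[OF B(1) _ tv]) (use e2 in simp_all)
      then show ?thesis by (simp add: algebra_simps)
    qed
    then show ?thesis using J'(1,2) J1(1) by blast
  qed
qed

text \<open>The bound for k = 1 places A inside \<open>2B\<close>; the bound for large k places A
  within a small multiple of B from a finite-dimensional space. The bounded approximations in that
  space can be refined, and the refinement carries over to the points of A.\<close>

lemma kolmogorov_diameter_refine:
  fixes A B E :: "'e::real_vector set"
  assumes B: "convex B" "uminus ` B = B" "0 \<in> B"
    and kol: "\<And>k. k \<ge> 1 \<Longrightarrow> kolmogorov_diameter E k A B \<le> ereal (1 / real k ^ 1)"
    and J: "infinite (J :: nat set)" and a: "\<And>j. j \<in> J \<Longrightarrow> a j \<in> A" and "\<epsilon> > 0"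
  shows "\<exists>J'\<subseteq>J. infinite J' \<and> (\<forall>i\<in>J'. \<forall>j\<in>J'. a i - a j \<in> (*\<^sub>R) \<epsilon> ` B)"
proof -
  have ex: "\<exists>t L. 0 < t \<and> t < c \<and> subspace L \<and> (\<exists>b. finite b \<and> span b = L) \<and> dim L < k \<and>
      A \<subseteq> {t *\<^sub>R y + l | y l. y \<in> B \<and> l \<in> L}" if "k \<ge> 1" "1 / real k < c" for k c
  proof -
    have "kolmogorov_diameter E k A B < ereal c"
      using kol[OF that(1)] that(2) by (simp add: le_less_trans)
    then obtain e where e: "e < ereal c" "\<exists>t. e = ereal t \<and> t > 0 \<and> (\<exists>L. subspace L \<and> L \<subseteq> E \<and>
        (\<exists>b. finite b \<and> span b = L) \<and> dim L < k \<and> A \<subseteq> {t *\<^sub>R y + l | y l. y \<in> B \<and> l \<in> L})"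
      unfolding kolmogorov_diameter_def Inf_less_iff by blast
    then obtain t L where tL: "e = ereal t" "0 < t" "subspace L" "\<exists>b. finite b \<and> span b = L" "dim L < k"
      "A \<subseteq> {t *\<^sub>R y + l | y l. y \<in> B \<and> l \<in> L}" by blast
    have "t < c" using e(1) tL(1) by simp
    show ?thesis by (rule exI[of _ t], rule exI[of _ L]) (intro conjI tL(2-6) \<open>t < c\<close>)
  qed
  \<comment> \<open>Any constant above the bound 1 would do in place of 2. That L1 is trivial uses
    its finite spanning set, since \<open>dim\<close> is 0 on infinite-dimensional spaces
    too.\<close>
  obtain t1 L1 where 1: "0 < t1" "t1 < 2" "subspace L1" "\<exists>b. finite b \<and> span b = L1" "dim L1 < 1"
    "A \<subseteq> {t1 *\<^sub>R y + l | y l. y \<in> B \<and> l \<in> L1}" using ex[of 1 2] by auto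
  have "L1 = {0}"
  proof -
    obtain b where b: "finite b" "span b = L1" using 1(4) by blast
    obtain b' where b': "b' \<subseteq> L1" "independent b'" "L1 \<subseteq> span b'" "card b' = dim L1"
      using basis_exists[of L1] by metis
    have "finite b'" using independent_span_bound[OF b(1) b'(2)] b'(1) b(2) by simp
    then have "b' = {}" using b'(4) 1(5) by simp
    then show ?thesis using b'(3) subspace_0[OF 1(3)] by auto
  qed
  have A2: "x \<in> (*\<^sub>R) 2 ` B" if "x \<in> A" for x
  proof -
    have "x \<in> (*\<^sub>R) t1 ` B" using that 1(6) \<open>L1 = {0}\<close> by auto
    then show ?thesis by (rule scaled_mono[OF B(1,3)]) (use 1(1,2) in simp_all)
  qed
  define \<eta> where "\<eta> = \<epsilon> / 3"
  have \<eta>: "\<eta> > 0" using \<open>\<epsilon> > 0\<close> by (simp add: \<eta>_def)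
  obtain k :: nat where k: "1 / \<eta> < real k" using reals_Archimedean2 by blast
  then have "real k > 0" using \<eta> by (meson divide_pos_pos less_trans zero_less_one)
  then have k1: "k \<ge> 1" "1 / real k < \<eta>" using k \<eta> by (auto simp: field_simps)
  obtain t L where t: "0 < t" "t < \<eta>" "subspace L" "\<exists>b. finite b \<and> span b = L"
    "A \<subseteq> {t *\<^sub>R y + l | y l. y \<in> B \<and> l \<in> L}" using ex[OF k1] by blast
  have "\<forall>j\<in>J. \<exists>p. fst p \<in> B \<and> snd p \<in> L \<and> a j = t *\<^sub>R fst p + snd p"
    using a t(5) by fastforce
  from bchoice[OF this] obtain p where p: "\<forall>j\<in>J. fst (p j) \<in> B \<and> snd (p j) \<in> L \<and> a j = t *\<^sub>R fst (p j) + snd (p j)" ..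
  define l where "l j = snd (p j)" for j
  have tB: "a j - l j \<in> (*\<^sub>R) t ` B" if "j \<in> J" for j using p that unfolding l_def by auto
  have l3: "l j \<in> (*\<^sub>R) (2 + t) ` B" if "j \<in> J" for j
  proof -
    have "a j - (a j - l j) \<in> (*\<^sub>R) (2 + t) ` B"
      by (rule scaled_diff[OF B(1,2) A2[OF a[OF that]] tB[OF that]]) (use t(1) in simp_all)
    then show ?thesis by simp
  qed
  \<comment> \<open>The basis is taken from the approximations \<open>l j\<close> and not from all
    of L: these lie in \<open>(2 + t)B\<close> and can be scaled into B, whereas L may contain
    directions that no multiple of B reaches.\<close>
  obtain Vs where Vs: "Vs \<subseteq> l ` J" "independent Vs" "l ` J \<subseteq> span Vs"
    using maximal_independent_subset[of "l ` J"] by metis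
  have "l ` J \<subseteq> L" using p by (auto simp: l_def)
  obtain b where b: "finite b" "span b = L" using t(4) by (elim exE conjE)
  have "Vs \<subseteq> span b" unfolding b(2) using Vs(1) \<open>l ` J \<subseteq> L\<close> by (rule subset_trans)
  from conjunct1[OF independent_span_bound[OF b(1) Vs(2) this]] have "finite Vs" .
  let ?c = "1 / (2 + t)"
  have c: "?c > 0" using t(1) by simp
  let ?Vs = "(*\<^sub>R) ?c ` Vs"
  have subB: "?Vs \<subseteq> B"
  proof
    fix x assume "x \<in> ?Vs"
    then obtain j where j: "j \<in> J" "x = ?c *\<^sub>R l j" using Vs(1) by blast
    then obtain b where "b \<in> B" "l j = (2 + t) *\<^sub>R b" using l3 by blast
    then show "x \<in> B" using j t(1) by simp
  qed
  have "l j \<in> span ?Vs" if "j \<in> J" for j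
  proof -
    have "Vs \<subseteq> span ?Vs"
    proof
      fix x assume "x \<in> Vs"
      then have "?c *\<^sub>R x \<in> span ?Vs" by (intro span_base) blast
      from span_scale[OF this, of "2 + t"] show "x \<in> span ?Vs" using t(1) by simp
    qed
    then have "span Vs \<subseteq> span ?Vs" by (rule span_minimal) simp
    then show ?thesis using Vs(3) that by blast
  qed
  then have lV: "\<forall>j\<in>J. l j \<in> span ?Vs \<and> l j \<in> (*\<^sub>R) (2 + t) ` B" using l3 by (intro ballI conjI)
  have t2: "2 + t \<ge> 0" using t(1) by simp
  obtain J' where J': "J' \<subseteq> J" "infinite J'" "\<forall>i\<in>J'. \<forall>j\<in>J'. l i - l j \<in> (*\<^sub>R) \<eta> ` B"
    using finite_dimensional_refine[OF B finite_imageI[OF \<open>finite Vs\<close>] subB J t2 \<eta> lV] by (elim exE conjE) (rule that)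
  have "a i - a j \<in> (*\<^sub>R) \<epsilon> ` B" if ij: "i \<in> J'" "j \<in> J'" for i j
  proof -
    have m: "a j - l j \<in> (*\<^sub>R) \<eta> ` B" if "j \<in> J'" for j
      by (rule scaled_mono[OF B(1,3) tB[OF subsetD[OF J'(1) that]]]) (use t(1,2) in simp_all)
    have "l i - l j \<in> (*\<^sub>R) \<eta> ` B" using J'(3) ij by blast
    then have "(l i - l j) + (a i - l i) \<in> (*\<^sub>R) (\<eta> + \<eta>) ` B"
      by (rule scaled_add[OF B(1) _ m[OF ij(1)]]) (use \<eta> in simp_all)
    then have "(l i - l j) + (a i - l i) - (a j - l j) \<in> (*\<^sub>R) (\<eta> + \<eta> + \<eta>) ` B"
      by (rule scaled_diff[OF B(1,2) _ m[OF ij(2)]]) (use \<eta> in simp_all)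
    then show ?thesis by (simp add: \<eta>_def)
  qed
  then show ?thesis using J'(1,2) by blast
qed

context LCA_null_sequences
begin

text \<open>Nuclearity is applied to \<open>N V\<close> with c = m = 1. Here W is the neighbourhood
  whose \<open>delta j w\<close> have preimages in A, and the n-th part P is the image of
  \<open>K\<close> intersected with B scaled by about 1/n: adding n of its vectors stays inside
  B.\<close>

theorem totally_disconnected_if_nuclear:
  assumes "nuclear_group TYPE('e::real_vector) F S"
  shows "totally_disconnected_space T"
proof (rule totally_disconnected_if_refinable[OF Hausdorff_X])
  fix V assume V: "openin T V" "\<one>\<^bsub>X\<^esub> \<in> V"
  note nuc = assms[unfolded nuclear_group_def, THEN conjunct2, THEN conjunct2, rule_format,
      of "N V" 1 1, OF conjI[OF nbhd_N[OF V] zero_less_one]]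
  obtain E A B :: "'e set" and K \<phi> where
    E: "subspace E" and "A \<subseteq> E" "convex A" "uminus ` A = A" "B \<subseteq> E" and AB: "convex B" "uminus ` B = B"
    and kol': "\<forall>k\<ge>1. kolmogorov_diameter E k A B \<le> ereal (1 / real k ^ 1)"
    and K: "subgroup K (additive_group E)" and \<phi>: "\<phi> \<in> hom (additive_group K) F"
    and nb: "neighbourhood_of_one F S (\<phi> ` (K \<inter> A))" and sub: "\<phi> ` (K \<inter> B) \<subseteq> N V"
    using nuc by (elim exE conjE) (rule that)
  have kol: "kolmogorov_diameter E k A B \<le> ereal (1 / real k ^ 1)" if "k \<ge> 1" for k using kol' that by blast
  have Ka: "0 \<in> K" "\<And>x y. x \<in> K \<Longrightarrow> y \<in> K \<Longrightarrow> x + y \<in> K"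
    using subgroup.one_closed[OF K] subgroup.m_closed[OF K] by (simp_all add: additive_group_def)
  have Km: "- x \<in> K" if x: "x \<in> K" for x
  proof -
    have KE: "K \<subseteq> E" using subgroup.subset[OF K] by (simp add: additive_group_def)
    have gE: "group (additive_group E)"
    proof (rule groupI)
      show "\<exists>y\<in>carrier (additive_group E). y \<otimes>\<^bsub>additive_group E\<^esub> x = \<one>\<^bsub>additive_group E\<^esub>"
        if "x \<in> carrier (additive_group E)" for x
        using that subspace_neg[OF E, of x] by (intro bexI[of _ "- x"]) (auto simp: additive_group_def)
    qed (auto simp: additive_group_def add.assoc subspace_0[OF E] subspace_add[OF E])
    have "inv\<^bsub>additive_group E\<^esub> x = - x"
      using x KE subspace_neg[OF E, of x] by (intro group.inv_equality[OF gE]) (auto simp: additive_group_def)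
    then show ?thesis using subgroup.m_inv_closed[OF K x] by simp
  qed
  have \<phi>F: "\<phi> x \<in> carrier F" if "x \<in> K" for x using \<phi> that by (auto simp: hom_def additive_group_def)
  have \<phi>add: "\<phi> (x + y) = \<phi> x \<otimes>\<^bsub>F\<^esub> \<phi> y" if "x \<in> K" "y \<in> K" for x y
    using \<phi> that by (simp add: hom_def additive_group_def del: mult_F)
  have \<phi>0: "\<phi> 0 = \<one>\<^bsub>F\<^esub>"
  proof -
    have "\<phi> 0 \<otimes>\<^bsub>F\<^esub> \<phi> 0 = \<phi> 0" using \<phi>add[OF Ka(1) Ka(1)] by (simp del: mult_F)
    then show ?thesis using F.l_cancel_one[OF \<phi>F[OF Ka(1)] \<phi>F[OF Ka(1)]] by blast
  qed
  have \<phi>diff: "\<phi> (x - y) = \<phi> x \<otimes>\<^bsub>F\<^esub> inv\<^bsub>F\<^esub> (\<phi> y)" if "x \<in> K" "y \<in> K" for x y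
  proof -
    have "\<phi> (- y) \<otimes>\<^bsub>F\<^esub> \<phi> y = \<one>\<^bsub>F\<^esub>" using \<phi>add[OF Km[OF that(2)] that(2)] \<phi>0 by (simp del: mult_F one_F)
    then have "inv\<^bsub>F\<^esub> (\<phi> y) = \<phi> (- y)" by (rule F.inv_equality[OF _ \<phi>F[OF that(2)] \<phi>F[OF Km[OF that(2)]]])
    then show ?thesis using \<phi>add[OF that(1) Km[OF that(2)]] by (simp del: mult_F)
  qed
  \<comment> \<open>With B empty the infimum would run over the empty set and be infinite, because A
    has an element over \<open>\<one>\<close>. Once B is non-empty, symmetry and convexity put 0
    into B.\<close>
  have "B \<noteq> {}"
  proof
    assume "B = {}"
    have "\<one>\<^bsub>F\<^esub> \<in> \<phi> ` (K \<inter> A)" using nb unfolding neighbourhood_of_one_def by blast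
    then obtain x where "x \<in> A" by blast
    have "kolmogorov_diameter E 1 A B < \<infinity>" by (rule le_less_trans[OF kol[OF order_refl]]) simp
    then show False using \<open>B = {}\<close> \<open>x \<in> A\<close> unfolding kolmogorov_diameter_def Inf_less_iff by auto
  qed
  then obtain b where b: "b \<in> B" by blast
  then have "- b \<in> B" using AB(2) by blast
  then have "(1/2) *\<^sub>R b + (1/2) *\<^sub>R (- b) \<in> B" using AB(1) b by (intro convexD) auto
  then have B0: "0 \<in> B" by simp
  obtain W where W: "openin T W" "\<one>\<^bsub>X\<^esub> \<in> W" "N W \<subseteq> \<phi> ` (K \<inter> A)" using nb unfolding nbhd_iff by blast
  have WX: "W \<subseteq> carrier X" using X.carrier_if_openin[OF W(1)] by blast
  have main: "\<exists>P\<subseteq>carrier F. set_power F P n \<subseteq> N V \<and>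
        (\<forall>w\<in>W. \<forall>J. infinite J \<longrightarrow>
          (\<exists>J'\<subseteq>J. infinite J' \<and> (\<forall>i\<in>J'. \<forall>j\<in>J'. delta i w \<otimes>\<^bsub>F\<^esub> inv\<^bsub>F\<^esub> (delta j w) \<in> P)))" for n
  proof -
    \<comment> \<open>The successor makes the definition sound for n = 0 and still leaves
      \<open>n * \<epsilon>\<close> at most 1.\<close>
    define \<epsilon> where "\<epsilon> = 1 / real (Suc n)"
    have \<epsilon>: "\<epsilon> > 0" by (simp add: \<epsilon>_def)
    define P where "P = \<phi> ` (K \<inter> (*\<^sub>R) \<epsilon> ` B)"
    have PF: "P \<subseteq> carrier F" using \<phi>F unfolding P_def by blast
    have pw: "x \<in> \<phi> ` (K \<inter> (*\<^sub>R) (real k * \<epsilon>) ` B)" if "x \<in> set_power F P k" for x k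
      using that
    proof (induction k arbitrary: x)
      case 0
      then have "x = \<phi> 0" using \<phi>0 by (simp del: one_F)
      moreover have "0 \<in> (*\<^sub>R) (real 0 * \<epsilon>) ` B" using b by (intro image_eqI[of _ _ b]) simp_all
      ultimately show ?case using Ka(1) by blast
    next
      case (Suc k)
      then obtain p q where pq: "p \<in> P" "q \<in> set_power F P k" "x = p \<otimes>\<^bsub>F\<^esub> q"
        by (auto simp: set_mult_def simp del: mult_F)
      obtain y where y: "y \<in> K" "y \<in> (*\<^sub>R) \<epsilon> ` B" "p = \<phi> y" using pq(1) unfolding P_def by blast
      obtain z where z: "z \<in> K" "z \<in> (*\<^sub>R) (real k * \<epsilon>) ` B" "q = \<phi> z" using Suc.IH[OF pq(2)] by blast
      have "x = \<phi> (y + z)" unfolding pq(3) y(3) z(3) using \<phi>add[OF y(1) z(1)] by (rule sym)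
      moreover have "y + z \<in> (*\<^sub>R) (\<epsilon> + real k * \<epsilon>) ` B"
        by (intro scaled_add[OF AB(1) y(2) z(2)]) (use \<epsilon> in simp_all)
      then have "y + z \<in> (*\<^sub>R) (real (Suc k) * \<epsilon>) ` B" by (simp add: algebra_simps)
      ultimately show ?case using Ka(2)[OF y(1) z(1)] by blast
    qed
    have setP: "set_power F P n \<subseteq> N V"
    proof
      fix x assume "x \<in> set_power F P n"
      then obtain y where y: "y \<in> K" "y \<in> (*\<^sub>R) (real n * \<epsilon>) ` B" "x = \<phi> y" using pw by blast
      have "real n * \<epsilon> \<le> 1" by (simp add: \<epsilon>_def)
      then have "y \<in> (*\<^sub>R) 1 ` B"
        by (intro scaled_mono[OF AB(1) B0 y(2)]) (use \<epsilon> in simp_all)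
      then have "y \<in> B" by simp
      then show "x \<in> N V" using sub y(1,3) by blast
    qed
    have refP: "\<exists>J'\<subseteq>J. infinite J' \<and> (\<forall>i\<in>J'. \<forall>j\<in>J'. delta i w \<otimes>\<^bsub>F\<^esub> inv\<^bsub>F\<^esub> (delta j w) \<in> P)"
      if w: "w \<in> W" and J: "infinite J" for w J
    proof -
      have "\<exists>y. y \<in> K \<and> y \<in> A \<and> \<phi> y = delta j w" for j
      proof -
        have "delta j w \<in> \<phi> ` (K \<inter> A)" by (rule subsetD[OF W(3) delta_in_N[OF WX W(2) w]])
        then obtain y where "delta j w = \<phi> y" "y \<in> K \<inter> A" by (rule imageE)
        then show ?thesis by (intro exI[of _ y]) simp
      qed
      then have "\<forall>j. \<exists>y. y \<in> K \<and> y \<in> A \<and> \<phi> y = delta j w" by (rule allI)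
      from choice[OF this] obtain a where a: "\<forall>j. a j \<in> K \<and> a j \<in> A \<and> \<phi> (a j) = delta j w" ..
      have "\<exists>J'\<subseteq>J. infinite J' \<and> (\<forall>i\<in>J'. \<forall>j\<in>J'. a i - a j \<in> (*\<^sub>R) \<epsilon> ` B)"
      proof (rule kolmogorov_diameter_refine[OF AB B0 _ J _ \<epsilon>])
        show "kolmogorov_diameter E k A B \<le> ereal (1 / real k ^ 1)" if "k \<ge> 1" for k using that by (rule kol)
        show "a j \<in> A" for j using a by blast
      qed
      then obtain J' where J': "J' \<subseteq> J" "infinite J'" "\<forall>i\<in>J'. \<forall>j\<in>J'. a i - a j \<in> (*\<^sub>R) \<epsilon> ` B" by blast
      have "delta i w \<otimes>\<^bsub>F\<^esub> inv\<^bsub>F\<^esub> (delta j w) \<in> P" if ij: "i \<in> J'" "j \<in> J'" for i j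
      proof -
        have aij: "a i \<in> K" "a j \<in> K" "\<phi> (a i) = delta i w" "\<phi> (a j) = delta j w" using a by blast+
        have "\<phi> (a i - a j) = delta i w \<otimes>\<^bsub>F\<^esub> inv\<^bsub>F\<^esub> (delta j w)"
          using \<phi>diff[OF aij(1,2)] unfolding aij(3,4) .
        moreover have "a i - a j \<in> K" using Ka(2)[OF aij(1) Km[OF aij(2)]] by simp
        moreover have "a i - a j \<in> (*\<^sub>R) \<epsilon> ` B" using J'(3) ij by blast
        ultimately show ?thesis unfolding P_def by (metis IntI image_eqI)
      qed
      then have "\<forall>i\<in>J'. \<forall>j\<in>J'. delta i w \<otimes>\<^bsub>F\<^esub> inv\<^bsub>F\<^esub> (delta j w) \<in> P" by simp
      with J'(1,2) show ?thesis by (intro exI[of _ J'] conjI)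
    qed
    show ?thesis
      by (rule exI[of _ P], intro conjI PF setP ballI allI impI) (rule refP)
  qed
  show "\<exists>W. openin T W \<and> \<one>\<^bsub>X\<^esub> \<in> W \<and>
      (\<forall>n. \<exists>P\<subseteq>carrier F. set_power F P n \<subseteq> N V \<and>
        (\<forall>w\<in>W. \<forall>J. infinite J \<longrightarrow>
          (\<exists>J'\<subseteq>J. infinite J' \<and> (\<forall>i\<in>J'. \<forall>j\<in>J'. delta i w \<otimes>\<^bsub>F\<^esub> inv\<^bsub>F\<^esub> (delta j w) \<in> P))))"
    by (rule exI[of _ W], intro conjI allI W(1,2) main)
qed

end


section \<open>Null sequences over groups that are not totally disconnected\<close>

lemma limitin_topology_generated_by:
  assumes "l \<in> \<Union>\<S>" and ev: "\<And>U. U \<in> \<S> \<Longrightarrow> l \<in> U \<Longrightarrow> eventually (\<lambda>x. f x \<in> U) F"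
  shows "limitin (topology_generated_by \<S>) f l F"
  unfolding limitin_def topology_generated_by_topspace
proof (intro conjI allI impI, rule assms(1))
  fix U assume U: "openin (topology_generated_by \<S>) U \<and> l \<in> U"
  have "generate_topology_on \<S> U" using U openin_topology_generated_by_iff by blast
  then have "l \<in> U \<longrightarrow> eventually (\<lambda>x. f x \<in> U) F"
  proof (induction rule: generate_topology_on.induct)
    case (Int a b)
    then show ?case by (auto simp: eventually_conj_iff)
  next
    case (UN K)
    show ?case
    proof
      assume "l \<in> \<Union>K"
      then obtain k where k: "k \<in> K" "l \<in> k" by blast
      then have "eventually (\<lambda>x. f x \<in> k) F" using UN by blast
      then show "eventually (\<lambda>x. f x \<in> \<Union>K) F" by (rule eventually_mono) (use k in blast)
    qed
  next
    case (Basis s)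
    then show ?case using ev by blast
  qed simp
  then show "eventually (\<lambda>x. f x \<in> U) F" using U by blast
qed

text \<open>A sequence in this set either takes some value infinitely often, or converges to l by
  itself: outside a neighbourhood of l only finitely many values are available, each attained
  finitely often.\<close>

lemma sequentially_compactin_insert_limit:
  assumes l: "limitin T s l sequentially" and s: "range s \<subseteq> topspace T"
  shows "sequentially_compactin T (insert l (range s))"
  unfolding sequentially_compactin_def
proof (intro conjI allI impI)
  have lT: "l \<in> topspace T" using l by (rule limitin_topspace)
  then show "insert l (range s) \<subseteq> topspace T" using s by blast
  fix \<sigma> :: "nat \<Rightarrow> 'a" assume \<sigma>: "range \<sigma> \<subseteq> insert l (range s)"
  show "\<exists>a\<in>insert l (range s). \<exists>r :: nat \<Rightarrow> nat. strict_mono r \<and> limitin T (\<sigma> \<circ> r) a sequentially"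
  proof (cases "\<exists>v. infinite {n. \<sigma> n = v}")
    case True
    then obtain v where v: "infinite {n. \<sigma> n = v}" by blast
    let ?r = "enumerate {n. \<sigma> n = v}"
    have "\<sigma> (?r n) = v" for n using enumerate_in_set[OF v, of n] by simp
    then have eq: "\<sigma> \<circ> ?r = (\<lambda>_. v)" by auto
    have vm: "v \<in> insert l (range s)" using \<sigma> \<open>\<And>n. \<sigma> (?r n) = v\<close> by (metis rangeI subsetD)
    then have "v \<in> topspace T" using lT s by blast
    then have "limitin T (\<sigma> \<circ> ?r) v sequentially" unfolding eq by (simp add: limitin_const)
    with vm strict_mono_enumerate[OF v] show ?thesis by blast
  next
    case False
    have "limitin T \<sigma> l sequentially"
      unfolding limitin_def
    proof (intro conjI allI impI lT)
      fix U assume U: "openin T U \<and> l \<in> U"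
      then obtain N where N: "\<And>k. k \<ge> N \<Longrightarrow> s k \<in> U" using l unfolding limitin_sequentially by blast
      have "{n. \<sigma> n \<notin> U} \<subseteq> (\<Union>k<N. {n. \<sigma> n = s k})"
      proof
        fix n assume n: "n \<in> {n. \<sigma> n \<notin> U}"
        then have "\<sigma> n \<noteq> l" using U by auto
        then obtain k where k: "\<sigma> n = s k" using \<sigma> by blast
        then have "k < N" using N[of k] n by (intro not_le_imp_less) auto
        then show "n \<in> (\<Union>k<N. {n. \<sigma> n = s k})" using k by blast
      qed
      moreover have "finite (\<Union>k<N. {n. \<sigma> n = s k})" using False by blast
      ultimately have "finite {n. \<sigma> n \<notin> U}" by (rule finite_subset)
      then show "eventually (\<lambda>n. \<sigma> n \<in> U) sequentially"
        unfolding cofinite_eq_sequentially[symmetric] eventually_cofinite .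
    qed
    then have "limitin T (\<sigma> \<circ> id) l sequentially" by simp
    moreover have "strict_mono (id :: nat \<Rightarrow> nat)" by (simp add: strict_mono_def)
    ultimately show ?thesis by blast
  qed
qed

text \<open>Adding an angle below \<open>pi / 2\<close> to a sum in \<open>[0, pi / 2)\<close> stays
  below \<open>pi\<close>, where a positive cosine forces the new sum below \<open>pi / 2\<close>
  again. So sums of angles of size at least \<open>\<epsilon>\<close> never leave this interval,
  which bounds their number by \<open>pi / (2 * \<epsilon>)\<close>.\<close>

lemma finite_large_angles:
  fixes \<theta> :: "nat \<Rightarrow> real"
  assumes cos: "\<And>S. finite S \<Longrightarrow> cos (\<Sum>k\<in>S. \<theta> k) > 0" and small: "\<And>k. \<bar>\<theta> k\<bar> < pi / 2" and "\<epsilon> > 0"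
  shows "finite {k. \<theta> k \<ge> \<epsilon>}"
proof (rule ccontr)
  assume inf: "infinite {k. \<theta> k \<ge> \<epsilon>}"
  have bound: "finite S \<Longrightarrow> S \<subseteq> {k. \<theta> k \<ge> \<epsilon>} \<Longrightarrow> 0 \<le> (\<Sum>k\<in>S. \<theta> k) \<and> (\<Sum>k\<in>S. \<theta> k) < pi / 2" for S
  proof (induction S rule: finite_induct)
    case (insert k S)
    then have IH: "0 \<le> (\<Sum>k\<in>S. \<theta> k)" "(\<Sum>k\<in>S. \<theta> k) < pi / 2" by auto
    have k: "\<epsilon> \<le> \<theta> k" "\<theta> k < pi / 2" using insert.prems small[of k] by auto
    have eq: "(\<Sum>k\<in>insert k S. \<theta> k) = \<theta> k + (\<Sum>k\<in>S. \<theta> k)" using insert.hyps by simp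
    have "\<theta> k + (\<Sum>k\<in>S. \<theta> k) < pi / 2"
    proof (rule ccontr)
      assume "\<not> ?thesis"
      then have "cos (\<theta> k + (\<Sum>k\<in>S. \<theta> k)) \<le> cos (pi / 2)"
        using IH k by (intro cos_monotone_0_pi_le) auto
      then show False using cos[of "insert k S"] insert.hyps unfolding eq by simp
    qed
    then show ?case unfolding eq using IH k \<open>\<epsilon> > 0\<close> by simp
  qed simp
  obtain m :: nat where m: "pi / 2 / \<epsilon> < real m" using reals_Archimedean2 by blast
  obtain S where S: "finite S" "card S = m" "S \<subseteq> {k. \<theta> k \<ge> \<epsilon>}" using infinite_arbitrarily_large[OF inf] by blast
  have "real m * \<epsilon> \<le> (\<Sum>k\<in>S. \<theta> k)" using sum_bounded_below[of S \<epsilon> \<theta>] S by auto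
  moreover have "pi / 2 < real m * \<epsilon>" using m \<open>\<epsilon> > 0\<close> by (simp add: field_simps)
  ultimately show False using bound[OF S(1,3)] by linarith
qed

lemma angles_tendsto_0:
  fixes \<theta> :: "nat \<Rightarrow> real"
  assumes cos: "\<And>S. finite S \<Longrightarrow> cos (\<Sum>k\<in>S. \<theta> k) > 0" and small: "\<And>k. \<bar>\<theta> k\<bar> < pi / 2"
  shows "\<theta> \<longlonglongrightarrow> 0"
proof (rule tendstoI)
  fix e :: real assume e: "e > 0"
  have "finite {k. \<theta> k \<ge> e}" using cos small e by (rule finite_large_angles)
  moreover have "finite {k. - \<theta> k \<ge> e}"
    by (rule finite_large_angles[of "\<lambda>k. - \<theta> k"]) (use cos small e in \<open>simp_all add: sum_negf\<close>)
  ultimately have "finite ({k. \<theta> k \<ge> e} \<union> {k. - \<theta> k \<ge> e})" by simp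
  moreover have "{k. \<not> dist (\<theta> k) 0 < e} \<subseteq> {k. \<theta> k \<ge> e} \<union> {k. - \<theta> k \<ge> e}" by (auto simp: abs_if split: if_splits)
  ultimately have "finite {k. \<not> dist (\<theta> k) 0 < e}" by (rule finite_subset[rotated])
  then show "eventually (\<lambda>k. dist (\<theta> k) 0 < e) sequentially"
    unfolding cofinite_eq_sequentially[symmetric] eventually_cofinite .
qed

context null_sequences
begin

lemma character_delta_tendsto:
  assumes f: "f \<in> continuous_characters F S" and C: "connectedin T C" "\<one>\<^bsub>X\<^esub> \<in> C" "x \<in> C"
  shows "(\<lambda>k. f (delta k x)) \<longlonglongrightarrow> 1"
proof -
  have fh: "f \<in> hom F circle_group" and fc: "continuous_map S euclidean f"
    using f by (simp_all add: continuous_characters_def continuous_map_in_subtopology)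
  have g: "f \<circ> delta k \<in> hom X circle_group" for k using hom_delta fh by (rule Group.hom_compose)
  have op: "openin S {y \<in> topspace S. f y \<in> {z. Re z > 0}}"
    by (rule openin_continuous_map_preimage[OF fc]) (simp add: open_halfspace_Re_gt)
  have "neighbourhood_of_one F S {y \<in> topspace S. f y \<in> {z. Re z > 0}}"
    unfolding neighbourhood_of_one_def
  proof (intro conjI exI)
    show "\<one>\<^bsub>F\<^esub> \<in> {y \<in> topspace S. f y \<in> {z. Re z > 0}}"
      using F.hom_circle(3)[OF fh] F.one_closed by (simp add: F.topspace_eq del: one_F)
    show "{y \<in> topspace S. f y \<in> {z. Re z > 0}} \<subseteq> carrier F" using F.topspace_eq by blast
  qed (rule op, rule order_refl)
  then obtain V where V: "openin T V" "\<one>\<^bsub>X\<^esub> \<in> V" "N V \<subseteq> {y \<in> topspace S. f y \<in> {z. Re z > 0}}"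
    unfolding nbhd_iff by blast
  have VX: "V \<subseteq> carrier X" using X.carrier_if_openin[OF V(1)] by blast
  have lim: "(\<lambda>k. f (delta k v)) \<longlonglongrightarrow> 1" if v: "v \<in> V" for v
  proof -
    have vX: "v \<in> carrier X" using v VX by blast
    \<comment> \<open>The product of \<open>delta k v\<close> over k in A. It takes only the values
      v and \<open>\<one>\<close>, so it lies in \<open>N V\<close> however many factors there are;
      this is where the uniform topology enters.\<close>
    define y where "y A = (\<lambda>i. if i \<in> A then v else \<one>\<^bsub>X\<^esub>)" for A :: "nat set"
    define \<theta> where "\<theta> k = Arg (f (delta k v))" for k
    have cis: "f (delta k v) = cis (\<theta> k)" for k
    proof -
      have "norm (f (delta k v)) = 1" using F.hom_circle(1)[OF fh delta_carrier[OF vX]] .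
      moreover then have "f (delta k v) \<noteq> 0" by auto
      ultimately show ?thesis unfolding \<theta>_def using cis_Arg[of "f (delta k v)"] by (simp add: sgn_eq)
    qed
    have yA: "finite A \<Longrightarrow> y A \<in> N V \<and> f (y A) = cis (\<Sum>k\<in>A. \<theta> k)" for A
    proof (induction A rule: finite_induct)
      case empty
      have "y {} = \<one>\<^bsub>F\<^esub>" by (simp add: y_def)
      then show ?case using one_in_N[OF V(2)] F.hom_circle(3)[OF fh] by (simp del: one_F)
    next
      case (insert k A)
      have eq: "y (insert k A) = delta k v \<otimes>\<^bsub>F\<^esub> y A"
        using insert.hyps vX by (auto simp: y_def delta_def)
      have c: "delta k v \<in> carrier F" "y A \<in> carrier F"
        using delta_carrier[OF vX] insert.IH by (simp_all add: in_N)
      have "y (insert k A) \<in> carrier F" unfolding eq using c by (rule F.m_closed)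
      then have "y (insert k A) \<in> N V" using v V(2) unfolding in_N by (simp add: y_def)
      moreover have "f (y (insert k A)) = cis (\<theta> k) * cis (\<Sum>k\<in>A. \<theta> k)"
        unfolding eq F.hom_circle(2)[OF fh c] cis[of k] using insert.IH by simp
      ultimately show ?case using insert.hyps by (simp add: cis_mult)
    qed
    have pos: "cos (\<Sum>k\<in>A. \<theta> k) > 0" if "finite A" for A
      using yA[OF that] V(3) by auto
    have "\<bar>\<theta> k\<bar> < pi / 2" for k
    proof -
      have "cos (\<theta> k) > 0" using pos[of "{k}"] by simp
      then have "Re (f (delta k v)) > 0" by (simp add: cis)
      then show ?thesis unfolding \<theta>_def by (rule Arg_Re_pos[THEN iffD2, OF disjI1])
    qed
    with pos have "\<theta> \<longlonglongrightarrow> 0" by (intro angles_tendsto_0)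
    then have "(\<lambda>k. Complex (cos (\<theta> k)) (sin (\<theta> k))) \<longlonglongrightarrow> Complex (cos 0) (sin 0)"
      by (intro tendsto_Complex tendsto_cos tendsto_sin)
    then show ?thesis by (simp add: cis cis.code one_complex.code)
  qed
  define H where "H = {v \<in> carrier X. (\<lambda>k. f (delta k v)) \<longlonglongrightarrow> 1}"
  have H: "subgroup H X"
  proof (rule X.subgroupI)
    show "H \<subseteq> carrier X" unfolding H_def by blast
    show "H \<noteq> {}" using lim[OF V(2)] V(2) VX unfolding H_def by blast
    show "inv\<^bsub>X\<^esub> a \<in> H" if "a \<in> H" for a
    proof -
      have a: "a \<in> carrier X" "(\<lambda>k. f (delta k a)) \<longlonglongrightarrow> 1" using that by (auto simp: H_def)
      have "f (delta k (inv\<^bsub>X\<^esub> a)) = inverse (f (delta k a))" for k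
        using X.hom_circle(4)[OF g a(1), of k] by simp
      moreover have "(\<lambda>k. inverse (f (delta k a))) \<longlonglongrightarrow> inverse 1" using a(2) by (rule tendsto_inverse) simp
      ultimately show ?thesis using a(1) by (simp add: H_def)
    qed
    show "a \<otimes>\<^bsub>X\<^esub> b \<in> H" if "a \<in> H" "b \<in> H" for a b
    proof -
      have a: "a \<in> carrier X" "(\<lambda>k. f (delta k a)) \<longlonglongrightarrow> 1" and b: "b \<in> carrier X" "(\<lambda>k. f (delta k b)) \<longlonglongrightarrow> 1"
        using that by (auto simp: H_def)
      have "f (delta k (a \<otimes>\<^bsub>X\<^esub> b)) = f (delta k a) * f (delta k b)" for k
        using X.hom_circle(2)[OF g a(1) b(1), of k] by simp
      moreover have "(\<lambda>k. f (delta k a) * f (delta k b)) \<longlonglongrightarrow> 1 * 1" using a(2) b(2) by (rule tendsto_mult)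
      ultimately show ?thesis using a(1) b(1) by (simp add: H_def)
    qed
  qed
  have "V \<subseteq> H" using lim VX unfolding H_def by blast
  then have "openin T H" using X.openin_subgroup_if_nbhd[OF H V(1,2)] by blast
  moreover have "closedin T H" using X.closedin_open_subgroup[OF H] calculation by blast
  moreover have "\<not> disjnt C H" using C(2) subgroup.one_closed[OF H] unfolding disjnt_iff by blast
  ultimately have "C \<subseteq> H" using connectedin_clopen_cases[OF C(1)] by blast
  then show ?thesis using C(3) unfolding H_def by blast
qed

lemma delta_limitin_bohr:
  assumes C: "connectedin T C" "\<one>\<^bsub>X\<^esub> \<in> C" "x \<in> C"
  shows "limitin (bohr_topology F S) (\<lambda>k. delta k x) \<one>\<^bsub>F\<^esub> sequentially"
  unfolding bohr_topology_def
proof (rule limitin_topology_generated_by)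
  show "\<one>\<^bsub>F\<^esub> \<in> \<Union>{{x \<in> carrier F. \<psi> x \<in> U} |\<psi> U. \<psi> \<in> continuous_characters F S \<and> open U}"
    using topspace_bohr[OF F.abelian_topological_group_axioms] F.one_closed
    unfolding bohr_topology_def topology_generated_by_topspace by (simp only:)
  have xX: "x \<in> carrier X" using connectedin_subset_topspace[OF C(1)] C(3) X.topspace_eq by blast
  fix W assume W: "W \<in> {{x \<in> carrier F. \<psi> x \<in> U} |\<psi> U. \<psi> \<in> continuous_characters F S \<and> open U}" "\<one>\<^bsub>F\<^esub> \<in> W"
  then obtain \<psi> U where U: "W = {x \<in> carrier F. \<psi> x \<in> U}" "\<psi> \<in> continuous_characters F S" "open U" by blast
  have "\<psi> \<one>\<^bsub>F\<^esub> = 1" using U(2) F.hom_circle(3) unfolding continuous_characters_def by blast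
  then have "1 \<in> U" using W(2) U(1) by (simp del: one_F)
  then have "eventually (\<lambda>k. \<psi> (delta k x) \<in> U) sequentially"
    using topological_tendstoD[OF character_delta_tendsto[OF U(2) C]] U(3) by blast
  then show "eventually (\<lambda>k. delta k x \<in> W) sequentially"
    unfolding U(1) using delta_carrier[OF xX] by simp
qed

end

section \<open>A Bohr convergent sequence that is not functionally bounded\<close>

context LCA_null_sequences
begin

text \<open>Let g be continuous on X, zero near \<open>\<one>\<close> and 1 at x. The sum of
  \<open>k * g (y k)\<close> over k is locally finite, as null sequences uniformly close to y enter
  the zero set of g from a common index on. Its value at \<open>delta k x\<close> is k.\<close>

lemma deltas_not_functionally_bounded:
  assumes x: "x \<in> carrier X" "x \<noteq> \<one>\<^bsub>X\<^esub>" and A: "range (\<lambda>k. delta k x) \<subseteq> A"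
  shows "\<not> functionally_boundedin S A"
proof
  assume fb: "functionally_boundedin S A"
  have one: "\<one>\<^bsub>X\<^esub> \<in> topspace T" "x \<in> topspace T" using x by (simp_all add: X.topspace_eq)
  obtain O1 where O1: "openin T O1" "\<one>\<^bsub>X\<^esub> \<in> O1" "x \<notin> O1"
    using Hausdorff_X one x(2) unfolding Hausdorff_space_def disjnt_iff by metis
  have "completely_regular_space T"
    using locally_compact_regular_imp_completely_regular_space[OF locally_compact_X] Hausdorff_X by blast
  moreover have "closedin T (topspace T - O1)" using O1(1) by blast
  ultimately obtain h where h: "continuous_map T (top_of_set {0..1::real}) h" "h \<one>\<^bsub>X\<^esub> = 0"
    "h ` (topspace T - O1) \<subseteq> {1}"
    unfolding completely_regular_space_def using one(1) O1(2) by (metis Diff_iff)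
  have hc: "continuous_map T euclideanreal h" using h(1) by (simp add: continuous_map_in_subtopology)
  have hx: "h x = 1" using h(3) one(2) O1(3) by blast
  \<comment> \<open>Complete regularity gives h vanishing at \<open>\<one>\<close> only as a point.
    Cutting off below 1/2 produces a function vanishing on a neighbourhood, as local finiteness
    requires.\<close>
  define g where "g z = max 0 (2 * h z - 1)" for z
  have gc: "continuous_map T euclideanreal g"
    unfolding g_def[abs_def] by (intro continuous_map_real_max continuous_map_diff continuous_map_real_mult hc) auto
  let ?V = "{z \<in> topspace T. h z \<in> {..<1/2}}"
  have V: "openin T ?V" by (rule openin_continuous_map_preimage[OF hc]) simp
  have V1: "\<one>\<^bsub>X\<^esub> \<in> ?V" using one(1) h(2) by simp
  have gV: "g z = 0" if "z \<in> ?V" for z using that by (simp add: g_def)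
  define f where "f y = (\<Sum>k\<in>{k. g (y k) \<noteq> 0}. real k * g (y k))" for y :: "nat \<Rightarrow> 'a"
  have f_eq: "f y = (\<Sum>k<n0. real k * g (y k))" if "\<And>k. k \<ge> n0 \<Longrightarrow> g (y k) = 0" for y n0
    unfolding f_def
  proof (rule sum.mono_neutral_left)
    show "{k. g (y k) \<noteq> 0} \<subseteq> {..<n0}" using that not_le by blast
  qed auto
  have "continuous_map S euclideanreal f"
  proof (rule continuous_map_locally)
    fix y assume "y \<in> topspace S"
    then have y: "y \<in> carrier F" by (simp add: F.topspace_eq)
    obtain W where W: "openin T W" "\<one>\<^bsub>X\<^esub> \<in> W" "\<And>a b. a \<in> W \<Longrightarrow> b \<in> W \<Longrightarrow> a \<otimes>\<^bsub>X\<^esub> b \<in> ?V"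
      using X.nbhd_sym_mult[OF V V1] by metis
    obtain n0 where n0: "\<And>n. n \<ge> n0 \<Longrightarrow> y n \<in> W" using carrier_F_eventually[OF y W(1,2)] by metis
    obtain O' where O': "openin S O'" "\<one>\<^bsub>F\<^esub> \<in> O'" "O' \<subseteq> N W"
      using nbhd_N[OF W(1,2)] unfolding neighbourhood_of_one_def by blast
    let ?U = "(\<lambda>u. y \<otimes>\<^bsub>F\<^esub> u) ` O'"
    have "openin S ?U" using O'(1) y by (rule F.openin_translate)
    moreover have "y \<in> ?U" using O'(2) F.r_one[OF y] by (metis image_eqI)
    moreover have "continuous_map S euclideanreal (\<lambda>z. \<Sum>k<n0. real k * g (z k))"
    proof (intro continuous_map_sum continuous_map_real_mult_left)
      fix k
      show "continuous_map S euclideanreal (\<lambda>z. g (z k))"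
        using continuous_map_compose[OF continuous_map_coord gc] by (simp add: o_def)
    qed simp
    moreover have "\<forall>z\<in>?U. f z = (\<Sum>k<n0. real k * g (z k))"
    proof
      fix z assume "z \<in> ?U"
      then obtain u where u: "u \<in> N W" "z = y \<otimes>\<^bsub>F\<^esub> u" using O'(3) by blast
      show "f z = (\<Sum>k<n0. real k * g (z k))"
      proof (rule f_eq, rule gV)
        fix k assume "k \<ge> n0"
        then have "y k \<otimes>\<^bsub>X\<^esub> u k \<in> ?V" using n0 u(1) W(3) unfolding in_N by blast
        then show "z k \<in> ?V" unfolding u(2) mult_F .
      qed
    qed
    ultimately show "\<exists>U g. openin S U \<and> y \<in> U \<and> continuous_map S euclideanreal g \<and> (\<forall>z\<in>U. f z = g z)"
      by (intro exI conjI)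
  qed
  then have "bounded (f ` A)" using fb unfolding functionally_boundedin_def by blast
  then obtain b where b: "\<forall>v\<in>f ` A. norm v \<le> b" unfolding bounded_iff ..
  obtain k :: nat where k: "b < real k" using reals_Archimedean2 by blast
  have g1: "g \<one>\<^bsub>X\<^esub> = 0" using gV[OF V1] .
  have "{i. g (delta k x i) \<noteq> 0} = {k}" using g1 hx by (auto simp: delta_def g_def)
  then have "f (delta k x) = real k" unfolding f_def using hx by (simp add: g_def)
  moreover have "delta k x \<in> A" using A by blast
  ultimately show False using b k by force
qed

lemma not_totally_disconnectedE:
  assumes "\<not> totally_disconnected_space T"
  obtains C x where "connectedin T C" "\<one>\<^bsub>X\<^esub> \<in> C" "x \<in> C" "x \<noteq> \<one>\<^bsub>X\<^esub>"
proof -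
  obtain p where p: "p \<in> topspace T" "connected_component_of_set T p \<noteq> {p}"
    using assms unfolding totally_disconnected_space_def by blast
  have "connected_component_of T p p" using p(1) connected_component_of_refl[of T p] by simp
  then obtain q where q: "connected_component_of T p q" "q \<noteq> p" using p(2) by auto
  then obtain C where C: "connectedin T C" "p \<in> C" "q \<in> C" unfolding connected_component_of_def by blast
  have pq: "p \<in> carrier X" "q \<in> carrier X"
    using C connectedin_subset_topspace[OF C(1)] X.topspace_eq by blast+
  let ?C = "(\<lambda>z. inv\<^bsub>X\<^esub> p \<otimes>\<^bsub>X\<^esub> z) ` C"
  have "connectedin T ?C"
    using connectedin_continuous_map_image[OF X.continuous_map_translation C(1)] pq by simp
  moreover have "\<one>\<^bsub>X\<^esub> \<in> ?C" using C(2) X.l_inv[OF pq(1)] by (metis image_eqI)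
  moreover have "inv\<^bsub>X\<^esub> p \<otimes>\<^bsub>X\<^esub> q \<in> ?C" using C(3) by blast
  moreover have "inv\<^bsub>X\<^esub> p \<otimes>\<^bsub>X\<^esub> q \<noteq> \<one>\<^bsub>X\<^esub>"
    using X.inv_equality[of "inv\<^bsub>X\<^esub> p" q] pq q(2) X.m_comm by (metis X.inv_closed X.inv_equality X.inv_inv)
  ultimately show thesis by (rule that)
qed

text \<open>A single set refutes all six properties at once: the deltas with their Bohr limit are
  compact and sequentially compact in the Bohr topology, hence have each of the five properties
  there, while no set containing the deltas is functionally bounded in \<open>F\<close>.\<close>

theorem totally_disconnected_if_respects:
  shows "respects_property compactin F S \<Longrightarrow> totally_disconnected_space T"
    and "respects_property countably_compactin F S \<Longrightarrow> totally_disconnected_space T"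
    and "respects_property sequentially_compactin F S \<Longrightarrow> totally_disconnected_space T"
    and "respects_property pseudocompactin F S \<Longrightarrow> totally_disconnected_space T"
    and "respects_property functionally_boundedin F S \<Longrightarrow> totally_disconnected_space T"
    and "schur_property F S \<Longrightarrow> totally_disconnected_space T"
proof -
  have key: "\<exists>x\<in>carrier X. compactin (bohr_topology F S) (insert \<one>\<^bsub>F\<^esub> (range (\<lambda>k. delta k x))) \<and>
      sequentially_compactin (bohr_topology F S) (insert \<one>\<^bsub>F\<^esub> (range (\<lambda>k. delta k x))) \<and>
      limitin (bohr_topology F S) (\<lambda>k. delta k x) \<one>\<^bsub>F\<^esub> sequentially \<and>
      (\<forall>A. range (\<lambda>k. delta k x) \<subseteq> A \<longrightarrow> \<not> functionally_boundedin S A)"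
    if nt: "\<not> totally_disconnected_space T"
  proof -
    obtain C x where C: "connectedin T C" "\<one>\<^bsub>X\<^esub> \<in> C" "x \<in> C" "x \<noteq> \<one>\<^bsub>X\<^esub>"
      using not_totally_disconnectedE[OF nt] by metis
    have xX: "x \<in> carrier X" using C connectedin_subset_topspace[OF C(1)] X.topspace_eq by blast
    note lim = delta_limitin_bohr[OF C(1-3)]
    have sub: "range (\<lambda>k. delta k x) \<subseteq> topspace (bohr_topology F S)"
      using delta_carrier[OF xX] topspace_bohr[OF F.abelian_topological_group_axioms] by blast
    show ?thesis
      using compactin_sequence_with_limit[OF lim order_refl sub] sequentially_compactin_insert_limit[OF lim sub]
        lim deltas_not_functionally_bounded[OF xX C(4)] xX by blast
  qed
  have respects: "totally_disconnected_space T"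
    if P: "respects_property P F S" and b: "\<And>A. compactin (bohr_topology F S) A \<Longrightarrow>
        sequentially_compactin (bohr_topology F S) A \<Longrightarrow> P (bohr_topology F S) A"
      and fb: "\<And>A. P S A \<Longrightarrow> functionally_boundedin S A" for P
  proof (rule ccontr)
    assume "\<not> totally_disconnected_space T"
    from key[OF this] obtain x where x: "compactin (bohr_topology F S) (insert \<one>\<^bsub>F\<^esub> (range (\<lambda>k. delta k x)))"
      "sequentially_compactin (bohr_topology F S) (insert \<one>\<^bsub>F\<^esub> (range (\<lambda>k. delta k x)))"
      "\<forall>A. range (\<lambda>k. delta k x) \<subseteq> A \<longrightarrow> \<not> functionally_boundedin S A"
      by (elim bexE conjE) (rule that)
    have "P (bohr_topology F S) (insert \<one>\<^bsub>F\<^esub> (range (\<lambda>k. delta k x)))" using x(1,2) by (rule b)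
    then have "P S (insert \<one>\<^bsub>F\<^esub> (range (\<lambda>k. delta k x)))" using P unfolding respects_property_def by blast
    from fb[OF this] x(3) show False by blast
  qed
  show "respects_property compactin F S \<Longrightarrow> totally_disconnected_space T"
    by (rule respects[where P = compactin]) (auto intro: compactin_imp_functionally_boundedin)
  show "respects_property countably_compactin F S \<Longrightarrow> totally_disconnected_space T"
    by (rule respects[where P = countably_compactin]) (auto intro: compactin_imp_countably_compactin
        countably_compactin_imp_functionally_boundedin[OF Hausdorff_F[OF Hausdorff_X]])
  show "respects_property sequentially_compactin F S \<Longrightarrow> totally_disconnected_space T"
    by (rule respects[where P = sequentially_compactin]) (auto intro: sequentially_compactin_imp_functionally_boundedin)
  show "respects_property pseudocompactin F S \<Longrightarrow> totally_disconnected_space T"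
    by (rule respects[where P = pseudocompactin]) (auto intro: compactin_imp_pseudocompactin pseudocompactin_imp_functionally_boundedin)
  show "respects_property functionally_boundedin F S \<Longrightarrow> totally_disconnected_space T"
    by (rule respects[where P = functionally_boundedin]) (auto intro: compactin_imp_functionally_boundedin)
  show "totally_disconnected_space T" if schur: "schur_property F S"
  proof (rule ccontr)
    assume "\<not> totally_disconnected_space T"
    from key[OF this] obtain x where x: "x \<in> carrier X" "limitin (bohr_topology F S) (\<lambda>k. delta k x) \<one>\<^bsub>F\<^esub> sequentially"
      "\<forall>A. range (\<lambda>k. delta k x) \<subseteq> A \<longrightarrow> \<not> functionally_boundedin S A"
      by (elim bexE conjE) (rule that)
    have sub: "range (\<lambda>k. delta k x) \<subseteq> carrier F" using delta_carrier[OF x(1)] by blast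
    then obtain l where l: "limitin S (\<lambda>k. delta k x) l sequentially"
      using schur x(2) unfolding schur_property_def by blast
    have "compactin S (insert l (range (\<lambda>k. delta k x)))"
      using compactin_sequence_with_limit[OF l order_refl] sub by (simp add: F.topspace_eq)
    from compactin_imp_functionally_boundedin[OF this] x(3) show False by blast
  qed
qed

end


section \<open>Invariant means\<close>

context comm_group
begin

definition bounded_fun :: "('a \<Rightarrow> real) \<Rightarrow> bool" where
  "bounded_fun f \<longleftrightarrow> (\<exists>b. \<forall>x\<in>carrier G. \<bar>f x\<bar> \<le> b)"

text \<open>Normalised positive functionals on the bounded functions. The argument m is total, but
  its values on unbounded functions are left unconstrained. The first clause combines additivity and
  homogeneity.\<close>

definition mean :: "(('a \<Rightarrow> real) \<Rightarrow> real) \<Rightarrow> bool" where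
  "mean m \<longleftrightarrow>
     (\<forall>f g c. bounded_fun f \<longrightarrow> bounded_fun g \<longrightarrow> m (\<lambda>x. f x + c * g x) = m f + c * m g) \<and>
     (\<forall>f. bounded_fun f \<longrightarrow> (\<forall>x\<in>carrier G. 0 \<le> f x) \<longrightarrow> 0 \<le> m f) \<and>
     m (\<lambda>x. 1) = 1"

lemma bounded_funI: "(\<And>x. x \<in> carrier G \<Longrightarrow> \<bar>f x\<bar> \<le> b) \<Longrightarrow> bounded_fun f"
  unfolding bounded_fun_def by blast

lemma bounded_funE:
  assumes "bounded_fun f"
  obtains b where "b > 0" "\<forall>x\<in>carrier G. \<bar>f x\<bar> \<le> b"
proof -
  obtain b where b: "\<forall>x\<in>carrier G. \<bar>f x\<bar> \<le> b" using assms unfolding bounded_fun_def by (elim exE)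
  show thesis
  proof (rule that[of "max b 1"])
    show "\<forall>x\<in>carrier G. \<bar>f x\<bar> \<le> max b 1" using b by (simp add: le_max_iff_disj)
  qed simp
qed

lemma bounded_fun_const [simp]: "bounded_fun (\<lambda>x. c)"
  by (rule bounded_funI[of _ "\<bar>c\<bar>"]) simp

lemma bounded_fun_mult:
  assumes "bounded_fun f" "bounded_fun g"
  shows "bounded_fun (\<lambda>x. f x * g x)"
proof -
  obtain b where b: "b > 0" "\<forall>x\<in>carrier G. \<bar>f x\<bar> \<le> b"
    by (rule bounded_funE[OF assms(1)]) (rule that)
  obtain c where c: "c > 0" "\<forall>x\<in>carrier G. \<bar>g x\<bar> \<le> c"
    by (rule bounded_funE[OF assms(2)]) (rule that)
  show ?thesis
    by (rule bounded_funI[of _ "b * c"]) (use b c in \<open>simp add: abs_mult mult_mono\<close>)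
qed

lemma bounded_fun_add:
  assumes "bounded_fun f" "bounded_fun g"
  shows "bounded_fun (\<lambda>x. f x + g x)"
proof -
  obtain b where b: "b > 0" "\<forall>x\<in>carrier G. \<bar>f x\<bar> \<le> b"
    by (rule bounded_funE[OF assms(1)]) (rule that)
  obtain c where c: "c > 0" "\<forall>x\<in>carrier G. \<bar>g x\<bar> \<le> c"
    by (rule bounded_funE[OF assms(2)]) (rule that)
  show ?thesis
  proof (rule bounded_funI[of _ "b + c"])
    fix x assume "x \<in> carrier G"
    then show "\<bar>f x + g x\<bar> \<le> b + c" using bspec[OF b(2), of x] bspec[OF c(2), of x] by linarith
  qed
qed

lemma bounded_fun_uminus: "bounded_fun f \<Longrightarrow> bounded_fun (\<lambda>x. - f x)"
  unfolding bounded_fun_def by simp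

lemma bounded_fun_diff: "bounded_fun f \<Longrightarrow> bounded_fun g \<Longrightarrow> bounded_fun (\<lambda>x. f x - g x)"
  using bounded_fun_add[OF _ bounded_fun_uminus] by simp

lemma bounded_fun_power2: "bounded_fun f \<Longrightarrow> bounded_fun (\<lambda>x. (f x)\<^sup>2)"
  using bounded_fun_mult[of f f] by (simp add: power2_eq_square)

lemma bounded_fun_sum: "(\<And>i. i \<in> I \<Longrightarrow> bounded_fun (f i)) \<Longrightarrow> bounded_fun (\<lambda>x. \<Sum>i\<in>I. f i x)"
  by (induction I rule: infinite_finite_induct) (auto intro: bounded_fun_add)

lemma bounded_fun_translate:
  assumes "bounded_fun f" "a \<in> carrier G"
  shows "bounded_fun (\<lambda>x. f (a \<otimes> x))"
  using assms unfolding bounded_fun_def by (meson m_closed)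

lemma mean_le:
  assumes m: "mean m" and f: "bounded_fun f" "bounded_fun g" and le: "\<And>x. x \<in> carrier G \<Longrightarrow> f x \<le> g x"
  shows "m f \<le> m g"
proof -
  have "0 \<le> m (\<lambda>x. g x + (- 1) * f x)"
    using m bounded_fun_diff[OF f(2,1)] le unfolding mean_def by simp
  also have "\<dots> = m g + (- 1) * m f" using m f unfolding mean_def by blast
  finally show ?thesis by simp
qed

lemma mean_const: "mean m \<Longrightarrow> m (\<lambda>x. c) = c"
proof -
  assume m: "mean m"
  have "m (\<lambda>x. 0 + d * e) = m (\<lambda>x. 0) + d * m (\<lambda>x. e)" for d e :: real
    using m bounded_fun_const unfolding mean_def by blast
  from this[of 1 0] this[of c 1] m show ?thesis unfolding mean_def by simp
qed

text \<open>Positivity is tested on the carrier only, so values elsewhere cannot influence a mean.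
  This allows computing under the mean with the group laws.\<close>

lemma mean_cong:
  assumes "mean m" "bounded_fun f" "\<And>x. x \<in> carrier G \<Longrightarrow> f x = g x"
  shows "m f = m g"
proof -
  have "bounded_fun g" using assms(2,3) unfolding bounded_fun_def by simp
  then show ?thesis using mean_le[OF assms(1), of f g] mean_le[OF assms(1), of g f] assms(2,3) by simp
qed

lemma mean_abs_le:
  assumes m: "mean m" and b: "\<And>x. x \<in> carrier G \<Longrightarrow> \<bar>f x\<bar> \<le> b"
  shows "\<bar>m f\<bar> \<le> b"
proof -
  have f: "bounded_fun f" using b by (rule bounded_funI)
  have "m f \<le> m (\<lambda>x. b)" by (rule mean_le[OF m f bounded_fun_const]) (use b in \<open>simp add: abs_le_iff\<close>)
  moreover have "m (\<lambda>x. - b) \<le> m f"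
    by (rule mean_le[OF m bounded_fun_const f]) (use b in \<open>simp add: abs_le_iff minus_le_iff\<close>)
  ultimately show ?thesis using mean_const[OF m] by (simp add: abs_le_iff)
qed

text \<open>Averaging over the translations by \<open>w^0, ..., w^n\<close> makes the change under w
  telescope to two boundary terms, hence at most 2b/(n+1). Since the group is commutative, averaging
  preserves the approximate invariance already obtained for other elements.\<close>

lemma approximately_invariant_mean:
  fixes P :: "('a \<times> nat) set"
  assumes "finite P" "P \<subseteq> carrier G \<times> UNIV"
  shows "\<exists>m. mean m \<and> (\<forall>(w, n)\<in>P. \<forall>f b. (\<forall>x\<in>carrier G. \<bar>f x\<bar> \<le> b) \<longrightarrow>
            \<bar>m (\<lambda>x. f (w \<otimes> x)) - m f\<bar> \<le> 2 * b / Suc n)"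
  using assms
proof (induction rule: finite_induct)
  case empty
  show ?case by (rule exI[of _ "\<lambda>f. f \<one>"]) (simp add: mean_def)
next
  case (insert p P)
  obtain w n where p: "p = (w, n)" by (cases p)
  have w: "w \<in> carrier G" using insert.prems p by simp
  from insert.IH insert.prems obtain m where m: "mean m"
    and inv: "\<forall>(w, n)\<in>P. \<forall>f b. (\<forall>x\<in>carrier G. \<bar>f x\<bar> \<le> b) \<longrightarrow> \<bar>m (\<lambda>x. f (w \<otimes> x)) - m f\<bar> \<le> 2 * b / Suc n"
    by auto
  define m' where "m' f = (\<Sum>k\<le>n. m (\<lambda>x. f (w [^] k \<otimes> x))) / Suc n" for f
  have tr: "bounded_fun (\<lambda>x. f (w [^] k \<otimes> x))" if "bounded_fun f" for f and k :: nat
    using bounded_fun_translate[OF that] w by simp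
  have mean': "mean m'"
    unfolding mean_def
  proof (intro conjI allI impI)
    show "m' (\<lambda>x. f x + c * g x) = m' f + c * m' g" if "bounded_fun f" "bounded_fun g" for f g c
    proof -
      have "m (\<lambda>x. f (w [^] k \<otimes> x) + c * g (w [^] k \<otimes> x)) =
          m (\<lambda>x. f (w [^] k \<otimes> x)) + c * m (\<lambda>x. g (w [^] k \<otimes> x))" for k :: nat
        using m tr[OF that(1)] tr[OF that(2)] unfolding mean_def by blast
      then show ?thesis by (simp add: m'_def sum.distrib sum_distrib_left add_divide_distrib)
    qed
    show "0 \<le> m' f" if f: "bounded_fun f" "\<forall>x\<in>carrier G. 0 \<le> f x" for f
    proof -
      have "0 \<le> m (\<lambda>x. f (w [^] k \<otimes> x))" for k :: nat
        using m tr[OF f(1)] f(2) w unfolding mean_def by simp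
      then show ?thesis by (simp add: m'_def sum_nonneg)
    qed
    show "m' (\<lambda>x. 1) = 1" using mean_const[OF m] by (simp add: m'_def)
  qed
  have new: "\<bar>m' (\<lambda>x. f (w \<otimes> x)) - m' f\<bar> \<le> 2 * b / Suc n" if b: "\<forall>x\<in>carrier G. \<bar>f x\<bar> \<le> b" for f b
  proof -
    define a where "a k = m (\<lambda>x. f (w [^] k \<otimes> x))" for k :: nat
    have eq: "m (\<lambda>x. f (w \<otimes> (w [^] k \<otimes> x))) = a (Suc k)" for k :: nat
    proof -
      have "f (w \<otimes> (w [^] k \<otimes> x)) = f (w [^] Suc k \<otimes> x)" if "x \<in> carrier G" for x
        using w that by (simp add: m_assoc[symmetric] m_comm)
      moreover have "bounded_fun f" using b unfolding bounded_fun_def by blast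
      then have "bounded_fun (\<lambda>x. f (w \<otimes> (w [^] k \<otimes> x)))"
        using tr[OF bounded_fun_translate[OF _ w]] by blast
      ultimately show ?thesis unfolding a_def by (rule mean_cong[OF m, rotated])
    qed
    have "m' (\<lambda>x. f (w \<otimes> x)) - m' f = ((\<Sum>k\<le>n. a (Suc k)) - (\<Sum>k\<le>n. a k)) / Suc n"
      unfolding m'_def eq by (simp add: a_def diff_divide_distrib)
    also have "\<dots> = (a (Suc n) - a 0) / Suc n"
      by (simp add: sum_subtractf[symmetric] sum_telescope) (induction n; simp)
    finally have "\<bar>m' (\<lambda>x. f (w \<otimes> x)) - m' f\<bar> = \<bar>a (Suc n) - a 0\<bar> / Suc n" by simp
    moreover have "\<bar>a k\<bar> \<le> b" for k
      unfolding a_def using b w by (intro mean_abs_le[OF m]) simp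
    from this[of "Suc n"] this[of 0] have "\<bar>a (Suc n) - a 0\<bar> \<le> 2 * b" by linarith
    ultimately show ?thesis by (simp add: divide_right_mono)
  qed
  have old: "\<bar>m' (\<lambda>x. f (v \<otimes> x)) - m' f\<bar> \<le> 2 * b / Suc j"
    if vj: "(v, j) \<in> P" and b: "\<forall>x\<in>carrier G. \<bar>f x\<bar> \<le> b" for v j f b
  proof -
    have v: "v \<in> carrier G" using insert.prems vj by auto
    have "\<bar>m (\<lambda>x. f (v \<otimes> (w [^] k \<otimes> x))) - m (\<lambda>x. f (w [^] k \<otimes> x))\<bar> \<le> 2 * b / Suc j" for k :: nat
    proof -
      have "f (v \<otimes> (w [^] k \<otimes> x)) = f (w [^] k \<otimes> (v \<otimes> x))" if "x \<in> carrier G" for x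
        using v w that by (simp add: m_lcomm)
      moreover have "bounded_fun f" using b unfolding bounded_fun_def by blast
      then have "bounded_fun (\<lambda>x. f (v \<otimes> (w [^] k \<otimes> x)))"
        using tr[OF bounded_fun_translate[OF _ v]] by blast
      ultimately have "m (\<lambda>x. f (v \<otimes> (w [^] k \<otimes> x))) = m (\<lambda>x. f (w [^] k \<otimes> (v \<otimes> x)))"
        by (rule mean_cong[OF m, rotated])
      moreover have "\<forall>x\<in>carrier G. \<bar>f (w [^] k \<otimes> x)\<bar> \<le> b" using b w by simp
      ultimately show ?thesis using inv vj by fastforce
    qed
    then have "(\<Sum>k\<le>n. \<bar>m (\<lambda>x. f (v \<otimes> (w [^] k \<otimes> x))) - m (\<lambda>x. f (w [^] k \<otimes> x))\<bar>) \<le> (\<Sum>k\<le>n. 2 * b / Suc j)"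
      by (intro sum_mono)
    then have "\<bar>\<Sum>k\<le>n. m (\<lambda>x. f (v \<otimes> (w [^] k \<otimes> x))) - m (\<lambda>x. f (w [^] k \<otimes> x))\<bar> \<le> Suc n * (2 * b / Suc j)"
      by (intro order_trans[OF sum_abs]) simp
    then have "\<bar>\<Sum>k\<le>n. m (\<lambda>x. f (v \<otimes> (w [^] k \<otimes> x))) - m (\<lambda>x. f (w [^] k \<otimes> x))\<bar> / Suc n \<le> 2 * b / Suc j"
      by (simp add: pos_divide_le_eq mult.commute del: of_nat_Suc)
    then show ?thesis unfolding m'_def by (simp add: sum_subtractf diff_divide_distrib[symmetric] del: of_nat_Suc)
  qed
  show ?case using mean' new old p by (intro exI[of _ m'] conjI) auto
qed

text \<open>The means are closed in a product of compact intervals, so Tychonoff's theorem yields a mean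
  invariant under all translations from approximately invariant ones.\<close>

theorem invariant_mean_exists:
  obtains m where "mean m" "\<And>f a. bounded_fun f \<Longrightarrow> a \<in> carrier G \<Longrightarrow> m (\<lambda>x. f (a \<otimes> x)) = m f"
proof -
  define I where "I = Collect bounded_fun"
  define b where "b f = (SOME b. \<forall>x\<in>carrier G. \<bar>f x\<bar> \<le> b)" for f :: "'a \<Rightarrow> real"
  have b: "\<forall>x\<in>carrier G. \<bar>f x\<bar> \<le> b f" if "bounded_fun f" for f
    unfolding b_def using that unfolding bounded_fun_def by (rule someI_ex)
  define Y where "Y = product_topology (\<lambda>f. top_of_set {- b f..b f}) I"
  have cY: "compact_space Y"
    unfolding Y_def compact_space_product_topology by (simp add: compact_space_subtopology)
  have coord: "continuous_map Y euclideanreal (\<lambda>m. m f)" if "bounded_fun f" for f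
    using continuous_map_product_projection[of f I "\<lambda>f. top_of_set {- b f..b f}"] that
    unfolding Y_def I_def by (simp add: continuous_map_in_subtopology)
  have closed_le: "closedin Y {m \<in> topspace Y. u m \<le> v m}"
    if u: "continuous_map Y euclideanreal u" and v: "continuous_map Y euclideanreal v" for u v
  proof -
    have "closedin Y {m \<in> topspace Y. v m - u m \<in> {0..}}"
      by (rule closedin_continuous_map_preimage[OF continuous_map_diff[OF v u]]) simp
    then show ?thesis by simp
  qed
  have closed_eq: "closedin Y {m \<in> topspace Y. u m = v m}"
    if u: "continuous_map Y euclideanreal u" and v: "continuous_map Y euclideanreal v" for u v
  proof -
    have "closedin Y ({m \<in> topspace Y. u m \<le> v m} \<inter> {m \<in> topspace Y. v m \<le> u m})"
      by (rule closedin_Int[OF closed_le[OF u v] closed_le[OF v u]])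
    moreover have "{m \<in> topspace Y. u m \<le> v m} \<inter> {m \<in> topspace Y. v m \<le> u m} = {m \<in> topspace Y. u m = v m}"
      by auto
    ultimately show ?thesis by simp
  qed
  \<comment> \<open>The closed conditions that define a mean. The sets \<open>Z (w, n)\<close> below
    add invariance under w up to an error of order 1/n; finitely many of these are satisfiable
    together, and all of them together mean exact invariance.\<close>
  define \<U> where "\<U> =
     {{m \<in> topspace Y. m (\<lambda>x. f x + c * g x) = m f + c * m g} |f g c. bounded_fun f \<and> bounded_fun g} \<union>
     {{m \<in> topspace Y. 0 \<le> m f} |f. bounded_fun f \<and> (\<forall>x\<in>carrier G. 0 \<le> f x)} \<union>
     {{m \<in> topspace Y. m (\<lambda>x. 1) = 1}}"
  define Z where "Z = (\<lambda>(w, n). {m \<in> topspace Y. \<forall>f\<in>I. \<bar>m (\<lambda>x. f (w \<otimes> x)) - m f\<bar> \<le> 2 * b f / Suc n})"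
  have bc: "bounded_fun (\<lambda>x. c * g x)" if "bounded_fun g" for g c
    using bounded_fun_mult[OF bounded_fun_const that] .
  have closedU: "closedin Y C" if "C \<in> \<U>" for C
    using that unfolding \<U>_def
    by (auto intro!: closed_eq closed_le coord bounded_fun_add bc continuous_map_add continuous_map_real_mult)
  have closedZ: "closedin Y (Z p)" if "p \<in> carrier G \<times> UNIV" for p
  proof -
    obtain w n where p: "p = (w, n)" by (cases p)
    have "Z p = topspace Y \<inter> (\<Inter>f\<in>I. {m \<in> topspace Y. \<bar>m (\<lambda>x. f (w \<otimes> x)) - m f\<bar> \<le> 2 * b f / Suc n})"
      unfolding Z_def p by auto
    moreover have "closedin Y {m \<in> topspace Y. \<bar>m (\<lambda>x. f (w \<otimes> x)) - m f\<bar> \<le> 2 * b f / Suc n}" if "f \<in> I" for f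
      using that p \<open>p \<in> _\<close> unfolding I_def
      by (intro closed_le continuous_map_real_abs continuous_map_diff coord)
        (auto intro: bounded_fun_translate)
    moreover have "(\<lambda>x. 0) \<in> I" by (simp add: I_def)
    ultimately show ?thesis by (auto intro!: closedin_Int closedin_Inter)
  qed
  have fip: "topspace Y \<inter> \<Inter>\<F> \<noteq> {}" if \<F>: "finite \<F>" "\<F> \<subseteq> \<U> \<union> Z ` (carrier G \<times> UNIV)" for \<F>
  proof -
    have "finite (\<F> - \<U>)" "\<F> - \<U> \<subseteq> Z ` (carrier G \<times> UNIV)" using \<F> by auto
    then obtain P where P: "finite P" "P \<subseteq> carrier G \<times> UNIV" "\<F> - \<U> = Z ` P"
      by (meson finite_subset_image)
    from approximately_invariant_mean[OF P(1,2)] obtain m where m: "mean m"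
      and inv: "\<forall>(w, n)\<in>P. \<forall>f b. (\<forall>x\<in>carrier G. \<bar>f x\<bar> \<le> b) \<longrightarrow> \<bar>m (\<lambda>x. f (w \<otimes> x)) - m f\<bar> \<le> 2 * b / Suc n"
      by (elim exE conjE)
    define \<mu> where "\<mu> = restrict m I"
    have \<mu>: "\<mu> f = m f" if "bounded_fun f" for f using that by (simp add: \<mu>_def I_def)
    have "\<bar>m f\<bar> \<le> b f" if "f \<in> I" for f
      using b that unfolding I_def by (intro mean_abs_le[OF m]) simp
    then have "\<mu> \<in> topspace Y"
      unfolding Y_def \<mu>_def by (auto simp: abs_le_iff minus_le_iff)
    moreover have "\<mu> \<in> C" if "C \<in> \<U>" for C
      using that m \<open>\<mu> \<in> topspace Y\<close> \<mu> unfolding \<U>_def mean_def by (auto simp: bounded_fun_add bc)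
    moreover have "\<mu> \<in> Z p" if "p \<in> P" for p
    proof -
      obtain w n where p: "p = (w, n)" by (cases p)
      have w: "w \<in> carrier G" using P(2) that p by auto
      have "\<bar>\<mu> (\<lambda>x. f (w \<otimes> x)) - \<mu> f\<bar> \<le> 2 * b f / Suc n" if "f \<in> I" for f
        using inv \<open>p \<in> P\<close> b[of f] that w unfolding p I_def
        by (auto simp: \<mu> bounded_fun_translate)
      then show ?thesis using \<open>\<mu> \<in> topspace Y\<close> unfolding Z_def p by simp
    qed
    ultimately have "\<mu> \<in> topspace Y" "\<And>C. C \<in> \<U> \<Longrightarrow> \<mu> \<in> C" "\<And>C. C \<in> Z ` P \<Longrightarrow> \<mu> \<in> C"
      by (simp, simp, elim imageE) simp
    note \<mu>C = this
    have "\<mu> \<in> C" if "C \<in> \<F>" for C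
    proof (cases "C \<in> \<U>")
      case True
      then show ?thesis by (rule \<mu>C(2))
    next
      case False
      with that have "C \<in> \<F> - \<U>" by simp
      then show ?thesis unfolding P(3) by (rule \<mu>C(3))
    qed
    then have "\<mu> \<in> topspace Y \<inter> \<Inter>\<F>" using \<mu>C(1) by (intro IntI InterI)
    then show ?thesis by (rule ex_in_conv[THEN iffD1, OF exI])
  qed
  have "\<forall>C\<in>\<U> \<union> Z ` (carrier G \<times> UNIV). closedin Y C"
  proof
    fix C assume "C \<in> \<U> \<union> Z ` (carrier G \<times> UNIV)"
    then show "closedin Y C" by (elim UnE imageE) (simp_all only: closedU closedZ)
  qed
  moreover have "\<forall>\<F>. finite \<F> \<and> \<F> \<subseteq> \<U> \<union> Z ` (carrier G \<times> UNIV) \<longrightarrow> topspace Y \<inter> \<Inter>\<F> \<noteq> {}"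
    by (intro allI impI) (elim conjE, rule fip)
  ultimately have "topspace Y \<inter> \<Inter>(\<U> \<union> Z ` (carrier G \<times> UNIV)) \<noteq> {}"
    by (rule compactin_fip[THEN iffD1, OF cY[unfolded compact_space_def], THEN conjunct2, THEN spec, THEN mp, OF conjI])
  then have "\<exists>m. m \<in> topspace Y \<inter> \<Inter>(\<U> \<union> Z ` (carrier G \<times> UNIV))" by (rule ex_in_conv[THEN iffD2])
  then obtain m where m: "m \<in> topspace Y \<inter> \<Inter>(\<U> \<union> Z ` (carrier G \<times> UNIV))" ..
  have mU: "m \<in> C" if "C \<in> \<U>" for C
    using m by (rule InterD[OF IntD2]) (rule UnI1[OF that])
  have mZ: "m \<in> Z p" if "p \<in> carrier G \<times> UNIV" for p
    using m by (rule InterD[OF IntD2]) (rule UnI2[OF imageI[OF that]])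
  have "mean m"
    unfolding mean_def
  proof (intro conjI allI impI)
    show "m (\<lambda>x. f x + c * g x) = m f + c * m g" if fg: "bounded_fun f" "bounded_fun g" for f g c
    proof -
      have "{m \<in> topspace Y. m (\<lambda>x. f x + c * g x) = m f + c * m g} \<in> \<U>" unfolding \<U>_def using fg by blast
      from mU[OF this] show ?thesis by simp
    qed
    show "0 \<le> m f" if f: "bounded_fun f" "\<forall>x\<in>carrier G. 0 \<le> f x" for f
    proof -
      have "{m \<in> topspace Y. 0 \<le> m f} \<in> \<U>" unfolding \<U>_def using f by blast
      from mU[OF this] show ?thesis by simp
    qed
    have "{m \<in> topspace Y. m (\<lambda>x. 1) = 1} \<in> \<U>" unfolding \<U>_def by blast
    from mU[OF this] show "m (\<lambda>x. 1) = 1" by simp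
  qed
  moreover have "m (\<lambda>x. f (a \<otimes> x)) = m f" if f: "bounded_fun f" and a: "a \<in> carrier G" for f a
  proof -
    have le: "\<bar>m (\<lambda>x. f (a \<otimes> x)) - m f\<bar> \<le> 2 * b f / Suc n" for n
      using mZ[of "(a, n)"] a f unfolding Z_def I_def by simp
    have "(\<lambda>n. 2 * b f / Suc n) \<longlonglongrightarrow> 0" by (rule LIMSEQ_Suc[OF lim_const_over_n])
    from LIMSEQ_le_const[OF this, of "\<bar>m (\<lambda>x. f (a \<otimes> x)) - m f\<bar>"] le
    show ?thesis by auto
  qed
  ultimately show thesis using that by blast
qed

end


section \<open>Convolution on compact groups\<close>

context abelian_topological_group
begin

definition unif_continuous :: "('a \<Rightarrow> real) \<Rightarrow> bool" where
  "unif_continuous f \<longleftrightarrow> (\<forall>e>0. \<exists>A. openin T A \<and> \<one> \<in> A \<and> (\<forall>a\<in>A. \<forall>x\<in>carrier G. \<bar>f (a \<otimes> x) - f x\<bar> \<le> e))"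

lemma unif_continuousE:
  assumes "unif_continuous f" "e > 0"
  obtains A where "openin T A" "\<one> \<in> A" "\<forall>a\<in>A. \<forall>x\<in>carrier G. \<bar>f (a \<otimes> x) - f x\<bar> \<le> e"
proof -
  have "\<exists>A. openin T A \<and> \<one> \<in> A \<and> (\<forall>a\<in>A. \<forall>x\<in>carrier G. \<bar>f (a \<otimes> x) - f x\<bar> \<le> e)"
    using assms unfolding unif_continuous_def by (elim allE impE)
  then show thesis by (elim exE conjE) (rule that)
qed

end

locale compact_abelian_group = abelian_topological_group +
  assumes compact: "compact_space T"
begin

lemma finite_translates_cover:
  assumes "openin T A" "\<one> \<in> A"
  obtains W where "finite W" "W \<subseteq> carrier G" "\<forall>x\<in>carrier G. \<exists>w\<in>W. \<exists>a\<in>A. x = w \<otimes> a"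
proof -
  have "compactin T (carrier G)" using compact by (simp add: compact_space_def topspace_eq)
  moreover have "openin T U" if "U \<in> (\<lambda>w. (\<lambda>x. w \<otimes> x) ` A) ` carrier G" for U
    using openin_translate[OF assms(1)] that by (elim imageE) simp
  moreover have "carrier G \<subseteq> \<Union> ((\<lambda>w. (\<lambda>x. w \<otimes> x) ` A) ` carrier G)"
  proof
    fix x assume "x \<in> carrier G"
    moreover then have "x \<in> (\<lambda>y. x \<otimes> y) ` A" using assms(2) by (intro image_eqI[of _ _ \<one>]) simp_all
    ultimately show "x \<in> \<Union> ((\<lambda>w. (\<lambda>x. w \<otimes> x) ` A) ` carrier G)" by (rule UN_I)
  qed
  ultimately have "\<exists>\<F>. finite \<F> \<and> \<F> \<subseteq> (\<lambda>w. (\<lambda>x. w \<otimes> x) ` A) ` carrier G \<and> carrier G \<subseteq> \<Union>\<F>"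
    by (rule compactinD)
  then obtain \<F> where \<F>: "finite \<F>" "\<F> \<subseteq> (\<lambda>w. (\<lambda>x. w \<otimes> x) ` A) ` carrier G" "carrier G \<subseteq> \<Union>\<F>"
    by (elim exE conjE)
  from finite_subset_image[OF \<F>(1,2)] obtain W where W: "W \<subseteq> carrier G" "finite W" "\<F> = (\<lambda>w. (\<lambda>x. w \<otimes> x) ` A) ` W"
    by (elim exE conjE)
  have "\<forall>x\<in>carrier G. \<exists>w\<in>W. \<exists>a\<in>A. x = w \<otimes> a"
    using \<F>(3) unfolding W(3) by blast
  with W(2,1) show thesis by (rule that)
qed

lemma unif_continuous_if_continuous:
  assumes "continuous_map T euclideanreal f"
  shows "unif_continuous f"
  unfolding unif_continuous_def
proof (intro allI impI)
  fix e :: real assume e: "e > 0"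
  let ?Q = "{p \<in> topspace (prod_topology T T). \<bar>f (snd p \<otimes> fst p) - f (fst p)\<bar> \<in> {..<e}}"
  have "continuous_map (prod_topology T T) euclideanreal (\<lambda>p. \<bar>f (snd p \<otimes> fst p) - f (fst p)\<bar>)"
    using continuous_map_compose[OF continuous_map_group_mult[OF continuous_map_snd continuous_map_fst] assms]
      continuous_map_compose[OF continuous_map_fst assms]
    by (intro continuous_map_real_abs continuous_map_diff) (simp_all add: o_def)
  then have "openin (prod_topology T T) ?Q"
    by (rule openin_continuous_map_preimage) (simp add: open_openin[symmetric])
  moreover have "compactin T (carrier G)" using compact by (simp add: compact_space_def topspace_eq)
  moreover have "\<one> \<in> topspace T" by (simp add: topspace_eq)
  moreover have "carrier G \<times> {\<one>} \<subseteq> ?Q" using e by (auto simp: topspace_eq)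
  ultimately have "\<exists>B A. openin T B \<and> openin T A \<and> carrier G \<subseteq> B \<and> \<one> \<in> A \<and> B \<times> A \<subseteq> ?Q"
    by (rule tube_lemma_left)
  then obtain A B where A: "openin T A" "\<one> \<in> A" "carrier G \<subseteq> B" "B \<times> A \<subseteq> ?Q" by (elim exE conjE)
  have "\<bar>f (a \<otimes> x) - f x\<bar> \<le> e" if "a \<in> A" "x \<in> carrier G" for a x
  proof -
    have "(x, a) \<in> ?Q" using A(3,4) that by blast
    then show ?thesis by simp
  qed
  then show "\<exists>A. openin T A \<and> \<one> \<in> A \<and> (\<forall>a\<in>A. \<forall>x\<in>carrier G. \<bar>f (a \<otimes> x) - f x\<bar> \<le> e)"
    using A(1,2) by (intro exI[of _ A]) simp
qed

lemma bounded_fun_if_continuous: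
  assumes "continuous_map T euclideanreal f"
  shows "bounded_fun f"
proof -
  have "compactin euclideanreal (f ` carrier G)"
    using image_compactin[OF _ assms, of "carrier G"] compact by (simp add: compact_space_def topspace_eq)
  then have "bounded (f ` carrier G)" by (simp add: compact_imp_bounded)
  then obtain b where "\<forall>y\<in>f ` carrier G. \<bar>y\<bar> \<le> b" by (auto simp: bounded_iff)
  then show ?thesis unfolding bounded_fun_def by (intro exI[of _ b]) simp
qed

end

section \<open>Fubini, Cauchy-Schwarz and positivity for an invariant mean\<close>

locale compact_group_mean = compact_abelian_group +
  fixes m :: "('a \<Rightarrow> real) \<Rightarrow> real"
  assumes mean: "mean m"
    and invariant: "bounded_fun f \<Longrightarrow> a \<in> carrier G \<Longrightarrow> m (\<lambda>x. f (a \<otimes> x)) = m f"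
begin

lemmas m_le = mean_le[OF mean] and m_const = mean_const[OF mean]
  and m_cong = mean_cong[OF mean] and m_abs_le = mean_abs_le[OF mean]

lemma m_add_mult: "bounded_fun f \<Longrightarrow> bounded_fun g \<Longrightarrow> m (\<lambda>x. f x + c * g x) = m f + c * m g"
  using mean unfolding mean_def by blast

lemma m_add: "bounded_fun f \<Longrightarrow> bounded_fun g \<Longrightarrow> m (\<lambda>x. f x + g x) = m f + m g"
  using m_add_mult[of f g 1] by simp

lemma m_diff: "bounded_fun f \<Longrightarrow> bounded_fun g \<Longrightarrow> m (\<lambda>x. f x - g x) = m f - m g"
  using m_add_mult[of f g "-1"] by simp

lemma m_mult: "bounded_fun f \<Longrightarrow> m (\<lambda>x. c * f x) = c * m f"
  using m_add_mult[of "\<lambda>x. 0" f c] m_const[of 0] by simp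

lemma m_sum:
  assumes "finite I" "\<And>i. i \<in> I \<Longrightarrow> bounded_fun (f i)"
  shows "m (\<lambda>x. \<Sum>i\<in>I. f i x) = (\<Sum>i\<in>I. m (f i))"
  using assms
proof (induction I rule: finite_induct)
  case (insert i I)
  then have "m (\<lambda>x. f i x + (\<Sum>i\<in>I. f i x)) = m (f i) + m (\<lambda>x. \<Sum>i\<in>I. f i x)"
    by (intro m_add bounded_fun_sum) simp_all
  with insert show ?case by simp
qed (simp add: m_const)

lemma m_dist:
  assumes "bounded_fun f" "bounded_fun g" "\<And>x. x \<in> carrier G \<Longrightarrow> \<bar>f x - g x\<bar> \<le> e"
  shows "\<bar>m f - m g\<bar> \<le> e"
  using m_abs_le[of "\<lambda>x. f x - g x" e] assms m_diff by simp

text \<open>A function factoring through a finite set is a combination of indicators of fibres. The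
  fibres may be arbitrary sets, since the mean is defined on all bounded functions.\<close>

lemma m_sum_fibres:
  assumes W: "finite W" "\<And>y. y \<in> carrier G \<Longrightarrow> r y \<in> W"
  shows "m (\<lambda>y. \<phi> (r y)) = (\<Sum>w\<in>W. \<phi> w * m (\<lambda>y. if r y = w then 1 else 0))"
    and "bounded_fun (\<lambda>y. \<phi> (r y))"
proof -
  have b1: "bounded_fun (\<lambda>y. if r y = w then 1 else 0)" for w
    by (rule bounded_funI[of _ 1]) simp
  have b: "bounded_fun (\<lambda>y. \<phi> w * (if r y = w then 1 else 0))" for w
    by (rule bounded_fun_mult[OF bounded_fun_const b1])
  have eq: "(\<Sum>w\<in>W. \<phi> w * (if r y = w then 1 else 0)) = \<phi> (r y)" if "y \<in> carrier G" for y
    using W that by (simp add: if_distrib[of "(*) _"] cong: if_cong)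
  have bs: "bounded_fun (\<lambda>y. \<Sum>w\<in>W. \<phi> w * (if r y = w then 1 else 0))"
    by (rule bounded_fun_sum) (rule b)
  have "m (\<lambda>y. \<phi> (r y)) = m (\<lambda>y. \<Sum>w\<in>W. \<phi> w * (if r y = w then 1 else 0))"
    by (rule m_cong[symmetric, OF bs]) (rule eq)
  also have "\<dots> = (\<Sum>w\<in>W. m (\<lambda>y. \<phi> w * (if r y = w then 1 else 0)))"
    by (rule m_sum[OF W(1)]) (rule b)
  also have "\<dots> = (\<Sum>w\<in>W. \<phi> w * m (\<lambda>y. if r y = w then 1 else 0))"
    by (rule sum.cong[OF refl]) (rule m_mult[OF b1])
  finally show "m (\<lambda>y. \<phi> (r y)) = (\<Sum>w\<in>W. \<phi> w * m (\<lambda>y. if r y = w then 1 else 0))" .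
  show "bounded_fun (\<lambda>y. \<phi> (r y))"
    using bs eq unfolding bounded_fun_def by (metis (no_types, lifting))
qed

text \<open>Uniform continuity in one variable reduces the exchange of two means to finite sums; the mean
  being defined on discontinuous functions, no partition of unity is needed.\<close>

lemma fubini:
  assumes B: "\<And>x y. x \<in> carrier G \<Longrightarrow> y \<in> carrier G \<Longrightarrow> \<bar>h x y\<bar> \<le> B"
    and uc: "\<And>e. e > 0 \<Longrightarrow> \<exists>A. openin T A \<and> \<one> \<in> A \<and>
        (\<forall>a\<in>A. \<forall>x\<in>carrier G. \<forall>y\<in>carrier G. \<bar>h x (a \<otimes> y) - h x y\<bar> \<le> e)"
  shows "m (\<lambda>x. m (\<lambda>y. h x y)) = m (\<lambda>y. m (\<lambda>x. h x y))" (is "?l = ?r")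
proof -
  have "\<bar>?l - ?r\<bar> \<le> 2 * e" if e: "e > 0" for e
  proof -
    obtain A where A: "openin T A" "\<one> \<in> A"
      "\<forall>a\<in>A. \<forall>x\<in>carrier G. \<forall>y\<in>carrier G. \<bar>h x (a \<otimes> y) - h x y\<bar> \<le> e"
      using uc[OF e] by (elim exE conjE)
    obtain W where W: "finite W" "W \<subseteq> carrier G" "\<forall>x\<in>carrier G. \<exists>w\<in>W. \<exists>a\<in>A. x = w \<otimes> a"
      by (rule finite_translates_cover[OF A(1,2)])
    have "\<forall>y\<in>carrier G. \<exists>w. w \<in> W \<and> (\<forall>x\<in>carrier G. \<bar>h x y - h x w\<bar> \<le> e)"
    proof
      fix y assume "y \<in> carrier G"
      then obtain w a where wa: "w \<in> W" "a \<in> A" "y = w \<otimes> a" using W(3) by blast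
      have G: "w \<in> carrier G" "a \<in> carrier G" using W(2) wa carrier_if_openin[OF A(1)] by auto
      have "\<bar>h x y - h x w\<bar> \<le> e" if "x \<in> carrier G" for x
        using A(3) wa(2) that G unfolding wa(3) m_comm[OF G] by simp
      with wa(1) show "\<exists>w. w \<in> W \<and> (\<forall>x\<in>carrier G. \<bar>h x y - h x w\<bar> \<le> e)" by (intro exI[of _ w]) simp
    qed
    from bchoice[OF this] obtain r where
      r: "\<forall>y\<in>carrier G. r y \<in> W \<and> (\<forall>x\<in>carrier G. \<bar>h x y - h x (r y)\<bar> \<le> e)" ..
    have rW: "r y \<in> W" if "y \<in> carrier G" for y using r that by simp
    define c where "c w = m (\<lambda>y. if r y = w then 1 else 0)" for w
    note fib = m_sum_fibres[OF W(1), of r, folded c_def]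
    have bx: "bounded_fun (\<lambda>y. h x y)" if "x \<in> carrier G" for x
      using B that by (intro bounded_funI)
    have by': "bounded_fun (\<lambda>x. h x y)" if "y \<in> carrier G" for y
      using B that by (intro bounded_funI)
    have bmx: "bounded_fun (\<lambda>x. m (\<lambda>y. h x y))"
      using B by (intro bounded_funI[of _ B] m_abs_le) simp
    have bmy: "bounded_fun (\<lambda>y. m (\<lambda>x. h x y))"
      using B by (intro bounded_funI[of _ B] m_abs_le) simp
    have bs: "bounded_fun (\<lambda>x. \<Sum>w\<in>W. h x w * c w)"
      using W(2) by (intro bounded_fun_sum bounded_fun_mult bounded_fun_const by') auto
    have l: "\<bar>m (\<lambda>x. m (\<lambda>y. h x y)) - m (\<lambda>x. \<Sum>w\<in>W. h x w * c w)\<bar> \<le> e"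
    proof (rule m_dist[OF bmx bs])
      fix x assume x: "x \<in> carrier G"
      have "\<bar>m (\<lambda>y. h x y) - m (\<lambda>y. h x (r y))\<bar> \<le> e"
        by (rule m_dist[OF bx[OF x] fib(2)[OF rW]]) (use r x in simp_all)
      then show "\<bar>m (\<lambda>y. h x y) - (\<Sum>w\<in>W. h x w * c w)\<bar> \<le> e" by (simp only: fib(1)[OF rW])
    qed
    have mid: "m (\<lambda>x. \<Sum>w\<in>W. h x w * c w) = (\<Sum>w\<in>W. m (\<lambda>x. h x w) * c w)"
    proof -
      have "m (\<lambda>x. \<Sum>w\<in>W. h x w * c w) = (\<Sum>w\<in>W. m (\<lambda>x. h x w * c w))"
        by (rule m_sum[OF W(1)]) (use W(2) in \<open>auto intro!: bounded_fun_mult by'\<close>)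
      also have "\<dots> = (\<Sum>w\<in>W. m (\<lambda>x. h x w) * c w)"
      proof (rule sum.cong[OF refl])
        fix w assume "w \<in> W"
        then show "m (\<lambda>x. h x w * c w) = m (\<lambda>x. h x w) * c w"
          using m_mult[OF by', of w "c w"] W(2) by (auto simp: mult.commute)
      qed
      finally show ?thesis .
    qed
    have "\<bar>m (\<lambda>y. m (\<lambda>x. h x y)) - m (\<lambda>y. m (\<lambda>x. h x (r y)))\<bar> \<le> e"
    proof (rule m_dist[OF bmy fib(2)[OF rW]])
      fix y assume y: "y \<in> carrier G"
      have "r y \<in> carrier G" using rW[OF y] W(2) by blast
      then show "\<bar>m (\<lambda>x. h x y) - m (\<lambda>x. h x (r y))\<bar> \<le> e"
        using r y by (intro m_dist by') simp_all
    qed simp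
    moreover have "m (\<lambda>y. m (\<lambda>x. h x (r y))) = (\<Sum>w\<in>W. m (\<lambda>x. h x w) * c w)"
      by (rule fib(1)[OF rW])
    ultimately show ?thesis using l unfolding mid by linarith
  qed
  \<comment> \<open>A positive difference would be at most half of itself.\<close>
  from this[of "\<bar>?l - ?r\<bar> / 4"] show ?thesis by (cases "?l = ?r") auto
qed

lemma cauchy_schwarz:
  assumes f: "bounded_fun f" "bounded_fun g" and pos: "m (\<lambda>x. (g x)\<^sup>2) > 0"
  shows "(m (\<lambda>x. f x * g x))\<^sup>2 \<le> m (\<lambda>x. (f x)\<^sup>2) * m (\<lambda>x. (g x)\<^sup>2)"
proof -
  define a b c where "a = m (\<lambda>x. (f x)\<^sup>2)" and "b = m (\<lambda>x. f x * g x)" and "c = m (\<lambda>x. (g x)\<^sup>2)"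
  \<comment> \<open>The minimum of the quadratic polynomial given by the mean of the square of
    \<open>f + t g\<close>.\<close>
  define t where "t = - b / c"
  have sq: "bounded_fun (\<lambda>x. (f x)\<^sup>2)" "bounded_fun (\<lambda>x. f x * g x)" "bounded_fun (\<lambda>x. (g x)\<^sup>2)"
    by (intro bounded_fun_power2 bounded_fun_mult f)+
  have "0 \<le> m (\<lambda>x. (f x + t * g x)\<^sup>2)"
    using m_le[of "\<lambda>x. 0" "\<lambda>x. (f x + t * g x)\<^sup>2"] m_const[of 0] f
    by (simp add: bounded_fun_power2 bounded_fun_add bounded_fun_mult)
  also have "(\<lambda>x. (f x + t * g x)\<^sup>2) = (\<lambda>x. ((f x)\<^sup>2 + (2 * t) * (f x * g x)) + t\<^sup>2 * (g x)\<^sup>2)"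
    by (auto simp: power2_eq_square algebra_simps)
  also have "m \<dots> = m (\<lambda>x. (f x)\<^sup>2 + (2 * t) * (f x * g x)) + t\<^sup>2 * c"
    unfolding c_def by (intro m_add_mult bounded_fun_add bounded_fun_mult[OF bounded_fun_const] sq)
  also have "m (\<lambda>x. (f x)\<^sup>2 + (2 * t) * (f x * g x)) = a + (2 * t) * b"
    unfolding a_def b_def by (intro m_add_mult sq)
  finally have nonneg: "0 \<le> a + 2 * t * b + t\<^sup>2 * c" .
  have c: "c > 0" using pos by (simp only: c_def)
  have "0 \<le> (a + 2 * t * b + t\<^sup>2 * c) * c" using nonneg c by (intro mult_nonneg_nonneg) simp_all
  also have "\<dots> = a * c - b\<^sup>2"
    using c by (simp add: t_def field_simps power2_eq_square)
  finally show ?thesis by (simp add: a_def b_def c_def)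
qed

text \<open>By uniform continuity f stays away from 0 on a translate of a neighbourhood of
  \<open>\<one>\<close>. Finitely many translates of its square then add up to at least
  \<open>e\<^sup>2\<close> everywhere, and all of them have the same mean.\<close>

lemma m_square_pos:
  assumes f: "bounded_fun f" "unif_continuous f" and x: "x \<in> carrier G" "f x \<noteq> 0"
  shows "m (\<lambda>y. (f y)\<^sup>2) > 0"
proof -
  define e where "e = \<bar>f x\<bar> / 2"
  have e: "e > 0" using x by (simp add: e_def)
  obtain A where A: "openin T A" "\<one> \<in> A" "\<forall>a\<in>A. \<forall>x\<in>carrier G. \<bar>f (a \<otimes> x) - f x\<bar> \<le> e"
    by (rule unif_continuousE[OF f(2) e])
  obtain W where W: "finite W" "W \<subseteq> carrier G" "\<forall>x\<in>carrier G. \<exists>w\<in>W. \<exists>a\<in>A. x = w \<otimes> a"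
    by (rule finite_translates_cover[OF A(1,2)])
  have bw: "bounded_fun (\<lambda>y. (f ((inv w \<otimes> x) \<otimes> y))\<^sup>2)" if "w \<in> W" for w
    using W(2) that x(1) by (intro bounded_fun_translate[OF bounded_fun_power2[OF f(1)]]) auto
  have "e\<^sup>2 \<le> (\<Sum>w\<in>W. (f ((inv w \<otimes> x) \<otimes> y))\<^sup>2)" if y: "y \<in> carrier G" for y
  proof -
    obtain w a where wa: "w \<in> W" "a \<in> A" "y = w \<otimes> a" using W(3) y by blast
    have G: "w \<in> carrier G" "a \<in> carrier G" using W(2) wa carrier_if_openin[OF A(1)] by auto
    \<comment> \<open>The translation is chosen to carry the patch around w, which contains y, to
      the patch around x, where f is large.\<close>
    have "(inv w \<otimes> x) \<otimes> y = a \<otimes> x"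
      unfolding wa(3) using G x(1) by (metis inv_closed inv_solve_left m_assoc m_closed m_comm)
    then have "f ((inv w \<otimes> x) \<otimes> y) = f (a \<otimes> x)" by (rule arg_cong)
    moreover have "\<bar>f (a \<otimes> x) - f x\<bar> \<le> e" using A(3) wa(2) x(1) by blast
    ultimately have "\<bar>e\<bar> \<le> \<bar>f ((inv w \<otimes> x) \<otimes> y)\<bar>" using e unfolding e_def by linarith
    then have "e\<^sup>2 \<le> (f ((inv w \<otimes> x) \<otimes> y))\<^sup>2" by (simp only: abs_le_square_iff)
    also have "\<dots> \<le> (\<Sum>w\<in>W. (f ((inv w \<otimes> x) \<otimes> y))\<^sup>2)"
      by (rule member_le_sum[OF wa(1) _ W(1)]) simp
    finally show ?thesis .
  qed
  note le = this
  have "m (\<lambda>y. e\<^sup>2) \<le> m (\<lambda>y. \<Sum>w\<in>W. (f ((inv w \<otimes> x) \<otimes> y))\<^sup>2)"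
  proof (rule m_le)
    show "bounded_fun (\<lambda>y. \<Sum>w\<in>W. (f ((inv w \<otimes> x) \<otimes> y))\<^sup>2)" by (rule bounded_fun_sum) (rule bw)
  qed (simp, rule le)
  also have "\<dots> = (\<Sum>w\<in>W. m (\<lambda>y. (f ((inv w \<otimes> x) \<otimes> y))\<^sup>2))" by (rule m_sum[OF W(1)]) (rule bw)
  also have "\<dots> = (\<Sum>w\<in>W. m (\<lambda>y. (f y)\<^sup>2))"
  proof (rule sum.cong[OF refl])
    fix w assume "w \<in> W"
    then show "m (\<lambda>y. (f ((inv w \<otimes> x) \<otimes> y))\<^sup>2) = m (\<lambda>y. (f y)\<^sup>2)"
      using W(2) x(1) by (intro invariant[OF bounded_fun_power2[OF f(1)]]) auto
  qed
  finally have "e\<^sup>2 \<le> card W * m (\<lambda>y. (f y)\<^sup>2)" by (simp add: m_const)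
  then have "0 < card W * m (\<lambda>y. (f y)\<^sup>2)" using e by (simp add: less_le_trans[OF zero_less_power])
  then show ?thesis by (simp add: zero_less_mult_iff)
qed

end


lemma le_if_nat_mult_le:
  fixes u v c :: real
  assumes "\<And>n::nat. n * u \<le> n * v + c"
  shows "u \<le> v"
proof (rule ccontr)
  assume "\<not> u \<le> v"
  then obtain n :: nat where "c < n * (u - v)" using reals_Archimedean3[of "u - v"] by auto
  then show False using assms[of n] by (simp add: algebra_simps)
qed

text \<open>Evenness of f makes convolution with f self-adjoint for the inner product given by the
  mean. Mean zero makes convolution annihilate constants, so all convolution powers have mean zero
  as well.\<close>

locale compact_group_kernel = compact_group_mean +
  fixes f B
  assumes f_bound: "\<And>x. x \<in> carrier G \<Longrightarrow> \<bar>f x\<bar> \<le> B" and B_pos: "B > 0"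
    and f_uc: "unif_continuous f"
    and f_even: "\<And>x. x \<in> carrier G \<Longrightarrow> f (inv x) = f x"
    and f_mean: "m f = 0"
    and f_nonzero: "\<exists>x\<in>carrier G. f x \<noteq> 0"
begin

definition conv :: "('a \<Rightarrow> real) \<Rightarrow> 'a \<Rightarrow> real" where
  "conv \<phi> x = m (\<lambda>y. f (x \<otimes> inv y) * \<phi> y)"

lemma f_sym: "x \<in> carrier G \<Longrightarrow> y \<in> carrier G \<Longrightarrow> f (x \<otimes> inv y) = f (y \<otimes> inv x)"
  using f_even[of "y \<otimes> inv x"] by (simp add: inv_mult m_comm)

lemma bounded_kernel:
  assumes "bounded_fun \<phi>" "x \<in> carrier G"
  shows "bounded_fun (\<lambda>y. f (x \<otimes> inv y) * \<phi> y)"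
proof (rule bounded_fun_mult[OF _ assms(1)])
  show "bounded_fun (\<lambda>y. f (x \<otimes> inv y))"
    by (rule bounded_funI[of _ B]) (use assms(2) in \<open>simp add: f_bound\<close>)
qed

lemma conv_bound:
  assumes "\<forall>y\<in>carrier G. \<bar>\<phi> y\<bar> \<le> b" "x \<in> carrier G"
  shows "\<bar>conv \<phi> x\<bar> \<le> B * b"
  unfolding conv_def
proof (rule m_abs_le)
  fix y assume y: "y \<in> carrier G"
  show "\<bar>f (x \<otimes> inv y) * \<phi> y\<bar> \<le> B * b"
    unfolding abs_mult by (rule mult_mono) (use assms y f_bound B_pos in \<open>simp_all add: less_imp_le\<close>)
qed

lemma bounded_conv:
  assumes "bounded_fun \<phi>"
  shows "bounded_fun (conv \<phi>)"
proof -
  obtain b where b: "b > 0" "\<forall>x\<in>carrier G. \<bar>\<phi> x\<bar> \<le> b"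
    by (rule bounded_funE[OF assms])
  show ?thesis by (rule bounded_funI) (rule conv_bound[OF b(2)])
qed

lemma conv_uc:
  assumes \<phi>: "bounded_fun \<phi>"
  shows "unif_continuous (conv \<phi>)"
  unfolding unif_continuous_def
proof (intro allI impI)
  fix e :: real assume e: "e > 0"
  obtain b where b: "b > 0" "\<forall>x\<in>carrier G. \<bar>\<phi> x\<bar> \<le> b"
    by (rule bounded_funE[OF \<phi>])
  have "e / b > 0" using e b(1) by simp
  then obtain A where A: "openin T A" "\<one> \<in> A" "\<forall>a\<in>A. \<forall>x\<in>carrier G. \<bar>f (a \<otimes> x) - f x\<bar> \<le> e / b"
    by (rule unif_continuousE[OF f_uc])
  have "\<bar>conv \<phi> (a \<otimes> x) - conv \<phi> x\<bar> \<le> e" if a: "a \<in> A" and x: "x \<in> carrier G" for a x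
    unfolding conv_def
  proof (rule m_dist)
    have aG: "a \<in> carrier G" using a A(1) carrier_if_openin by blast
    show "bounded_fun (\<lambda>y. f (a \<otimes> x \<otimes> inv y) * \<phi> y)" "bounded_fun (\<lambda>y. f (x \<otimes> inv y) * \<phi> y)"
      using \<phi> x aG by (simp_all add: bounded_kernel)
    fix y assume y: "y \<in> carrier G"
    have "\<bar>f (a \<otimes> (x \<otimes> inv y)) - f (x \<otimes> inv y)\<bar> \<le> e / b" using A(3) a x y by simp
    then have "\<bar>f (a \<otimes> (x \<otimes> inv y)) - f (x \<otimes> inv y)\<bar> * \<bar>\<phi> y\<bar> \<le> (e / b) * b"
      using b y e by (intro mult_mono) simp_all
    then show "\<bar>f (a \<otimes> x \<otimes> inv y) * \<phi> y - f (x \<otimes> inv y) * \<phi> y\<bar> \<le> e"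
      using b(1) x y aG by (simp add: m_assoc left_diff_distrib[symmetric] abs_mult)
  qed
  then show "\<exists>A. openin T A \<and> \<one> \<in> A \<and> (\<forall>a\<in>A. \<forall>x\<in>carrier G. \<bar>conv \<phi> (a \<otimes> x) - conv \<phi> x\<bar> \<le> e)"
    using A(1,2) by (intro exI[of _ A]) simp
qed

text \<open>The kernel \<open>f (x \<otimes> inv y)\<close> is symmetric in x and y, so the identity
  is an exchange of two means.\<close>

lemma conv_self_adjoint:
  assumes \<psi>: "bounded_fun \<psi>" and \<phi>: "bounded_fun \<phi>" "unif_continuous \<phi>"
  shows "m (\<lambda>x. \<psi> x * conv \<phi> x) = m (\<lambda>y. \<phi> y * conv \<psi> y)"
proof -
  obtain b where b: "b > 0" "\<forall>x\<in>carrier G. \<bar>\<phi> x\<bar> \<le> b"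
    by (rule bounded_funE[OF \<phi>(1)])
  obtain c where c: "c > 0" "\<forall>x\<in>carrier G. \<bar>\<psi> x\<bar> \<le> c"
    by (rule bounded_funE[OF \<psi>])
  define h where "h x y = \<psi> x * (f (x \<otimes> inv y) * \<phi> y)" for x y
  have "m (\<lambda>x. \<psi> x * conv \<phi> x) = m (\<lambda>x. m (\<lambda>y. h x y))"
    by (rule m_cong[OF bounded_fun_mult[OF \<psi> bounded_conv[OF \<phi>(1)]]])
      (simp add: h_def conv_def m_mult[OF bounded_kernel[OF \<phi>(1)]])
  also have "\<dots> = m (\<lambda>y. m (\<lambda>x. h x y))"
  proof (rule fubini)
    fix x y assume xy: "x \<in> carrier G" "y \<in> carrier G"
    show "\<bar>h x y\<bar> \<le> c * (B * b)"
      unfolding h_def abs_mult using xy b c B_pos f_bound by (intro mult_mono) simp_all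
  next
    fix e :: real assume e: "e > 0"
    \<comment> \<open>B, b and c bound f, \<open>\<phi>\<close> and \<open>\<psi>\<close>. Each of
      the two summands in the product rule below contributes half of e.\<close>
    have e1: "e / (2 * b * c) > 0" and e2: "e / (2 * B * c) > 0" using e b c B_pos by simp_all
    obtain A where A: "openin T A" "\<one> \<in> A" "\<forall>a\<in>A. \<forall>x\<in>carrier G. \<bar>f (a \<otimes> x) - f x\<bar> \<le> e / (2 * b * c)"
      by (rule unif_continuousE[OF f_uc e1])
    obtain A' where A': "openin T A'" "\<one> \<in> A'" "\<forall>a\<in>A'. \<forall>x\<in>carrier G. \<bar>\<phi> (a \<otimes> x) - \<phi> x\<bar> \<le> e / (2 * B * c)"
      by (rule unif_continuousE[OF \<phi>(2) e2])
    have "\<bar>h x (a \<otimes> y) - h x y\<bar> \<le> e" if a: "a \<in> A \<inter> A'" and x: "x \<in> carrier G" and y: "y \<in> carrier G" for a x y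
    proof -
      have aG: "a \<in> carrier G" using a A(1) carrier_if_openin by blast
      have "f (x \<otimes> inv (a \<otimes> y)) = f (a \<otimes> (y \<otimes> inv x))"
        using f_sym[of x "a \<otimes> y"] x y aG by (simp add: m_assoc)
      moreover have "\<bar>f (a \<otimes> (y \<otimes> inv x)) - f (y \<otimes> inv x)\<bar> \<le> e / (2 * b * c)" using A(3) a x y by simp
      ultimately have 1: "\<bar>f (x \<otimes> inv (a \<otimes> y)) - f (x \<otimes> inv y)\<bar> \<le> e / (2 * b * c)"
        using f_sym[OF x y] by simp
      have 2: "\<bar>\<phi> (a \<otimes> y) - \<phi> y\<bar> \<le> e / (2 * B * c)" using A'(3) a y by simp
      have "h x (a \<otimes> y) - h x y = \<psi> x * ((f (x \<otimes> inv (a \<otimes> y)) - f (x \<otimes> inv y)) * \<phi> (a \<otimes> y) +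
          f (x \<otimes> inv y) * (\<phi> (a \<otimes> y) - \<phi> y))"
        by (simp add: h_def algebra_simps)
      also have "\<bar>\<dots>\<bar> \<le> c * (e / (2 * b * c) * b + B * (e / (2 * B * c)))"
      proof -
        have "\<bar>(f (x \<otimes> inv (a \<otimes> y)) - f (x \<otimes> inv y)) * \<phi> (a \<otimes> y)\<bar> \<le> e / (2 * b * c) * b"
          unfolding abs_mult using 1 b(2) aG y e1 by (intro mult_mono) simp_all
        moreover have "\<bar>f (x \<otimes> inv y) * (\<phi> (a \<otimes> y) - \<phi> y)\<bar> \<le> B * (e / (2 * B * c))"
          unfolding abs_mult using 2 f_bound x y B_pos by (intro mult_mono) simp_all
        ultimately have "\<bar>(f (x \<otimes> inv (a \<otimes> y)) - f (x \<otimes> inv y)) * \<phi> (a \<otimes> y) +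
          f (x \<otimes> inv y) * (\<phi> (a \<otimes> y) - \<phi> y)\<bar> \<le> e / (2 * b * c) * b + B * (e / (2 * B * c))"
          by (rule order_trans[OF abs_triangle_ineq add_mono])
        then show ?thesis
          unfolding abs_mult[of "\<psi> x"] using c x by (intro mult_mono) simp_all
      qed
      also have "\<dots> = e" using b(1) c(1) B_pos by (simp add: field_simps)
      finally show ?thesis .
    qed
    then show "\<exists>A. openin T A \<and> \<one> \<in> A \<and>
        (\<forall>a\<in>A. \<forall>x\<in>carrier G. \<forall>y\<in>carrier G. \<bar>h x (a \<otimes> y) - h x y\<bar> \<le> e)"
      using A(1,2) A'(1,2) by (intro exI[of _ "A \<inter> A'"]) (simp add: openin_Int)
  qed
  also have "\<dots> = m (\<lambda>y. \<phi> y * conv \<psi> y)"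
  proof (rule m_cong[symmetric, OF bounded_fun_mult[OF \<phi>(1) bounded_conv[OF \<psi>]]])
    fix y assume y: "y \<in> carrier G"
    have "\<phi> y * conv \<psi> y = m (\<lambda>x. \<phi> y * (f (y \<otimes> inv x) * \<psi> x))"
      unfolding conv_def by (rule m_mult[symmetric, OF bounded_kernel[OF \<psi> y]])
    also have "\<dots> = m (\<lambda>x. h x y)"
      by (rule m_cong[OF bounded_fun_mult[OF bounded_fun_const bounded_kernel[OF \<psi> y]]])
        (simp add: h_def f_sym[OF y])
    finally show "\<phi> y * conv \<psi> y = m (\<lambda>x. h x y)" .
  qed
  finally show ?thesis .
qed

text \<open>The mean is the pairing with the constant 1. By self-adjointness the convolution moves
  onto this constant, where it gives 0.\<close>

lemma m_conv:
  assumes "bounded_fun \<phi>" "unif_continuous \<phi>"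
  shows "m (conv \<phi>) = 0"
proof -
  have bf: "bounded_fun f" using f_bound by (rule bounded_funI)
  have conv1: "conv (\<lambda>x. 1) y = 0" if y: "y \<in> carrier G" for y
  proof -
    have "conv (\<lambda>x. 1) y = m (\<lambda>x. f (inv y \<otimes> x))"
      unfolding conv_def
      by (rule m_cong[OF bounded_kernel[OF bounded_fun_const y]]) (use y in \<open>simp add: f_sym[of y] m_comm\<close>)
    also have "\<dots> = 0" using invariant[OF bf] y f_mean by simp
    finally show ?thesis .
  qed
  have "m (conv \<phi>) = m (\<lambda>y. \<phi> y * conv (\<lambda>x. 1) y)"
    using conv_self_adjoint[OF bounded_fun_const assms, of 1] by simp
  also have "\<dots> = m (\<lambda>y. 0)"
    by (rule m_cong[OF bounded_fun_mult[OF assms(1) bounded_conv[OF bounded_fun_const]]]) (simp add: conv1)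
  finally show ?thesis by (simp add: m_const)
qed

text \<open>If \<open>f\<close> varies little along all powers of \<open>w\<close>, then so does the convolution \<open>conv \<phi>\<close> of \<open>f\<close> and \<open>\<phi>\<close> relative to \<open>\<phi>\<close>:
  up to the error \<open>\<delta> d\<close>, the increments along \<open>x, w x, w\<^sup>2 x, \<dots>\<close> are all equal, while
  their sums remain bounded.\<close>

lemma conv_increment:
  assumes w: "w \<in> carrier G" and \<delta>: "\<And>k::nat. \<And>x. x \<in> carrier G \<Longrightarrow> \<bar>f (w [^] k \<otimes> x) - f x\<bar> \<le> \<delta>"
    and \<phi>: "bounded_fun \<phi>" and d: "\<And>y. y \<in> carrier G \<Longrightarrow> \<bar>\<phi> (w \<otimes> y) - \<phi> y\<bar> \<le> d"
    and x: "x \<in> carrier G"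
  shows "\<bar>conv \<phi> (w \<otimes> x) - conv \<phi> x\<bar> \<le> \<delta> * d"
proof -
  obtain b where b: "b > 0" "\<forall>x\<in>carrier G. \<bar>\<phi> x\<bar> \<le> b"
    by (rule bounded_funE[OF \<phi>])
  have \<phi>w: "bounded_fun (\<lambda>y. \<phi> (w \<otimes> y))" by (rule bounded_fun_translate[OF \<phi> w])
  have \<delta>0: "\<delta> \<ge> 0" using \<delta>[OF x, of 0] by linarith
  \<comment> \<open>Substituting \<open>w \<otimes> y\<close> for y under the mean moves the
    translation from f to \<open>\<phi>\<close>. So the increment of the convolution is the
    convolution with the increment of \<open>\<phi>\<close>.\<close>
  have diff: "conv \<phi> (w \<otimes> z) - conv \<phi> z = m (\<lambda>y. f (z \<otimes> inv y) * (\<phi> (w \<otimes> y) - \<phi> y))"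
    if z: "z \<in> carrier G" for z
  proof -
    have "conv \<phi> (w \<otimes> z) = m (\<lambda>y. f (w \<otimes> z \<otimes> inv (w \<otimes> y)) * \<phi> (w \<otimes> y))"
      unfolding conv_def using w z by (intro invariant[symmetric] bounded_kernel \<phi>) simp_all
    also have "\<dots> = m (\<lambda>y. f (z \<otimes> inv y) * \<phi> (w \<otimes> y))"
    proof (rule m_cong[symmetric, OF bounded_kernel[OF \<phi>w z]])
      fix y assume y: "y \<in> carrier G"
      have "w \<otimes> z \<otimes> inv (w \<otimes> y) = z \<otimes> inv y"
      proof -
        have "w \<otimes> z \<otimes> inv (w \<otimes> y) = (w \<otimes> inv w) \<otimes> (z \<otimes> inv y)"
          unfolding inv_mult[OF w y] using w z y by (simp only: m_ac inv_closed m_closed)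
        then show ?thesis using w z y by simp
      qed
      then show "f (z \<otimes> inv y) * \<phi> (w \<otimes> y) = f (w \<otimes> z \<otimes> inv (w \<otimes> y)) * \<phi> (w \<otimes> y)" by simp
    qed
    finally show ?thesis
      using m_diff[OF bounded_kernel[OF \<phi>w z] bounded_kernel[OF \<phi> z]] by (simp add: conv_def right_diff_distrib)
  qed
  define a where "a k = conv \<phi> (w [^] k \<otimes> x)" for k :: nat
  have step: "\<bar>(a (Suc k) - a k) - (a 1 - a 0)\<bar> \<le> \<delta> * d" for k
  proof -
    have wk: "w [^] k \<otimes> x \<in> carrier G" using w x by simp
    have \<phi>d: "bounded_fun (\<lambda>y. \<phi> (w \<otimes> y) - \<phi> y)" by (rule bounded_fun_diff[OF \<phi>w \<phi>])
    have "w [^] Suc k \<otimes> x = w \<otimes> (w [^] k \<otimes> x)" using w x by (simp add: m_ac)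
    then have 1: "a (Suc k) - a k = m (\<lambda>y. f (w [^] k \<otimes> x \<otimes> inv y) * (\<phi> (w \<otimes> y) - \<phi> y))"
      using diff[OF wk] by (simp add: a_def)
    have 2: "a 1 - a 0 = m (\<lambda>y. f (x \<otimes> inv y) * (\<phi> (w \<otimes> y) - \<phi> y))"
      using diff[OF x] w x by (simp add: a_def)
    show ?thesis
      unfolding 1 2
    proof (rule m_dist[OF bounded_kernel[OF \<phi>d wk] bounded_kernel[OF \<phi>d x]])
      fix y assume y: "y \<in> carrier G"
      have "\<bar>f (w [^] k \<otimes> (x \<otimes> inv y)) - f (x \<otimes> inv y)\<bar> * \<bar>\<phi> (w \<otimes> y) - \<phi> y\<bar> \<le> \<delta> * d"
        using \<delta>[of "x \<otimes> inv y" k] d[OF y] x y \<delta>0 by (intro mult_mono) simp_all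
      then show "\<bar>f (w [^] k \<otimes> x \<otimes> inv y) * (\<phi> (w \<otimes> y) - \<phi> y) - f (x \<otimes> inv y) * (\<phi> (w \<otimes> y) - \<phi> y)\<bar> \<le> \<delta> * d"
        using w x y by (simp add: m_assoc left_diff_distrib[symmetric] abs_mult)
    qed
  qed
  have tele: "\<bar>a n - a 0 - n * (a 1 - a 0)\<bar> \<le> n * (\<delta> * d)" for n :: nat
  proof (induction n)
    case (Suc n)
    then show ?case using step[of n] by (simp add: algebra_simps)
  qed simp
  have bd: "\<bar>a n\<bar> \<le> B * b" for n :: nat
    unfolding a_def by (rule conv_bound[OF b(2)]) (use w x in simp)
  have "n * \<bar>a 1 - a 0\<bar> \<le> n * (\<delta> * d) + 2 * (B * b)" for n :: nat
  proof -
    have "n * \<bar>a 1 - a 0\<bar> = \<bar>n * (a 1 - a 0)\<bar>" by (simp add: abs_mult)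
    then show ?thesis using tele[of n] bd[of n] bd[of 0] by linarith
  qed
  then have "\<bar>a 1 - a 0\<bar> \<le> \<delta> * d" by (rule le_if_nat_mult_le)
  then show ?thesis using w x by (simp add: a_def)
qed

text \<open>The convolution power of f with n+1 factors.\<close>

definition P :: "nat \<Rightarrow> 'a \<Rightarrow> real" where "P n = (conv ^^ n) f"

lemma P_simps: "P 0 = f" "P (Suc n) = conv (P n)"
  by (simp_all add: P_def)

lemma P_bounded: "bounded_fun (P n)"
  by (induction n) (auto simp: P_simps intro: bounded_conv bounded_funI f_bound)

lemma P_uc: "unif_continuous (P n)"
  by (cases n) (simp_all add: P_simps f_uc conv_uc P_bounded)

lemma m_P: "m (P n) = 0"
  by (cases n) (simp_all add: P_simps f_mean m_conv P_bounded P_uc)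

definition U :: "nat \<Rightarrow> real" where "U n = m (\<lambda>x. (P n x)\<^sup>2)"

text \<open>\<open>U n\<close> is the squared norm of \<open>P n\<close>. By self-adjointness
  \<open>U (Suc n)\<close> is also the inner product of \<open>P n\<close> and
  \<open>P (Suc (Suc n))\<close>, to which the Cauchy-Schwarz inequality applies.\<close>

lemma U_log_convex: "U n > 0 \<Longrightarrow> (U (Suc n))\<^sup>2 \<le> U n * U (Suc (Suc n))"
proof -
  assume pos: "U n > 0"
  have "U (Suc n) = m (\<lambda>x. P (Suc n) x * conv (P n) x)"
    unfolding U_def by (simp add: P_simps power2_eq_square)
  also have "\<dots> = m (\<lambda>x. P n x * P (Suc (Suc n)) x)"
    using conv_self_adjoint[OF P_bounded P_bounded P_uc, of "Suc n" n] by (simp only: P_simps)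
  finally show ?thesis
    using cauchy_schwarz[OF P_bounded P_bounded pos[unfolded U_def], of "Suc (Suc n)"]
    by (simp add: U_def mult.commute)
qed

text \<open>For even f the value of the convolution square at \<open>\<one>\<close> is the mean of
  the square of f, which is positive.\<close>

lemma U_pos: "U 0 > 0" "U 1 > 0"
proof -
  obtain x where "x \<in> carrier G" "f x \<noteq> 0" using f_nonzero by blast
  then show U0: "U 0 > 0" unfolding U_def using m_square_pos[OF P_bounded P_uc, of x 0] by (simp add: P_simps)
  have "conv f \<one> = m (\<lambda>y. (f y)\<^sup>2)"
    unfolding conv_def
  proof (rule m_cong[OF bounded_kernel])
    show "bounded_fun f" using f_bound by (rule bounded_funI)
    show "f (\<one> \<otimes> inv y) * f y = (f y)\<^sup>2" if "y \<in> carrier G" for y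
      using that f_even by (simp add: power2_eq_square)
  qed simp
  then have "P 1 \<one> \<noteq> 0" using U0 by (simp add: P_simps U_def)
  then show "U 1 > 0" unfolding U_def by (rule m_square_pos[OF P_bounded P_uc one_closed])
qed

text \<open>Log-convexity makes the quotients of consecutive terms non-decreasing, so none falls
  below the first. Positivity is carried along to allow the next division.\<close>

lemma U_ratio: "U n > 0 \<and> U 1 / U 0 * U n \<le> U (Suc n)"
proof (induction n)
  case 0
  then show ?case using U_pos by simp
next
  case (Suc n)
  have r: "U 1 / U 0 > 0" using U_pos by simp
  have pos: "U (Suc n) > 0" using Suc r by (meson less_le_trans mult_pos_pos)
  have "(U 1 / U 0 * U n) * U (Suc n) \<le> U (Suc n) * U (Suc n)"
    using Suc pos by (intro mult_right_mono) simp_all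
  also have "\<dots> \<le> U n * U (Suc (Suc n))" using U_log_convex Suc by (simp add: power2_eq_square)
  finally have "U n * (U 1 / U 0 * U (Suc n)) \<le> U n * U (Suc (Suc n))" by (simp add: mult_ac)
  then have "U 1 / U 0 * U (Suc n) \<le> U (Suc (Suc n))"
    by (rule mult_left_le_imp_le) (use Suc in simp)
  with pos show ?case by blast
qed

lemma U_ge: "U 0 * (U 1 / U 0) ^ n \<le> U n"
proof (induction n)
  case (Suc n)
  have "U 0 * (U 1 / U 0) ^ Suc n = U 1 / U 0 * (U 0 * (U 1 / U 0) ^ n)" by simp
  also have "\<dots> \<le> U 1 / U 0 * U n" using Suc U_pos by (intro mult_left_mono) simp_all
  also have "\<dots> \<le> U (Suc n)" using U_ratio by simp
  finally show ?case .
qed simp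

text \<open>Each convolution multiplies the increment by \<open>\<delta>\<close> and not by a bound
  of f. This is the gain that smallness along all powers of w provides.\<close>

lemma P_increment:
  assumes w: "w \<in> carrier G" and \<delta>: "\<And>k::nat. \<And>x. x \<in> carrier G \<Longrightarrow> \<bar>f (w [^] k \<otimes> x) - f x\<bar> \<le> \<delta>"
    and "x \<in> carrier G"
  shows "\<bar>P n (w \<otimes> x) - P n x\<bar> \<le> \<delta> ^ Suc n"
  using assms(3)
proof (induction n arbitrary: x)
  case 0
  then show ?case using \<delta>[of x 1] w by (simp add: P_simps)
next
  case (Suc n)
  show ?case unfolding P_simps power_Suc[of \<delta> "Suc n"] by (rule conv_increment[OF w \<delta> P_bounded Suc.IH Suc.prems])
qed

text \<open>In a connected compact group every element is a product of at most M elements of W, so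
  the increments along W bound the oscillation of \<open>P n\<close> by a multiple of
  \<open>\<delta> ^ Suc n\<close>. As \<open>P n\<close> has mean zero, this bounds
  \<open>U n\<close> from above, against the exponential lower bound with rate
  \<open>\<rho>\<close>.\<close>

lemma not_connected:
  assumes small: "\<And>V. openin T V \<Longrightarrow> \<one> \<in> V \<Longrightarrow> \<exists>W. openin T W \<and> \<one> \<in> W \<and> (\<forall>w\<in>W. \<forall>k::nat. w [^] k \<in> V)"
  shows "\<not> connected_space T"
proof
  assume conn: "connected_space T"
  define \<rho> where "\<rho> = U 1 / U 0"
  have \<rho>: "\<rho> > 0" using U_pos by (simp add: \<rho>_def)
  \<comment> \<open>The upper bound for \<open>U n\<close> decays like the powers of
    \<open>\<delta>\<^sup>2\<close>, so this must be smaller than \<open>\<rho>\<close>; the factor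
    1/2 makes it \<open>\<rho> / 4\<close>.\<close>
  define \<delta> where "\<delta> = sqrt \<rho> / 2"
  have \<delta>: "\<delta> > 0" using \<rho> by (simp add: \<delta>_def)
  have \<delta>2: "\<delta>\<^sup>2 = \<rho> / 4" using \<rho> by (simp add: \<delta>_def power_divide)
  obtain A where A: "openin T A" "\<one> \<in> A" "\<forall>a\<in>A. \<forall>x\<in>carrier G. \<bar>f (a \<otimes> x) - f x\<bar> \<le> \<delta>"
    by (rule unif_continuousE[OF f_uc \<delta>])
  obtain V where V: "openin T V" "\<one> \<in> V" "\<forall>w\<in>V. \<forall>k::nat. w [^] k \<in> A"
    using small[OF A(1,2)] by (elim exE conjE)
  obtain W where W: "openin T W" "\<one> \<in> W" "\<And>a. a \<in> W \<Longrightarrow> inv a \<in> W" "W \<subseteq> V"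
    by (rule nbhd_sym_mult[OF V(1,2)]) (rule that)
  have WG: "W \<subseteq> carrier G" using W(1) carrier_if_openin by blast
  have incr: "\<bar>P n (w \<otimes> x) - P n x\<bar> \<le> \<delta> ^ Suc n" if "w \<in> W" "x \<in> carrier G" for w x n
  proof (rule P_increment[OF _ _ that(2)])
    show "w \<in> carrier G" using that WG by blast
    show "\<bar>f (w [^] k \<otimes> x) - f x\<bar> \<le> \<delta>" if "x \<in> carrier G" for k :: nat and x
      using A(3) V(3) W(4) \<open>w \<in> W\<close> that by blast
  qed
  have powers: "\<bar>P n y - P n \<one>\<bar> \<le> k * \<delta> ^ Suc n" if "y \<in> set_power G W k" for y k n
    using that
  proof (induction k arbitrary: y)
    case (Suc k)
    then obtain a z where az: "a \<in> W" "z \<in> set_power G W k" "y = a \<otimes> z" by (auto simp: set_mult_def)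
    have "z \<in> carrier G" using az(2) set_power_subset[OF WG] by blast
    then show ?case using incr[OF az(1), of z n] Suc.IH[OF az(2)] unfolding az(3) by (simp add: algebra_simps)
  qed simp
  define H where "H = (\<Union>k. set_power G W k)"
  have H: "subgroup H G" unfolding H_def by (rule subgroup_Union_set_power[OF WG W(3)])
  have "W = set_power G W (Suc 0)" using set_power_1[OF WG] by simp
  then have "W \<subseteq> H" unfolding H_def by blast
  then have "openin T H" using openin_subgroup_if_nbhd[OF H W(1,2)] by simp
  moreover have "closedin T H" by (rule closedin_open_subgroup[OF H \<open>openin T H\<close>])
  moreover have "H \<noteq> {}" using subgroup.one_closed[OF H] by blast
  ultimately have HG: "H = carrier G"
    using conn unfolding connected_space_clopen_in topspace_eq by blast
  obtain Q where Q: "finite Q" "Q \<subseteq> carrier G" "\<forall>x\<in>carrier G. \<exists>w\<in>Q. \<exists>a\<in>W. x = w \<otimes> a"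
    by (rule finite_translates_cover[OF W(1,2)])
  have "\<forall>q\<in>Q. \<exists>k. q \<in> set_power G W k" using Q(2) unfolding HG[symmetric] H_def by blast
  from bchoice[OF this] obtain \<kappa> where \<kappa>: "\<forall>q\<in>Q. q \<in> set_power G W (\<kappa> q)" ..
  \<comment> \<open>A bound for the number of factors from W, valid for every element: connectedness
    makes W generate the group, and compactness reduces the question to finitely many q. The
    successor accounts for the additional factor in W.\<close>
  define M where "M = Suc (\<Sum>q\<in>Q. \<kappa> q)"
  have osc: "\<bar>P n y - P n \<one>\<bar> \<le> M * \<delta> ^ Suc n" if y: "y \<in> carrier G" for y n
  proof -
    obtain q a where qa: "q \<in> Q" "a \<in> W" "y = q \<otimes> a" using Q(3) y by blast
    have "a \<in> set_power G W (Suc 0)" using qa(2) set_power_1[OF WG] by simp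
    then have "y \<in> set_power G W (\<kappa> q + Suc 0)"
      unfolding qa(3) using \<kappa> qa(1) by (intro set_power_add[OF WG]) simp_all
    then have "\<bar>P n y - P n \<one>\<bar> \<le> real (\<kappa> q + Suc 0) * \<delta> ^ Suc n" by (rule powers)
    also have "\<kappa> q \<le> (\<Sum>q\<in>Q. \<kappa> q)" by (rule member_le_sum[OF qa(1) _ Q(1)]) simp
    then have "real (\<kappa> q + Suc 0) \<le> real M" unfolding M_def of_nat_le_iff by simp
    then have "real (\<kappa> q + Suc 0) * \<delta> ^ Suc n \<le> M * \<delta> ^ Suc n"
      using \<delta> by (intro mult_right_mono) simp_all
    finally show ?thesis .
  qed
  \<comment> \<open>Mean zero turns the oscillation bound into a bound on \<open>P n\<close> itself,
    first at \<open>\<one>\<close> and then everywhere.\<close>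
  have Pn: "\<bar>P n y\<bar> \<le> 2 * M * \<delta> ^ Suc n" if y: "y \<in> carrier G" for y n
  proof -
    have "\<bar>m (P n) - m (\<lambda>x. P n \<one>)\<bar> \<le> M * \<delta> ^ Suc n"
      by (rule m_dist[OF P_bounded bounded_fun_const]) (rule osc)
    then show ?thesis using osc[OF y, of n] by (simp add: m_P m_const)
  qed
  have "U 0 * 4 ^ n \<le> M\<^sup>2 * \<rho>" for n
  proof -
    have "U n \<le> (2 * M * \<delta> ^ Suc n)\<^sup>2"
    proof -
      have "\<bar>U n\<bar> \<le> (2 * M * \<delta> ^ Suc n)\<^sup>2"
        unfolding U_def
      proof (rule m_abs_le)
        fix x assume "x \<in> carrier G"
        from Pn[OF this, of n] have "\<bar>P n x\<bar>\<^sup>2 \<le> (2 * M * \<delta> ^ Suc n)\<^sup>2" by (intro power_mono) simp_all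
        then show "\<bar>(P n x)\<^sup>2\<bar> \<le> (2 * M * \<delta> ^ Suc n)\<^sup>2" by simp
      qed
      then show ?thesis by simp
    qed
    also have "(2 * M * \<delta> ^ Suc n)\<^sup>2 = 4 * M\<^sup>2 * (\<delta>\<^sup>2) ^ Suc n"
      by (simp add: power_mult_distrib power_mult[symmetric] mult.commute)
    also have "\<dots> = M\<^sup>2 * \<rho> * \<rho> ^ n / 4 ^ n" unfolding \<delta>2 by (simp add: power_divide)
    finally have "U 0 * \<rho> ^ n \<le> M\<^sup>2 * \<rho> * \<rho> ^ n / 4 ^ n" using U_ge[of n] unfolding \<rho>_def[symmetric] by simp
    then have "(U 0 * 4 ^ n) * \<rho> ^ n \<le> (M\<^sup>2 * \<rho>) * \<rho> ^ n" by (simp add: field_simps)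
    then show ?thesis using \<rho> by (simp add: mult_le_cancel_right)
  qed
  moreover obtain n where "M\<^sup>2 * \<rho> / U 0 < 4 ^ n" using real_arch_pow[of 4 "M\<^sup>2 * \<rho> / U 0"] by auto
  then have "M\<^sup>2 * \<rho> < U 0 * 4 ^ n" using U_pos by (simp add: field_simps)
  ultimately show False by (meson not_less)
qed

end

context compact_abelian_group
begin

text \<open>A non-trivial compact connected group has a non-zero even continuous function \<open>f\<close> of mean zero.
  Its iterated convolution powers decay at a fixed exponential rate. If all powers of the elements near
  \<open>\<one>\<close> were near \<open>\<one>\<close>, their oscillation would decay faster.\<close>

theorem trivial_if_connected_small_powers:
  assumes conn: "connected_space T" and Haus: "Hausdorff_space T"
    and small: "\<And>V. openin T V \<Longrightarrow> \<one> \<in> V \<Longrightarrow> \<exists>W. openin T W \<and> \<one> \<in> W \<and> (\<forall>w\<in>W. \<forall>k::nat. w [^] k \<in> V)"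
  shows "carrier G = {\<one>}"
proof (rule ccontr)
  assume "carrier G \<noteq> {\<one>}"
  then obtain x where x: "x \<in> carrier G" "x \<noteq> \<one>" using one_closed by blast
  have "completely_regular_space T"
    using compact Haus by (intro normal_imp_completely_regular_space compact_Hausdorff_or_regular_imp_normal_space) auto
  moreover have "closedin T {x}" using x Haus by (simp add: closedin_Hausdorff_sing_eq topspace_eq)
  moreover have "\<one> \<in> topspace T - {x}" using x by (simp add: topspace_eq)
  ultimately obtain g where "continuous_map T (top_of_set {0..1}) g" "g \<one> = 0" "g ` {x} \<subseteq> {1::real}"
    unfolding completely_regular_space_def by blast
  then have g: "continuous_map T euclideanreal g" "g \<one> = 0" "g x = 1" "\<And>y. y \<in> carrier G \<Longrightarrow> 0 \<le> g y"
    by (auto simp: continuous_map_in_subtopology topspace_eq)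
  obtain m where m: "mean m" "\<And>f a. bounded_fun f \<Longrightarrow> a \<in> carrier G \<Longrightarrow> m (\<lambda>x. f (a \<otimes> x)) = m f"
    by (rule invariant_mean_exists) (rule that)
  interpret compact_group_mean G T m by unfold_locales (rule m; assumption)+
  \<comment> \<open>Symmetrisation gives evenness. As g is non-negative, the two summands cannot
    cancel at x.\<close>
  define h where "h y = g y + g (inv y)" for y
  have h: "continuous_map T euclideanreal h"
    unfolding h_def using continuous_map_compose[OF continuous_inv g(1)]
    by (intro continuous_map_add g(1)) (simp add: o_def)
  define f where "f y = h y - m h" for y
  have f: "continuous_map T euclideanreal f"
    unfolding f_def by (intro continuous_map_diff h) simp
  obtain B where B: "B > 0" "\<forall>x\<in>carrier G. \<bar>f x\<bar> \<le> B"
    by (rule bounded_funE[OF bounded_fun_if_continuous[OF f]])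
  interpret compact_group_kernel G T m f B
  proof unfold_locales
    show "\<bar>f x\<bar> \<le> B" if "x \<in> carrier G" for x using B(2) that by (rule bspec)
    show "unif_continuous f" by (rule unif_continuous_if_continuous[OF f])
    show "f (inv x) = f x" if "x \<in> carrier G" for x using that by (simp add: f_def h_def)
    show "m f = 0"
      unfolding f_def by (simp add: m_diff[OF bounded_fun_if_continuous[OF h] bounded_fun_const] m_const)
    \<comment> \<open>Before the constant is subtracted the value is 0 at \<open>\<one>\<close> and
      at least 1 at x, so f cannot vanish at both points.\<close>
    have "f x \<noteq> f \<one>" using g(2,3) g(4)[of "inv x"] x by (simp add: f_def h_def)
    then show "\<exists>x\<in>carrier G. f x \<noteq> 0" using x(1) one_closed by metis
  qed (rule B)
  show False using not_connected[OF small] conn by blast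
qed

end


section \<open>Groups with small cyclic subgroups\<close>

context abelian_topological_group
begin

lemma abelian_topological_group_subgroup:
  assumes H: "subgroup H G"
  shows "abelian_topological_group (G\<lparr>carrier := H\<rparr>) (subtopology T H)"
proof -
  have HG: "H \<subseteq> carrier G" by (rule subgroup.subset[OF H])
  then have top: "topspace (subtopology T H) = H" by (auto simp: topspace_eq)
  have "continuous_map (prod_topology (subtopology T H) (subtopology T H)) T (\<lambda>(x, y). x \<otimes> y)"
    unfolding subtopology_Times[symmetric] by (rule continuous_map_from_subtopology[OF continuous_mult])
  then have mult: "continuous_map (prod_topology (subtopology T H) (subtopology T H)) (subtopology T H) (\<lambda>(x, y). x \<otimes> y)"
    using top subgroup.m_closed[OF H] by (auto simp: continuous_map_in_subtopology)
  have "continuous_map (subtopology T H) (subtopology T H) (\<lambda>x. inv x)"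
    using continuous_map_from_subtopology[OF continuous_inv] top subgroup.m_inv_closed[OF H]
    by (auto simp: continuous_map_in_subtopology)
  then have inv: "continuous_map (subtopology T H) (subtopology T H) (\<lambda>x. inv\<^bsub>G\<lparr>carrier := H\<rparr>\<^esub> x)"
    by (rule continuous_map_eq) (simp add: top H)
  show ?thesis
    by (intro abelian_topological_group.intro abelian_topological_group_axioms.intro comm_group_subgroup[OF H])
      (use top mult inv in simp_all)
qed

lemma subgroup_connected_component: "subgroup (connected_component_of_set T \<one>) G"
proof (rule subgroupI)
  have one: "connected_component_of T \<one> \<one>"
    using connected_component_of_refl[of T \<one>] by (simp add: topspace_eq)
  have G: "x \<in> carrier G" if "connected_component_of T \<one> x" for x
    using connected_component_in_topspace[OF that] by (simp add: topspace_eq)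
  show "connected_component_of_set T \<one> \<subseteq> carrier G" using G by blast
  show "connected_component_of_set T \<one> \<noteq> {}" using one by blast
  show "inv x \<in> connected_component_of_set T \<one>" if x: "x \<in> connected_component_of_set T \<one>" for x
  proof -
    obtain C where C: "connectedin T C" "\<one> \<in> C" "x \<in> C"
      using x unfolding mem_Collect_eq connected_component_of_def by (elim exE conjE)
    have "connectedin T ((\<lambda>y. inv y) ` C)" by (rule connectedin_continuous_map_image[OF continuous_inv C(1)])
    moreover have "\<one> \<in> (\<lambda>y. inv y) ` C" using C(2) by (intro image_eqI[of _ _ \<one>]) simp_all
    moreover have "inv x \<in> (\<lambda>y. inv y) ` C" using C(3) by (rule imageI)
    ultimately show ?thesis unfolding mem_Collect_eq connected_component_of_def by (intro exI conjI)
  qed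
  show "x \<otimes> y \<in> connected_component_of_set T \<one>"
    if xy: "x \<in> connected_component_of_set T \<one>" "y \<in> connected_component_of_set T \<one>" for x y
  proof -
    obtain C where C: "connectedin T C" "\<one> \<in> C" "y \<in> C"
      using xy(2) unfolding mem_Collect_eq connected_component_of_def by (elim exE conjE)
    have x: "x \<in> carrier G" using xy(1) G by simp
    have "connectedin T ((\<lambda>y. x \<otimes> y) ` C)"
      by (rule connectedin_continuous_map_image[OF continuous_map_translation[OF x] C(1)])
    moreover have "x \<in> (\<lambda>y. x \<otimes> y) ` C" using C(2) x by (intro image_eqI[of _ _ \<one>]) simp_all
    moreover have "x \<otimes> y \<in> (\<lambda>y. x \<otimes> y) ` C" using C(3) by (rule imageI)
    ultimately have "connected_component_of T x (x \<otimes> y)" unfolding connected_component_of_def by (intro exI conjI)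
    with xy(1) show ?thesis unfolding mem_Collect_eq by (rule connected_component_of_trans)
  qed
qed

text \<open>If the powers of all elements of \<open>W\<close> remain in a compact set \<open>K\<close>, finitely many of these cyclic
  semigroups generate a set \<open>C\<close> in a finite power of \<open>K\<close> with \<open>W W \<subseteq> C W\<close>, and then \<open>W\<close> generates
  a subgroup of \<open>C W\<close>.\<close>

lemma compact_generated_subgroup:
  assumes W: "openin T W" "\<one> \<in> W" "\<forall>a\<in>W. inv a \<in> W"
    and K: "compactin T K" and pow: "\<forall>a\<in>W. \<forall>k::nat. a [^] k \<in> K"
  shows "\<exists>H. subgroup H G \<and> openin T H \<and> compactin T H"
proof -
  have WG: "W \<subseteq> carrier G" using W(1) carrier_if_openin by blast
  have KG: "K \<subseteq> carrier G" using compactin_subset_topspace[OF K] by (simp add: topspace_eq)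
  have WK: "W \<subseteq> K"
  proof
    fix a assume "a \<in> W"
    then show "a \<in> K" using pow[THEN bspec, THEN spec, of a 1] WG by auto
  qed
  define H where "H = (\<Union>n. set_power G W n)"
  have H: "subgroup H G" unfolding H_def by (rule subgroup_Union_set_power[OF WG bspec[OF W(3)]])
  have WH: "W \<subseteq> H" using set_power_1[OF WG] unfolding H_def by blast
  have oH: "openin T H" by (rule openin_subgroup_if_nbhd[OF H W(1,2) WH])
  have cH: "closedin T H" by (rule closedin_open_subgroup[OF H oH])
  \<comment> \<open>Submonoids inside a finite power of K. The powers of one element of W form such
    a set, and by commutativity the product of two such sets is another; hence every finite subset
    of H lies in one.\<close>
  define good where "good C \<longleftrightarrow> C \<subseteq> carrier G \<and> \<one> \<in> C \<and> (\<forall>a\<in>C. \<forall>b\<in>C. a \<otimes> b \<in> C) \<and>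
      (\<exists>q. C \<subseteq> set_power G K q)" for C
  have good1: "good {\<one>}" unfolding good_def by (auto intro: exI[of _ 0])
  have goodpow: "good (range (\<lambda>k::nat. a [^] k))" if a: "a \<in> W" for a
    unfolding good_def
  proof (intro conjI ballI)
    have aG: "a \<in> carrier G" using a WG by blast
    then show "range (\<lambda>k::nat. a [^] k) \<subseteq> carrier G" by auto
    show "\<one> \<in> range (\<lambda>k::nat. a [^] k)" by (rule range_eqI[of _ _ 0]) simp
    show "\<exists>q. range (\<lambda>k::nat. a [^] k) \<subseteq> set_power G K q"
      using pow a set_power_1[OF KG] by (intro exI[of _ "Suc 0"]) auto
    fix x y assume "x \<in> range (\<lambda>k::nat. a [^] k)" "y \<in> range (\<lambda>k::nat. a [^] k)"
    then obtain k l :: nat where "x = a [^] k" "y = a [^] l" by blast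
    then show "x \<otimes> y \<in> range (\<lambda>k::nat. a [^] k)"
      using nat_pow_mult[OF aG, of k l] by (intro range_eqI[of _ _ "k + l"]) simp
  qed
  have goodmult: "good (C <#> D)" "C \<subseteq> C <#> D" "D \<subseteq> C <#> D" if CD: "good C" "good D" for C D
  proof -
    have G: "C \<subseteq> carrier G" "D \<subseteq> carrier G" "\<one> \<in> C" "\<one> \<in> D" using CD unfolding good_def by blast+
    have mult: "x \<otimes> y \<in> C <#> D" if "x \<in> C" "y \<in> D" for x y using that unfolding set_mult_def by blast
    show sub: "C \<subseteq> C <#> D"
    proof
      fix x assume x: "x \<in> C"
      then show "x \<in> C <#> D" using mult[OF x G(4)] G(1) by auto
    qed
    show "D \<subseteq> C <#> D"
    proof
      fix x assume x: "x \<in> D"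
      then show "x \<in> C <#> D" using mult[OF G(3) x] G(2) by auto
    qed
    show "good (C <#> D)"
      unfolding good_def
    proof (intro conjI ballI)
      show "C <#> D \<subseteq> carrier G" using G by (rule_tac set_mult_closed)
      show "\<one> \<in> C <#> D" using sub G(3) by blast
      obtain p where p: "C \<subseteq> set_power G K p" using CD(1) unfolding good_def by blast
      obtain q where q: "D \<subseteq> set_power G K q" using CD(2) unfolding good_def by blast
      have "C <#> D \<subseteq> set_power G K (p + q)"
      proof
        fix z assume "z \<in> C <#> D"
        then obtain x y where "x \<in> C" "y \<in> D" "z = x \<otimes> y" unfolding set_mult_def by blast
        then show "z \<in> set_power G K (p + q)" using set_power_add[OF KG subsetD[OF p] subsetD[OF q]] by simp
      qed
      then show "\<exists>q. C <#> D \<subseteq> set_power G K q" by (rule exI)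
      fix a b assume "a \<in> C <#> D" "b \<in> C <#> D"
      then obtain x y x' y' where e: "x \<in> C" "y \<in> D" "a = x \<otimes> y" "x' \<in> C" "y' \<in> D" "b = x' \<otimes> y'"
        unfolding set_mult_def by blast
      have "x \<otimes> x' \<in> C" "y \<otimes> y' \<in> D" using CD e unfolding good_def by blast+
      moreover have "a \<otimes> b = (x \<otimes> x') \<otimes> (y \<otimes> y')"
        unfolding e using subsetD[OF G(1) e(1)] subsetD[OF G(2) e(2)] subsetD[OF G(1) e(4)] subsetD[OF G(2) e(5)]
        by (simp add: m_ac)
      ultimately show "a \<otimes> b \<in> C <#> D" using mult by simp
    qed
  qed
  have elem: "\<exists>C. good C \<and> h \<in> C" if "h \<in> set_power G W n" for h n
    using that
  proof (induction n arbitrary: h)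
    case 0
    then show ?case using good1 by auto
  next
    case (Suc n)
    then obtain a b where ab: "a \<in> W" "b \<in> set_power G W n" "h = a \<otimes> b" by (auto simp: set_mult_def)
    obtain C where C: "good C" "b \<in> C" using Suc.IH[OF ab(2)] by (elim exE conjE)
    have "a \<in> range (\<lambda>k::nat. a [^] k)" using ab(1) WG by (intro range_eqI[of _ _ 1]) auto
    then have "h \<in> range (\<lambda>k::nat. a [^] k) <#> C" using C(2) ab(3) unfolding set_mult_def by blast
    with goodmult(1)[OF goodpow[OF ab(1)] C(1)] show ?case by (intro exI conjI)
  qed
  have fin: "\<exists>C. good C \<and> Q \<subseteq> C" if "finite Q" "Q \<subseteq> H" for Q
    using that
  proof (induction rule: finite_induct)
    case empty
    show ?case by (rule exI[of _ "{\<one>}"]) (simp add: good1)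
  next
    case (insert h Q)
    have "Q \<subseteq> H" using insert.prems by simp
    from insert.IH[OF this] obtain C where C: "good C" "Q \<subseteq> C" by (elim exE conjE)
    obtain n where "h \<in> set_power G W n" using insert.prems unfolding H_def by blast
    from elem[OF this] obtain D where D: "good D" "h \<in> D" by (elim exE conjE)
    have "insert h Q \<subseteq> C <#> D" using C(2) D(2) goodmult(2,3)[OF C(1) D(1)] by blast
    with goodmult(1)[OF C(1) D(1)] show ?case by (intro exI conjI)
  qed
  \<comment> \<open>The cover consists of translates of W by elements of H. Their finitely many
    centres are therefore products of elements of W and lie together in one good set C, and this
    gives that \<open>W W\<close> lies in \<open>C W\<close>.\<close>
  have "compactin T (H \<inter> (K <#> K))" by (rule closed_Int_compactin[OF cH compactin_mult[OF K K]])
  moreover have "openin T U" if "U \<in> (\<lambda>h. (\<lambda>x. h \<otimes> x) ` W) ` H" for U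
    using that openin_translate[OF W(1)] subgroup.subset[OF H] by (elim imageE) auto
  moreover have "H \<inter> (K <#> K) \<subseteq> \<Union> ((\<lambda>h. (\<lambda>x. h \<otimes> x) ` W) ` H)"
  proof
    fix h assume "h \<in> H \<inter> (K <#> K)"
    then have h: "h \<in> H" by blast
    then have "h \<in> (\<lambda>x. h \<otimes> x) ` W" using W(2) subgroup.subset[OF H] by (intro image_eqI[of _ _ \<one>]) auto
    with h show "h \<in> \<Union> ((\<lambda>h. (\<lambda>x. h \<otimes> x) ` W) ` H)" by (rule UN_I)
  qed
  ultimately have "\<exists>\<F>. finite \<F> \<and> \<F> \<subseteq> (\<lambda>h. (\<lambda>x. h \<otimes> x) ` W) ` H \<and> H \<inter> (K <#> K) \<subseteq> \<Union>\<F>"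
    by (rule compactinD)
  then obtain \<F> where \<F>: "finite \<F>" "\<F> \<subseteq> (\<lambda>h. (\<lambda>x. h \<otimes> x) ` W) ` H" "H \<inter> (K <#> K) \<subseteq> \<Union>\<F>"
    by (elim exE conjE)
  from finite_subset_image[OF \<F>(1,2)] obtain Q where Q: "Q \<subseteq> H" "finite Q" "\<F> = (\<lambda>h. (\<lambda>x. h \<otimes> x) ` W) ` Q"
    by (elim exE conjE)
  from fin[OF Q(2,1)] obtain C where C: "good C" "Q \<subseteq> C" by (elim exE conjE)
  have CG: "C \<subseteq> carrier G" "\<one> \<in> C" using C(1) unfolding good_def by blast+
  have CC: "a \<otimes> b \<in> C" if "a \<in> C" "b \<in> C" for a b using C(1) that unfolding good_def by blast
  have WW: "\<exists>q\<in>C. \<exists>w\<in>W. a \<otimes> b = q \<otimes> w" if "a \<in> W" "b \<in> W" for a b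
  proof -
    have "a \<otimes> b \<in> H" using that WH subgroup.m_closed[OF H] by blast
    moreover have "a \<otimes> b \<in> K <#> K" using that WK unfolding set_mult_def by blast
    ultimately have "a \<otimes> b \<in> \<Union>\<F>" using \<F>(3) by blast
    then show ?thesis unfolding Q(3) using C(2) by blast
  qed
  have "set_power G W n \<subseteq> C <#> W" for n
  proof (induction n)
    case 0
    have "\<one> \<otimes> \<one> \<in> C <#> W" using CG(2) W(2) unfolding set_mult_def by blast
    then show ?case by simp
  next
    case (Suc n)
    show ?case
    proof
      fix x assume "x \<in> set_power G W (Suc n)"
      then obtain a y where ay: "a \<in> W" "y \<in> set_power G W n" "x = a \<otimes> y" by (auto simp: set_mult_def)
      obtain c w where cw: "c \<in> C" "w \<in> W" "y = c \<otimes> w" using subsetD[OF Suc ay(2)] unfolding set_mult_def by blast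
      obtain q w' where q: "q \<in> C" "w' \<in> W" "a \<otimes> w = q \<otimes> w'" using WW[OF ay(1) cw(2)] by blast
      have G: "a \<in> carrier G" "c \<in> carrier G" "w \<in> carrier G" "q \<in> carrier G" "w' \<in> carrier G"
        using ay(1) cw(1,2) q(1,2) WG CG(1) by blast+
      have "x = c \<otimes> (a \<otimes> w)" unfolding ay(3) cw(3) using G(1-3) by (rule m_lcomm)
      also have "\<dots> = (c \<otimes> q) \<otimes> w'" unfolding q(3) using G by (simp add: m_assoc)
      finally show "x \<in> C <#> W" using CC[OF cw(1) q(1)] q(2) unfolding set_mult_def by blast
    qed
  qed
  then have "H \<subseteq> C <#> W" unfolding H_def by blast
  moreover obtain q where "C \<subseteq> set_power G K q" using C(1) unfolding good_def by blast
  ultimately have HK: "H \<subseteq> set_power G K q <#> K" using WK unfolding set_mult_def by blast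
  have "compactin T (set_power G K q)"
  proof (induction q)
    case 0
    show ?case by (simp add: topspace_eq)
  next
    case (Suc q)
    then show ?case using compactin_mult[OF K] by simp
  qed
  from closed_compactin[OF compactin_mult[OF this K] HK cH] H oH show ?thesis by (intro exI conjI)
qed

text \<open>A compact neighbourhood K contains all powers of elements near \<open>\<one>\<close>,
  which yields a compact open subgroup. Being connected and meeting this clopen set, the component
  of \<open>\<one>\<close> lies inside it and is compact. The hypothesis on powers passes to the
  component.\<close>

theorem connected_trivial_if_small_powers:
  assumes Haus: "Hausdorff_space T" and lc: "locally_compact_space T"
    and small: "\<And>V. openin T V \<Longrightarrow> \<one> \<in> V \<Longrightarrow> \<exists>W. openin T W \<and> \<one> \<in> W \<and> (\<forall>w\<in>W. \<forall>k::nat. w [^] k \<in> V)"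
    and C: "connectedin T C" "\<one> \<in> C" "x \<in> C"
  shows "x = \<one>"
proof -
  define Z where "Z = connected_component_of_set T \<one>"
  have Z: "subgroup Z G" unfolding Z_def by (rule subgroup_connected_component)
  have ZG: "Z \<subseteq> carrier G" by (rule subgroup.subset[OF Z])
  have one: "\<one> \<in> topspace T" by (simp add: topspace_eq)
  obtain A K where AK: "openin T A" "compactin T K" "\<one> \<in> A" "A \<subseteq> K"
    using lc one unfolding locally_compact_space_def by blast
  obtain V where V: "openin T V" "\<one> \<in> V" "\<forall>w\<in>V. \<forall>k::nat. w [^] k \<in> A"
    using small[OF AK(1,3)] by (elim exE conjE)
  obtain W where W: "openin T W" "\<one> \<in> W" "\<And>a. a \<in> W \<Longrightarrow> inv a \<in> W" "W \<subseteq> V"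
    by (rule nbhd_sym_mult[OF V(1,2)]) (rule that)
  have "\<forall>a\<in>W. \<forall>k::nat. a [^] k \<in> K" using V(3) W(4) AK(4) by blast
  moreover have "\<forall>a\<in>W. inv a \<in> W" using W(3) by simp
  ultimately have "\<exists>H. subgroup H G \<and> openin T H \<and> compactin T H"
    by (rule compact_generated_subgroup[OF W(1,2) _ AK(2), rotated])
  then obtain H where H: "subgroup H G" "openin T H" "compactin T H" by (elim exE conjE)
  have cZ: "connectedin T Z" unfolding Z_def by (rule connectedin_connected_component_of)
  have "\<not> disjnt Z H"
    using subgroup.one_closed[OF Z] subgroup.one_closed[OF H(1)] by (auto simp: disjnt_iff)
  then have "Z \<subseteq> H"
    using connectedin_clopen_cases[OF cZ closedin_open_subgroup[OF H(1,2)] H(2)] by blast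
  moreover have "closedin T Z" unfolding Z_def by (rule closedin_connected_component_of)
  ultimately have "compactin T Z" using closed_compactin[OF H(3)] by blast
  then have compactZ: "compact_space (subtopology T Z)" by (rule compact_space_subtopology)
  let ?Z = "G\<lparr>carrier := Z\<rparr>"
  interpret Z: abelian_topological_group ?Z "subtopology T Z"
    by (rule abelian_topological_group_subgroup[OF Z])
  interpret Z: compact_abelian_group ?Z "subtopology T Z"
    by unfold_locales (rule compactZ)
  have "carrier ?Z = {\<one>\<^bsub>?Z\<^esub>}"
  proof (rule Z.trivial_if_connected_small_powers)
    show "connected_space (subtopology T Z)" using cZ by (simp add: connectedin_def)
    show "Hausdorff_space (subtopology T Z)" by (rule Hausdorff_space_subtopology[OF Haus])
    fix V assume "openin (subtopology T Z) V" "\<one>\<^bsub>?Z\<^esub> \<in> V"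
    then obtain V' where V': "openin T V'" "V = V' \<inter> Z" "\<one> \<in> V'" by (auto simp: openin_subtopology)
    from small[OF V'(1,3)] obtain W where W: "openin T W" "\<one> \<in> W" "\<forall>w\<in>W. \<forall>k::nat. w [^] k \<in> V'"
      by (elim exE conjE)
    have "w [^]\<^bsub>?Z\<^esub> k \<in> V" if "w \<in> W \<inter> Z" for w and k :: nat
    proof -
      have "w [^]\<^bsub>?Z\<^esub> k \<in> carrier ?Z" using that by (intro Z.nat_pow_closed) simp
      moreover have "w [^]\<^bsub>?Z\<^esub> k = w [^] k" by (rule nat_pow_consistent[symmetric])
      ultimately show ?thesis using W(3) that unfolding V'(2) by simp
    qed
    moreover have "openin (subtopology T Z) (W \<inter> Z)" using W(1) by (auto simp: openin_subtopology)
    moreover have "\<one>\<^bsub>?Z\<^esub> \<in> W \<inter> Z" using W(2) subgroup.one_closed[OF Z] by simp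
    ultimately show "\<exists>W. openin (subtopology T Z) W \<and> \<one>\<^bsub>?Z\<^esub> \<in> W \<and> (\<forall>w\<in>W. \<forall>k::nat. w [^]\<^bsub>?Z\<^esub> k \<in> V)"
      by (intro exI[of _ "W \<inter> Z"]) simp
  qed
  moreover have "x \<in> Z" unfolding Z_def mem_Collect_eq connected_component_of_def using C by (intro exI conjI)
  ultimately show ?thesis by simp
qed

end


section \<open>Schwartz groups of null sequences\<close>

context LCA_null_sequences
begin

text \<open>Fix w in W and k > 0, and write each \<open>delta j w\<close> as a product of an element
  of \<open>(1/k)(N A)\<close> and one of a finite set. Two indices j and l share the second factor.
  Comparing the j-th coordinates gives \<open>w = p g\<close> and \<open>\<one> = p' g\<close>, so
  \<open>w^k\<close> is the quotient of \<open>p^k\<close> and \<open>p'^k\<close>, both in A. W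
  does not depend on k.\<close>

lemma small_powers_if_schwartz:
  assumes sch: "schwartz_group F S" and V: "openin T V" "\<one>\<^bsub>X\<^esub> \<in> V"
  shows "\<exists>W. openin T W \<and> \<one>\<^bsub>X\<^esub> \<in> W \<and> (\<forall>w\<in>W. \<forall>k::nat. w [^]\<^bsub>X\<^esub> k \<in> V)"
proof -
  obtain A where A: "openin T A" "\<one>\<^bsub>X\<^esub> \<in> A" "\<And>a. a \<in> A \<Longrightarrow> inv\<^bsub>X\<^esub> a \<in> A"
    "\<And>a b. a \<in> A \<Longrightarrow> b \<in> A \<Longrightarrow> a \<otimes>\<^bsub>X\<^esub> b \<in> V"
    by (rule X.nbhd_sym_mult[OF V]) (rule that)
  have "\<exists>Q. (\<forall>n\<ge>1. finite (Q n) \<and> Q n \<subseteq> carrier F) \<and>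
      neighbourhood_of_one F S (\<Inter>n\<in>{1..}. group_fraction F n (N A) <#>\<^bsub>F\<^esub> Q n)"
    using sch nbhd_N[OF A(1,2)] unfolding schwartz_group_def by (elim conjE allE impE)
  then obtain Q where Q: "\<forall>n\<ge>1. finite (Q n) \<and> Q n \<subseteq> carrier F"
    and nb: "neighbourhood_of_one F S (\<Inter>n\<in>{1..}. group_fraction F n (N A) <#>\<^bsub>F\<^esub> Q n)"
    by (elim exE conjE)
  obtain W where W: "openin T W" "\<one>\<^bsub>X\<^esub> \<in> W"
    "N W \<subseteq> (\<Inter>n\<in>{1..}. group_fraction F n (N A) <#>\<^bsub>F\<^esub> Q n)"
    using nb unfolding nbhd_iff by (elim exE conjE)
  have WX: "W \<subseteq> carrier X" using W(1) X.carrier_if_openin by blast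
  have "w [^]\<^bsub>X\<^esub> k \<in> V" if w: "w \<in> W" for w and k :: nat
  proof (cases "k = 0")
    case True
    then show ?thesis using V(2) by simp
  next
    case False
    have wX: "w \<in> carrier X" using w WX by blast
    have "\<forall>j. \<exists>pq. fst pq \<in> group_fraction F k (N A) \<and> snd pq \<in> Q k \<and> delta j w = fst pq \<otimes>\<^bsub>F\<^esub> snd pq"
    proof
      fix j
      have "delta j w \<in> group_fraction F k (N A) <#>\<^bsub>F\<^esub> Q k"
        using W(3) delta_in_N[OF WX W(2) w, of j] False by auto
      then obtain p q where "p \<in> group_fraction F k (N A)" "q \<in> Q k" "delta j w = p \<otimes>\<^bsub>F\<^esub> q"
        unfolding set_mult_def by blast
      then show "\<exists>pq. fst pq \<in> group_fraction F k (N A) \<and> snd pq \<in> Q k \<and> delta j w = fst pq \<otimes>\<^bsub>F\<^esub> snd pq"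
        by (intro exI[of _ "(p, q)"]) simp
    qed
    from choice[OF this] obtain pq where
      pq: "\<forall>j. fst (pq j) \<in> group_fraction F k (N A) \<and> snd (pq j) \<in> Q k \<and> delta j w = fst (pq j) \<otimes>\<^bsub>F\<^esub> snd (pq j)" ..
    have "finite (Q k)" "Q k \<subseteq> carrier F" using Q False by simp_all
    have "range (snd \<circ> pq) \<subseteq> Q k" using pq by auto
    then have "finite (range (snd \<circ> pq))" using \<open>finite (Q k)\<close> by (rule finite_subset)
    then have "\<not> inj (snd \<circ> pq)" using finite_imageD[of "snd \<circ> pq" UNIV] infinite_UNIV_nat by blast
    then obtain j l where jl: "j \<noteq> l" "snd (pq j) = snd (pq l)" unfolding inj_def by auto
    have frac: "fst (pq i) n \<in> carrier X" "(fst (pq i) n) [^]\<^bsub>X\<^esub> k \<in> A" for i n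
    proof -
      have f: "fst (pq i) \<in> group_fraction F k (N A)" using pq by simp
      then have "fst (pq i) \<in> carrier F" unfolding group_fraction_def by simp
      then show "fst (pq i) n \<in> carrier X" by (rule carrier_F_coord)
      have "fst (pq i) [^]\<^bsub>F\<^esub> k \<in> N A" using f False unfolding group_fraction_def by simp
      then show "(fst (pq i) n) [^]\<^bsub>X\<^esub> k \<in> A" unfolding in_N pow_F by simp
    qed
    define p p' g where "p = fst (pq j) j" and "p' = fst (pq l) j" and "g = snd (pq j) j"
    have gX: "g \<in> carrier X" unfolding g_def using pq \<open>Q k \<subseteq> carrier F\<close> carrier_F_coord by blast
    have pX: "p \<in> carrier X" "p' \<in> carrier X" unfolding p_def p'_def by (rule frac)+
    have "delta j w j = p \<otimes>\<^bsub>X\<^esub> g"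
      using pq[THEN spec, of j, THEN conjunct2, THEN conjunct2, THEN fun_cong, of j] unfolding p_def g_def mult_F .
    moreover have "delta l w j = p' \<otimes>\<^bsub>X\<^esub> g"
      using pq[THEN spec, of l, THEN conjunct2, THEN conjunct2, THEN fun_cong, of j] unfolding p'_def g_def jl(2) mult_F .
    ultimately have "w = p \<otimes>\<^bsub>X\<^esub> g" "\<one>\<^bsub>X\<^esub> = p' \<otimes>\<^bsub>X\<^esub> g" using delta_other[OF jl(1)] by simp_all
    moreover from this(2) have "g \<otimes>\<^bsub>X\<^esub> p' = \<one>\<^bsub>X\<^esub>" using X.m_comm[OF gX pX(2)] by simp
    then have "g = inv\<^bsub>X\<^esub> p'" by (rule X.inv_equality[symmetric, OF _ pX(2) gX])
    ultimately have "w [^]\<^bsub>X\<^esub> k = (p [^]\<^bsub>X\<^esub> k) \<otimes>\<^bsub>X\<^esub> inv\<^bsub>X\<^esub> (p' [^]\<^bsub>X\<^esub> k)"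
      using pX by (simp add: X.nat_pow_distrib X.nat_pow_inv)
    then show ?thesis using A(3,4) frac(2) unfolding p_def p'_def by simp
  qed
  then show ?thesis using W(1,2) by (intro exI[of _ W]) simp
qed

end


text \<open>The equivalences with embeddability and nuclearity are stated at fixed types. The
  implications for the free types \<open>'i\<close>, \<open>'h\<close> and \<open>'e\<close> show
  that passing to other types could not make these conditions weaker. Compactness of closures
  belongs to the totally disconnected case: otherwise the deltas with their Bohr limit form a
  functionally bounded set of the Bohr topology whose closure in \<open>F\<close> is not
  compact.\<close>

theorem theorem1p10:
  fixes X :: "('a, 'm) monoid_scheme" and T :: "'a topology"
  assumes "locally_compact_abelian_group X T"
  defines "F \<equiv> null_seq_group X T" and "S \<equiv> null_seq_topology X T"
  shows
    "(totally_disconnected_space T \<longleftrightarrow>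
        embeds_in_product_of_LCA TYPE((nat \<Rightarrow> 'a) set) TYPE((nat \<Rightarrow> 'a) set set) F S) \<and>
     (totally_disconnected_space T \<longleftrightarrow> nuclear_group TYPE(((nat \<Rightarrow> 'a) \<times> nat, real) poly_mapping) F S) \<and>
     (totally_disconnected_space T \<longleftrightarrow> schwartz_group F S) \<and>
     (totally_disconnected_space T \<longleftrightarrow> respects_property compactin F S) \<and>
     (totally_disconnected_space T \<longleftrightarrow> schur_property F S) \<and>
     (totally_disconnected_space T \<longleftrightarrow> respects_property countably_compactin F S) \<and>
     (totally_disconnected_space T \<longleftrightarrow> respects_property sequentially_compactin F S) \<and>
     (totally_disconnected_space T \<longleftrightarrow> respects_property pseudocompactin F S) \<and>
     (totally_disconnected_space T \<longleftrightarrow> respects_property functionally_boundedin F S) \<and>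
     (embeds_in_product_of_LCA TYPE('i) TYPE('h) F S \<longrightarrow> totally_disconnected_space T) \<and>
     (nuclear_group TYPE('e::real_vector) F S \<longrightarrow> totally_disconnected_space T) \<and>
     (totally_disconnected_space T \<longrightarrow>
        (\<forall>E. functionally_boundedin (bohr_topology F S) E \<longrightarrow> compactin S (S closure_of E)))"
proof -
  have lca: "abelian_topological_group X T" "Hausdorff_space T" "locally_compact_space T"
    using assms(1) unfolding locally_compact_abelian_group_def by blast+
  interpret X: abelian_topological_group X T by (rule lca(1))
  interpret L: LCA_null_sequences X T by unfold_locales (rule lca(2), rule lca(3))
  have TD: "TD_null_sequences X T" if "totally_disconnected_space T" by unfold_locales (rule that)
  have schwartz: "totally_disconnected_space T" if "schwartz_group F S"
  proof (rule ccontr)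
    assume "\<not> totally_disconnected_space T"
    then obtain C x where C: "connectedin T C" "\<one>\<^bsub>X\<^esub> \<in> C" "x \<in> C" "x \<noteq> \<one>\<^bsub>X\<^esub>"
      by (rule L.not_totally_disconnectedE)
    have "x = \<one>\<^bsub>X\<^esub>"
      by (rule X.connected_trivial_if_small_powers[OF lca(2,3) _ C(1-3)])
        (rule L.small_powers_if_schwartz[OF that[unfolded F_def S_def]])
    with C(4) show False ..
  qed
  show ?thesis
    unfolding F_def S_def
  proof (intro conjI iffI impI allI)
    assume td: "totally_disconnected_space T"
    interpret D: TD_null_sequences X T by (rule TD[OF td])
    show "embeds_in_product_of_LCA TYPE((nat \<Rightarrow> 'a) set) TYPE((nat \<Rightarrow> 'a) set set) (null_seq_group X T) (null_seq_topology X T)"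
      by (rule D.embeds_F)
    show "nuclear_group TYPE(((nat \<Rightarrow> 'a) \<times> nat, real) poly_mapping) (null_seq_group X T) (null_seq_topology X T)"
      by (rule D.nuclear_F)
    show "schwartz_group (null_seq_group X T) (null_seq_topology X T)" by (rule D.schwartz_F)
    show "respects_property compactin (null_seq_group X T) (null_seq_topology X T)"
      "respects_property countably_compactin (null_seq_group X T) (null_seq_topology X T)"
      "respects_property sequentially_compactin (null_seq_group X T) (null_seq_topology X T)"
      "respects_property pseudocompactin (null_seq_group X T) (null_seq_topology X T)"
      "respects_property functionally_boundedin (null_seq_group X T) (null_seq_topology X T)"
      by (rule D.respects_all)+
    show "schur_property (null_seq_group X T) (null_seq_topology X T)" by (rule D.schur)
    show "compactin (null_seq_topology X T) (null_seq_topology X T closure_of E)"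
      if "functionally_boundedin (bohr_topology (null_seq_group X T) (null_seq_topology X T)) E" for E
      using that by (rule D.compactin_closure_of_functionally_bounded)
  qed (erule L.totally_disconnected_if_embeds L.totally_disconnected_if_nuclear
        L.totally_disconnected_if_respects schwartz[unfolded F_def S_def])+
qed

end
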